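(* (General Balance Criterion.) Let $\sigma\ge\frac12$ and let $L\subset\mathbb{R}^3$ be a $C^{1,1}$ link (in a possibly constrained link type) with $\sigma$-thickness $\mathrm{Thi}_\sigma(L)=1$. Then $L$ is strongly $\sigma$-critical if and only if $L$ is $\sigma$-balanced.
   Context: Curves. A $C^{1,1}$ curve (link) $L\subset\mathbb{R}^3$ is a compact embedded 1-dimensional submanifold with boundary (finite union of circles and arcs) whose arclength parametrization $\gamma$ is $C^{1,1}$ (Lipschitz unit tangent). Fix an orientation; $T$ is the unit tangent, $'$ is arclength derivative. $E_L\subset L$ is the (full measure) set of points where $\gamma$ is twice differentiable (one-sidedly at endpoints); $\kappa(x)=T'(x)$ for $x\in E_L$. Thickness. $\mathrm{reach}(L)$ is the supremal $r\ge 0$ such that every point at distance less than $r$ from $L$ has a unique nearest point on $L$. $\mathrm{Circ}=\{(p,T,\kappa):p\in\mathbb{R}^3,\ |T|=1,\ \kappa\perp T\}$ is the space of oriented pointed circles/lines ($\kappa$ the curvature vector), with radius $R(p,T,\kappa)=1/|\kappa|\in(0,\infty]$. $\overline{\mathrm{Osc}L}$ is the closure in $\mathrm{Circ}$ of $\{(x,T(x),\kappa(x)):x\in E_L\}$, and $\rho(x)=\min\{R(c):c\in\overline{\mathrm{Osc}L}\text{ with base point }x\}$. For $\sigma\ge\frac12$, $\mathrm{Thi}_\sigma(L)=\min\{2\,\mathrm{reach}(L),\ \frac1\sigma\min_L\rho\}$. Struts and kinks. The tangent cone $T_xL$ is the tangent line at $x$ (the inward tangent ray if $x\in\partial L$);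 $N_xL=\{p:\langle p-x,q-x\rangle\le 0\ \forall q\in T_xL\}$. Distinct $x,y\in L$ form a critical pair if $x\in N_yL$ and $y\in N_xL$. $\mathrm{Strut}(L)\subset L\times L$ is the set of critical pairs with $|x-y|=\mathrm{Thi}_\sigma(L)$. $\mathrm{Kink}(L)$ is the set of $c\in\overline{\mathrm{Osc}L}$ with $R(c)=\sigma\,\mathrm{Thi}_\sigma(L)$. Constraints. At each endpoint $p\in\partial L$ there are given an affine subspace $H^0_p\ni p$ (dimension 0, 1 or 2) and a linear subspace $H^1_p\ni T(p)$ (dimension 1 or 3). A vector field $\xi\in C^2(\mathbb{R}^3,\mathbb{R}^3)$ is compatible if at each $p\in\partial L$, $\xi(p)$ is tangent to $H^0_p$ and $D_p\xi(T(p))\in H^1_p$. Variations. For $\xi\in C^2(\mathbb{R}^3,\mathbb{R}^3)$, let $\phi^t$ be any $C^1$-smooth family of $C^2$ diffeomorphisms of $\mathbb{R}^3$ with $\phi^0=\mathrm{Id}$ and initial velocity $\xi$. Then $\delta_\xi\mathrm{Thi}_\sigma(L)$ is the right derivative at $t=0$ of $\mathrm{Thi}_\sigma(\phi^t(L))$ (it exists and depends only on $\xi$), $\delta_\xi\mathrm{len}(L)=\int_L\langle\xi',T\rangle\,ds$, and for $c=(x,T,\kappa)$ with $\kappa\neq0$, $\delta_\xi R(c)=2R\langle T,D_x\xi(T)\rangle-R^3\langle\kappa,D^2_x\xi(T,T)+D_x\xi(\kappa)\rangle$ with $R=1/|\kappa|$. Strongly $\sigma$-critical ($\mathrm{Thi}_\sigma(L)=1$):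 there is $\epsilon>0$ such that for every compatible $\xi\in C^2(\mathbb{R}^3,\mathbb{R}^3)$, $\delta_\xi\mathrm{len}(L)=-1$ implies $\delta_\xi\mathrm{Thi}_\sigma(L)\le-\epsilon$. Measures. A kink measure is a nonnegative Radon measure on $\mathrm{Kink}(L)$. A strut measure is a nonnegative Radon measure $\mu$ on $\mathrm{Strut}(L)$ invariant under $(x,y)\mapsto(y,x)$; its strut force measure $\Omega$ is the vector-valued measure on $L$ obtained by pushing forward $2(x-y)\mu(x,y)$ under $(x,y)\mapsto x$. $\sigma$-balanced ($\mathrm{Thi}_\sigma(L)=1$): there exist a strut measure $\mu$ (with strut force measure $\Omega$) and a kink measure $\nu$ such that for every compatible $\xi$, $$\delta_\xi\mathrm{len}(L)=\int_L\langle\xi,d\Omega\rangle+\int_{\mathrm{Kink}(L)}\delta_\xi R(c)\,d\nu(c).$$ *)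

theory Defs
  imports "HOL-Analysis.Analysis"
begin

type_synonym pt = "real^3"

section \<open>Twice continuously differentiable maps\<close>

definition D1 :: "(pt \<Rightarrow> pt) \<Rightarrow> pt \<Rightarrow> pt \<Rightarrow> pt" where
  "D1 f x v = frechet_derivative f (at x) v"

definition D2 :: "(pt \<Rightarrow> pt) \<Rightarrow> pt \<Rightarrow> pt \<Rightarrow> pt \<Rightarrow> pt" where
  "D2 f x u v = frechet_derivative (\<lambda>y. D1 f y v) (at x) u"

text \<open>
  Since the dimension is finite, differentiability of \<open>x \<mapsto> Df(x)\<close> and continuity of
  \<open>x \<mapsto> D\<^sup>2f(x)\<close> may be tested on each fixed argument separately.
\<close>

definition C2 :: "(pt \<Rightarrow> pt) \<Rightarrow> bool" where
  "C2 f \<longleftrightarrow> f differentiable_on UNIV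
        \<and> (\<forall>v. (\<lambda>x. D1 f x v) differentiable_on UNIV)
        \<and> (\<forall>u v. continuous_on UNIV (\<lambda>x. D2 f x u v))"

definition C2_diffeo :: "(pt \<Rightarrow> pt) \<Rightarrow> bool" where
  "C2_diffeo f \<longleftrightarrow> bij f \<and> C2 f \<and> C2 (inv f)"

section \<open>Oriented links of class $C^{1,1}$\<close>

text \<open>
  An oriented link is a set \<open>L\<close> with a unit tangent field \<open>T\<close>, of which only the values on \<open>L\<close>
  matter. The predicate below says that \<open>\<gamma>\<close> is an arclength parametrization, positively oriented
  and of class $C^{1,1}$, of a component \<open>C\<close> of length \<open>l\<close>. The domain \<open>J\<close> is \<open>{0..l}\<close> for an
  arc, and the whole line for a circle, where \<open>\<gamma>\<close> is periodic.
\<close>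

definition arclength_param ::
    "(pt \<Rightarrow> pt) \<Rightarrow> pt set \<Rightarrow> real \<Rightarrow> real set \<Rightarrow> (real \<Rightarrow> pt) \<Rightarrow> bool" where
  "arclength_param T C l J \<gamma> \<longleftrightarrow>
     0 < l \<and> C = \<gamma> ` J
     \<and> (J = {0..l} \<and> inj_on \<gamma> {0..l}
        \<or> J = UNIV \<and> inj_on \<gamma> {0..<l} \<and> (\<forall>s. \<gamma> (s + l) = \<gamma> s))
     \<and> (\<forall>s\<in>J. (\<gamma> has_vector_derivative T (\<gamma> s)) (at s within J))
     \<and> (\<forall>s\<in>J. norm (T (\<gamma> s)) = 1)
     \<and> (\<exists>B. B-lipschitz_on J (\<lambda>s. T (\<gamma> s)))"

definition C11_link :: "pt set \<Rightarrow> (pt \<Rightarrow> pt) \<Rightarrow> bool" where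
  "C11_link L T \<longleftrightarrow> finite (components L)
      \<and> (\<forall>C\<in>components L. \<exists>l J \<gamma>. arclength_param T C l J \<gamma>)"

definition initial_points :: "pt set \<Rightarrow> (pt \<Rightarrow> pt) \<Rightarrow> pt set" where
  "initial_points L T =
     {x. \<exists>C\<in>components L. \<exists>l \<gamma>. arclength_param T C l {0..l} \<gamma> \<and> x = \<gamma> 0}"

definition final_points :: "pt set \<Rightarrow> (pt \<Rightarrow> pt) \<Rightarrow> pt set" where
  "final_points L T =
     {x. \<exists>C\<in>components L. \<exists>l \<gamma>. arclength_param T C l {0..l} \<gamma> \<and> x = \<gamma> l}"

definition boundary :: "pt set \<Rightarrow> (pt \<Rightarrow> pt) \<Rightarrow> pt set" where
  "boundary L T = initial_points L T \<union> final_points L T"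

text \<open>
  \<open>has_curvature L T x k\<close> means that \<open>x\<close> is a point of \<open>L\<close> at which \<open>\<gamma>\<close> is twice
  differentiable, with \<open>k = \<gamma>'' = T'\<close> there.
\<close>

definition has_curvature :: "pt set \<Rightarrow> (pt \<Rightarrow> pt) \<Rightarrow> pt \<Rightarrow> pt \<Rightarrow> bool" where
  "has_curvature L T x k \<longleftrightarrow>
     (\<exists>C\<in>components L. \<exists>l J \<gamma>. \<exists>s\<in>J. arclength_param T C l J \<gamma> \<and> x = \<gamma> s
        \<and> ((\<lambda>s. T (\<gamma> s)) has_vector_derivative k) (at s within J))"

text \<open>
  Integration with respect to arclength. The value does not depend on which arclength
  parametrization of the component is chosen.
\<close>

definition component_param :: "(pt \<Rightarrow> pt) \<Rightarrow> pt set \<Rightarrow> real \<times> (real \<Rightarrow> pt)" where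
  "component_param T C = (SOME p. \<exists>J. arclength_param T C (fst p) J (snd p))"

definition arclength_integral :: "pt set \<Rightarrow> (pt \<Rightarrow> pt) \<Rightarrow> (pt \<Rightarrow> real) \<Rightarrow> real" where
  "arclength_integral L T f =
     (\<Sum>C\<in>components L. case component_param T C of (l, \<gamma>) \<Rightarrow>
         integral {0..l} (\<lambda>s. f (\<gamma> s)))"

section \<open>Thickness\<close>

definition reach :: "pt set \<Rightarrow> ereal" where
  "reach L = Sup {r. 0 \<le> r \<and>
     (\<forall>p. ereal (infdist p L) < r \<longrightarrow> (\<exists>!q. q \<in> L \<and> dist p q = infdist p L))}"

text \<open>A pointed circle \<open>(p, T, \<kappa>)\<close> is an element of \<open>pt \<times> pt \<times> pt\<close>.\<close>

definition Circ :: "(pt \<times> pt \<times> pt) set" where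
  "Circ = {(p, u, k). norm u = 1 \<and> k \<bullet> u = 0}"

definition radius :: "pt \<times> pt \<times> pt \<Rightarrow> ereal" where
  "radius c = (case c of (p, u, k) \<Rightarrow> if k = 0 then \<infinity> else ereal (1 / norm k))"

definition osc_closure :: "pt set \<Rightarrow> (pt \<Rightarrow> pt) \<Rightarrow> (pt \<times> pt \<times> pt) set" where
  "osc_closure L T = top_of_set Circ closure_of {(x, T x, k) | x k. has_curvature L T x k}"

definition osc_radius :: "pt set \<Rightarrow> (pt \<Rightarrow> pt) \<Rightarrow> pt \<Rightarrow> ereal" where
  "osc_radius L T x = (INF c\<in>{c \<in> osc_closure L T. fst c = x}. radius c)"

definition Thi :: "real \<Rightarrow> pt set \<Rightarrow> (pt \<Rightarrow> pt) \<Rightarrow> ereal" where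
  "Thi \<sigma> L T = min (2 * reach L) (ereal (1 / \<sigma>) * (INF x\<in>L. osc_radius L T x))"

section \<open>Struts and kinks\<close>

definition tangent_cone :: "pt set \<Rightarrow> (pt \<Rightarrow> pt) \<Rightarrow> pt \<Rightarrow> pt set" where
  "tangent_cone L T x = {x + a *\<^sub>R T x | a.
     (x \<in> initial_points L T \<longrightarrow> 0 \<le> a) \<and> (x \<in> final_points L T \<longrightarrow> a \<le> 0)}"

definition normal_cone :: "pt set \<Rightarrow> (pt \<Rightarrow> pt) \<Rightarrow> pt \<Rightarrow> pt set" where
  "normal_cone L T x = {p. \<forall>q\<in>tangent_cone L T x. (p - x) \<bullet> (q - x) \<le> 0}"

definition critical_pair :: "pt set \<Rightarrow> (pt \<Rightarrow> pt) \<Rightarrow> pt \<Rightarrow> pt \<Rightarrow> bool" where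
  "critical_pair L T x y \<longleftrightarrow> x \<in> L \<and> y \<in> L \<and> x \<noteq> y
      \<and> x \<in> normal_cone L T y \<and> y \<in> normal_cone L T x"

definition Strut :: "real \<Rightarrow> pt set \<Rightarrow> (pt \<Rightarrow> pt) \<Rightarrow> (pt \<times> pt) set" where
  "Strut \<sigma> L T = {(x, y). critical_pair L T x y \<and> ereal (norm (x - y)) = Thi \<sigma> L T}"

definition Kink :: "real \<Rightarrow> pt set \<Rightarrow> (pt \<Rightarrow> pt) \<Rightarrow> (pt \<times> pt \<times> pt) set" where
  "Kink \<sigma> L T = {c \<in> osc_closure L T. radius c = ereal \<sigma> * Thi \<sigma> L T}"

section \<open>Endpoint constraints\<close>

definition endpoint_constraints ::
    "pt set \<Rightarrow> (pt \<Rightarrow> pt) \<Rightarrow> (pt \<Rightarrow> pt set) \<Rightarrow> (pt \<Rightarrow> pt set) \<Rightarrow> bool" where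
  "endpoint_constraints L T H0 H1 \<longleftrightarrow> (\<forall>p\<in>boundary L T.
      affine (H0 p) \<and> p \<in> H0 p \<and> aff_dim (H0 p) \<in> {0, 1, 2}
      \<and> subspace (H1 p) \<and> T p \<in> H1 p \<and> dim (H1 p) \<in> {1, 3})"

definition compatible ::
    "pt set \<Rightarrow> (pt \<Rightarrow> pt) \<Rightarrow> (pt \<Rightarrow> pt set) \<Rightarrow> (pt \<Rightarrow> pt set) \<Rightarrow> (pt \<Rightarrow> pt) \<Rightarrow> bool" where
  "compatible L T H0 H1 \<xi> \<longleftrightarrow> C2 \<xi>
      \<and> (\<forall>p\<in>boundary L T. \<xi> p \<in> (\<lambda>q. q - p) ` H0 p \<and> D1 \<xi> p (T p) \<in> H1 p)"

section \<open>Variations\<close>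

text \<open>
  A $C^1$-smooth family of $C^2$ diffeomorphisms is a $C^1$ map from an interval of times into
  the space of $C^2$ maps, with uniform convergence of derivatives up to order two on compact
  sets. Concretely, the maps and their first two spatial derivatives have time derivatives that
  are jointly continuous in time and space.
\<close>

definition C1_in_time :: "real set \<Rightarrow> (real \<Rightarrow> pt \<Rightarrow> pt) \<Rightarrow> bool" where
  "C1_in_time I f \<longleftrightarrow> (\<exists>f'.
      (\<forall>t\<in>I. \<forall>x. ((\<lambda>s. f s x) has_vector_derivative f' t x) (at t))
      \<and> continuous_on (I \<times> UNIV) (\<lambda>(t, x). f' t x))"

definition diffeo_family :: "(real \<Rightarrow> pt \<Rightarrow> pt) \<Rightarrow> (pt \<Rightarrow> pt) \<Rightarrow> bool" where
  "diffeo_family \<phi> \<xi> \<longleftrightarrow>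
     (\<exists>\<tau>>0. (\<forall>t\<in>{-\<tau><..<\<tau>}. C2_diffeo (\<phi> t))
        \<and> C1_in_time {-\<tau><..<\<tau>} \<phi>
        \<and> (\<forall>v. C1_in_time {-\<tau><..<\<tau>} (\<lambda>t x. D1 (\<phi> t) x v))
        \<and> (\<forall>u v. C1_in_time {-\<tau><..<\<tau>} (\<lambda>t x. D2 (\<phi> t) x u v)))
     \<and> \<phi> 0 = id
     \<and> (\<forall>x. ((\<lambda>t. \<phi> t x) has_vector_derivative \<xi> x) (at 0))"

definition push_tangent :: "(pt \<Rightarrow> pt) \<Rightarrow> (pt \<Rightarrow> pt) \<Rightarrow> pt \<Rightarrow> pt" where
  "push_tangent f T y = sgn (D1 f (inv f y) (T (inv f y)))"

text \<open>
  The right derivative exists and is the same for all families with initial velocity \<open>\<xi>\<close> when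
  \<open>Thi \<sigma> L T\<close> is finite and positive. It is then finite for small times, so that the
  convention \<open>real_of_ereal \<infinity> = 0\<close> plays no role.
\<close>

definition Thi_variation :: "real \<Rightarrow> pt set \<Rightarrow> (pt \<Rightarrow> pt) \<Rightarrow> (pt \<Rightarrow> pt) \<Rightarrow> real" where
  "Thi_variation \<sigma> L T \<xi> = (THE d. \<forall>\<phi>. diffeo_family \<phi> \<xi> \<longrightarrow>
     ((\<lambda>t. real_of_ereal (Thi \<sigma> (\<phi> t ` L) (push_tangent (\<phi> t) T)))
        has_real_derivative d) (at_right 0))"

text \<open>The arclength derivative \<open>\<xi>'\<close> along \<open>L\<close> is \<open>D\<^sub>x\<xi>(T)\<close>.\<close>

definition len_variation :: "pt set \<Rightarrow> (pt \<Rightarrow> pt) \<Rightarrow> (pt \<Rightarrow> pt) \<Rightarrow> real" where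
  "len_variation L T \<xi> = arclength_integral L T (\<lambda>x. D1 \<xi> x (T x) \<bullet> T x)"

definition radius_variation :: "(pt \<Rightarrow> pt) \<Rightarrow> pt \<times> pt \<times> pt \<Rightarrow> real" where
  "radius_variation \<xi> c = (case c of (x, u, k) \<Rightarrow> let R = 1 / norm k in
      2 * R * (u \<bullet> D1 \<xi> x u) - R ^ 3 * (k \<bullet> (D2 \<xi> x u u + D1 \<xi> x k)))"

definition strongly_critical ::
    "real \<Rightarrow> pt set \<Rightarrow> (pt \<Rightarrow> pt) \<Rightarrow> (pt \<Rightarrow> pt set) \<Rightarrow> (pt \<Rightarrow> pt set) \<Rightarrow> bool" where
  "strongly_critical \<sigma> L T H0 H1 \<longleftrightarrow>
     (\<exists>\<epsilon>>0. \<forall>\<xi>. compatible L T H0 H1 \<xi> \<longrightarrow> len_variation L T \<xi> = -1 \<longrightarrow>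
        Thi_variation \<sigma> L T \<xi> \<le> -\<epsilon>)"

section \<open>Strut and kink measures\<close>

definition radon_measure_on :: "'a::topological_space set \<Rightarrow> 'a measure \<Rightarrow> bool" where
  "radon_measure_on K \<mu> \<longleftrightarrow> sets \<mu> = sets (restrict_space borel K)
     \<and> (\<forall>C. compact C \<and> C \<subseteq> K \<longrightarrow> emeasure \<mu> C < \<infinity>)
     \<and> (\<forall>A\<in>sets \<mu>. emeasure \<mu> A = (SUP C\<in>{C. compact C \<and> C \<subseteq> A}. emeasure \<mu> C))"

definition kink_measure ::
    "real \<Rightarrow> pt set \<Rightarrow> (pt \<Rightarrow> pt) \<Rightarrow> (pt \<times> pt \<times> pt) measure \<Rightarrow> bool" where
  "kink_measure \<sigma> L T \<nu> \<longleftrightarrow> radon_measure_on (Kink \<sigma> L T) \<nu>"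

definition strut_measure ::
    "real \<Rightarrow> pt set \<Rightarrow> (pt \<Rightarrow> pt) \<Rightarrow> (pt \<times> pt) measure \<Rightarrow> bool" where
  "strut_measure \<sigma> L T \<mu> \<longleftrightarrow> radon_measure_on (Strut \<sigma> L T) \<mu>
     \<and> distr \<mu> \<mu> prod.swap = \<mu>"

text \<open>A vector-valued measure is given as a set function on the Borel subsets of \<open>L\<close>.\<close>

definition strut_force :: "(pt \<times> pt) measure \<Rightarrow> pt set \<Rightarrow> pt" where
  "strut_force \<mu> A = (\<integral>(x, y). indicator A x *\<^sub>R (2 *\<^sub>R (x - y)) \<partial>\<mu>)"

text \<open>
  The integral \<open>\<integral>\<^sub>L \<langle>\<xi>, d\<Omega>\<rangle>\<close>: each component of \<open>\<Omega>\<close> is a signed measure, written as a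
  difference of finite positive measures. For \<open>\<xi>\<close> continuous and \<open>L\<close> compact the value does not
  depend on the choice of the decomposition.
\<close>

definition vector_measure_integral :: "pt set \<Rightarrow> (pt \<Rightarrow> pt) \<Rightarrow> (pt set \<Rightarrow> pt) \<Rightarrow> real" where
  "vector_measure_integral L \<xi> \<Omega> = (THE I. \<exists>P N :: 3 \<Rightarrow> pt measure.
     (\<forall>i. finite_measure (P i) \<and> sets (P i) = sets (restrict_space borel L)
        \<and> finite_measure (N i) \<and> sets (N i) = sets (restrict_space borel L)
        \<and> (\<forall>A\<in>sets (restrict_space borel L). \<Omega> A $ i = measure (P i) A - measure (N i) A))
     \<and> I = (\<Sum>i\<in>UNIV. (\<integral>x. \<xi> x $ i \<partial>P i) - (\<integral>x. \<xi> x $ i \<partial>N i)))"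

definition balanced ::
    "real \<Rightarrow> pt set \<Rightarrow> (pt \<Rightarrow> pt) \<Rightarrow> (pt \<Rightarrow> pt set) \<Rightarrow> (pt \<Rightarrow> pt set) \<Rightarrow> bool" where
  "balanced \<sigma> L T H0 H1 \<longleftrightarrow>
     (\<exists>\<mu> \<nu>. strut_measure \<sigma> L T \<mu> \<and> kink_measure \<sigma> L T \<nu> \<and>
        (\<forall>\<xi>. compatible L T H0 H1 \<xi> \<longrightarrow>
           len_variation L T \<xi> =
             vector_measure_integral L \<xi> (strut_force \<mu>)
             + (\<integral>c. radius_variation \<xi> c \<partial>\<nu>)))"

end

theory Submission
  imports Defs "HOL-Probability.Discrete_Topology"
begin

text \<open>
  The right derivative of the thickness is the minimum of the first variations of the lengths of
  struts and, divided by \<open>\<sigma>\<close>, of the radii of kinks. It is bounded above by these numbers because a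
  chord of a set of reach \<open>r\<close> meeting the tangents almost orthogonally has length almost \<open>2r\<close>, and
  because osculating circles are carried along. It is bounded below because the reach is at least
  \<open>r\<close> once all curvatures are at most \<open>1/r\<close> and all critical pairs at distance at least \<open>2r\<close>: the
  circles and pairs that could violate this at small times accumulate, by compactness, at kinks and
  struts. The set of struts and kinks is not empty, since otherwise the thickness would increase
  under the constant variation.

  Strong criticality therefore says that the variation of length is dominated by a multiple of
  the positive part of the largest variation of a strut or kink. By the theorems of Hahn-Banach and
  Riesz this holds if and only if it is an integral of these variations against positive measures.
\<close>

section \<open>Positive functionals and measures\<close>

text \<open>A pair that is critical at time t is critical at time 0 only up to angles of order t, so
  its length at time 0 may fall below 1. The chord bound turns such an angle into a defect of order
  t^2 of the length, which no first derivative sees; this is what allows the compactness argument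
  for struts. Curvature exists only almost everywhere, yet the reach is estimated through Lipschitz
  bounds for the tangent; hence the section on derivatives of Lipschitz functions. As
  \<open>Thi_variation\<close> is a description over all families, at least one family must be
  exhibited for every \<xi>, although the flow of \<xi> may blow up; a damped displacement takes its
  place. In the duality step the functional is extended to all bounded functions on struts and
  kinks, not only to continuous ones: indicators are then in its domain and yield a finitely
  additive content, from which the measures are built. Domination by the positive part is what makes
  the extension positive.\<close>

definition sublinear :: "('v::real_vector \<Rightarrow> real) \<Rightarrow> bool" where
  "sublinear p \<longleftrightarrow> (\<forall>x y. p (x + y) \<le> p x + p y) \<and> (\<forall>a x. 0 \<le> a \<longrightarrow> p (a *\<^sub>R x) = a * p x)"

lemma sublinear_add: "sublinear p \<Longrightarrow> p (x + y) \<le> p x + p y"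
  and sublinear_scale: "sublinear p \<Longrightarrow> 0 \<le> a \<Longrightarrow> p (a *\<^sub>R x) = a * p x"
  by (auto simp: sublinear_def)

lemma sublinear_0: "sublinear p \<Longrightarrow> p 0 = 0"
  using sublinear_scale[of p 0 0] by simp

lemma sublinear_ge: "sublinear p \<Longrightarrow> - p (- x) \<le> p x"
  using sublinear_add[of p x "-x"] sublinear_0[of p] by simp

text \<open>Serves three infima: along a ray, over a chain of functionals, and over a graph. For
  positive factors only an upper bound is assumed; the reverse inequality is the same bound with the
  inverse factor.\<close>

lemma sublinear_INF:
  fixes q :: "'i \<Rightarrow> 'v::real_vector \<Rightarrow> real"
  assumes ne: "I \<noteq> {}"
    and bd: "\<And>x. bdd_below ((\<lambda>i. q i x) ` I)"
    and add: "\<And>i j x y. i \<in> I \<Longrightarrow> j \<in> I \<Longrightarrow> \<exists>k\<in>I. q k (x + y) \<le> q i x + q j y"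
    and scale: "\<And>i a x. i \<in> I \<Longrightarrow> 0 < a \<Longrightarrow> \<exists>k\<in>I. q k (a *\<^sub>R x) \<le> a * q i x"
    and zero: "(INF i\<in>I. q i 0) = 0"
  shows "sublinear (\<lambda>x. INF i\<in>I. q i x)"
proof -
  let ?r = "\<lambda>x. INF i\<in>I. q i x"
  have le: "?r x \<le> q i x" if "i \<in> I" for i x using bd that by (rule cINF_lower)
  have 1: "?r (x + y) \<le> ?r x + ?r y" for x y
  proof -
    have "?r (x + y) - q j y \<le> ?r x" if j: "j \<in> I" for j
    proof (rule cINF_greatest[OF ne])
      fix i assume "i \<in> I"
      then obtain k where "k \<in> I" "q k (x + y) \<le> q i x + q j y" using add j by blast
      then show "?r (x + y) - q j y \<le> q i x" using le[of k "x + y"] by linarith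
    qed
    then have "?r (x + y) - ?r x \<le> q j y" if "j \<in> I" for j using that by force
    then have "?r (x + y) - ?r x \<le> ?r y" by (intro cINF_greatest[OF ne])
    then show ?thesis by simp
  qed
  have 2: "?r (a *\<^sub>R x) \<le> a * ?r x" if a: "0 < a" for a x
  proof -
    have "?r (a *\<^sub>R x) / a \<le> ?r x"
    proof (rule cINF_greatest[OF ne])
      fix i assume "i \<in> I"
      then obtain k where "k \<in> I" "q k (a *\<^sub>R x) \<le> a * q i x" using scale a by blast
      then have "?r (a *\<^sub>R x) \<le> a * q i x" using le[of k "a *\<^sub>R x"] by linarith
      then show "?r (a *\<^sub>R x) / a \<le> q i x" using a by (simp add: field_simps)
    qed
    then show ?thesis using a by (simp add: field_simps)
  qed
  have "?r (a *\<^sub>R x) = a * ?r x" if "0 \<le> a" for a x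
  proof (cases "a = 0")
    case True then show ?thesis using zero by simp
  next
    case False
    then have a: "0 < a" using that by simp
    have "?r (inverse a *\<^sub>R (a *\<^sub>R x)) \<le> inverse a * ?r (a *\<^sub>R x)" by (rule 2) (use a in simp)
    then have "a * ?r x \<le> ?r (a *\<^sub>R x)" using a by (simp add: field_simps)
    then show ?thesis using 2[OF a, of x] by linarith
  qed
  then show ?thesis using 1 by (auto simp: sublinear_def)
qed

text \<open>The infimum over t >= 0 of q (x + t y) - t q y is sublinear and at most q. By minimality
  it equals q, and its term at t = 1 then gives q x + q y <= q (x + y), the missing half of
  additivity.\<close>

lemma minimal_sublinear_linear:
  fixes q :: "'v::real_vector \<Rightarrow> real"
  assumes q: "sublinear q"
    and min: "\<And>r. sublinear r \<Longrightarrow> (\<forall>x. r x \<le> q x) \<Longrightarrow> r = q"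
  shows "linear q"
proof -
  have sup: "q x + q y \<le> q (x + y)" for x y
  proof -
    let ?r = "\<lambda>x. INF t\<in>{0..}. q (x + t *\<^sub>R y) - t * q y"
    have lower: "- q (- x) \<le> q (x + t *\<^sub>R y) - t * q y" if "0 \<le> t" for t x
      using sublinear_add[OF q, of "x + t *\<^sub>R y" "- x"] sublinear_scale[OF q that, of y] by simp
    have bd: "bdd_below ((\<lambda>t. q (x + t *\<^sub>R y) - t * q y) ` {0..})" for x
      using lower[of _ x] by (intro bdd_belowI2[of _ "- q (- x)"]) auto
    have "sublinear ?r"
    proof (rule sublinear_INF)
      fix i j :: real and x z assume "i \<in> {0..}" "j \<in> {0..}"
      then show "\<exists>k\<in>{0..}. q (x + z + k *\<^sub>R y) - k * q y
          \<le> (q (x + i *\<^sub>R y) - i * q y) + (q (z + j *\<^sub>R y) - j * q y)" using sublinear_add[OF q, of "x + i *\<^sub>R y" "z + j *\<^sub>R y"]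
        by (intro bexI[of _ "i + j"]) (auto simp: algebra_simps)
    next
      fix i a :: real and x assume "i \<in> {0..}" "0 < a"
      then show "\<exists>k\<in>{0..}. q (a *\<^sub>R x + k *\<^sub>R y) - k * q y \<le> a * (q (x + i *\<^sub>R y) - i * q y)"
        using sublinear_scale[OF q, of a "x + i *\<^sub>R y"] by (intro bexI[of _ "a * i"]) (auto simp: algebra_simps)
    next
      have "(\<lambda>t. q (0 + t *\<^sub>R y) - t * q y) ` {0..} = {0}" using sublinear_scale[OF q, of _ y] by (auto simp: image_def)
      then show "(INF t\<in>{0..}. q (0 + t *\<^sub>R y) - t * q y) = 0" by simp
    qed (use bd in auto)
    moreover have "?r x \<le> q x" for x using cINF_lower[OF bd[of x], of 0] by simp
    ultimately have "?r = q" using min by blast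
    then have "?r x = q x" by (rule fun_cong)
    moreover have "?r x \<le> q (x + y) - q y" using cINF_lower[OF bd[of x], of 1] by simp
    ultimately show ?thesis by simp
  qed
  have add: "q (x + y) = q x + q y" for x y using sup[of x y] sublinear_add[OF q, of x y] by simp
  have neg: "q (- x) = - q x" for x using add[of x "- x"] sublinear_0[OF q] by simp
  have "q (a *\<^sub>R x) = a * q x" for a x
  proof (cases "0 \<le> a")
    case True then show ?thesis using sublinear_scale[OF q] by simp
  next
    case False
    then show ?thesis using sublinear_scale[OF q, of "- a" x] neg[of "(- a) *\<^sub>R x"] by simp
  qed
  then show ?thesis using add by (intro linearI) auto
qed

text \<open>Zorn's lemma for the reversed pointwise order, so that its maximal element is a minimal
  functional. The infimum of a chain stays finite because every sublinear minorant of p is at least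
  - p (- x).\<close>

lemma sublinear_minorant:
  fixes p :: "'v::real_vector \<Rightarrow> real"
  assumes p: "sublinear p"
  shows "\<exists>\<Lambda>. linear \<Lambda> \<and> (\<forall>x. \<Lambda> x \<le> p x)"
proof -
  define A where "A = {q. sublinear q \<and> (\<forall>x. q x \<le> p x)}"
  define r where "r = {(f, g). f \<in> A \<and> g \<in> A \<and> (\<forall>x. g x \<le> f x)}"
  have F: "Field r = A" by (auto simp: r_def Field_def)
  have po: "Partial_order r" unfolding partial_order_on_def preorder_on_def F
    by (auto simp: r_def refl_on_def trans_def antisym_def fun_eq_iff intro: order_trans antisym)
  have lowerA: "- p (- x) \<le> q x" if "q \<in> A" for q x
    using that sublinear_ge[of q x] unfolding A_def by (smt (verit) mem_Collect_eq)
  have "\<exists>u\<in>A. \<forall>q\<in>C. (q, u) \<in> r" if C: "C \<in> Chains r" for C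
  proof (cases "C = {}")
    case True
    then show ?thesis using p by (auto simp: A_def)
  next
    case False
    have CA: "C \<subseteq> A" using C by (auto simp: Chains_def r_def)
    have bd: "bdd_below ((\<lambda>q. q x) ` C)" for x using lowerA CA by (intro bdd_belowI2[of _ "- p (- x)"]) auto
    let ?u = "\<lambda>x. INF q\<in>C. q x"
    have le: "?u x \<le> q x" if "q \<in> C" for q x using bd that by (rule cINF_lower)
    have "sublinear ?u"
    proof (rule sublinear_INF[OF False bd])
      fix i j and x y assume ij: "i \<in> C" "j \<in> C"
      then have "(i, j) \<in> r \<or> (j, i) \<in> r" using C by (auto simp: Chains_def)
      then obtain k where k: "k \<in> C" "\<forall>z. k z \<le> i z" "\<forall>z. k z \<le> j z" using ij unfolding r_def by auto
      then have "sublinear k" using CA by (auto simp: A_def)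
      then have "k (x + y) \<le> i x + j y" using sublinear_add[of k x y] k by (smt (verit))
      then show "\<exists>k\<in>C. k (x + y) \<le> i x + j y" using k by blast
    next
      fix i and a :: real and x assume "i \<in> C" "0 < a"
      moreover have "sublinear i" using \<open>i \<in> C\<close> CA by (auto simp: A_def)
      ultimately show "\<exists>k\<in>C. k (a *\<^sub>R x) \<le> a * i x" using sublinear_scale[of i a x] by (intro bexI[of _ i]) auto
    next
      have "(\<lambda>q. q 0) ` C = {0}" using False CA sublinear_0 by (fastforce simp: A_def)
      then show "(INF q\<in>C. q 0) = 0" by simp
    qed
    moreover have "?u x \<le> p x" for x
    proof -
      obtain q where "q \<in> C" using False by blast
      then show ?thesis using le[of q x] CA by (force simp: A_def intro: order_trans)
    qed
    ultimately have "?u \<in> A" by (auto simp: A_def)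
    then show ?thesis using le CA by (intro bexI[of _ ?u]) (auto simp: r_def)
  qed
  then obtain q where q: "q \<in> A" and max: "\<forall>s\<in>A. (q, s) \<in> r \<longrightarrow> s = q" using Zorns_po_lemma[OF po] unfolding F by metis
  have "linear q"
  proof (rule minimal_sublinear_linear)
    show "sublinear q" using q by (simp add: A_def)
    fix s assume s: "sublinear s" "\<forall>x. s x \<le> q x"
    then have "s \<in> A" using q by (auto simp: A_def intro: order_trans)
    then show "s = q" using max q s by (auto simp: r_def)
  qed
  then show ?thesis using q by (auto simp: A_def)
qed

text \<open>\<open>G\<close> is the graph of the functional to be extended. The infimum of p (x + f)
  - l over the graph is sublinear and at most p; at x = - f it is at most - l. A linear minorant is
  thus at least l at f, and equality follows because the graph also contains the opposite
  pair.\<close>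

lemma hahn_banach:
  fixes p :: "'v::real_vector \<Rightarrow> real" and G :: "('v \<times> real) set"
  assumes p: "sublinear p" and G: "subspace G"
    and dom: "\<And>f l. (f, l) \<in> G \<Longrightarrow> l \<le> p f"
  shows "\<exists>\<Lambda>. linear \<Lambda> \<and> (\<forall>x. \<Lambda> x \<le> p x) \<and> (\<forall>(f, l)\<in>G. \<Lambda> f = l)"
proof -
  let ?r = "\<lambda>x. INF g\<in>G. p (x + fst g) - snd g"
  have G0: "(0, 0) \<in> G" using subspace_0[OF G] by (simp add: zero_prod_def)
  have lower: "- p (- x) \<le> p (x + fst g) - snd g" if "g \<in> G" for g x
    using sublinear_add[OF p, of "x + fst g" "- x"] dom[of "fst g" "snd g"] that by simp
  have bd: "bdd_below ((\<lambda>g. p (x + fst g) - snd g) ` G)" for x using lower[of _ x] by (intro bdd_belowI2[of _ "- p (- x)"]) auto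
  have "sublinear ?r"
  proof (rule sublinear_INF[OF _ bd])
    show "G \<noteq> {}" using G0 by blast
    fix i j x y assume "i \<in> G" "j \<in> G"
    then show "\<exists>k\<in>G. p (x + y + fst k) - snd k \<le> (p (x + fst i) - snd i) + (p (y + fst j) - snd j)"
      using sublinear_add[OF p, of "x + fst i" "y + fst j"]
      by (intro bexI[of _ "i + j"]) (auto simp: algebra_simps intro: subspace_add[OF G])
  next
    fix i and a :: real and x assume "i \<in> G" "0 < a"
    then show "\<exists>k\<in>G. p (a *\<^sub>R x + fst k) - snd k \<le> a * (p (x + fst i) - snd i)" using sublinear_scale[OF p, of a "x + fst i"]
      by (intro bexI[of _ "a *\<^sub>R i"]) (auto simp: algebra_simps intro: subspace_scale[OF G])
  next
    have "?r 0 \<le> 0" using cINF_lower[OF bd[of 0] G0] sublinear_0[OF p] by simp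
    moreover have "0 \<le> ?r 0"
    proof (rule cINF_greatest)
      fix g assume "g \<in> G" then show "0 \<le> p (0 + fst g) - snd g" using dom[of "fst g" "snd g"] by simp
    qed (use G0 in blast)
    ultimately show "?r 0 = 0" by simp
  qed
  then obtain \<Lambda> where lin: "linear \<Lambda>" and le: "\<And>x. \<Lambda> x \<le> ?r x" using sublinear_minorant by blast
  have 1: "\<Lambda> x \<le> p x" for x using le[of x] cINF_lower[OF bd[of x] G0] by simp
  have 2: "l \<le> \<Lambda> f" if "(f, l) \<in> G" for f l
    using le[of "- f"] cINF_lower[OF bd[of "- f"] that] sublinear_0[OF p] linear_neg[OF lin, of f] by simp
  have "\<Lambda> f = l" if "(f, l) \<in> G" for f l
    using 2[OF that] 2[of "- f" "- l"] subspace_neg[OF G that] linear_neg[OF lin, of f] by simp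
  then show ?thesis using lin 1 by blast
qed

section \<open>Riesz representation for functionals on all bounded functions\<close>

lemma closed_Un_decompose:
  fixes C :: "'a::euclidean_space set"
  assumes "closed C" "open U" "open V" "C \<subseteq> U \<union> V"
  obtains C1 C2 where "closed C1" "closed C2" "C1 \<subseteq> U" "C2 \<subseteq> V" "C = C1 \<union> C2"
proof -
  obtain U' V' where "open U'" "open V'" "C - V \<subseteq> U'" "C - U \<subseteq> V'" "U' \<inter> V' = {}"
    using separation_normal[of "C - V" "C - U"] assms by (auto simp: closed_Diff)
  then show ?thesis using assms by (intro that[of "C - V'" "C - U'"]) (auto simp: closed_Diff)
qed

text \<open>Turns a finitely additive set function carried by a compact set into a Borel measure.
  The inner content of an open set is the supremum of m over closed subsets; it is subadditive by
  normality and countably so by compactness, and for the outer measure that it induces open sets are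
  measurable. On closed sets the measure can only exceed m, but the total masses agree; this is
  enough for \<open>riesz_compact\<close>.\<close>

lemma inner_content_measure:
  fixes m :: "'a::euclidean_space set \<Rightarrow> real"
  assumes K: "compact K"
    and nonneg: "\<And>A. 0 \<le> m A"
    and add: "\<And>A B. A \<inter> B = {} \<Longrightarrow> m (A \<union> B) = m A + m B"
    and mK: "\<And>A. m (A \<inter> K) = m A"
  shows "\<exists>M. sets M = sets borel \<and> (\<forall>A. closed A \<longrightarrow> ennreal (m A) \<le> emeasure M A)
     \<and> emeasure M UNIV = ennreal (m UNIV) \<and> emeasure M (- K) = 0"
proof -
  have mono: "m A \<le> m B" if "A \<subseteq> B" for A B using add[of A "B - A"] that nonneg[of "B - A"] by (simp add: Un_absorb1)
  have m0: "m {} = 0" using add[of "{}" "{}"] by simp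
  have sub: "m (A \<union> B) \<le> m A + m B" for A B using add[of A "B - A"] mono[of "B - A" B] by simp
  define \<mu> where "\<mu> U = (SUP C\<in>{C. closed C \<and> C \<subseteq> U}. ennreal (m C))" for U
  define out where "out A = (INF U\<in>{U. open U \<and> A \<subseteq> U}. \<mu> U)" for A
  have \<mu>_ge: "ennreal (m C) \<le> \<mu> U" if "closed C" "C \<subseteq> U" for C U unfolding \<mu>_def using that by (intro SUP_upper) auto
  have \<mu>_le: "\<mu> U \<le> ennreal (m U)" for U unfolding \<mu>_def using mono by (intro SUP_least) (auto intro: ennreal_leI)
  have \<mu>_mono: "\<mu> U \<le> \<mu> V" if "U \<subseteq> V" for U V unfolding \<mu>_def using that by (intro SUP_subset_mono) auto
  have \<mu>_Un: "\<mu> (U \<union> V) \<le> \<mu> U + \<mu> V" if "open U" "open V" for U V unfolding \<mu>_def[of "U \<union> V"]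
  proof (rule SUP_least, clarify)
    fix C assume "closed C" "C \<subseteq> U \<union> V"
    then obtain C1 C2 where C: "closed C1" "closed C2" "C1 \<subseteq> U" "C2 \<subseteq> V" "C = C1 \<union> C2"
      by (rule closed_Un_decompose[OF _ \<open>open U\<close> \<open>open V\<close>])
    have "ennreal (m C) \<le> ennreal (m C1) + ennreal (m C2)"
      using sub[of C1 C2] C nonneg by (simp add: ennreal_plus[symmetric] del: ennreal_plus)
    also have "\<dots> \<le> \<mu> U + \<mu> V" using C by (intro add_mono \<mu>_ge)
    finally show "ennreal (m C) \<le> \<mu> U + \<mu> V" .
  qed
  have \<mu>_fin: "\<mu> (\<Union>i<n. U i) \<le> (\<Sum>i<n. \<mu> (U i))" if "\<And>i. open (U i)" for U :: "nat \<Rightarrow> _" and n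
  proof (induction n)
    case 0
    have "\<mu> {} \<le> 0" using \<mu>_le[of "{}"] m0 by simp
    then show ?case by simp
  next
    case (Suc n)
    have "\<mu> (\<Union>i<Suc n. U i) = \<mu> ((\<Union>i<n. U i) \<union> U n)" by (simp add: lessThan_Suc Un_commute)
    also have "\<dots> \<le> \<mu> (\<Union>i<n. U i) + \<mu> (U n)" using that by (intro \<mu>_Un) auto
    also have "\<dots> \<le> (\<Sum>i<Suc n. \<mu> (U i))" using Suc by (simp add: add_right_mono)
    finally show ?case .
  qed
  have \<mu>_UN: "\<mu> (\<Union>i. U i) \<le> (\<Sum>i. \<mu> (U i))" if U: "\<And>i. open (U i)" for U :: "nat \<Rightarrow> _" unfolding \<mu>_def[of "\<Union>i. U i"]
  proof (rule SUP_least, clarify)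
    fix C assume C: "closed C" "C \<subseteq> (\<Union>i. U i)"
    \<comment> \<open>Intersecting with K does not change m and makes a finite subcover
      available.\<close>
    then have "compact (C \<inter> K)" "C \<inter> K \<subseteq> (\<Union>i. U i)" using K by (auto simp: closed_Int_compact)
    then obtain I where I: "finite I" "C \<inter> K \<subseteq> (\<Union>i\<in>I. U i)" using compactE_image[of "C \<inter> K" UNIV U] U by (metis subset_UNIV)
    obtain n where "I \<subseteq> {..<n}" using I by (meson finite_nat_iff_bounded)
    with I have n: "C \<inter> K \<subseteq> (\<Union>i<n. U i)" by blast
    have "ennreal (m C) = ennreal (m (C \<inter> K))" by (simp add: mK)
    also have "\<dots> \<le> \<mu> (\<Union>i<n. U i)" using I n C K by (intro \<mu>_ge) (auto intro: closed_Int compact_imp_closed)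
    also have "\<dots> \<le> (\<Sum>i<n. \<mu> (U i))" using U by (rule \<mu>_fin)
    also have "\<dots> \<le> (\<Sum>i. \<mu> (U i))" by (intro sum_le_suminf) auto
    finally show "ennreal (m C) \<le> (\<Sum>i. \<mu> (U i))" .
  qed
  have out_open: "out U = \<mu> U" if "open U" for U
    unfolding out_def using that \<mu>_mono by (intro antisym INF_lower INF_greatest) auto
  have out_mono: "out A \<le> out B" if "A \<subseteq> B" for A B unfolding out_def using that by (intro INF_superset_mono) auto
  have out_le: "out A \<le> \<mu> U" if "open U" "A \<subseteq> U" for A U unfolding out_def using that by (intro INF_lower) auto
  have out_fin: "out A < top" for A
    using order_trans[OF out_le[of UNIV A] \<mu>_le[of UNIV]] by (simp add: le_less_trans[OF _ ennreal_less_top])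
  have oms: "outer_measure_space (Pow UNIV) out" unfolding outer_measure_space_def
  proof (intro conjI)
    show "positive (Pow UNIV) out" using out_open[of "{}"] \<mu>_le[of "{}"] m0 by (simp add: positive_def)
    show "increasing (Pow UNIV) out" using out_mono by (auto simp: increasing_def)
    show "countably_subadditive (Pow UNIV) out" unfolding countably_subadditive_def
    proof (intro allI impI)
      fix A :: "nat \<Rightarrow> 'a set"
      show "out (\<Union>i. A i) \<le> (\<Sum>i. out (A i))"
      proof (rule ennreal_le_epsilon)
        fix e :: real assume e: "0 < e"
        have "\<exists>U. open U \<and> A n \<subseteq> U \<and> \<mu> U \<le> out (A n) + ennreal (e * (1/2)^Suc n)" for n
        proof -
          have "0 < ennreal (e * (1/2)^Suc n)" using e by simp
          then have "out (A n) + 0 < out (A n) + ennreal (e * (1/2)^Suc n)"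
            using out_fin[of "A n"] unfolding ennreal_add_left_cancel_less by simp
          then have "out (A n) < out (A n) + ennreal (e * (1/2)^Suc n)" by (simp only: add_0_right)
          then obtain U where "open U" "A n \<subseteq> U" "\<mu> U < out (A n) + ennreal (e * (1/2)^Suc n)"
            unfolding out_def[of "A n"] INF_less_iff by auto
          then show ?thesis by (auto intro: less_imp_le)
        qed
        then obtain U where U: "\<And>n. open (U n)" "\<And>n. A n \<subseteq> U n"
          "\<And>n. \<mu> (U n) \<le> out (A n) + ennreal (e * (1/2)^Suc n)" by metis
        have "out (\<Union>i. A i) \<le> \<mu> (\<Union>i. U i)" using U by (intro out_le) auto
        also have "\<dots> \<le> (\<Sum>i. \<mu> (U i))" using U(1) by (rule \<mu>_UN)
        also have "\<dots> \<le> (\<Sum>n. out (A n) + ennreal (e * (1/2) ^ Suc n))" by (intro suminf_le U) auto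
        also have "\<dots> = (\<Sum>n. out (A n)) + (\<Sum>n. ennreal e * ennreal ((1/2) ^ Suc n))" using e by (subst suminf_add[symmetric])
            (auto simp del: ennreal_suminf_cmult simp add: ennreal_mult[symmetric])
        also have "\<dots> = (\<Sum>n. out (A n)) + e" unfolding ennreal_suminf_cmult
          by (subst suminf_ennreal_eq[OF zero_le_power power_half_series]) auto
        finally show "out (\<Union>i. A i) \<le> (\<Sum>n. out (A n)) + ennreal e" .
      qed
    qed
  qed
  interpret P: sigma_algebra UNIV "Pow UNIV :: 'a set set" by (rule sigma_algebra_Pow)
  have ms: "measure_space UNIV (lambda_system UNIV (Pow UNIV) out) out" by (rule P.caratheodory_lemma[OF oms])
  have open_lam: "U \<in> lambda_system UNIV (Pow UNIV) out" if U: "open U" for U unfolding P.lambda_system_eq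
  proof (clarsimp, rule antisym)
    fix A
    show "out (A \<inter> U) + out (A - U) \<le> out A" unfolding out_def[of A]
    proof (rule INF_greatest, clarify)
      fix V assume V: "open V" "A \<subseteq> V"
      have "out (A \<inter> U) + out (A - U) \<le> \<mu> (V \<inter> U) + out (V - U)" using V U by (intro add_mono out_le out_mono) auto
      \<comment> \<open>Exhaust the intersection of V and U by closed sets C, then V - C by closed
        sets D. As C and D are disjoint, m adds up on them.\<close>
      also have "\<dots> \<le> \<mu> V" unfolding \<mu>_def[of "V \<inter> U"]
      proof (subst ennreal_SUP_add_left[symmetric], force, rule SUP_least, clarify)
        fix C assume C: "closed C" "C \<subseteq> V \<inter> U"
        have "ennreal (m C) + out (V - U) \<le> ennreal (m C) + \<mu> (V - C)" using C V by (intro add_mono out_le) auto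
        also have "\<dots> = (SUP D\<in>{D. closed D \<and> D \<subseteq> V - C}. ennreal (m C) + ennreal (m D))"
          unfolding \<mu>_def by (subst ennreal_SUP_add_right) auto
        also have "\<dots> \<le> \<mu> V"
        proof (rule SUP_least, clarify)
          fix D assume D: "closed D" "D \<subseteq> V - C"
          have "ennreal (m C) + ennreal (m D) = ennreal (m (C \<union> D))" using D add[of C D] nonneg by (subst add) auto
          also have "\<dots> \<le> \<mu> V" using C D by (intro \<mu>_ge) auto
          finally show "ennreal (m C) + ennreal (m D) \<le> \<mu> V" .
        qed
        finally show "ennreal (m C) + out (V - U) \<le> \<mu> V" .
      qed
      finally show "out (A \<inter> U) + out (A - U) \<le> \<mu> V" .
    qed
    have "subadditive (Pow UNIV) out" using oms P.countably_subadditive_subadditive by (auto simp: outer_measure_space_def)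
    then have "out ((A \<inter> U) \<union> (A - U)) \<le> out (A \<inter> U) + out (A - U)" by (intro subadditiveD) auto
    then show "out A \<le> out (A \<inter> U) + out (A - U)" by (simp add: Int_Diff_Un)
  qed
  have "sigma_algebra UNIV (lambda_system UNIV (Pow UNIV) out)" using ms by (simp add: measure_space_def)
  then have "sigma_sets UNIV {U. open U} \<subseteq> lambda_system UNIV (Pow UNIV) out"
    using open_lam by (intro sigma_algebra.sigma_sets_subset) auto
  then have "sets borel \<subseteq> lambda_system UNIV (Pow UNIV) out" by (simp add: borel_def)
  then have ms': "measure_space UNIV (sets borel) out" using measure_down[OF ms] sets.sigma_algebra_axioms[of borel] by simp
  define M where "M = measure_of UNIV (sets (borel :: 'a measure)) out"
  have sM: "sets M = sets borel" unfolding M_def using sets.sigma_sets_eq[of borel] by simp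
  have eM: "emeasure M A = out A" if "A \<in> sets borel" for A
    unfolding M_def using ms' that by (intro emeasure_measure_of_sigma) (auto simp: measure_space_def)
  have 1: "ennreal (m A) \<le> emeasure M A" if "closed A" for A
  proof -
    have "ennreal (m A) \<le> out A" unfolding out_def using that \<mu>_ge by (intro INF_greatest) auto
    then show ?thesis using that by (simp add: eM)
  qed
  moreover have "emeasure M UNIV = ennreal (m UNIV)"
    using 1[of UNIV] \<mu>_le[of UNIV] by (intro antisym) (simp_all add: eM out_open)
  moreover have "emeasure M (- K) = 0"
  proof -
    have "m (- K) = 0" using mK[of "- K"] m0 by simp
    then have "\<mu> (- K) \<le> 0" using \<mu>_le[of "- K"] by simp
    then show ?thesis using K by (simp add: eM out_open compact_imp_closed open_Compl)
  qed
  ultimately show ?thesis using sM by blast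
qed

lemma bounded_range_scale:
  fixes f :: "'a \<Rightarrow> real"
  assumes "bounded (range f)"
  shows "bounded (range (\<lambda>x. c * f x))"
  using bounded_scaling[OF assms, of c] unfolding image_image by simp

text \<open>The functional lives on all bounded functions, so its values on indicators form a
  content m on all sets. For f with values in [0, 1] the superlevel sets are closed, and there m is
  at most the measure; hence the functional is at most the integral. Applying this to f and to - f,
  both moved into [0, 1], gives equality, because constants have the same value on both
  sides.\<close>

lemma riesz_compact:
  fixes \<Lambda> :: "('a::euclidean_space \<Rightarrow> real) \<Rightarrow> real"
  assumes K: "compact K"
    and add: "\<And>f g. bounded (range f) \<Longrightarrow> bounded (range g) \<Longrightarrow> \<Lambda> (\<lambda>x. f x + g x) = \<Lambda> f + \<Lambda> g"
    and scale: "\<And>c f. bounded (range f) \<Longrightarrow> \<Lambda> (\<lambda>x. c * f x) = c * \<Lambda> f"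
    and pos: "\<And>f. bounded (range f) \<Longrightarrow> (\<And>x. x \<in> K \<Longrightarrow> 0 \<le> f x) \<Longrightarrow> 0 \<le> \<Lambda> f"
  shows "\<exists>M. sets M = sets borel \<and> finite_measure M \<and> emeasure M (- K) = 0 \<and>
     (\<forall>f. continuous_on K f \<longrightarrow>
        \<Lambda> (\<lambda>x. if x \<in> K then f x else 0) = (\<integral>x. (if x \<in> K then f x else 0) \<partial>M))"
proof -
  define m where "m A = \<Lambda> (indicat_real A)" for A
  have bi: "bounded (range (indicat_real A))" for A :: "'a set" by (rule boundedI[of _ 1]) (auto simp: indicator_def)
  have mono: "\<Lambda> f \<le> \<Lambda> g"
    if "bounded (range f)" "bounded (range g)" "\<And>x. x \<in> K \<Longrightarrow> f x \<le> g x" for f g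
  proof -
    have "bounded (range (\<lambda>x. -1 * f x))" using that(1) by (rule bounded_range_scale)
    then have "\<Lambda> (\<lambda>x. g x + -1 * f x) = \<Lambda> g + -1 * \<Lambda> f" using that add[of g "\<lambda>x. -1 * f x"] scale[of f "-1"] by simp
    moreover have "bounded (range (\<lambda>x. g x + -1 * f x))"
      using bounded_plus_comp[OF that(2) \<open>bounded (range (\<lambda>x. -1 * f x))\<close>] by simp
    ultimately show ?thesis using pos[of "\<lambda>x. g x + -1 * f x"] that(3) by force
  qed
  have "\<exists>M. sets M = sets borel \<and> (\<forall>A. closed A \<longrightarrow> ennreal (m A) \<le> emeasure M A)
     \<and> emeasure M UNIV = ennreal (m UNIV) \<and> emeasure M (- K) = 0"
  proof (rule inner_content_measure[OF K])
    show "0 \<le> m A" for A unfolding m_def by (rule pos[OF bi]) auto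
    show "m (A \<union> B) = m A + m B" if "A \<inter> B = {}" for A B unfolding m_def add[OF bi bi, symmetric]
      using that by (intro arg_cong[of _ _ \<Lambda>]) (auto simp: indicator_def fun_eq_iff)
    show "m (A \<inter> K) = m A" for A unfolding m_def by (intro antisym mono bi) (auto simp: indicator_def)
  qed
  then obtain M where sM: "sets M = sets borel" and cl: "\<And>A. closed A \<Longrightarrow> ennreal (m A) \<le> emeasure M A"
    and tot: "emeasure M UNIV = ennreal (m UNIV)" and supp: "emeasure M (- K) = 0" by blast
  have sp: "space M = UNIV" using sets_eq_imp_space_eq[OF sM] by simp
  interpret finite_measure M by standard (simp add: sp tot)
  have m_nonneg: "0 \<le> m A" for A unfolding m_def by (rule pos[OF bi]) auto
  have cl': "m A \<le> measure M A" if "closed A" for A using cl[OF that] m_nonneg[of A] by (simp add: emeasure_eq_measure)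
  have Kb: "K \<in> sets M" using K by (simp add: sM compact_imp_closed)
  have totK: "m UNIV = measure M K"
  proof -
    have "measure M (- K) = 0" using supp by (simp add: measure_def)
    moreover have "measure M UNIV = measure M K + measure M (- K)"
      using Kb finite_measure_compl[of K] by (simp add: sp Compl_eq_Diff_UNIV)
    moreover have "m UNIV = measure M UNIV" using tot m_nonneg[of UNIV] by (simp add: emeasure_eq_measure)
    ultimately show ?thesis by simp
  qed
  let ?h = "\<lambda>f x. if x \<in> K then f x else 0::real"
  have hm: "?h f \<in> borel_measurable M" if "continuous_on K f" for f
  proof -
    have "(\<lambda>x. indicator K x *\<^sub>R f x) \<in> borel_measurable borel"
      using that K by (intro borel_measurable_continuous_on_indicator) (auto simp: compact_imp_closed)
    moreover have "(\<lambda>x. indicator K x *\<^sub>R f x) = ?h f" by (auto simp: indicator_def)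
    ultimately show ?thesis by (simp add: measurable_cong_sets[OF sM refl])
  qed
  have hi: "integrable M (?h f) \<and> bounded (range (?h f))" if f: "continuous_on K f" for f
  proof -
    have "bounded (f ` K)" using K f compact_continuous_image compact_imp_bounded by blast
    then obtain B where B: "\<And>x. x \<in> K \<Longrightarrow> \<bar>f x\<bar> \<le> B" by (auto simp: bounded_iff)
    have le: "norm (?h f x) \<le> \<bar>B\<bar>" for x using B[of x] by auto
    show ?thesis
    proof
      show "integrable M (?h f)" using le by (intro integrable_const_bound[of _ "\<bar>B\<bar>"] hm[OF f]) blast
      show "bounded (range (?h f))" using le by (intro boundedI[of _ "\<bar>B\<bar>"]) blast
    qed
  qed
  have le: "\<Lambda> (?h f) \<le> (\<integral>x. ?h f x \<partial>M)"
    if f: "continuous_on K f" and f01: "\<And>x. x \<in> K \<Longrightarrow> 0 \<le> f x \<and> f x \<le> 1" for f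
  proof (rule field_le_epsilon)
    fix e :: real assume e: "0 < e"
    obtain n where n: "m UNIV / e < real n" "0 < n"
    proof -
      obtain n where "max 0 (m UNIV / e) < real n" using reals_Archimedean2 by blast
      then show ?thesis by (intro that[of n]) auto
    qed
    \<comment> \<open>Layer-cake approximation: the indicators of n closed superlevel sets, each
      with weight 1 / n, add up to \<lfloor>n f\<rfloor> / n, which is within 1 / n of f.\<close>
    define C where "C i = {x \<in> K. real i / n \<le> f x}" for i
    have Cc: "closed (C i)" for i
    proof -
      have "C i = K \<inter> f -` {real i / n..}" by (auto simp: C_def)
      then show ?thesis using continuous_closed_preimage[OF f compact_imp_closed[OF K] closed_atLeast] by simp
    qed
    define s where "s x = (\<Sum>i\<in>{1..n}. (1 / n) * indicat_real (C i) x)" for x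
    have s: "s x = \<lfloor>n * f x\<rfloor> / n" if "x \<in> K" for x
    proof -
      define k where "k = nat \<lfloor>n * f x\<rfloor>"
      have "n * f x \<le> n" using f01[OF that] n by (simp add: mult_left_le)
      then have 1: "k \<le> n" unfolding k_def by linarith
      have 2: "0 \<le> n * f x" using f01[OF that] by simp
      have mem: "x \<in> C i \<longleftrightarrow> i \<le> k" for i
      proof -
        have "x \<in> C i \<longleftrightarrow> real i \<le> n * f x" using that n by (simp add: C_def pos_divide_le_eq mult.commute)
        also have "\<dots> \<longleftrightarrow> i \<le> k" using 2 unfolding k_def by linarith
        finally show ?thesis .
      qed
      have "s x = (\<Sum>i\<in>{1..n}. if i \<le> k then 1 / n else 0)"
        unfolding s_def by (intro sum.cong refl) (simp add: indicator_def mem)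
      also have "\<dots> = (\<Sum>i\<in>{i\<in>{1..n}. i \<le> k}. 1 / n)" by (rule sum.inter_filter[symmetric]) simp
      also have "{i\<in>{1..n}. i \<le> k} = {1..k}" using 1 by auto
      finally have "s x = (1 / n) * real k" by simp
      then have "s x = (1 / n) * real (nat \<lfloor>n * f x\<rfloor>)" by (simp only: k_def)
      then show ?thesis using f01[OF that] by simp
    qed
    have bs: "bounded (range (\<lambda>x. \<Sum>i\<in>I. (1 / n) * indicat_real (C i) x))" for I
    proof (rule boundedI[of _ "\<Sum>i\<in>I. 1 / n"], clarify)
      fix x have "norm (\<Sum>i\<in>I. (1 / n) * indicat_real (C i) x) \<le> (\<Sum>i\<in>I. norm ((1 / n) * indicat_real (C i) x))"
        by (rule norm_sum)
      also have "\<dots> \<le> (\<Sum>i\<in>I. 1 / n)" by (intro sum_mono) (auto simp: indicator_def)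
      finally show "norm (\<Sum>i\<in>I. (1 / n) * indicat_real (C i) x) \<le> (\<Sum>i\<in>I. 1 / n)" .
    qed
    have bc: "bounded (range (\<lambda>x. c * indicat_real A x))" for c and A :: "'a set"
      by (rule boundedI[of _ "\<bar>c\<bar>"]) (auto simp: indicator_def)
    have Ls: "\<Lambda> (\<lambda>x. \<Sum>i\<in>I. (1 / n) * indicat_real (C i) x) = (\<Sum>i\<in>I. (1 / n) * m (C i))"
      if "finite I" for I using that
    proof induction
      case empty
      then show ?case using scale[OF bi, of 0 UNIV] by simp
    next
      case (insert i I)
      have "\<Lambda> (\<lambda>x. (1 / n) * indicat_real (C i) x + (\<Sum>i\<in>I. (1 / n) * indicat_real (C i) x))
        = (1 / n) * m (C i) + (\<Sum>i\<in>I. (1 / n) * m (C i))" using add[OF bc bs] scale[OF bi] insert.IH by (simp only: m_def)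
      then show ?case using insert.hyps by simp
    qed
    have "\<Lambda> (?h f) \<le> \<Lambda> (\<lambda>x. s x + (1 / n) * indicat_real UNIV x)"
    proof (rule mono)
      show "bounded (range (?h f))" using hi f by blast
      show "bounded (range (\<lambda>x. s x + (1 / n) * indicat_real UNIV x))" unfolding s_def by (rule bounded_plus_comp[OF bs bc])
      fix x assume x: "x \<in> K"
      have "n * f x \<le> \<lfloor>n * f x\<rfloor> + 1" by linarith
      then show "?h f x \<le> s x + (1 / n) * indicat_real UNIV x" using x n by (simp add: s field_simps)
    qed
    also have "\<dots> = (\<Sum>i\<in>{1..n}. (1 / n) * m (C i)) + (1 / n) * m UNIV"
      using add[OF bs bc, of "{1..n}" "1/n" UNIV] Ls[of "{1..n}"] scale[OF bi, of "1/n" UNIV] by (simp add: s_def m_def)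
    also have "(\<Sum>i\<in>{1..n}. (1 / n) * m (C i)) \<le> (\<Sum>i\<in>{1..n}. (1 / n) * measure M (C i))"
      using Cc by (intro sum_mono mult_left_mono cl') auto
    also have "\<dots> = (\<integral>x. s x \<partial>M)"
      unfolding s_def using Cc by (subst Bochner_Integration.integral_sum) (auto simp: sM emeasure_eq_measure)
    also have "\<dots> \<le> (\<integral>x. ?h f x \<partial>M)"
    proof (rule integral_mono)
      show "integrable M s" unfolding s_def using Cc
        by (intro Bochner_Integration.integrable_sum integrable_mult_right) (auto simp: sM emeasure_eq_measure)
      show "integrable M (?h f)" using hi f by blast
      fix x
      have "s x = 0" if "x \<notin> K" using that by (simp add: s_def C_def)
      moreover have "\<lfloor>n * f x\<rfloor> \<le> n * f x" by linarith
      ultimately show "s x \<le> ?h f x" using n by (auto simp: s field_simps)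
    qed
    also have "(1 / n) * m UNIV \<le> e" using n e by (simp add: field_simps)
    finally show "\<Lambda> (?h f) \<le> (\<integral>x. ?h f x \<partial>M) + e" by simp
  qed
  have "\<Lambda> (?h f) = (\<integral>x. ?h f x \<partial>M)" if f: "continuous_on K f" for f
  proof -
    have "bounded (f ` K)" using K f compact_continuous_image compact_imp_bounded by blast
    then obtain B where B: "B > 0" "\<And>x. x \<in> K \<Longrightarrow> \<bar>f x\<bar> \<le> B" by (auto simp: bounded_pos)
    have lin: "\<Lambda> (?h (\<lambda>x. a * f x + b)) = a * \<Lambda> (?h f) + b * m UNIV \<and>
       (\<integral>x. ?h (\<lambda>x. a * f x + b) x \<partial>M) = a * (\<integral>x. ?h f x \<partial>M) + b * m UNIV" for a b
    proof -
      have e: "?h (\<lambda>x. a * f x + b) = (\<lambda>x. a * ?h f x + b * indicat_real K x)" by (rule ext) simp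
      have b1: "bounded (range (\<lambda>x. a * ?h f x))" using hi[OF f] by (intro bounded_range_scale) blast
      have b2: "bounded (range (\<lambda>x. b * indicat_real K x))" by (rule boundedI[of _ "\<bar>b\<bar>"]) (auto simp: indicator_def)
      have mK: "\<Lambda> (indicat_real K) = m UNIV" unfolding m_def by (intro antisym mono bi) (auto simp: indicator_def)
      have 1: "\<Lambda> (\<lambda>x. a * ?h f x + b * indicat_real K x) = a * \<Lambda> (?h f) + b * m UNIV"
        unfolding add[OF b1 b2] scale[OF bi] scale[OF conjunct2[OF hi[OF f]]] mK ..
      have "(\<integral>x. a * ?h f x + b * indicat_real K x \<partial>M) = (\<integral>x. a * ?h f x \<partial>M) + (\<integral>x. b * indicat_real K x \<partial>M)"
        using hi[OF f] Kb by (intro Bochner_Integration.integral_add integrable_mult_right)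
          (auto simp: emeasure_eq_measure)
      also have "\<dots> = a * (\<integral>x. ?h f x \<partial>M) + b * m UNIV" using Kb by (simp add: totK)
      finally show ?thesis unfolding e using 1 by (intro conjI)
    qed
    \<comment> \<open>As f is bounded by B on K, both f / (2 B) + 1 / 2 and - f / (2 B) + 1 / 2 take
      values in [0, 1] there.\<close>
    let ?a = "1 / (2 * B)"
    have "\<Lambda> (?h (\<lambda>x. ?a * f x + 1 / 2)) \<le> (\<integral>x. ?h (\<lambda>x. ?a * f x + 1 / 2) x \<partial>M)"
    proof (rule le)
      fix x assume "x \<in> K"
      then have "- B \<le> f x" "f x \<le> B" using B(2)[of x] by auto
      then show "0 \<le> ?a * f x + 1 / 2 \<and> ?a * f x + 1 / 2 \<le> 1" using B(1) by (simp add: field_simps)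
    qed (intro continuous_intros f)
    moreover have "\<Lambda> (?h (\<lambda>x. (- ?a) * f x + 1 / 2)) \<le> (\<integral>x. ?h (\<lambda>x. (- ?a) * f x + 1 / 2) x \<partial>M)"
    proof (rule le)
      fix x assume "x \<in> K"
      then have "- B \<le> f x" "f x \<le> B" using B(2)[of x] by auto
      then show "0 \<le> (- ?a) * f x + 1 / 2 \<and> (- ?a) * f x + 1 / 2 \<le> 1" using B(1) by (simp add: field_simps)
    qed (intro continuous_intros f)
    ultimately have "?a * \<Lambda> (?h f) = ?a * (\<integral>x. ?h f x \<partial>M)"
      unfolding conjunct1[OF lin] conjunct2[OF lin] by (simp only: mult_minus_left)
    then show ?thesis using B(1) by (simp only: mult_cancel_left) auto
  qed
  then show ?thesis by (intro exI[of _ M] conjI allI impI sM supp finite_measure_axioms)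
qed

text \<open>Every function on a discrete space is continuous. In this way all bounded functions form
  a type of vectors, as \<open>hahn_banach\<close> requires.\<close>

definition bounded_fun :: "('k \<Rightarrow> real) \<Rightarrow> 'k discrete \<Rightarrow>\<^sub>C real" where
  "bounded_fun f = Bcontfun (\<lambda>z. f (of_discrete z))"

lemma apply_bounded_fun:
  assumes "bounded (range f)"
  shows "apply_bcontfun (bounded_fun f) z = f (of_discrete z)"
proof -
  have "(\<lambda>z. f (of_discrete z)) \<in> bcontfun" unfolding bcontfun_def mem_Collect_eq
  proof
    show "continuous_on UNIV (\<lambda>z. f (of_discrete z))" by (simp add: continuous_on_open_vimage open_discrete)
    show "bounded (range (\<lambda>z. f (of_discrete z)))" using assms by (rule bounded_subset) auto
  qed
  then show ?thesis unfolding bounded_fun_def by (simp add: Bcontfun_inverse)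
qed

text \<open>A Farkas alternative with infinitely many test objects. A function on K1 and one on K2
  make a single bounded function on the sum type, and l becomes a functional of it, dominated by C
  times the supremum of the positive part. A linear functional dominated in this way is nonnegative
  on nonnegative functions, since the dominating functional vanishes on their negatives;
  \<open>riesz_compact\<close> then represents its restrictions to the two summands.\<close>

lemma compact_farkas:
  fixes K1 :: "'a::euclidean_space set" and K2 :: "'b::euclidean_space set"
    and G :: "'x set" and l :: "'x \<Rightarrow> real" and a :: "'x \<Rightarrow> 'a \<Rightarrow> real" and b :: "'x \<Rightarrow> 'b \<Rightarrow> real"
  assumes K1: "compact K1" and K2: "compact K2" and C: "0 \<le> C"
    and cont: "\<And>\<xi>. \<xi> \<in> G \<Longrightarrow> continuous_on K1 (a \<xi>) \<and> continuous_on K2 (b \<xi>)"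
    and ne: "G \<noteq> {}"
    and comb: "\<And>\<xi> \<eta> s t. \<xi> \<in> G \<Longrightarrow> \<eta> \<in> G \<Longrightarrow> \<exists>\<zeta>\<in>G. l \<zeta> = s * l \<xi> + t * l \<eta>
        \<and> (\<forall>x\<in>K1. a \<zeta> x = s * a \<xi> x + t * a \<eta> x) \<and> (\<forall>y\<in>K2. b \<zeta> y = s * b \<xi> y + t * b \<eta> y)"
    and dom: "\<And>\<xi> m. \<xi> \<in> G \<Longrightarrow> 0 \<le> m \<Longrightarrow> (\<And>x. x \<in> K1 \<Longrightarrow> a \<xi> x \<le> m) \<Longrightarrow> (\<And>y. y \<in> K2 \<Longrightarrow> b \<xi> y \<le> m)
        \<Longrightarrow> l \<xi> \<le> C * m"
  shows "\<exists>M N. sets M = sets borel \<and> finite_measure M \<and> emeasure M (- K1) = 0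
     \<and> sets N = sets borel \<and> finite_measure N \<and> emeasure N (- K2) = 0
     \<and> (\<forall>\<xi>\<in>G. l \<xi> = (\<integral>x. (if x \<in> K1 then a \<xi> x else 0) \<partial>M) + (\<integral>y. (if y \<in> K2 then b \<xi> y else 0) \<partial>N))"
proof -
  define J :: "('a \<Rightarrow> real) \<Rightarrow> ('b \<Rightarrow> real) \<Rightarrow> ('a + 'b) \<Rightarrow> real"
    where "J f g = case_sum f g" for f g
  define S where "S f g = J (\<lambda>x. if x \<in> K1 then f x else 0) (\<lambda>y. if y \<in> K2 then g y else 0)" for f g
  have bJ: "bounded (range (J f g))" if "bounded (range f)" "bounded (range g)" for f g
  proof -
    have "range (J f g) \<subseteq> range f \<union> range g" unfolding J_def by (rule image_subsetI) (simp split: sum.split)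
    then show ?thesis using that by (meson bounded_Un bounded_subset)
  qed
  have bK: "bounded (range (\<lambda>x. if x \<in> K then f x else 0))" if "compact K" "continuous_on K f"
    for K :: "'c::euclidean_space set" and f :: "'c \<Rightarrow> real"
  proof -
    have "bounded (f ` K)" using that compact_continuous_image compact_imp_bounded by blast
    then have "bounded (insert 0 (f ` K))" by simp
    then show ?thesis by (rule bounded_subset) auto
  qed
  have bS: "bounded (range (S (a \<xi>) (b \<xi>)))" if "\<xi> \<in> G" for \<xi> unfolding S_def using cont[OF that] K1 K2 by (intro bJ bK) auto
  let ?E = "bounded_fun :: ('a + 'b \<Rightarrow> real) \<Rightarrow> _"
  define p where "p h = C * (SUP z. max 0 (apply_bcontfun h z))" for h :: "('a + 'b) discrete \<Rightarrow>\<^sub>C real"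
  have bdd: "bdd_above (range (\<lambda>z. max 0 (apply_bcontfun h z)))" for h :: "('a + 'b) discrete \<Rightarrow>\<^sub>C real"
  proof (rule bdd_aboveI2)
    fix z show "max 0 (apply_bcontfun h z) \<le> norm h" using norm_bounded[of h z] by auto
  qed
  have p: "sublinear p" unfolding sublinear_def
  proof (intro conjI allI impI)
    fix g h :: "('a + 'b) discrete \<Rightarrow>\<^sub>C real"
    have "(SUP z. max 0 (apply_bcontfun (g + h) z)) \<le> (SUP z. max 0 (apply_bcontfun g z)) + (SUP z. max 0 (apply_bcontfun h z))"
    proof (rule cSUP_least)
      fix z show "max 0 (apply_bcontfun (g + h) z) \<le> (SUP z. max 0 (apply_bcontfun g z)) + (SUP z. max 0 (apply_bcontfun h z))"
        using cSUP_upper[OF _ bdd[of g], of z] cSUP_upper[OF _ bdd[of h], of z] by simp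
    qed simp
    then show "p (g + h) \<le> p g + p h" unfolding p_def using C by (simp add: distrib_left[symmetric] mult_left_mono)
  next
    fix c :: real and h :: "('a + 'b) discrete \<Rightarrow>\<^sub>C real" assume c: "0 \<le> c"
    have "(SUP z. max 0 (apply_bcontfun (c *\<^sub>R h) z)) = (SUP z. c * max 0 (apply_bcontfun h z))"
      using c by (intro SUP_cong) (auto simp: max_def mult_le_0_iff zero_le_mult_iff)
    also have "\<dots> = c * (SUP z. max 0 (apply_bcontfun h z))"
    proof -
      let ?S = "range (\<lambda>z. max 0 (apply_bcontfun h z))"
      have "continuous (at_left (Sup ?S)) (\<lambda>x. c * x)" by (intro continuous_intros)
      then have "c * Sup ?S = (SUP s\<in>?S. c * s)"
        using c bdd[of h] by (intro continuous_at_Sup_mono) (auto simp: mono_def mult_left_mono)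
      then show ?thesis by (simp add: image_image)
    qed
    finally show "p (c *\<^sub>R h) = c * p h" unfolding p_def by simp
  qed
  \<comment> \<open>The graph of l as a function of the values of a \<xi> and b \<xi>;
    \<open>comb\<close> makes it a subspace.\<close>
  define V where "V = (\<lambda>\<xi>. (?E (S (a \<xi>) (b \<xi>)), l \<xi>)) ` G"
  have V: "subspace V"
  proof -
    have V2: "s *\<^sub>R u + t *\<^sub>R v \<in> V" if "u \<in> V" "v \<in> V" for s t u v
    proof -
      obtain \<xi> \<eta> where x: "\<xi> \<in> G" "u = (?E (S (a \<xi>) (b \<xi>)), l \<xi>)" and y: "\<eta> \<in> G" "v = (?E (S (a \<eta>) (b \<eta>)), l \<eta>)"
        using \<open>u \<in> V\<close> \<open>v \<in> V\<close> by (auto simp: V_def)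
      obtain \<zeta> where z: "\<zeta> \<in> G" "l \<zeta> = s * l \<xi> + t * l \<eta>"
        "\<forall>x\<in>K1. a \<zeta> x = s * a \<xi> x + t * a \<eta> x" "\<forall>y\<in>K2. b \<zeta> y = s * b \<xi> y + t * b \<eta> y" using comb[OF x(1) y(1)] by blast
      have "S (a \<zeta>) (b \<zeta>) w = s * S (a \<xi>) (b \<xi>) w + t * S (a \<eta>) (b \<eta>) w" for w using z by (cases w) (auto simp: S_def J_def)
      then have "?E (S (a \<zeta>) (b \<zeta>)) = s *\<^sub>R ?E (S (a \<xi>) (b \<xi>)) + t *\<^sub>R ?E (S (a \<eta>) (b \<eta>))"
        by (intro bcontfun_eqI) (simp add: apply_bounded_fun[OF bS[OF x(1)]]
            apply_bounded_fun[OF bS[OF y(1)]] apply_bounded_fun[OF bS[OF z(1)]])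
      then have "s *\<^sub>R u + t *\<^sub>R v = (?E (S (a \<zeta>) (b \<zeta>)), l \<zeta>)" using x y z by simp
      then show ?thesis using z by (auto simp: V_def)
    qed
    obtain u where u: "u \<in> V" using ne by (auto simp: V_def)
    show ?thesis unfolding subspace_def using V2[OF u u, of 0 0] V2[of _ _ 1 1] V2[of _ _ _ 0] by auto
  qed
  have "l' \<le> p f" if fl: "(f, l') \<in> V" for f l'
  proof -
    obtain \<xi> where x: "\<xi> \<in> G" "f = ?E (S (a \<xi>) (b \<xi>))" "l' = l \<xi>" using fl by (auto simp: V_def)
    let ?m = "SUP z. max 0 (apply_bcontfun f z)"
    have ub: "max 0 (apply_bcontfun f z) \<le> ?m" for z using bdd[of f] by (rule cSUP_upper[OF UNIV_I])
    have ap: "apply_bcontfun f (discrete w) = S (a \<xi>) (b \<xi>) w" for w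
      by (simp add: x(2) apply_bounded_fun[OF bS[OF x(1)]] discrete_inverse)
    have "l \<xi> \<le> C * ?m"
    proof (rule dom[OF x(1)])
      show "0 \<le> ?m" using ub[of undefined] by simp
      show "a \<xi> w \<le> ?m" if "w \<in> K1" for w using ub[of "discrete (Inl w)"] that unfolding ap by (simp add: S_def J_def)
      show "b \<xi> w \<le> ?m" if "w \<in> K2" for w using ub[of "discrete (Inr w)"] that unfolding ap by (simp add: S_def J_def)
    qed
    then show ?thesis using x by (simp add: p_def)
  qed
  then obtain \<Lambda> where lin: "linear \<Lambda>" and le: "\<And>h. \<Lambda> h \<le> p h" and ext: "\<forall>(f, l')\<in>V. \<Lambda> f = l'" using hahn_banach[OF p V] by blast
  define \<Lambda>1 where "\<Lambda>1 f = \<Lambda> (?E (J (\<lambda>x. if x \<in> K1 then f x else 0) (\<lambda>_. 0)))" for f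
  define \<Lambda>2 where "\<Lambda>2 g = \<Lambda> (?E (J (\<lambda>_. 0) (\<lambda>y. if y \<in> K2 then g y else 0)))" for g
  have bif: "bounded (range (\<lambda>x. if x \<in> K then f x else 0))" if "bounded (range f)" for K and f :: "'c \<Rightarrow> real"
  proof -
    have "bounded (insert 0 (range f))" using that by simp
    then show ?thesis by (rule bounded_subset) auto
  qed
  have b0: "bounded (range (\<lambda>_::'c. 0::real))" by simp
  have Epos: "0 \<le> \<Lambda> (?E h)" if "bounded (range h)" "\<And>w. 0 \<le> h w" for h
  proof -
    have "p (- ?E h) = 0"
    proof -
      have "max 0 (apply_bcontfun (- ?E h) z) = 0" for z using that by (simp add: apply_bounded_fun)
      then show ?thesis by (simp add: p_def)
    qed
    then show ?thesis using le[of "- ?E h"] linear_neg[OF lin, of "?E h"] by simp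
  qed
  have Eadd: "\<Lambda> (?E (\<lambda>w. s * f w + t * g w)) = s * \<Lambda> (?E f) + t * \<Lambda> (?E g)"
    if "bounded (range f)" "bounded (range g)" for f g s t
  proof -
    have "bounded (range (\<lambda>w. s * f w + t * g w))" by (intro bounded_plus_comp bounded_range_scale that)
    then have "?E (\<lambda>w. s * f w + t * g w) = s *\<^sub>R ?E f + t *\<^sub>R ?E g"
      using that by (intro bcontfun_eqI) (simp add: apply_bounded_fun)
    then show ?thesis using lin by (simp add: linear_add linear_scale)
  qed
  have "\<exists>M. sets M = sets borel \<and> finite_measure M \<and> emeasure M (- K1) = 0 \<and>
     (\<forall>f. continuous_on K1 f \<longrightarrow>
        \<Lambda>1 (\<lambda>x. if x \<in> K1 then f x else 0) = (\<integral>x. (if x \<in> K1 then f x else 0) \<partial>M))"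
  proof (rule riesz_compact[OF K1])
    fix f g :: "'a \<Rightarrow> real" and c :: real assume f: "bounded (range f)"
    let ?I = "\<lambda>f. J (\<lambda>x. if x \<in> K1 then f x else 0) (\<lambda>_. 0)"
    have b: "bounded (range (?I f))" if "bounded (range f)" for f by (intro bJ bif b0 that)
    have e1: "?I (\<lambda>x. f x + g x) = (\<lambda>w. 1 * ?I f w + 1 * ?I g w)" by (auto simp: J_def fun_eq_iff split: sum.splits)
    have e2: "?I (\<lambda>x. c * f x) = (\<lambda>w. c * ?I f w + 0 * ?I f w)" by (auto simp: J_def fun_eq_iff split: sum.splits)
    show "\<Lambda>1 (\<lambda>x. f x + g x) = \<Lambda>1 f + \<Lambda>1 g" if "bounded (range g)" unfolding \<Lambda>1_def e1 Eadd[OF b[OF f] b[OF that]] by simp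
    show "\<Lambda>1 (\<lambda>x. c * f x) = c * \<Lambda>1 f" unfolding \<Lambda>1_def e2 Eadd[OF b[OF f] b[OF f]] by simp
    show "0 \<le> \<Lambda>1 f" if "\<And>x. x \<in> K1 \<Longrightarrow> 0 \<le> f x"
      unfolding \<Lambda>1_def using that by (intro Epos b f) (auto simp: J_def split: sum.splits)
  qed
  then obtain M where M: "sets M = sets borel" "finite_measure M" "emeasure M (- K1) = 0"
    "\<And>f. continuous_on K1 f \<Longrightarrow> \<Lambda>1 (\<lambda>x. if x \<in> K1 then f x else 0) = (\<integral>x. (if x \<in> K1 then f x else 0) \<partial>M)" by blast
  have "\<exists>N. sets N = sets borel \<and> finite_measure N \<and> emeasure N (- K2) = 0 \<and>
     (\<forall>f. continuous_on K2 f \<longrightarrow>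
        \<Lambda>2 (\<lambda>x. if x \<in> K2 then f x else 0) = (\<integral>x. (if x \<in> K2 then f x else 0) \<partial>N))"
  proof (rule riesz_compact[OF K2])
    fix f g :: "'b \<Rightarrow> real" and c :: real assume f: "bounded (range f)"
    let ?I = "\<lambda>f. J (\<lambda>_. 0) (\<lambda>x. if x \<in> K2 then f x else 0)"
    have b: "bounded (range (?I f))" if "bounded (range f)" for f by (intro bJ bif b0 that)
    have e1: "?I (\<lambda>x. f x + g x) = (\<lambda>w. 1 * ?I f w + 1 * ?I g w)" by (auto simp: J_def fun_eq_iff split: sum.splits)
    have e2: "?I (\<lambda>x. c * f x) = (\<lambda>w. c * ?I f w + 0 * ?I f w)" by (auto simp: J_def fun_eq_iff split: sum.splits)
    show "\<Lambda>2 (\<lambda>x. f x + g x) = \<Lambda>2 f + \<Lambda>2 g" if "bounded (range g)" unfolding \<Lambda>2_def e1 Eadd[OF b[OF f] b[OF that]] by simp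
    show "\<Lambda>2 (\<lambda>x. c * f x) = c * \<Lambda>2 f" unfolding \<Lambda>2_def e2 Eadd[OF b[OF f] b[OF f]] by simp
    show "0 \<le> \<Lambda>2 f" if "\<And>x. x \<in> K2 \<Longrightarrow> 0 \<le> f x"
      unfolding \<Lambda>2_def using that by (intro Epos b f) (auto simp: J_def split: sum.splits)
  qed
  then obtain N where N: "sets N = sets borel" "finite_measure N" "emeasure N (- K2) = 0"
    "\<And>f. continuous_on K2 f \<Longrightarrow> \<Lambda>2 (\<lambda>x. if x \<in> K2 then f x else 0) = (\<integral>x. (if x \<in> K2 then f x else 0) \<partial>N)" by blast
  have "l \<xi> = (\<integral>x. (if x \<in> K1 then a \<xi> x else 0) \<partial>M) + (\<integral>y. (if y \<in> K2 then b \<xi> y else 0) \<partial>N)"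
    if x: "\<xi> \<in> G" for \<xi>
  proof -
    let ?f = "J (\<lambda>x. if x \<in> K1 then a \<xi> x else 0) (\<lambda>_. 0)" and ?g = "J (\<lambda>_. 0) (\<lambda>y. if y \<in> K2 then b \<xi> y else 0)"
    have c: "continuous_on K1 (a \<xi>)" "continuous_on K2 (b \<xi>)" using cont[OF x] by auto
    have "l \<xi> = \<Lambda> (?E (S (a \<xi>) (b \<xi>)))" using ext x by (auto simp: V_def)
    also have "S (a \<xi>) (b \<xi>) = (\<lambda>w. 1 * ?f w + 1 * ?g w)" by (auto simp: S_def J_def fun_eq_iff split: sum.splits)
    also have "\<Lambda> (?E \<dots>) = 1 * \<Lambda> (?E ?f) + 1 * \<Lambda> (?E ?g)" using c K1 K2 by (intro Eadd bJ bK b0) auto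
    also have "\<dots> = \<Lambda>1 (\<lambda>x. if x \<in> K1 then a \<xi> x else 0) + \<Lambda>2 (\<lambda>y. if y \<in> K2 then b \<xi> y else 0)"
      by (simp add: \<Lambda>1_def \<Lambda>2_def cong: if_cong)
    finally show ?thesis using M(4)[OF c(1)] N(4)[OF c(2)] by simp
  qed
  then show ?thesis using M N by blast
qed

section \<open>Derivatives of Lipschitz functions\<close>

lemma emeasure_lborel_negligible:
  "negligible N \<Longrightarrow> N \<in> sets borel \<Longrightarrow> emeasure lborel N = 0"
  by (simp add: negligible_iff_null_sets null_sets_def)

text \<open>Adding (B + 1) x to a B-Lipschitz function gives such an h. The lower bound on its slope
  makes h injective, so it maps disjoint intervals to disjoint intervals, and the measure of the
  image is the sum of the increments.\<close>

locale bilipschitz_increasing =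
  fixes h :: "real \<Rightarrow> real" and C :: real
  assumes lower: "x \<le> y \<Longrightarrow> y - x \<le> h y - h x"
    and upper: "x \<le> y \<Longrightarrow> h y - h x \<le> C * (y - x)"
begin

lemma C_ge_1: "1 \<le> C"
  using lower[of 0 1] upper[of 0 1] by simp

lemma h_mono: "x < y \<Longrightarrow> h x < h y"
  using lower[of x y] by simp

lemma h_inj: "inj h"
  by (intro linorder_injI) (metis h_mono less_irrefl)

lemma h_lipschitz: "\<bar>h y - h x\<bar> \<le> C * \<bar>y - x\<bar>"
  using upper[of x y] upper[of y x] lower[of x y] lower[of y x] by (cases "x \<le> y") auto

lemma h_cont: "continuous_on S h"
proof -
  have "C-lipschitz_on S h" using C_ge_1 h_lipschitz by (intro lipschitz_onI) (auto simp: dist_real_def)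
  then show ?thesis by (rule lipschitz_on_continuous_on)
qed

lemma h_image: "y < z \<Longrightarrow> h ` {y..z} = {h y..h z}"
proof (intro equalityI subsetI)
  fix w assume "y < z" "w \<in> {h y..h z}"
  then show "w \<in> h ` {y..z}" using IVT'[of h y w z] h_cont by force
next
  fix w assume "y < z" "w \<in> h ` {y..z}"
  then show "w \<in> {h y..h z}" using h_mono by (auto simp: less_le_not_le) (metis linorder_not_le order_le_less)+
qed

lemma emeasure_image_UN:
  assumes I: "countable I" and lt: "\<And>i. i \<in> I \<Longrightarrow> y i < z i"
    and disj: "disjoint_family_on (\<lambda>i. {y i..z i}) I"
  shows "emeasure lborel (h ` (\<Union>i\<in>I. {y i..z i})) = (\<integral>\<^sup>+i. ennreal (h (z i) - h (y i)) \<partial>count_space I)"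
    and "emeasure lborel (\<Union>i\<in>I. {y i..z i}) = (\<integral>\<^sup>+i. ennreal (z i - y i) \<partial>count_space I)"
    and "h ` (\<Union>i\<in>I. {y i..z i}) \<in> sets borel"
proof -
  have im: "h ` (\<Union>i\<in>I. {y i..z i}) = (\<Union>i\<in>I. {h (y i)..h (z i)})" using h_image lt by (simp add: image_UN)
  have d: "disjoint_family_on (\<lambda>i. {h (y i)..h (z i)}) I" unfolding disjoint_family_on_def
  proof (intro ballI impI)
    fix i j assume ij: "i \<in> I" "j \<in> I" "i \<noteq> j"
    have "h ` {y i..z i} \<inter> h ` {y j..z j} = h ` ({y i..z i} \<inter> {y j..z j})" by (rule image_Int[OF h_inj, symmetric])
    also have "{y i..z i} \<inter> {y j..z j} = {}" using disj ij by (simp add: disjoint_family_on_def)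
    finally show "{h (y i)..h (z i)} \<inter> {h (y j)..h (z j)} = {}" using h_image lt ij by simp
  qed
  have "emeasure lborel (\<Union>i\<in>I. {h (y i)..h (z i)}) = (\<integral>\<^sup>+i. emeasure lborel {h (y i)..h (z i)} \<partial>count_space I)"
    by (rule emeasure_UN_countable[OF _ I d]) simp
  also have "\<dots> = (\<integral>\<^sup>+i. ennreal (h (z i) - h (y i)) \<partial>count_space I)"
    using lt h_mono by (intro nn_integral_cong) (simp add: less_imp_le)
  finally show "emeasure lborel (h ` (\<Union>i\<in>I. {y i..z i})) = (\<integral>\<^sup>+i. ennreal (h (z i) - h (y i)) \<partial>count_space I)" using im by simp
  have "emeasure lborel (\<Union>i\<in>I. {y i..z i}) = (\<integral>\<^sup>+i. emeasure lborel {y i..z i} \<partial>count_space I)"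
    by (rule emeasure_UN_countable[OF _ I disj]) simp
  also have "\<dots> = (\<integral>\<^sup>+i. ennreal (z i - y i) \<partial>count_space I)" using lt by (intro nn_integral_cong) (simp add: less_imp_le)
  finally show "emeasure lborel (\<Union>i\<in>I. {y i..z i}) = (\<integral>\<^sup>+i. ennreal (z i - y i) \<partial>count_space I)" .
  show "h ` (\<Union>i\<in>I. {y i..z i}) \<in> sets borel" unfolding im by (rule sets.countable_UN'[OF I]) auto
qed

lemma emeasure_image_le:
  assumes I: "countable I" and lt: "\<And>i. i \<in> I \<Longrightarrow> y i < z i"
    and disj: "disjoint_family_on (\<lambda>i. {y i..z i}) I"
    and c: "\<And>i. i \<in> I \<Longrightarrow> h (z i) - h (y i) \<le> c * (z i - y i)" "0 \<le> c"
  shows "emeasure lborel (h ` (\<Union>i\<in>I. {y i..z i})) \<le> ennreal c * emeasure lborel (\<Union>i\<in>I. {y i..z i})"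
proof -
  have "(\<integral>\<^sup>+i. ennreal (h (z i) - h (y i)) \<partial>count_space I) \<le> (\<integral>\<^sup>+i. ennreal c * ennreal (z i - y i) \<partial>count_space I)"
  proof (rule nn_integral_mono)
    fix i assume "i \<in> space (count_space I)"
    then have "i \<in> I" by simp
    then show "ennreal (h (z i) - h (y i)) \<le> ennreal c * ennreal (z i - y i)"
      using c(1)[of i] lt[of i] c(2) by (simp add: ennreal_mult[symmetric] less_imp_le ennreal_leI)
  qed
  then show ?thesis using emeasure_image_UN[OF I lt disj] by (simp add: nn_integral_cmult)
qed

lemma emeasure_image_ge:
  assumes I: "countable I" and lt: "\<And>i. i \<in> I \<Longrightarrow> y i < z i"
    and disj: "disjoint_family_on (\<lambda>i. {y i..z i}) I"
    and c: "\<And>i. i \<in> I \<Longrightarrow> c * (z i - y i) \<le> h (z i) - h (y i)" "0 \<le> c"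
  shows "ennreal c * emeasure lborel (\<Union>i\<in>I. {y i..z i}) \<le> emeasure lborel (h ` (\<Union>i\<in>I. {y i..z i}))"
proof -
  have "(\<integral>\<^sup>+i. ennreal c * ennreal (z i - y i) \<partial>count_space I) \<le> (\<integral>\<^sup>+i. ennreal (h (z i) - h (y i)) \<partial>count_space I)"
  proof (rule nn_integral_mono)
    fix i assume "i \<in> space (count_space I)"
    then have "i \<in> I" by simp
    then show "ennreal c * ennreal (z i - y i) \<le> ennreal (h (z i) - h (y i))"
      using c(1)[of i] lt[of i] c(2) by (simp add: ennreal_mult[symmetric] less_imp_le ennreal_leI)
  qed
  then show ?thesis using emeasure_image_UN[OF I lt disj] by (simp add: nn_integral_cmult)
qed

end

section \<open>Vitali coverings and differentiability almost everywhere\<close>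

lemma vitali_intervals:
  fixes S :: "real set" and P :: "real \<Rightarrow> real \<Rightarrow> bool"
  assumes "\<And>x d. x \<in> S \<Longrightarrow> 0 < d \<Longrightarrow> \<exists>y z. y < x \<and> x < z \<and> z - y < d \<and> P y z"
  obtains I :: "(real \<times> real) set" where "countable I" "\<And>i. i \<in> I \<Longrightarrow> fst i < snd i \<and> P (fst i) (snd i)"
    "disjoint_family_on (\<lambda>i. {fst i..snd i}) I"
    "negligible (S - (\<Union>i\<in>I. {fst i..snd i}))"
proof -
  let ?K = "{i :: real \<times> real. fst i < snd i \<and> P (fst i) (snd i)}"
  let ?a = "\<lambda>i :: real \<times> real. (fst i + snd i) / 2" and ?r = "\<lambda>i :: real \<times> real. (snd i - fst i) / 2"
  \<comment> \<open>The covering theorem speaks of balls. Every interval is a ball about its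
    midpoint, which need not be the point to be covered.\<close>
  have cb: "cball (?a i) (?r i) = {fst i..snd i}" for i by (auto simp: cball_eq_atLeastAtMost field_simps)
  obtain I where I: "countable I" "I \<subseteq> ?K"
     "pairwise (\<lambda>i j. disjnt (cball (?a i) (?r i)) (cball (?a j) (?r j))) I"
     "negligible (S - (\<Union>i \<in> I. cball (?a i) (?r i)))"
  proof (rule Vitali_covering_theorem_cballs[of ?K ?r S ?a])
    show "0 < ?r i" if "i \<in> ?K" for i using that by simp
    fix x d :: real assume "x \<in> S" "0 < d"
    then obtain y z where "y < x" "x < z" "z - y < d" "P y z" using assms by blast
    then show "\<exists>i. i \<in> ?K \<and> x \<in> cball (?a i) (?r i) \<and> ?r i < d" unfolding cb by (intro exI[of _ "(y, z)"]) auto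
  qed blast
  show ?thesis
  proof (rule that[of I])
    show "disjoint_family_on (\<lambda>i. {fst i..snd i}) I"
      using I(3) unfolding cb by (auto simp: disjoint_family_on_def pairwise_def disjnt_def)
  qed (use I in \<open>auto simp: cb\<close>)
qed

lemma localize_intervals:
  fixes x d :: real
  assumes "open Q" "x \<in> Q" and ex: "\<forall>d>0. \<exists>y z. y < x \<and> x < z \<and> z - y < d \<and> P y z" and d: "0 < d"
  shows "\<exists>y z. y < x \<and> x < z \<and> z - y < d \<and> ({y..z} \<subseteq> Q \<and> P y z)"
proof -
  obtain \<delta> where \<delta>: "0 < \<delta>" "ball x \<delta> \<subseteq> Q" using assms(1,2) by (meson open_contains_ball)
  have "\<exists>y z. y < x \<and> x < z \<and> z - y < min d \<delta> \<and> P y z" using ex by (elim allE[of _ "min d \<delta>"] impE) (use d \<delta>(1) in simp)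
  then obtain y z where yz: "y < x" "x < z" "z - y < min d \<delta>" "P y z" by (elim exE conjE)
  have "{y..z} \<subseteq> ball x \<delta>" using yz by (auto simp: dist_real_def)
  then show ?thesis using yz \<delta> by (intro exI[of _ y] exI[of _ z]) auto
qed

context bilipschitz_increasing
begin

text \<open>The intervals straddle x instead of starting at x; this makes the set a countable
  intersection of open sets, hence Borel.\<close>

definition low_slope :: "real \<Rightarrow> real set" where
  "low_slope r = {x. \<forall>d>0. \<exists>y z. y < x \<and> x < z \<and> z - y < d \<and> h z - h y < r * (z - y)}"

definition high_slope :: "real \<Rightarrow> real set" where
  "high_slope s = {x. \<forall>d>0. \<exists>y z. y < x \<and> x < z \<and> z - y < d \<and> s * (z - y) < h z - h y}"

lemma slope_set_borel:
  "{x. \<forall>d>0. \<exists>y z. y < x \<and> x < z \<and> z - y < d \<and> P y z} \<in> sets (borel :: real measure)"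
proof -
  have "{x. \<forall>d>0. \<exists>y z. y < x \<and> x < z \<and> z - y < d \<and> P y z}
      = (\<Inter>n::nat. \<Union>(y, z)\<in>{(y, z). z - y < 1 / Suc n \<and> P y z}. {y<..<z})" (is "?A = ?B")
  proof (intro equalityI subsetI)
    fix x assume "x \<in> ?A"
    then have *: "\<exists>y z. y < x \<and> x < z \<and> z - y < 1 / Suc n \<and> P y z" for n :: nat by simp
    show "x \<in> ?B"
    proof
      fix n :: nat
      obtain y z where "y < x" "x < z" "z - y < 1 / Suc n" "P y z" using *[of n] by blast
      then show "x \<in> (\<Union>(y, z)\<in>{(y, z). z - y < 1 / Suc n \<and> P y z}. {y<..<z})" by (intro UN_I[of "(y, z)"]) auto
    qed
  next
    fix x assume x: "x \<in> ?B"
    show "x \<in> ?A"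
    proof (intro CollectI allI impI)
      fix d :: real assume "0 < d"
      then obtain n where n: "inverse (Suc n) < d" using reals_Archimedean by blast
      obtain y z where "y < x" "x < z" "z - y < 1 / Suc n" "P y z" using x by force
      then show "\<exists>y z. y < x \<and> x < z \<and> z - y < d \<and> P y z"
        using n by (intro exI[of _ y] exI[of _ z]) (simp add: inverse_eq_divide)
    qed
  qed
  moreover have "?B \<in> sets borel" by (intro sets.countable_INT'' borel_open open_UN) auto
  ultimately show ?thesis by simp
qed

text \<open>Lebesgue's argument with two coverings. Let E be a bounded part of the set and Q an open
  set of hardly larger measure. Intervals of slope below r fill E inside Q, so their image has
  measure at most r |Q|. Inside these, intervals of slope above s fill E again, so the image has
  measure at least s |E|. Hence s |E| <= r (|E| + e) for every e > 0.\<close>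

lemma slope_gap_negligible:
  assumes rs: "r < s" and r: "0 \<le> r"
  shows "negligible (low_slope r \<inter> high_slope s)"
proof -
  \<comment> \<open>Cut down to a bounded set, so that the measures to be compared are
    finite.\<close>
  have "negligible (low_slope r \<inter> high_slope s \<inter> {- real N<..<real N})" for N
  proof -
    define E where "E = low_slope r \<inter> high_slope s \<inter> {- real N<..<real N}"
    have Eb: "E \<in> sets borel" unfolding E_def low_slope_def high_slope_def by (intro sets.Int slope_set_borel) auto
    have El: "E \<in> lmeasurable"
    proof (rule bounded_set_imp_lmeasurable)
      show "bounded E" by (rule boundedI[of _ "real N"]) (auto simp: E_def)
      show "E \<in> sets lebesgue" using Eb by (simp add: sets_completionI_sets)
    qed
    have *: "(s - r) * measure lebesgue E \<le> r * e" if e: "0 < e" for e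
    proof -
      obtain Q where Q: "open Q" "E \<subseteq> Q" "Q \<in> lmeasurable" "measure lebesgue Q < measure lebesgue E + e"
      proof -
        obtain Q where Q: "open Q" "E \<subseteq> Q" "Q - E \<in> lmeasurable" "emeasure lebesgue (Q - E) < ennreal e"
          by (rule sets_lebesgue_outer_open[OF fmeasurableD[OF El] e])
        have QE: "Q = E \<union> (Q - E)" using Q(2) by blast
        have 1: "Q \<in> lmeasurable" by (subst QE) (intro fmeasurable.Un El Q(3))
        have "measure lebesgue Q \<le> measure lebesgue E + measure lebesgue (Q - E)"
          by (subst QE) (intro measure_Un_le fmeasurableD El Q(3))
        moreover have "measure lebesgue (Q - E) < e"
          using Q(4) unfolding emeasure_eq_measure2[OF Q(3)] by (simp add: ennreal_less_iff)
        ultimately have "measure lebesgue Q < measure lebesgue E + e" by linarith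
        then show ?thesis using Q(1,2) 1 by (rule that[rotated -1])
      qed
      have cover: "\<exists>y z. y < x \<and> x < z \<and> z - y < d \<and> ({y..z} \<subseteq> Q \<and> h z - h y < r * (z - y))"
        if "x \<in> E" "0 < d" for x d
      proof (rule localize_intervals[OF Q(1) _ _ \<open>0 < d\<close>])
        show "x \<in> Q" using Q(2) \<open>x \<in> E\<close> by blast
        show "\<forall>d>0. \<exists>y z. y < x \<and> x < z \<and> z - y < d \<and> h z - h y < r * (z - y)"
          using \<open>x \<in> E\<close> unfolding E_def low_slope_def by blast
      qed
      obtain I where I: "countable I"
          "\<And>i. i \<in> I \<Longrightarrow> fst i < snd i \<and> ({fst i..snd i} \<subseteq> Q \<and> h (snd i) - h (fst i) < r * (snd i - fst i))"
          "disjoint_family_on (\<lambda>i. {fst i..snd i}) I" "negligible (E - (\<Union>i\<in>I. {fst i..snd i}))"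
        by (rule vitali_intervals[OF cover]) (assumption | rule that; assumption)+
      define U where "U = (\<Union>i\<in>I. {fst i..snd i})"
      \<comment> \<open>The interiors of the first intervals, inside which the second covering is
        placed; only countably many endpoints are lost.\<close>
      define V where "V = (\<Union>i\<in>I. {fst i<..<snd i})"
      have V: "open V" unfolding V_def by auto
      have UV: "negligible (U - V)"
      proof -
        have "U - V \<subseteq> fst ` I \<union> snd ` I" unfolding U_def V_def by force
        moreover have "countable (fst ` I \<union> snd ` I)" using I(1) by simp
        ultimately have "U - V \<in> null_sets lborel" by (intro countable_imp_null_set_lborel) (rule countable_subset)
        then show ?thesis by (simp add: negligible_iff_null_sets null_sets_completionI)
      qed
      have cover2: "\<exists>y z. y < x \<and> x < z \<and> z - y < d \<and> ({y..z} \<subseteq> V \<and> s * (z - y) < h z - h y)"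
        if "x \<in> E \<inter> V" "0 < d" for x d
      proof (rule localize_intervals[OF V _ _ \<open>0 < d\<close>])
        show "x \<in> V" using \<open>x \<in> E \<inter> V\<close> by blast
        show "\<forall>d>0. \<exists>y z. y < x \<and> x < z \<and> z - y < d \<and> s * (z - y) < h z - h y"
          using \<open>x \<in> E \<inter> V\<close> unfolding E_def high_slope_def by blast
      qed
      obtain J where J: "countable J"
          "\<And>i. i \<in> J \<Longrightarrow> fst i < snd i \<and> ({fst i..snd i} \<subseteq> V \<and> s * (snd i - fst i) < h (snd i) - h (fst i))"
          "disjoint_family_on (\<lambda>i. {fst i..snd i}) J" "negligible (E \<inter> V - (\<Union>i\<in>J. {fst i..snd i}))"
        by (rule vitali_intervals[OF cover2]) (assumption | rule that; assumption)+
      define W where "W = (\<Union>i\<in>J. {fst i..snd i})"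
      have Wb: "W \<in> sets borel" unfolding W_def by (rule sets.countable_UN'[OF J(1)]) auto
      have "E - W \<subseteq> (E - U) \<union> (U - V) \<union> (E \<inter> V - W)" by blast
      then have "negligible (E - W)" using I(4) J(4) UV unfolding U_def W_def by (meson negligible_Un negligible_subset)
      then have "emeasure lborel (E - W) = 0" using Eb Wb by (intro emeasure_lborel_negligible) auto
      then have EW: "emeasure lborel E \<le> emeasure lborel W"
        using emeasure_subadditive[of W lborel "E - W"] emeasure_mono[of E "W \<union> (E - W)" lborel] Eb Wb
        by (simp add: order_trans)
      have OO: "emeasure lborel Q = ennreal (measure lebesgue Q)"
        using emeasure_eq_measure2[OF Q(3)] borel_open[OF Q(1)] by simp
      have EE: "emeasure lborel E = ennreal (measure lebesgue E)" using emeasure_eq_measure2[OF El] Eb by simp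
      have "ennreal s * emeasure lborel E \<le> ennreal s * emeasure lborel W" using EW by (rule mult_left_mono) simp
      also have "\<dots> \<le> emeasure lborel (h ` W)"
        unfolding W_def using J rs r by (intro emeasure_image_ge) (auto intro: less_imp_le)
      also have "\<dots> \<le> emeasure lborel (h ` U)"
      proof (rule emeasure_mono)
        have "W \<subseteq> V" unfolding W_def using J(2) by blast
        also have "V \<subseteq> U" unfolding U_def V_def by (intro UN_mono) auto
        finally show "h ` W \<subseteq> h ` U" by blast
        show "h ` U \<in> sets lborel" unfolding U_def using emeasure_image_UN(3)[OF I(1) _ I(3)] I(2) by simp
      qed
      also have "\<dots> \<le> ennreal r * emeasure lborel U"
        unfolding U_def using I r by (intro emeasure_image_le) (auto intro: less_imp_le)
      also have "\<dots> \<le> ennreal r * emeasure lborel Q" using I(2) Q(1) by (intro mult_left_mono emeasure_mono) (auto simp: U_def)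
      finally have "ennreal (s * measure lebesgue E) \<le> ennreal (r * measure lebesgue Q)"
        using r rs by (simp add: OO EE ennreal_mult)
      then have "s * measure lebesgue E \<le> r * measure lebesgue Q"
        using r by (subst (asm) ennreal_le_iff) (auto intro: mult_nonneg_nonneg)
      also have "\<dots> \<le> r * (measure lebesgue E + e)" using Q(4) r by (intro mult_left_mono) auto
      finally show ?thesis by (simp add: algebra_simps)
    qed
    have "(s - r) * measure lebesgue E \<le> 0"
    proof (rule field_le_epsilon)
      fix e :: real assume e: "0 < e"
      have "(s - r) * measure lebesgue E \<le> r * (e / (r + 1))" using e r by (intro *) auto
      also have "\<dots> \<le> e" using e r by (simp add: field_simps)
      finally show "(s - r) * measure lebesgue E \<le> 0 + e" by simp
    qed
    then have "measure lebesgue E \<le> 0" using rs by (simp add: mult_le_0_iff)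
    then have "measure lebesgue E = 0" by (simp add: measure_le_0_iff)
    then show ?thesis using El unfolding E_def by (simp add: negligible_iff_measure)
  qed
  then have "negligible (\<Union>N. low_slope r \<inter> high_slope s \<inter> {- real N<..<real N})" by (intro negligible_countable_Union) auto
  moreover have "(\<Union>N. low_slope r \<inter> high_slope s \<inter> {- real N<..<real N}) = low_slope r \<inter> high_slope s"
  proof (intro equalityI subsetI)
    fix x assume x: "x \<in> low_slope r \<inter> high_slope s"
    obtain N where "\<bar>x\<bar> < real N" using reals_Archimedean2 by blast
    then have "x \<in> {- real N<..<real N}" by auto
    then show "x \<in> (\<Union>N. low_slope r \<inter> high_slope s \<inter> {- real N<..<real N})" using x by blast
  qed blast
  ultimately show ?thesis by simp
qed

text \<open>The derivative is the supremum D of the numbers that bound all short straddling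
  quotients from below. A rational p just above D is not such a bound, which puts x into
  \<open>low_slope p\<close>; the hypothesis then makes a rational q slightly above p a bound from
  above.\<close>

lemma differentiable_off_gaps:
  assumes x: "\<And>r s. r \<in> \<rat> \<Longrightarrow> s \<in> \<rat> \<Longrightarrow> 0 \<le> r \<Longrightarrow> r < s \<Longrightarrow> x \<notin> low_slope r \<inter> high_slope s"
  shows "h differentiable (at x)"
proof -
  define A where "A = {r. \<exists>d>0. \<forall>y z. y < x \<and> x < z \<and> z - y < d \<longrightarrow> r * (z - y) \<le> h z - h y}"
  have A1: "1 \<in> A" unfolding A_def using lower by (auto intro!: exI[of _ 1])
  have AC: "r \<le> C" if rA: "r \<in> A" for r
  proof -
    obtain d where d: "0 < d" "\<forall>y z. y < x \<and> x < z \<and> z - y < d \<longrightarrow> r * (z - y) \<le> h z - h y" using rA unfolding A_def by blast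
    have "r * ((x + d/4) - (x - d/4)) \<le> h (x + d/4) - h (x - d/4)" using d(1) by (intro d(2)[rule_format]) auto
    also have "\<dots> \<le> C * ((x + d/4) - (x - d/4))" using d(1) by (intro upper) auto
    finally show ?thesis using d(1) by (simp add: mult_le_cancel_right)
  qed
  have bdd: "bdd_above A" using AC by (auto simp: bdd_above_def)
  define D where "D = Sup A"
  have D1: "1 \<le> D" unfolding D_def using A1 bdd by (rule cSup_upper)
  have main: "\<exists>d>0. \<forall>y z. y < x \<and> x < z \<and> z - y < d \<longrightarrow> \<bar>(h z - h y) - D * (z - y)\<bar> \<le> e * (z - y)"
    if e: "0 < e" for e
  proof -
    obtain r where r: "r \<in> A" "D - e < r" using less_cSup_iff[of A "D - e"] A1 bdd e unfolding D_def by auto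
    then obtain d1 where d1: "0 < d1" "\<And>y z. y < x \<and> x < z \<and> z - y < d1 \<Longrightarrow> r * (z - y) \<le> h z - h y" unfolding A_def by blast
    obtain p where p: "p \<in> \<rat>" "D < p" "p < D + e" using Rats_dense_in_real[of D "D + e"] e by auto
    obtain q where q: "q \<in> \<rat>" "p < q" "q < D + e" using Rats_dense_in_real[of p "D + e"] p by auto
    have "p \<notin> A" using cSup_upper[OF _ bdd, of p] p unfolding D_def by auto
    then have "x \<in> low_slope p" unfolding A_def low_slope_def by (auto simp: not_le)
    then have "x \<notin> high_slope q" using x[OF p(1) q(1)] p q D1 by auto
    then obtain d2 where "0 < d2" "\<not> (\<exists>y z. y < x \<and> x < z \<and> z - y < d2 \<and> q * (z - y) < h z - h y)"
      unfolding high_slope_def by blast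
    then have d2: "0 < d2" "\<And>y z. y < x \<and> x < z \<and> z - y < d2 \<Longrightarrow> h z - h y \<le> q * (z - y)" by (meson not_less)+
    have "\<bar>(h z - h y) - D * (z - y)\<bar> \<le> e * (z - y)" if "y < x" "x < z" "z - y < min d1 d2" for y z
    proof -
      have "(D - e) * (z - y) \<le> r * (z - y)" using r that by (intro mult_right_mono) auto
      moreover have "r * (z - y) \<le> h z - h y" using d1 that by auto
      moreover have "h z - h y \<le> q * (z - y)" using d2 that by auto
      moreover have "q * (z - y) \<le> (D + e) * (z - y)" using q that by (intro mult_right_mono) auto
      ultimately show ?thesis by (simp add: algebra_simps abs_le_iff)
    qed
    then show ?thesis using d1(1) d2(1) by (intro exI[of _ "min d1 d2"]) auto
  qed
  have "(h has_field_derivative D) (at x)" unfolding has_field_derivative_def has_derivative_at_alt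
  proof (intro conjI allI impI)
    show "bounded_linear ((*) D)" by (rule bounded_linear_mult_right)
    fix e :: real assume "0 < e"
    then obtain d where d: "0 < d"
      "\<And>y z. y < x \<Longrightarrow> x < z \<Longrightarrow> z - y < d \<Longrightarrow> \<bar>(h z - h y) - D * (z - y)\<bar> \<le> e * (z - y)" using main by blast
    have cont: "isCont h w" for w using h_cont[of UNIV] by (simp add: continuous_on_eq_continuous_at)
    have "norm (h y - h x - D * (y - x)) \<le> e * norm (y - x)" if y: "norm (y - x) < d" for y
    proof (cases y x rule: linorder_cases)
      case greater
      \<comment> \<open>The estimates so far have x strictly between the endpoints; continuity of h
        lets one endpoint tend to x.\<close>
      have "\<bar>(h y - h x) - D * (y - x)\<bar> \<le> e * (y - x)"
      proof (rule tendsto_le[of "at_left x" "\<lambda>w. e * (y - w)" _ "\<lambda>w. \<bar>(h y - h w) - D * (y - w)\<bar>"])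
        show "((\<lambda>w. e * (y - w)) \<longlongrightarrow> e * (y - x)) (at_left x)" by (intro tendsto_intros)
        have "(h \<longlongrightarrow> h x) (at_left x)" using cont by (simp add: isCont_def filterlim_at_split)
        then show "((\<lambda>w. \<bar>(h y - h w) - D * (y - w)\<bar>) \<longlongrightarrow> \<bar>(h y - h x) - D * (y - x)\<bar>) (at_left x)" by (intro tendsto_intros)
        have "\<forall>\<^sub>F w in at_left x. w \<in> {max (y - d) (x - 1)<..<x}" using y greater by (intro eventually_at_left_real) auto
        then show "\<forall>\<^sub>F w in at_left x. \<bar>(h y - h w) - D * (y - w)\<bar> \<le> e * (y - w)"
          by eventually_elim (use greater in \<open>auto intro!: d(2)\<close>)
      qed simp
      then show ?thesis using greater by simp
    next
      case less
      have "\<bar>(h x - h y) - D * (x - y)\<bar> \<le> e * (x - y)"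
      proof (rule tendsto_le[of "at_right x" "\<lambda>w. e * (w - y)" _ "\<lambda>w. \<bar>(h w - h y) - D * (w - y)\<bar>"])
        show "((\<lambda>w. e * (w - y)) \<longlongrightarrow> e * (x - y)) (at_right x)" by (intro tendsto_intros)
        have "(h \<longlongrightarrow> h x) (at_right x)" using cont by (simp add: isCont_def filterlim_at_split)
        then show "((\<lambda>w. \<bar>(h w - h y) - D * (w - y)\<bar>) \<longlongrightarrow> \<bar>(h x - h y) - D * (x - y)\<bar>) (at_right x)" by (intro tendsto_intros)
        have "\<forall>\<^sub>F w in at_right x. w \<in> {x<..<min (y + d) (x + 1)}" using y less by (intro eventually_at_right_real) auto
        then show "\<forall>\<^sub>F w in at_right x. \<bar>(h w - h y) - D * (w - y)\<bar> \<le> e * (w - y)"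
          by eventually_elim (use less in \<open>auto intro!: d(2)\<close>)
      qed simp
      moreover have "norm (h y - h x - D * (y - x)) = \<bar>(h x - h y) - D * (x - y)\<bar>"
        by (simp add: algebra_simps abs_minus_commute)
      ultimately show ?thesis using less by simp
    qed simp
    then show "\<exists>d>0. \<forall>y. norm (y - x) < d \<longrightarrow> norm (h y - h x - D * (y - x)) \<le> e * norm (y - x)" using d(1) by blast
  qed
  then show ?thesis unfolding differentiable_def has_field_derivative_def by blast
qed

lemma AE_differentiable: "negligible {x. \<not> h differentiable (at x)}"
proof (rule negligible_subset)
  let ?Q = "{(r, s). r \<in> \<rat> \<and> s \<in> \<rat> \<and> 0 \<le> r \<and> r < s} :: (real \<times> real) set"
  have "?Q \<subseteq> \<rat> \<times> \<rat>" by auto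
  then have "countable ?Q" by (rule countable_subset) (intro countable_SIGMA countable_rat)
  then have "countable ((\<lambda>(r, s). low_slope r \<inter> high_slope s) ` ?Q)" by simp
  then show "negligible (\<Union>((\<lambda>(r, s). low_slope r \<inter> high_slope s) ` ?Q))"
    by (rule negligible_countable_Union) (auto intro: slope_gap_negligible)
  show "{x. \<not> h differentiable (at x)} \<subseteq> \<Union>((\<lambda>(r, s). low_slope r \<inter> high_slope s) ` ?Q)"
    using differentiable_off_gaps by fastforce
qed

end

lemma lipschitz_real_AE_differentiable:
  fixes f :: "real \<Rightarrow> real"
  assumes f: "B-lipschitz_on UNIV f"
  shows "bilipschitz_increasing (\<lambda>x. f x + (B + 1) * x) (2 * B + 1)"
    and "negligible {x. \<not> f differentiable (at x)}"
proof -
  let ?h = "\<lambda>x. f x + (B + 1) * x"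
  have ab: "\<bar>f y - f x\<bar> \<le> B * (y - x)" if "x \<le> y" for x y using lipschitz_onD[OF f, of y x] that by (simp add: dist_real_def)
  show b: "bilipschitz_increasing ?h (2 * B + 1)"
  proof
    fix x y :: real assume "x \<le> y"
    then have "- (B * (y - x)) \<le> f y - f x" "f y - f x \<le> B * (y - x)" using ab[of x y] by auto
    then show "y - x \<le> ?h y - ?h x" "?h y - ?h x \<le> (2 * B + 1) * (y - x)" by (simp_all add: algebra_simps)
  qed
  have "f differentiable (at x)" if "?h differentiable (at x)" for x
  proof -
    have "(\<lambda>x. ?h x - (B + 1) * x) differentiable (at x)" by (intro differentiable_diff that) simp
    then show ?thesis by simp
  qed
  then have "{x. \<not> f differentiable (at x)} \<subseteq> {x. \<not> ?h differentiable (at x)}" by blast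
  then show "negligible {x. \<not> f differentiable (at x)}"
    using bilipschitz_increasing.AE_differentiable[OF b] negligible_subset by blast
qed

lemma lipschitz_AE_differentiable:
  fixes f :: "real \<Rightarrow> 'a::euclidean_space"
  assumes f: "B-lipschitz_on UNIV f"
  shows "negligible {x. \<not> f differentiable (at x)}"
proof -
  have comp: "B-lipschitz_on UNIV (\<lambda>x. f x \<bullet> b)" if "b \<in> Basis" for b
  proof (rule lipschitz_onI)
    fix x y
    have "dist (f x \<bullet> b) (f y \<bullet> b) \<le> dist (f x) (f y)"
      unfolding dist_norm by (simp flip: inner_diff_left) (metis Basis_le_norm that)
    also have "\<dots> \<le> B * dist x y" using lipschitz_onD[OF f] by simp
    finally show "dist (f x \<bullet> b) (f y \<bullet> b) \<le> B * dist x y" .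
  qed (rule lipschitz_on_nonneg[OF f])
  have "{x. \<not> f differentiable (at x)} \<subseteq> (\<Union>b\<in>Basis. {x. \<not> (\<lambda>x. f x \<bullet> b) differentiable (at x)})"
    by (subst differentiable_componentwise_within) auto
  moreover have "negligible (\<Union>b\<in>(Basis :: 'a set). {x. \<not> (\<lambda>x. f x \<bullet> b) differentiable (at x)})"
    using lipschitz_real_AE_differentiable(2)[OF comp] by (intro negligible_Union) auto
  ultimately show ?thesis using negligible_subset by blast
qed

section \<open>Increments bounded by derivatives that exist almost everywhere\<close>

lemma small_slope_interval:
  fixes f :: "real \<Rightarrow> real"
  assumes D: "(f has_real_derivative D) (at x)" "D < c" and d: "0 < d" and x: "a < x" "x < b"
  shows "\<exists>y z. y < x \<and> x < z \<and> z - y < d \<and> {y..z} \<subseteq> {a<..<b} \<and> f z - f y \<le> c * (z - y)"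
proof -
  define e where "e = c - D"
  have e: "0 < e" using D by (simp add: e_def)
  have "\<exists>\<delta>>0. \<forall>y. norm (y - x) < \<delta> \<longrightarrow> norm (f y - f x - D * (y - x)) \<le> e * norm (y - x)"
    using conjunct2[OF D(1)[unfolded has_field_derivative_def has_derivative_at_alt]] e by blast
  then obtain \<delta> where \<delta>: "0 < \<delta>" "\<And>y. norm (y - x) < \<delta> \<Longrightarrow> norm (f y - f x - D * (y - x)) \<le> e * norm (y - x)" by blast
  define \<eta> where "\<eta> = min (min (d/4) (\<delta>/2)) (min ((x - a)/2) ((b - x)/2))"
  have \<eta>: "0 < \<eta>" "\<eta> \<le> d/4" "\<eta> \<le> \<delta>/2" "\<eta> \<le> (x - a)/2" "\<eta> \<le> (b - x)/2" using x d \<delta>(1) by (auto simp: \<eta>_def min_def)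
  have 1: "\<bar>f (x + \<eta>) - f x - D * \<eta>\<bar> \<le> e * \<eta>" using \<delta>(2)[of "x + \<eta>"] \<eta> \<delta>(1) by simp
  have 2: "\<bar>f (x - \<eta>) - f x + D * \<eta>\<bar> \<le> e * \<eta>" using \<delta>(2)[of "x - \<eta>"] \<eta> \<delta>(1) by simp
  have "f (x + \<eta>) - f (x - \<eta>) \<le> 2 * (D * \<eta> + e * \<eta>)" using abs_le_D1[OF 1] abs_le_D2[OF 2] by (simp add: algebra_simps)
  also have "\<dots> = c * ((x + \<eta>) - (x - \<eta>))" by (simp add: e_def algebra_simps)
  finally have "f (x + \<eta>) - f (x - \<eta>) \<le> c * ((x + \<eta>) - (x - \<eta>))" .
  moreover have "x - \<eta> < x" "x < x + \<eta>" "(x + \<eta>) - (x - \<eta>) < d" "a < x - \<eta>" "x + \<eta> < b"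
    using \<eta>(1,2) d x mult_left_mono[of "\<eta>" "(x - a)/2" 1] \<eta>(4,5) by (simp_all add: field_simps)
  moreover from this have "{x - \<eta>..x + \<eta>} \<subseteq> {a<..<b}" by auto
  ultimately show ?thesis by blast
qed

text \<open>Intervals on which the slope is hardly above M fill (a, b) up to a null set by Vitali.
  The Lipschitz function h maps that null set to a null set, so the images of the intervals fill
  [h a, h b] in measure, and their lengths are bounded by the slopes.\<close>

lemma lipschitz_real_deriv_bound:
  fixes f :: "real \<Rightarrow> real"
  assumes f: "B-lipschitz_on UNIV f" and ab: "a < b" and N: "negligible N"
    and der: "\<And>x. x \<in> {a<..<b} - N \<Longrightarrow> \<exists>D\<le>M. (f has_real_derivative D) (at x)"
  shows "f b - f a \<le> M * (b - a)"
proof -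
  let ?h = "\<lambda>x. f x + (B + 1) * x"
  interpret bilipschitz_increasing ?h "2 * B + 1" by (rule lipschitz_real_AE_differentiable(1)[OF f])
  have B: "0 \<le> B" by (rule lipschitz_on_nonneg[OF f])
  \<comment> \<open>Keeps the slope constant of h nonnegative, as multiplication in
    \<open>ennreal\<close> requires. Values of M below - B are treated separately at the
    end.\<close>
  define M' where "M' = max M (- (B + 1))"
  have "f b - f a + (B + 1) * (b - a) \<le> (M' + B + 1) * (b - a)"
  proof (rule field_le_epsilon)
    fix e' :: real assume e': "0 < e'"
    define e where "e = e' / (b - a)"
    have e: "0 < e" using e' ab by (simp add: e_def)
    let ?c = "M' + B + 1 + e"
    have c: "0 \<le> ?c" using e by (simp add: M'_def)
    have cover: "\<exists>y z. y < x \<and> x < z \<and> z - y < d \<and> ({y..z} \<subseteq> {a<..<b} \<and> ?h z - ?h y \<le> ?c * (z - y))"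
      if x: "x \<in> {a<..<b} - N" and d: "0 < d" for x d
    proof -
      have "\<exists>D\<le>M. (f has_real_derivative D) (at x)" by (rule der[OF x])
      then obtain D where D: "D \<le> M" "(f has_real_derivative D) (at x)" by (elim exE conjE)
      have 1: "(?h has_real_derivative D + (B + 1) * 1) (at x)" by (intro DERIV_add DERIV_cmult DERIV_ident D(2))
      have 2: "D + (B + 1) * 1 < ?c" using D(1) e by (simp add: M'_def)
      have "a < x" "x < b" using x by simp_all
      from small_slope_interval[OF 1 2 d this] show ?thesis by simp
    qed
    obtain I where I: "countable I"
        "\<And>i. i \<in> I \<Longrightarrow> fst i < snd i \<and> ({fst i..snd i} \<subseteq> {a<..<b} \<and> ?h (snd i) - ?h (fst i) \<le> ?c * (snd i - fst i))"
        "disjoint_family_on (\<lambda>i. {fst i..snd i}) I" "negligible ({a<..<b} - N - (\<Union>i\<in>I. {fst i..snd i}))"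
      by (rule vitali_intervals[OF cover]) (assumption | rule that; assumption)+
    define W where "W = (\<Union>i\<in>I. {fst i..snd i})"
    have hWb: "?h ` W \<in> sets borel" unfolding W_def using emeasure_image_UN(3)[OF I(1) _ I(3)] I(2) by simp
    have "negligible (?h ` ({a<..<b} - W))"
    proof (rule negligible_locally_Lipschitz_image)
      have "{a<..<b} - W \<subseteq> ({a<..<b} - N - W) \<union> N" by blast
      then show "negligible ({a<..<b} - W)" using I(4) N unfolding W_def by (meson negligible_Un negligible_subset)
      show "\<exists>T C. open T \<and> x \<in> T \<and> (\<forall>y\<in>({a<..<b} - W) \<inter> T. norm (?h y - ?h x) \<le> C * norm (y - x))" for x
        using h_lipschitz by (intro exI[of _ UNIV] exI[of _ "2 * B + 1"]) auto
    qed simp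
    then have "negligible (?h ` ({a<..<b} - W) \<union> {?h a, ?h b})" by (simp add: negligible_Un)
    moreover have "{?h a..?h b} - ?h ` W \<subseteq> ?h ` ({a<..<b} - W) \<union> {?h a, ?h b}" unfolding h_image[OF ab, symmetric] by force
    ultimately have "negligible ({?h a..?h b} - ?h ` W)" by (rule negligible_subset)
    then have z: "emeasure lborel ({?h a..?h b} - ?h ` W) = 0" using hWb by (intro emeasure_lborel_negligible) auto
    have "emeasure lborel {?h a..?h b} \<le> emeasure lborel (?h ` W \<union> ({?h a..?h b} - ?h ` W))"
      using hWb by (intro emeasure_mono) auto
    also have "\<dots> \<le> emeasure lborel (?h ` W) + emeasure lborel ({?h a..?h b} - ?h ` W)"
      using hWb by (intro emeasure_subadditive) auto
    also have "\<dots> \<le> ennreal ?c * emeasure lborel W"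
      using emeasure_image_le[OF I(1) _ I(3) _ c] I(2) unfolding z unfolding W_def by simp
    also have "\<dots> \<le> ennreal ?c * emeasure lborel {a..b}" using I(2) by (intro mult_left_mono emeasure_mono) (force simp: W_def)+
    finally have "ennreal (?h b - ?h a) \<le> ennreal (?c * (b - a))" using ab h_mono[OF ab] c by (simp add: ennreal_mult)
    then have "?h b - ?h a \<le> ?c * (b - a)" using c ab by (subst (asm) ennreal_le_iff) auto
    moreover have "?c * (b - a) = (M' + B + 1) * (b - a) + e'" using ab by (simp add: e_def distrib_right)
    moreover have "?h b - ?h a = f b - f a + (B + 1) * (b - a)" by (simp add: algebra_simps)
    ultimately show "f b - f a + (B + 1) * (b - a) \<le> (M' + B + 1) * (b - a) + e'" by linarith
  qed
  then have *: "f b - f a \<le> M' * (b - a)" by (simp add: algebra_simps)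
  show ?thesis
  proof (cases "- B \<le> M")
    case True
    then show ?thesis using * B by (simp add: M'_def max_def split: if_splits)
  next
    case False
    \<comment> \<open>Every derivative of f is at least - B > M, so no point off N remains, and (a,
      b) would be a null set.\<close>
    have "{a<..<b} \<subseteq> N"
    proof
      fix x assume x: "x \<in> {a<..<b}"
      show "x \<in> N"
      proof (rule ccontr)
        assume "x \<notin> N"
        then obtain D where D: "D \<le> M" "(f has_real_derivative D) (at x)" using der x by blast
        have "((\<lambda>y. (f y - f x) / (y - x)) \<longlongrightarrow> D) (at x)" using D(2) by (simp add: has_field_derivative_iff)
        moreover have "- B \<le> (f y - f x) / (y - x)" if "y \<noteq> x" for y
        proof -
          have "\<bar>(f y - f x) / (y - x)\<bar> \<le> B"
            using lipschitz_onD[OF f, of y x] that by (simp add: dist_real_def abs_divide field_simps)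
          then show ?thesis by linarith
        qed
        ultimately have "- B \<le> D" by (intro tendsto_lowerbound) (auto simp: eventually_at_filter)
        then show False using D(1) False by simp
      qed
    qed
    then have "negligible {a<..<b}" using N negligible_subset by blast
    then show ?thesis using ab negligible_interval(2)[of a b] by simp
  qed
qed

text \<open>The aim of the section: a bound on the curvature at the points where it exists is a
  Lipschitz bound for the tangent. The function is extended by constants beyond [a, b] and paired
  with the unit vector along f b - f a, which leaves the real case.\<close>

theorem lipschitz_deriv_bound:
  fixes f :: "real \<Rightarrow> 'a::euclidean_space"
  assumes f: "B-lipschitz_on {a..b} f" and ab: "a \<le> b"
    and der: "\<And>x k. x \<in> {a<..<b} \<Longrightarrow> (f has_vector_derivative k) (at x) \<Longrightarrow> norm k \<le> M"
  shows "norm (f b - f a) \<le> M * (b - a)"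
proof (cases "a = b")
  case False
  then have ab': "a < b" using ab by simp
  define c where "c x = max a (min b x)" for x
  define g where "g x = f (c x)" for x
  have c: "c x \<in> {a..b}" "\<bar>c x - c y\<bar> \<le> \<bar>x - y\<bar>" for x y using ab by (auto simp: c_def)
  have g: "B-lipschitz_on UNIV g"
  proof (rule lipschitz_onI)
    fix x y
    have "dist (g x) (g y) \<le> B * dist (c x) (c y)" unfolding g_def using lipschitz_onD[OF f] c by blast
    also have "\<dots> \<le> B * dist x y" using c(2) lipschitz_on_nonneg[OF f] by (intro mult_left_mono) (auto simp: dist_real_def)
    finally show "dist (g x) (g y) \<le> B * dist x y" .
  qed (rule lipschitz_on_nonneg[OF f])
  define u where "u = sgn (f b - f a)"
  have u: "norm u \<le> 1" by (simp add: u_def norm_sgn)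
  have gu: "B-lipschitz_on UNIV (\<lambda>x. g x \<bullet> u)"
  proof (rule lipschitz_onI)
    fix x y
    have "dist (g x \<bullet> u) (g y \<bullet> u) = \<bar>(g x - g y) \<bullet> u\<bar>" by (simp add: dist_real_def inner_diff_left)
    also have "\<dots> \<le> norm (g x - g y) * norm u" by (rule Cauchy_Schwarz_ineq2)
    also have "\<dots> \<le> dist (g x) (g y)" using u by (simp add: dist_norm mult_left_le)
    also have "\<dots> \<le> B * dist x y" using lipschitz_onD[OF g] by simp
    finally show "dist (g x \<bullet> u) (g y \<bullet> u) \<le> B * dist x y" .
  qed (rule lipschitz_on_nonneg[OF f])
  have "g b \<bullet> u - g a \<bullet> u \<le> M * (b - a)"
  proof (rule lipschitz_real_deriv_bound[OF gu ab' lipschitz_AE_differentiable[OF g]])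
    fix x assume x: "x \<in> {a<..<b} - {x. \<not> g differentiable (at x)}"
    then obtain k where k: "(g has_vector_derivative k) (at x)" using vector_derivative_works by blast
    have "(f has_vector_derivative k) (at x)" by (rule has_vector_derivative_transform_within_open[OF k, of "{a<..<b}"])
        (use x in \<open>auto simp: g_def c_def\<close>)
    then have "norm k \<le> M" using der x by blast
    then have "k \<bullet> u \<le> M" using norm_cauchy_schwarz[of k u] u mult_left_le[of "norm u" "norm k"] by simp
    moreover have "((\<lambda>x. g x \<bullet> u) has_real_derivative k \<bullet> u) (at x)"
      using bounded_linear.has_vector_derivative[OF bounded_linear_inner_left k] by (simp add: has_real_derivative_iff_has_vector_derivative)
    ultimately show "\<exists>D\<le>M. ((\<lambda>x. g x \<bullet> u) has_real_derivative D) (at x)" by blast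
  qed
  moreover have "(f b - f a) \<bullet> u = norm (f b - f a)"
    by (cases "f b = f a") (simp_all add: u_def sgn_div_norm dot_square_norm power2_eq_square)
  moreover have "g b \<bullet> u - g a \<bullet> u = (f b - f a) \<bullet> u" using ab by (simp add: g_def c_def inner_diff_left)
  ultimately show ?thesis by simp
qed simp

section \<open>Arclength curves and links\<close>

locale arclength_curve =
  fixes T :: "pt \<Rightarrow> pt" and C :: "pt set" and l :: real and J :: "real set" and \<gamma> :: "real \<Rightarrow> pt"
  assumes param: "arclength_param T C l J \<gamma>"
begin

lemma l_pos: "0 < l" and C_eq: "C = \<gamma> ` J"
  and J_cases: "J = {0..l} \<and> inj_on \<gamma> {0..l} \<or> J = UNIV \<and> inj_on \<gamma> {0..<l} \<and> (\<forall>s. \<gamma> (s + l) = \<gamma> s)"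
  and deriv: "s \<in> J \<Longrightarrow> (\<gamma> has_vector_derivative T (\<gamma> s)) (at s within J)"
  and unit: "s \<in> J \<Longrightarrow> norm (T (\<gamma> s)) = 1"
  using param by (auto simp: arclength_param_def)

lemma convex_J: "convex J"
  using J_cases by auto

lemma segment_J: "a \<in> J \<Longrightarrow> b \<in> J \<Longrightarrow> closed_segment a b \<subseteq> J"
  using convex_J by (simp add: closed_segment_subset)

lemma ivl_J: "a \<in> J \<Longrightarrow> b \<in> J \<Longrightarrow> {min a b..max a b} \<subseteq> J"
  using segment_J[of a b] by (auto simp: closed_segment_eq_real_ivl split: if_splits)

text \<open>Taken positive, because later radii are fractions with denominator
  \<open>B\<close>.\<close>

definition B :: real where "B = (SOME b. 0 < b \<and> b-lipschitz_on J (\<lambda>s. T (\<gamma> s)))"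

lemma B_pos: "0 < B" and B_lipschitz: "B-lipschitz_on J (\<lambda>s. T (\<gamma> s))"
proof -
  obtain b where b: "b-lipschitz_on J (\<lambda>s. T (\<gamma> s))" using param by (auto simp: arclength_param_def)
  have "(max b 1)-lipschitz_on J (\<lambda>s. T (\<gamma> s))" by (rule lipschitz_on_le[OF b]) simp
  then have "\<exists>b. 0 < b \<and> b-lipschitz_on J (\<lambda>s. T (\<gamma> s))" by (intro exI[of _ "max b 1"]) simp
  then have "0 < B \<and> B-lipschitz_on J (\<lambda>s. T (\<gamma> s))" unfolding B_def by (rule someI_ex)
  then show "0 < B" "B-lipschitz_on J (\<lambda>s. T (\<gamma> s))" by auto
qed

lemma T_lipschitz: "s \<in> J \<Longrightarrow> u \<in> J \<Longrightarrow> norm (T (\<gamma> s) - T (\<gamma> u)) \<le> B * \<bar>s - u\<bar>"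
  using lipschitz_onD[OF B_lipschitz] by (simp add: dist_norm)

text \<open>Mean value inequality for \<gamma> minus a tangent line. The constant K and the point of
  tangency are left free: \<open>double_nearest_separated\<close> needs the constant 1 / r from the
  curvature and the tangent at the far end of the chord.\<close>

lemma chord_lipschitz:
  assumes "K-lipschitz_on {min a b..max a b} (\<lambda>s. T (\<gamma> s))" "a \<in> J" "b \<in> J"
    and x: "x \<in> {min a b..max a b}"
  shows "norm (\<gamma> b - \<gamma> a - (b - a) *\<^sub>R T (\<gamma> x)) \<le> K * \<bar>b - a\<bar>\<^sup>2"
proof -
  let ?S = "{min a b..max a b}"
  have S: "?S \<subseteq> J" by (rule ivl_J[OF assms(2,3)])
  have "norm (\<gamma> b - \<gamma> a - (b - a) *\<^sub>R T (\<gamma> x)) \<le> norm (b - a) * (K * \<bar>b - a\<bar>)"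
  proof (rule vector_differentiable_bound_linearization[where S = ?S and f' = "\<lambda>u. T (\<gamma> u)"])
    show "(\<gamma> has_vector_derivative T (\<gamma> u)) (at u within ?S)" if "u \<in> ?S" for u
      using deriv[of u] that S by (meson has_vector_derivative_within_subset subsetD)
    show "closed_segment a b \<subseteq> ?S" by (auto simp: closed_segment_eq_real_ivl)
    show "norm (T (\<gamma> u) - T (\<gamma> x)) \<le> K * \<bar>b - a\<bar>" if u: "u \<in> ?S" for u
    proof -
      have "norm (T (\<gamma> u) - T (\<gamma> x)) \<le> K * \<bar>u - x\<bar>" using lipschitz_onD[OF assms(1) u x] by (simp add: dist_norm)
      also have "\<dots> \<le> K * \<bar>b - a\<bar>" using u x lipschitz_on_nonneg[OF assms(1)] by (intro mult_left_mono) auto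
      finally show ?thesis .
    qed
  qed (rule x)
  then show ?thesis by (simp add: power2_eq_square mult.commute mult.left_commute)
qed

lemma chord: "s \<in> J \<Longrightarrow> u \<in> J \<Longrightarrow> norm (\<gamma> u - \<gamma> s - (u - s) *\<^sub>R T (\<gamma> s)) \<le> B * \<bar>u - s\<bar>\<^sup>2"
  using segment_J[of s u]
  by (intro chord_lipschitz lipschitz_on_subset[OF B_lipschitz])
    (auto simp: closed_segment_eq_real_ivl split: if_splits)

lemma chord_inner:
  assumes "s \<in> J" "u \<in> J" "norm e \<le> 1"
  shows "\<bar>(\<gamma> u - \<gamma> s) \<bullet> e - (u - s) * (T (\<gamma> s) \<bullet> e)\<bar> \<le> B * \<bar>u - s\<bar>\<^sup>2"
proof -
  have "\<bar>(\<gamma> u - \<gamma> s - (u - s) *\<^sub>R T (\<gamma> s)) \<bullet> e\<bar> \<le> norm (\<gamma> u - \<gamma> s - (u - s) *\<^sub>R T (\<gamma> s)) * norm e" by (rule Cauchy_Schwarz_ineq2)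
  also have "\<dots> \<le> B * \<bar>u - s\<bar>\<^sup>2 * 1"
    using chord[OF assms(1,2)] assms(3) by (intro mult_mono) (auto simp: zero_le_mult_iff B_pos less_imp_le)
  finally show ?thesis by (simp add: inner_diff_left)
qed

lemma speed: "s \<in> J \<Longrightarrow> u \<in> J \<Longrightarrow> norm (\<gamma> u - \<gamma> s) \<le> \<bar>u - s\<bar>"
proof -
  assume "s \<in> J" "u \<in> J"
  moreover have "onorm (\<lambda>h. h *\<^sub>R T (\<gamma> x)) \<le> 1" if "x \<in> J" for x using unit[OF that] by (intro onorm_le) simp
  ultimately show ?thesis using differentiable_bound[OF convex_J, of \<gamma> "\<lambda>s h. h *\<^sub>R T (\<gamma> s)" 1 u s] deriv
    by (simp add: has_vector_derivative_def)
qed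

lemma continuous_\<gamma>: "continuous_on J \<gamma>"
  using deriv by (auto simp: continuous_on_eq_continuous_within intro: has_vector_derivative_continuous)

lemma periodic:
  assumes "J = UNIV"
  shows "\<gamma> (s + of_int k * l) = \<gamma> s"
proof -
  have p: "\<gamma> (s + l) = \<gamma> s" for s
    using J_cases assms l_pos bounded_closed_interval[of 0 l] not_bounded_UNIV[where 'a=real] by metis
  have n: "\<gamma> (s + of_nat n * l) = \<gamma> s" for n s
  proof (induction n)
    case (Suc n)
    have "s + of_nat (Suc n) * l = (s + of_nat n * l) + l" by (simp add: algebra_simps)
    then show ?case using Suc p by metis
  qed simp
  show ?thesis
  proof (cases "0 \<le> k")
    case True
    then show ?thesis using n[of s "nat k"] by simp
  next
    case False
    then show ?thesis using n[of "s + of_int k * l" "nat (- k)"] by simp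
  qed
qed

text \<open>Both parameters are reduced modulo l to [0, l), where injectivity is assumed. Their
  difference is then an integer multiple of l of modulus less than l.\<close>

lemma circle_inj:
  assumes J: "J = UNIV" and eq: "\<gamma> a = \<gamma> b" and ab: "\<bar>a - b\<bar> < l"
  shows "a = b"
proof -
  have inj: "inj_on \<gamma> {0..<l}" using J_cases J l_pos bounded_closed_interval[of 0 l] not_bounded_UNIV[where 'a=real] by metis
  define r where "r x = x - of_int \<lfloor>x / l\<rfloor> * l" for x
  have r: "r x \<in> {0..<l}" for x
  proof -
    have "of_int \<lfloor>x / l\<rfloor> * l \<le> x" using of_int_floor_le[of "x / l"] unfolding pos_le_divide_eq[OF l_pos] .
    moreover have "x / l < of_int \<lfloor>x / l\<rfloor> + 1" by linarith
    then have "x < of_int \<lfloor>x / l\<rfloor> * l + l" using l_pos by (simp add: field_simps)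
    ultimately show ?thesis by (simp add: r_def)
  qed
  have "\<gamma> (r x) = \<gamma> x" for x using periodic[OF J, of x "- \<lfloor>x / l\<rfloor>"] by (simp add: r_def)
  then have "r a = r b" using inj r eq by (metis inj_onD)
  then have d: "a - b = of_int (\<lfloor>a / l\<rfloor> - \<lfloor>b / l\<rfloor>) * l" by (simp add: r_def algebra_simps)
  define m where "m = \<lfloor>a / l\<rfloor> - \<lfloor>b / l\<rfloor>"
  have "\<bar>of_int m\<bar> * l < 1 * l" using ab l_pos unfolding d m_def[symmetric] by (simp add: abs_mult)
  then have "\<bar>of_int m :: real\<bar> < 1" using l_pos by (simp only: mult_less_cancel_right_pos)
  then have "m = 0" by linarith
  then show ?thesis using d by (simp add: m_def)
qed

text \<open>A fundamental domain of the parameter, centred at \<open>s\<close> in the periodic case.\<close>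

definition dom :: "real \<Rightarrow> real set" where
  "dom s = (if J = UNIV then {s - l/2..s + l/2} else J)"

lemma compact_dom: "compact (dom s)" and dom_J: "dom s \<subseteq> J"
  using J_cases by (auto simp: dom_def)

lemma image_dom: "\<gamma> ` dom s = C"
proof (cases "J = UNIV")
  case True
  have "\<gamma> u \<in> \<gamma> ` dom s" for u
  proof
    let ?k = "\<lfloor>(u - s) / l + 1/2\<rfloor>"
    show "\<gamma> u = \<gamma> (u + of_int (- ?k) * l)" using periodic[OF True, of u "- ?k"] by simp
    have "of_int ?k \<le> (u - s) / l + 1/2" "(u - s) / l + 1/2 \<le> of_int ?k + 1" by linarith+
    then have "of_int ?k * l \<le> ((u - s) / l + 1/2) * l" "((u - s) / l + 1/2) * l \<le> (of_int ?k + 1) * l"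
      using l_pos by (auto intro: mult_right_mono)
    moreover have "((u - s) / l + 1/2) * l = u - s + l/2" using l_pos by (simp add: distrib_right)
    ultimately have "of_int ?k * l \<le> (u - s) + l/2" "(u - s) + l/2 \<le> of_int ?k * l + l" by (simp_all add: distrib_right)
    then show "u + of_int (- ?k) * l \<in> dom s" unfolding dom_def using True by simp
  qed
  then show ?thesis using True by (auto simp: C_eq)
qed (simp add: dom_def C_eq)

lemma dom_inj: "s \<in> J \<Longrightarrow> u \<in> dom s \<Longrightarrow> \<gamma> u = \<gamma> s \<Longrightarrow> u = s"
proof (cases "J = UNIV")
  case True
  then show "u \<in> dom s \<Longrightarrow> \<gamma> u = \<gamma> s \<Longrightarrow> u = s" using l_pos circle_inj[OF True, of u s] unfolding dom_def by auto
next
  case False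
  then have "inj_on \<gamma> J" using J_cases by auto
  then show "s \<in> J \<Longrightarrow> u \<in> dom s \<Longrightarrow> \<gamma> u = \<gamma> s \<Longrightarrow> u = s" using False by (auto simp: dom_def inj_on_def)
qed

lemma compact_C: "compact C"
  using compact_continuous_image[OF continuous_on_subset[OF continuous_\<gamma> dom_J] compact_dom, of 0]
  by (simp add: image_dom)

text \<open>One step length for both directions; a direction is missing only at the endpoint where
  the arc stops.\<close>

lemma J_near:
  assumes s: "s \<in> J"
  shows "\<exists>h0>0. (J \<noteq> {0..l} \<or> s \<noteq> 0 \<longrightarrow> (\<forall>h\<in>{0..h0}. s - h \<in> J)) \<and> (J \<noteq> {0..l} \<or> s \<noteq> l \<longrightarrow> (\<forall>h\<in>{0..h0}. s + h \<in> J))"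
proof (cases "J = {0..l}")
  case False
  then have "J = UNIV" using J_cases by blast
  then show ?thesis by (intro exI[of _ 1]) simp
next
  case True
  define h0 where "h0 = (if s = 0 \<or> s = l then l else min s (l - s))"
  have "0 < h0" using s True l_pos by (auto simp: h0_def)
  moreover have "s \<noteq> 0 \<longrightarrow> h0 \<le> s" "s \<noteq> l \<longrightarrow> h0 \<le> l - s" using s True l_pos by (auto simp: h0_def)
  ultimately show ?thesis using s True by (intro exI[of _ h0]) auto
qed

end

section \<open>Links: local charts, endpoints and nearest points\<close>

locale link =
  fixes L :: "pt set" and T :: "pt \<Rightarrow> pt"
  assumes link: "C11_link L T"
begin

lemma finite_components: "finite (components L)"
  using link by (simp add: C11_link_def)

lemma component_curve:
  assumes "x \<in> L"
  obtains C l J \<gamma> s where "C \<in> components L" "arclength_curve T C l J \<gamma>" "s \<in> J" "x = \<gamma> s"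
proof -
  obtain C where C: "C \<in> components L" "x \<in> C" using assms Union_components[of L] by blast
  then obtain l J \<gamma> where p: "arclength_curve T C l J \<gamma>" using link by (auto simp: C11_link_def arclength_curve_def)
  then have "x \<in> \<gamma> ` J" using C arclength_curve.C_eq by blast
  then show ?thesis using that C p by blast
qed

lemma compact_component: "C \<in> components L \<Longrightarrow> compact C"
  using link arclength_curve.compact_C by (fastforce simp: C11_link_def arclength_curve_def)

lemma compact_L: "compact L"
  using compact_Union[OF finite_components] compact_component Union_components[of L] by fastforce

lemma closed_L: "closed L"
  by (rule compact_imp_closed[OF compact_L])

text \<open>Embeddedness in quantitative form: the other components, and the part of the fundamental
  domain away from s, have compact images that miss \<gamma> s and hence keep a positive distance
  from it.\<close>

lemma local_chart:
  assumes C: "C \<in> components L" and p: "arclength_curve T C l J \<gamma>" and s: "s \<in> J" and d: "0 < \<delta>"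
  shows "\<exists>e>0. L \<inter> ball (\<gamma> s) e \<subseteq> \<gamma> ` (J \<inter> ball s \<delta>)"
proof -
  interpret arclength_curve T C l J \<gamma> by (rule p)
  define M where "M = \<Union>(components L - {C})"
  define N where "N = \<gamma> ` (dom s - ball s \<delta>)"
  have "compact M" unfolding M_def by (rule compact_Union) (use finite_components compact_component in auto)
  moreover have "compact N" unfolding N_def by (rule compact_continuous_image[OF continuous_on_subset[OF continuous_\<gamma>]])
      (use dom_J compact_dom in \<open>auto intro: compact_diff\<close>)
  ultimately have "open (- (M \<union> N))" by (intro open_Compl compact_imp_closed compact_Un)
  moreover have "\<gamma> s \<notin> M"
  proof
    assume "\<gamma> s \<in> M"
    then obtain D where "D \<in> components L" "D \<noteq> C" "\<gamma> s \<in> D" by (auto simp: M_def)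
    moreover have "\<gamma> s \<in> C" using C_eq s by blast
    ultimately show False using components_nonoverlap[of C L D] C by blast
  qed
  moreover have "\<gamma> s \<notin> N" using dom_inj[OF s] d by (force simp: N_def)
  ultimately obtain e where e: "0 < e" "ball (\<gamma> s) e \<subseteq> - (M \<union> N)" by (metis ComplI UnE open_contains_ball)
  have "z \<in> \<gamma> ` (J \<inter> ball s \<delta>)" if z: "z \<in> L" "z \<in> ball (\<gamma> s) e" for z
  proof -
    have "z \<notin> M" "z \<notin> N" using e z by auto
    moreover obtain D where "D \<in> components L" "z \<in> D" using z(1) Union_components[of L] by blast
    ultimately have "z \<in> C" unfolding M_def by blast
    then obtain u where "u \<in> dom s" "z = \<gamma> u" using image_dom[of s] by blast
    then show ?thesis using \<open>z \<notin> N\<close> dom_J by (auto simp: N_def)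
  qed
  then show ?thesis using e(1) by blast
qed

lemma norm_T: "x \<in> L \<Longrightarrow> norm (T x) = 1"
  by (metis component_curve arclength_curve.unit)

lemma continuous_T: "continuous_on L T"
  unfolding continuous_on_iff
proof (intro ballI allI impI)
  fix x and e :: real assume x: "x \<in> L" and e: "0 < e"
  obtain C l J \<gamma> s where c: "C \<in> components L" "arclength_curve T C l J \<gamma>" "s \<in> J" "x = \<gamma> s" using component_curve[OF x] .
  interpret arclength_curve T C l J \<gamma> by (rule c)
  obtain d where d: "0 < d" "L \<inter> ball (\<gamma> s) d \<subseteq> \<gamma> ` (J \<inter> ball s (e / B))"
    using local_chart[OF c(1,2,3), of "e / B"] e B_pos by auto
  have "dist (T y) (T x) < e" if "y \<in> L" "dist y x < d" for y
  proof -
    have "y \<in> \<gamma> ` (J \<inter> ball s (e / B))" using d that c(4) by (auto simp: dist_commute)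
    then obtain u where u: "u \<in> J" "\<bar>u - s\<bar> < e / B" "y = \<gamma> u" by (auto simp: dist_real_def abs_minus_commute)
    have "dist (T y) (T x) \<le> B * \<bar>u - s\<bar>" using T_lipschitz[OF u(1) c(3)] u c by (simp add: dist_norm)
    also have "\<dots> < e" using u B_pos by (simp add: field_simps)
    finally show ?thesis .
  qed
  then show "\<exists>d>0. \<forall>x'\<in>L. dist x' x < d \<longrightarrow> dist (T x') (T x) < e" using d(1) by blast
qed

text \<open>Near the endpoint \<gamma>' a the link lies, to first order, on one side along the
  tangent, whereas \<gamma> would continue to the other side. The sign g treats both kinds of
  endpoint: it is 1 at initial and -1 at final points.\<close>

lemma endpoint_one_sided:
  assumes C: "C \<in> components L" and p: "arclength_curve T C l J \<gamma>" and s: "s \<in> J"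
    and D: "D \<in> components L" "arclength_curve T D l' {0..l'} \<gamma>'" and a: "a \<in> {0..l'}" "\<gamma> s = \<gamma>' a"
    and g: "g * g = 1" "\<bar>g\<bar> = 1" "\<And>u. u \<in> {0..l'} \<Longrightarrow> 0 \<le> g * (u - a)"
    and h0: "0 < h0" "\<And>h. h \<in> {0..h0} \<Longrightarrow> s - g * h \<in> J"
  shows False
proof -
  interpret a: arclength_curve T C l J \<gamma> by (rule p)
  interpret b: arclength_curve T D l' "{0..l'}" \<gamma>' by (rule D)
  obtain e where e: "0 < e" "L \<inter> ball (\<gamma>' a) e \<subseteq> \<gamma>' ` ({0..l'} \<inter> ball a (1 / b.B))"
    using local_chart[OF D a(1), of "1 / b.B"] b.B_pos by auto
  \<comment> \<open>Small enough for \<gamma> (s - g h) to lie in the chart of \<gamma>' and for the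
    quadratic error of the chord to be at most h / 2.\<close>
  define h where "h = min h0 (min (e / 2) (1 / (2 * a.B)))"
  have h: "0 < h" "h \<le> h0" "h < e" "h \<le> 1 / (2 * a.B)" using h0 e(1) a.B_pos by (auto simp: h_def)
  have sh: "s - g * h \<in> J" using h h0 by auto
  have gh: "\<bar>g * h\<bar> = h" using g(2) h(1) by (simp add: abs_mult)
  let ?t = "g *\<^sub>R T (\<gamma> s)"
  have t: "norm ?t = 1" "T (\<gamma> s) \<bullet> ?t = g" using a.unit[OF s] g(2) by (simp_all add: dot_square_norm)
  have "\<gamma> (s - g * h) \<in> C" using a.C_eq sh by blast
  then have "\<gamma> (s - g * h) \<in> L" using in_components_subset[OF C] by blast
  moreover have "\<gamma> (s - g * h) \<in> ball (\<gamma>' a) e" using a.speed[OF s sh] h gh a(2) by (simp add: dist_norm norm_minus_commute)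
  ultimately have "\<gamma> (s - g * h) \<in> \<gamma>' ` ({0..l'} \<inter> ball a (1 / b.B))" using e(2) by blast
  then obtain u where u: "u \<in> {0..l'}" "\<bar>u - a\<bar> < 1 / b.B" "\<gamma> (s - g * h) = \<gamma>' u"
    by (auto simp: dist_real_def abs_minus_commute)
  have "\<bar>(\<gamma> (s - g * h) - \<gamma> s) \<bullet> ?t - (s - g * h - s) * g\<bar> \<le> a.B * \<bar>s - g * h - s\<bar>\<^sup>2"
    by (rule a.chord_inner[OF s sh, of ?t, unfolded t(2)]) (simp only: t(1) order_refl)
  moreover have "(s - g * h - s) * g = - h" using g(1) by (simp add: mult.commute mult.left_commute)
  moreover have "\<bar>s - g * h - s\<bar> = h" using gh by simp
  ultimately have "(\<gamma> (s - g * h) - \<gamma> s) \<bullet> ?t \<le> - h + a.B * h\<^sup>2" by (simp only: abs_le_iff) linarith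
  also have "a.B * h\<^sup>2 = (a.B * h) * h" by (simp add: power2_eq_square)
  also have "(a.B * h) * h \<le> (1/2) * h" using h a.B_pos by (intro mult_right_mono) (auto simp: field_simps)
  finally have 1: "(\<gamma> (s - g * h) - \<gamma> s) \<bullet> ?t < 0" using h by simp
  define w where "w = g * (u - a)"
  have w: "0 \<le> w" "\<bar>u - a\<bar> = w" "(u - a) * g = w"
    using g(2) g(3)[OF u(1)] abs_mult[of g "u - a"] by (simp_all add: w_def mult.commute)
  have "\<bar>(\<gamma>' u - \<gamma> s) \<bullet> ?t - (u - a) * g\<bar> \<le> b.B * \<bar>u - a\<bar>\<^sup>2"
    by (rule b.chord_inner[OF a(1) u(1), of ?t, unfolded a(2)[symmetric] t(2)]) (simp only: t(1) order_refl)
  then have "w - b.B * w\<^sup>2 \<le> (\<gamma>' u - \<gamma> s) \<bullet> ?t" unfolding w(2,3) by linarith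
  moreover have "b.B * w\<^sup>2 = (b.B * w) * w" by (simp add: power2_eq_square)
  moreover have "(b.B * w) * w \<le> 1 * w" using u(2) w b.B_pos by (intro mult_right_mono) (auto simp: field_simps)
  ultimately show False using 1 unfolding u(3) by linarith
qed

text \<open>\<open>initial_points\<close> quantifies over all parametrizations; by this lemma any
  single one decides.\<close>

lemma initial_iff:
  assumes C: "C \<in> components L" and p: "arclength_curve T C l J \<gamma>" and s: "s \<in> J"
  shows "\<gamma> s \<in> initial_points L T \<longleftrightarrow> J = {0..l} \<and> s = 0"
proof
  assume "J = {0..l} \<and> s = 0"
  then show "\<gamma> s \<in> initial_points L T" using C p by (auto simp: initial_points_def arclength_curve_def)
next
  assume "\<gamma> s \<in> initial_points L T"
  then obtain D l' \<gamma>' where D: "D \<in> components L" "arclength_curve T D l' {0..l'} \<gamma>'" "\<gamma> s = \<gamma>' 0"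
    by (auto simp: initial_points_def arclength_curve_def)
  have 0: "0 \<in> {0..l'}" using arclength_curve.l_pos[OF D(2)] by simp
  show "J = {0..l} \<and> s = 0"
  proof (rule ccontr)
    assume neg: "\<not> (J = {0..l} \<and> s = 0)"
    obtain h0 where "0 < h0 \<and> (\<forall>h\<in>{0..h0}. s - h \<in> J)" using arclength_curve.J_near[OF p s] neg by blast
    then show False using endpoint_one_sided[OF C p s D(1,2) 0 D(3), of 1 h0] by auto
  qed
qed

lemma final_iff:
  assumes C: "C \<in> components L" and p: "arclength_curve T C l J \<gamma>" and s: "s \<in> J"
  shows "\<gamma> s \<in> final_points L T \<longleftrightarrow> J = {0..l} \<and> s = l"
proof
  assume "J = {0..l} \<and> s = l"
  then show "\<gamma> s \<in> final_points L T" using C p by (auto simp: final_points_def arclength_curve_def)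
next
  assume "\<gamma> s \<in> final_points L T"
  then obtain D l' \<gamma>' where D: "D \<in> components L" "arclength_curve T D l' {0..l'} \<gamma>'" "\<gamma> s = \<gamma>' l'"
    by (auto simp: final_points_def arclength_curve_def)
  have l': "l' \<in> {0..l'}" using arclength_curve.l_pos[OF D(2)] by simp
  show "J = {0..l} \<and> s = l"
  proof (rule ccontr)
    assume neg: "\<not> (J = {0..l} \<and> s = l)"
    obtain h0 where "0 < h0 \<and> (\<forall>h\<in>{0..h0}. s + h \<in> J)" using arclength_curve.J_near[OF p s] neg by blast
    then show False using endpoint_one_sided[OF C p s D(1,2) l' D(3), of "-1" h0] by auto
  qed
qed

lemma initial_L: "x \<in> initial_points L T \<Longrightarrow> x \<in> L"
  and final_L: "x \<in> final_points L T \<Longrightarrow> x \<in> L"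
proof -
  have "\<gamma> s \<in> L" if "D \<in> components L" "arclength_curve T D l {0..l} \<gamma>" "s \<in> {0..l}" for D l \<gamma> s
    using that in_components_subset arclength_curve.C_eq by blast
  moreover have "0 \<in> {0..l} \<and> l \<in> {0..l}" if "arclength_curve T D l {0..l} \<gamma>" for D l \<gamma>
    using arclength_curve.l_pos[OF that] by simp
  ultimately show "x \<in> initial_points L T \<Longrightarrow> x \<in> L" "x \<in> final_points L T \<Longrightarrow> x \<in> L"
    by (auto simp: initial_points_def final_points_def arclength_curve_def)
qed

lemma initial_final_disjoint: "x \<in> initial_points L T \<Longrightarrow> x \<notin> final_points L T"
proof
  assume x: "x \<in> initial_points L T" "x \<in> final_points L T"
  obtain C l J \<gamma> s where c: "C \<in> components L" "arclength_curve T C l J \<gamma>" "s \<in> J" "x = \<gamma> s"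
    using component_curve[OF initial_L[OF x(1)]] .
  then show False using x initial_iff[OF c(1-3)] final_iff[OF c(1-3)] arclength_curve.l_pos[OF c(2)] by auto
qed

lemma finite_boundary: "finite (boundary L T)"
proof -
  have "\<exists>q J. arclength_curve T C (fst q) J (snd q)" if C: "C \<in> components L" for C
  proof -
    obtain l J \<gamma> where "arclength_param T C l J \<gamma>" using link C unfolding C11_link_def by blast
    then show ?thesis by (intro exI[of _ "(l, \<gamma>)"] exI[of _ J]) (simp add: arclength_curve_def)
  qed
  then have "\<forall>C\<in>components L. \<exists>q. \<exists>J. arclength_curve T C (fst q) J (snd q)" by blast
  then obtain q where q: "\<And>C. C \<in> components L \<Longrightarrow> \<exists>J. arclength_curve T C (fst (q C)) J (snd (q C))" by (metis bchoice)
  have "boundary L T \<subseteq> (\<Union>C\<in>components L. {snd (q C) 0, snd (q C) (fst (q C))})"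
  proof
    fix x assume x: "x \<in> boundary L T"
    then have "x \<in> L" using initial_L final_L by (auto simp: boundary_def)
    then obtain C where C: "C \<in> components L" "x \<in> C" using Union_components[of L] by blast
    obtain J where J: "arclength_curve T C (fst (q C)) J (snd (q C))" using q[OF C(1)] by blast
    then obtain s where s: "s \<in> J" "x = snd (q C) s" using C arclength_curve.C_eq by blast
    have "s = 0 \<or> s = fst (q C)" using x s initial_iff[OF C(1) J s(1)] final_iff[OF C(1) J s(1)] by (auto simp: boundary_def)
    then show "x \<in> (\<Union>C\<in>components L. {snd (q C) 0, snd (q C) (fst (q C))})" using s C by auto
  qed
  then show ?thesis by (rule finite_subset) (use finite_components in auto)
qed

end

text \<open>
  The length of the projection of \<open>v\<close> to the tangent cone at \<open>x\<close> when \<open>x\<close> is an endpoint, and of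
  its projection to the tangent line otherwise.
\<close>

definition tangential :: "pt set \<Rightarrow> (pt \<Rightarrow> pt) \<Rightarrow> pt \<Rightarrow> pt \<Rightarrow> real" where
  "tangential L T x v = (if x \<in> initial_points L T then max 0 (v \<bullet> T x)
     else if x \<in> final_points L T then max 0 (- (v \<bullet> T x)) else \<bar>v \<bullet> T x\<bar>)"

lemma tangential_nonneg: "0 \<le> tangential L T x v"
  by (simp add: tangential_def)

lemma tangential_scale: "0 \<le> a \<Longrightarrow> tangential L T x (a *\<^sub>R v) = a * tangential L T x v"
  by (simp add: tangential_def abs_mult max_mult_distrib_left)

context link
begin

lemma normal_cone_iff:
  assumes x: "x \<in> L"
  shows "p \<in> normal_cone L T x \<longleftrightarrow> tangential L T x (p - x) = 0"
proof -
  let ?i = "x \<in> initial_points L T" and ?f = "x \<in> final_points L T" and ?c = "(p - x) \<bullet> T x"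
  have "p \<in> normal_cone L T x \<longleftrightarrow> (\<forall>a. (?i \<longrightarrow> 0 \<le> a) \<and> (?f \<longrightarrow> a \<le> 0) \<longrightarrow> a * ?c \<le> 0)"
  proof (intro iffI allI impI)
    fix a :: real assume p: "p \<in> normal_cone L T x" and a: "(?i \<longrightarrow> 0 \<le> a) \<and> (?f \<longrightarrow> a \<le> 0)"
    have "x + a *\<^sub>R T x \<in> tangent_cone L T x" using a unfolding tangent_cone_def by blast
    then have "(p - x) \<bullet> ((x + a *\<^sub>R T x) - x) \<le> 0" using p unfolding normal_cone_def by blast
    then show "a * ?c \<le> 0" by simp
  next
    assume R: "\<forall>a. (?i \<longrightarrow> 0 \<le> a) \<and> (?f \<longrightarrow> a \<le> 0) \<longrightarrow> a * ?c \<le> 0"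
    show "p \<in> normal_cone L T x" unfolding normal_cone_def
    proof (intro CollectI ballI)
      fix q assume "q \<in> tangent_cone L T x"
      then obtain a where a: "q = x + a *\<^sub>R T x" "(?i \<longrightarrow> 0 \<le> a) \<and> (?f \<longrightarrow> a \<le> 0)" unfolding tangent_cone_def by blast
      then have "a * ?c \<le> 0" using R by blast
      then show "(p - x) \<bullet> (q - x) \<le> 0" by (simp add: a(1))
    qed
  qed
  also have "\<dots> \<longleftrightarrow> tangential L T x (p - x) = 0"
  proof (cases "?i")
    case True
    then have "\<not> ?f" by (rule initial_final_disjoint)
    then have "(\<forall>a. (?i \<longrightarrow> 0 \<le> a) \<and> (?f \<longrightarrow> a \<le> 0) \<longrightarrow> a * ?c \<le> 0) \<longleftrightarrow> (\<forall>a\<ge>0. a * ?c \<le> 0)" using True by simp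
    also have "\<dots> \<longleftrightarrow> ?c \<le> 0" by (metis mult_nonneg_nonpos mult_1 zero_le_one)
    finally show ?thesis using True by (simp add: tangential_def max_def)
  next
    case i: False
    show ?thesis
    proof (cases "?f")
      case True
      then have "(\<forall>a. (?i \<longrightarrow> 0 \<le> a) \<and> (?f \<longrightarrow> a \<le> 0) \<longrightarrow> a * ?c \<le> 0) \<longleftrightarrow> (\<forall>a\<le>0. a * ?c \<le> 0)" using i by simp
      also have "\<dots> \<longleftrightarrow> 0 \<le> ?c"
      proof
        assume "\<forall>a\<le>0. a * ?c \<le> 0"
        from this[rule_format, of "-1"] show "0 \<le> ?c" by simp
      qed (simp add: mult_nonpos_nonneg)
      finally show ?thesis using True i by (simp add: tangential_def max_def)
    next
      case False
      then have "(\<forall>a. (?i \<longrightarrow> 0 \<le> a) \<and> (?f \<longrightarrow> a \<le> 0) \<longrightarrow> a * ?c \<le> 0) \<longleftrightarrow> (\<forall>a. a * ?c \<le> 0)" using i by simp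
      also have "\<dots> \<longleftrightarrow> ?c = 0"
      proof
        assume R: "\<forall>a. a * ?c \<le> 0"
        from R[rule_format, of 1] R[rule_format, of "-1"] show "?c = 0" by simp
      qed simp
      finally show ?thesis using False i by (simp add: tangential_def)
    qed
  qed
  finally show ?thesis .
qed

lemma critical_iff:
  "critical_pair L T x y \<longleftrightarrow> x \<in> L \<and> y \<in> L \<and> x \<noteq> y \<and> tangential L T x (y - x) = 0 \<and> tangential L T y (x - y) = 0"
  unfolding critical_pair_def using normal_cone_iff by blast

text \<open>First variation of the distance to p along the curve from s towards u; convexity of J
  keeps the path inside the parameter domain. The factor u - s covers both directions, and at an
  endpoint only one of them is available.\<close>

lemma first_order:
  assumes q: "q \<in> L" and near: "\<And>z. z \<in> L \<Longrightarrow> dist p q \<le> dist p z"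
    and C: "C \<in> components L" and p: "arclength_curve T C l J \<gamma>" and s: "s \<in> J" "q = \<gamma> s" and u: "u \<in> J"
  shows "(u - s) * ((p - q) \<bullet> T q) \<le> 0"
proof -
  interpret arclength_curve T C l J \<gamma> by (rule p)
  define h where "h = u - s"
  define A where "A = h * ((p - q) \<bullet> T q)"
  define K where "K = h\<^sup>2 + 2 * norm (p - q) * B * h\<^sup>2"
  have main: "2 * A \<le> t * K" if t: "0 < t" "t \<le> 1" for t
  proof -
    have sJ: "s + t * h \<in> J"
    proof -
      have "s + t * h = (1 - t) *\<^sub>R s + t *\<^sub>R u" by (simp add: h_def algebra_simps)
      then show ?thesis using convexD[OF convex_J s(1) u, of "1 - t" t] t by simp
    qed
    define w where "w = \<gamma> (s + t * h) - q"
    have "\<gamma> (s + t * h) \<in> L" using C_eq sJ in_components_subset[OF C] by blast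
    then have "(norm (p - q))\<^sup>2 \<le> (norm (p - q - w))\<^sup>2" using near unfolding dist_norm w_def by (intro power_mono) auto
    then have 1: "2 * ((p - q) \<bullet> w) \<le> (norm w)\<^sup>2" by (simp add: power2_norm_eq_inner inner_diff inner_commute)
    have "norm w \<le> t * \<bar>h\<bar>" using speed[OF s(1) sJ] t by (simp add: w_def s abs_mult)
    then have "(norm w)\<^sup>2 \<le> (t * \<bar>h\<bar>)\<^sup>2" by (intro power_mono) auto
    also have "(t * \<bar>h\<bar>)\<^sup>2 = t * (t * h\<^sup>2)" by (simp add: power_mult_distrib power2_eq_square[of t])
    finally have 2: "(norm w)\<^sup>2 \<le> t * (t * h\<^sup>2)" .
    have "norm (w - (t * h) *\<^sub>R T q) \<le> B * \<bar>t * h\<bar>\<^sup>2" using chord[OF s(1) sJ] by (simp add: w_def s)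
    then have "\<bar>(p - q) \<bullet> (w - (t * h) *\<^sub>R T q)\<bar> \<le> norm (p - q) * (B * \<bar>t * h\<bar>\<^sup>2)"
      by (intro order_trans[OF Cauchy_Schwarz_ineq2] mult_left_mono) auto
    then have 3: "t * A - norm (p - q) * (B * (t * h)\<^sup>2) \<le> (p - q) \<bullet> w" by (simp add: inner_diff_right A_def mult.assoc)
    have "t * (2 * A) \<le> t * (t * K)" using 1 2 3 by (simp add: K_def algebra_simps power2_eq_square)
    then show ?thesis using t by simp
  qed
  have "2 * A \<le> 0"
  proof (rule field_le_epsilon)
    fix e :: real assume e: "0 < e"
    have K: "0 \<le> K" using B_pos by (simp add: K_def)
    define t where "t = min 1 (e / (K + 1))"
    have t: "0 < t" "t \<le> 1" "t \<le> e / (K + 1)" using e K by (auto simp: t_def)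
    have "2 * A \<le> t * K" using main t by blast
    also have "\<dots> \<le> e / (K + 1) * (K + 1)" using t K e by (intro mult_mono) auto
    also have "\<dots> = e" using K by simp
    finally show "2 * A \<le> 0 + e" by simp
  qed
  then show ?thesis by (simp add: A_def h_def)
qed

lemma nearest_tangential:
  assumes q: "q \<in> L" and near: "\<And>z. z \<in> L \<Longrightarrow> dist p q \<le> dist p z"
  shows "tangential L T q (p - q) = 0"
proof -
  obtain C l J \<gamma> s where c: "C \<in> components L" "arclength_curve T C l J \<gamma>" "s \<in> J" "q = \<gamma> s" using component_curve[OF q] .
  interpret arclength_curve T C l J \<gamma> by (rule c)
  obtain h0 where h00: "h0 > 0" "J \<noteq> {0..l} \<or> s \<noteq> 0 \<longrightarrow> (\<forall>h\<in>{0..h0}. s - h \<in> J)"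
      "J \<noteq> {0..l} \<or> s \<noteq> l \<longrightarrow> (\<forall>h\<in>{0..h0}. s + h \<in> J)" using J_near[OF c(3)] by blast
  have "h0 \<in> {0..h0}" using h00(1) by simp
  then have h0: "h0 > 0" "J \<noteq> {0..l} \<or> s \<noteq> 0 \<Longrightarrow> s - h0 \<in> J" "J \<noteq> {0..l} \<or> s \<noteq> l \<Longrightarrow> s + h0 \<in> J" using h00 by blast+
  have a: "0 \<le> (p - q) \<bullet> T q" if "q \<notin> initial_points L T"
    using first_order[OF q near c(1-4), of "s - h0"] h0 that initial_iff[OF c(1-3)] c(4)
    by (simp add: mult_le_0_iff zero_le_mult_iff)
  have b: "(p - q) \<bullet> T q \<le> 0" if "q \<notin> final_points L T"
    using first_order[OF q near c(1-4), of "s + h0"] h0 that final_iff[OF c(1-3)] c(4) by (simp add: mult_le_0_iff)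
  show ?thesis using a b initial_final_disjoint[of q] by (auto simp: tangential_def)
qed

end

section \<open>Reach\<close>

definition nearest :: "'a::metric_space set \<Rightarrow> 'a \<Rightarrow> 'a" where
  "nearest L p = (THE q. q \<in> L \<and> dist p q = infdist p L)"

definition unique_nearest :: "'a::metric_space set \<Rightarrow> 'a \<Rightarrow> bool" where
  "unique_nearest L p \<longleftrightarrow> (\<exists>!q. q \<in> L \<and> dist p q = infdist p L)"

lemma nearest:
  assumes "unique_nearest L p"
  shows "nearest L p \<in> L" "dist p (nearest L p) = infdist p L"
    "q \<in> L \<Longrightarrow> dist p q = infdist p L \<Longrightarrow> q = nearest L p"
proof -
  have "nearest L p \<in> L \<and> dist p (nearest L p) = infdist p L"
    using theI'[OF assms[unfolded unique_nearest_def]] by (simp add: nearest_def)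
  then show "nearest L p \<in> L" "dist p (nearest L p) = infdist p L"
    "q \<in> L \<Longrightarrow> dist p q = infdist p L \<Longrightarrow> q = nearest L p" using assms unfolding unique_nearest_def by blast+
qed

lemma infdist_eqI:
  assumes "q \<in> L" "\<And>z. z \<in> L \<Longrightarrow> dist p q \<le> dist p z"
  shows "infdist p L = dist p q"
proof (rule antisym)
  show "infdist p L \<le> dist p q" using assms(1) by (rule infdist_le)
  show "dist p q \<le> infdist p L" using assms by (subst infdist_notempty) (auto intro!: cINF_greatest)
qed

text \<open>By compactness a subsequence of nearest points converges; its limit is nearest to the
  limit point, hence the only such point.\<close>

lemma continuous_nearest:
  fixes L :: "'a::heine_borel set"
  assumes L: "compact L" and U: "\<And>p. p \<in> U \<Longrightarrow> unique_nearest L p"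
  shows "continuous_on U (nearest L)"
proof (rule continuous_on_sequentiallyI)
  fix u a assume u: "\<forall>n. u n \<in> U" "a \<in> U" "u \<longlonglongrightarrow> a"
  show "(\<lambda>n. nearest L (u n)) \<longlonglongrightarrow> nearest L a"
  proof (rule ccontr)
    assume "\<not> ?thesis"
    then obtain e where e: "0 < e" "\<not> (\<forall>\<^sub>F n in sequentially. dist (nearest L (u n)) (nearest L a) < e)"
      unfolding tendsto_iff by blast
    have "\<forall>n. \<exists>m>n. e \<le> dist (nearest L (u m)) (nearest L a)"
    proof
      fix n
      have "\<exists>m\<ge>Suc n. \<not> dist (nearest L (u m)) (nearest L a) < e" using e(2) unfolding eventually_sequentially by blast
      then show "\<exists>m>n. e \<le> dist (nearest L (u m)) (nearest L a)" by (auto simp: Suc_le_eq not_less)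
    qed
    then have "infinite {m. e \<le> dist (nearest L (u m)) (nearest L a)}" by (simp add: infinite_nat_iff_unbounded)
    then obtain r :: "nat \<Rightarrow> nat" where r: "strict_mono r" "\<And>n. e \<le> dist (nearest L (u (r n))) (nearest L a)"
      using infinite_enumerate by (metis mem_Collect_eq)
    have "\<forall>n. nearest L (u (r n)) \<in> L" using nearest(1)[OF U] u by blast
    then have "\<exists>z\<in>L. \<exists>s::nat \<Rightarrow> nat. strict_mono s \<and> ((\<lambda>n. nearest L (u (r n))) \<circ> s) \<longlonglongrightarrow> z"
      using L[unfolded compact_def, rule_format, of "\<lambda>n. nearest L (u (r n))"] by blast
    then obtain z and s :: "nat \<Rightarrow> nat" where z: "z \<in> L" "strict_mono s" "(\<lambda>n. nearest L (u (r (s n)))) \<longlonglongrightarrow> z"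
      by (auto simp: o_def)
    have us: "(\<lambda>n. u (r (s n))) \<longlonglongrightarrow> a" using LIMSEQ_subseq_LIMSEQ[OF u(3) strict_mono_o[OF r(1) z(2)]] by (simp add: o_def)
    have "(\<lambda>n. dist (u (r (s n))) (nearest L (u (r (s n))))) \<longlonglongrightarrow> dist a z" by (intro tendsto_intros us z)
    moreover have "(\<lambda>n. dist (u (r (s n))) (nearest L (u (r (s n))))) = (\<lambda>n. infdist (u (r (s n))) L)"
      using nearest(2)[OF U] u(1) by simp
    moreover have "(\<lambda>n. infdist (u (r (s n))) L) \<longlonglongrightarrow> infdist a L" by (intro tendsto_infdist us)
    ultimately have "dist a z = infdist a L" by (metis LIMSEQ_unique)
    then have "z = nearest L a" using nearest(3)[OF U[OF u(2)] z(1)] by simp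
    moreover have "(\<lambda>n. dist (nearest L (u (r (s n)))) (nearest L a)) \<longlonglongrightarrow> dist z (nearest L a)" by (intro tendsto_intros z)
    then have "e \<le> dist z (nearest L a)" by (rule LIMSEQ_le_const) (use r(2) in blast)
    ultimately show False using e(1) by simp
  qed
qed

lemma reach_unique_nearest:
  assumes "ereal s < reach L" "infdist p L \<le> s"
  shows "unique_nearest L p"
proof -
  obtain r where r: "ereal s < r" "\<forall>p. ereal (infdist p L) < r \<longrightarrow> (\<exists>!q. q \<in> L \<and> dist p q = infdist p L)"
    using assms(1) unfolding reach_def less_Sup_iff by blast
  have "ereal (infdist p L) \<le> ereal s" using assms(2) by simp
  then have "ereal (infdist p L) < r" using r(1) by (rule le_less_trans)
  with r show ?thesis unfolding unique_nearest_def by blast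
qed

text \<open>
  Brouwer's theorem yields a point \<open>q\<close> beyond \<open>p\<close> on the line through \<open>p\<close> and the projection of \<open>q\<close>;
  hence segments realizing the distance to \<open>L\<close> can be prolonged.
\<close>

lemma extend_normal:
  fixes L :: "pt set"
  assumes L: "compact L" and x: "x \<in> L" and n: "norm n = 1" and s: "0 < s" "ereal s < reach L"
    and near: "\<And>z. z \<in> L \<Longrightarrow> s \<le> dist (x + s *\<^sub>R n) z"
  shows "\<exists>\<delta>>0. \<forall>z\<in>L. s + \<delta> \<le> dist (x + (s + \<delta>) *\<^sub>R n) z"
proof -
  let ?p = "x + s *\<^sub>R n" and ?\<pi> = "nearest L"
  obtain \<rho> where \<rho>: "s < \<rho>" "ereal \<rho> < reach L" using ereal_dense2[OF s(2)] by auto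
  define \<delta> where "\<delta> = \<rho> - s"
  have \<delta>: "0 < \<delta>" using \<rho> by (simp add: \<delta>_def)
  have px: "dist ?p x = s" using n s by (simp add: dist_norm)
  have "infdist ?p L = dist ?p x" using x near by (intro infdist_eqI) (simp_all add: px)
  then have ip: "infdist ?p L = s" by (simp add: px)
  have un: "unique_nearest L q" if "q \<in> cball ?p \<delta>" for q
  proof (rule reach_unique_nearest[OF \<rho>(2)])
    have "infdist q L \<le> infdist ?p L + dist q ?p" by (rule infdist_triangle)
    then show "infdist q L \<le> \<rho>" using that by (simp add: ip \<delta>_def dist_commute)
  qed
  have ne: "?p \<noteq> ?\<pi> q" if "q \<in> cball ?p \<delta>" for q using near[OF nearest(1)[OF un[OF that]]] s by auto
  let ?g = "\<lambda>q. ?p + \<delta> *\<^sub>R sgn (?p - ?\<pi> q)"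
  have "continuous_on (cball ?p \<delta>) ?\<pi>" by (rule continuous_nearest[OF L un])
  then have gc: "continuous_on (cball ?p \<delta>) ?g" using ne by (intro continuous_intros) auto
  have gm: "?g \<in> cball ?p \<delta> \<rightarrow> cball ?p \<delta>" using \<delta> by (auto simp: dist_norm norm_sgn)
  obtain q where q: "q \<in> cball ?p \<delta>" "?g q = q" by (rule brouwer_ball[OF \<delta> gc gm])
  have Lq: "?\<pi> q \<in> L" by (rule nearest(1)[OF un[OF q(1)]])
  have dq: "dist q (?\<pi> q) = dist ?p (?\<pi> q) + \<delta>"
  proof -
    have "q - ?\<pi> q = (norm (?p - ?\<pi> q) + \<delta>) *\<^sub>R sgn (?p - ?\<pi> q)"
    proof -
      have "v = norm v *\<^sub>R sgn v" for v :: pt by (cases "v = 0") (simp_all add: sgn_div_norm)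
      then have "?p - ?\<pi> q = norm (?p - ?\<pi> q) *\<^sub>R sgn (?p - ?\<pi> q)" by blast
      moreover have "q - ?\<pi> q = (?p - ?\<pi> q) + \<delta> *\<^sub>R sgn (?p - ?\<pi> q)" using q(2) by (metis add_diff_eq add.commute)
      ultimately show ?thesis by (metis scaleR_add_left)
    qed
    then show ?thesis using ne[OF q(1)] \<delta> by (simp add: dist_norm norm_sgn)
  qed
  have far: "dist ?p (?\<pi> q) + \<delta> \<le> dist q z" if "z \<in> L" for z
    using infdist_le[OF that, of q] nearest(2)[OF un[OF q(1)]] dq by simp
  have pq: "dist ?p q \<le> \<delta>" using q(1) by simp
  \<comment> \<open>Since \<open>?p\<close> lies on the segment from q to the projection of q, that
    projection is also nearest to \<open>?p\<close>; uniqueness at \<open>?p\<close> identifies it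
    with x.\<close>
  have "dist ?p (?\<pi> q) \<le> dist ?p z" if "z \<in> L" for z using far[OF that] dist_triangle[of q z ?p] pq by (simp add: dist_commute)
  then have "infdist ?p L = dist ?p (?\<pi> q)" by (intro infdist_eqI Lq)
  moreover have "unique_nearest L ?p" using \<delta> by (intro un) simp
  moreover have "dist ?p x = infdist ?p L" by (simp add: ip px)
  ultimately have "?\<pi> q = x" using nearest(3)[of L ?p] Lq x by metis
  moreover have "sgn (s *\<^sub>R n) = n" using s n by (simp add: sgn_div_norm)
  ultimately have "q = x + (s + \<delta>) *\<^sub>R n" using q(2) by (simp add: scaleR_add_left add.assoc[symmetric])
  then have "s + \<delta> \<le> dist (x + (s + \<delta>) *\<^sub>R n) z" if "z \<in> L" for z using far[OF that] px \<open>?\<pi> q = x\<close> by simp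
  then show ?thesis using \<delta> by blast
qed

section \<open>Tangent balls, and bounds for the reach\<close>

context link
begin

lemma normal_nearest_small:
  assumes x: "x \<in> L" and n: "norm n = 1" "tangential L T x n = 0"
  shows "\<exists>s>0. \<forall>z\<in>L. s \<le> dist (x + s *\<^sub>R n) z"
proof -
  obtain C l J \<gamma> s0 where c: "C \<in> components L" "arclength_curve T C l J \<gamma>" "s0 \<in> J" "x = \<gamma> s0" using component_curve[OF x] .
  interpret arclength_curve T C l J \<gamma> by (rule c)
  obtain e where e: "0 < e" "L \<inter> ball x e \<subseteq> \<gamma> ` (J \<inter> ball s0 (1 / (2 * B)))"
    using local_chart[OF c(1,2,3), of "1 / (2 * B)"] B_pos c(4) by auto
  \<comment> \<open>The bound e / 2 disposes of points outside the chart. Inside, (z - x) \<bullet>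
    n <= B h^2 and |z - x| >= |h| / 2, so s <= 1 / (8 B) gives 2 s ((z - x) \<bullet> n) <= |z -
    x|^2, which says that z is outside the open ball.\<close>
  define s where "s = min (e / 2) (1 / (8 * B))"
  have s: "0 < s" "s \<le> e / 2" "s * B \<le> 1 / 8" using e(1) B_pos by (auto simp: s_def min_def field_simps)
  have "s \<le> dist (x + s *\<^sub>R n) z" if z: "z \<in> L" for z
  proof (cases "z \<in> ball x e")
    case False
    then have "e \<le> dist x z" by simp
    moreover have "dist x z \<le> dist x (x + s *\<^sub>R n) + dist (x + s *\<^sub>R n) z" by (rule dist_triangle)
    moreover have "dist x (x + s *\<^sub>R n) = s" using n s by (simp add: dist_norm)
    ultimately show ?thesis using s by linarith
  next
    case True
    then obtain u where u: "u \<in> J" "\<bar>u - s0\<bar> < 1 / (2 * B)" "z = \<gamma> u"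
      using e(2) z by (auto simp: dist_real_def abs_minus_commute)
    define h where "h = u - s0"
    have cone: "h * (T x \<bullet> n) \<le> 0"
    proof -
      have i: "x \<in> initial_points L T \<Longrightarrow> 0 \<le> h" using initial_iff[OF c(1-3)] c(4) u(1) by (auto simp: h_def)
      have f: "x \<in> final_points L T \<Longrightarrow> h \<le> 0" using final_iff[OF c(1-3)] c(4) u(1) by (auto simp: h_def)
      have "n \<bullet> T x \<le> 0" if "x \<in> initial_points L T" using n(2) that by (simp add: tangential_def max_def split: if_splits)
      moreover have "0 \<le> n \<bullet> T x" if "x \<in> final_points L T" "x \<notin> initial_points L T"
        using n(2) that by (simp add: tangential_def max_def split: if_splits)
      moreover have "n \<bullet> T x = 0" if "x \<notin> final_points L T" "x \<notin> initial_points L T"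
        using n(2) that by (simp add: tangential_def)
      ultimately show ?thesis using i f by (cases "x \<in> initial_points L T"; cases "x \<in> final_points L T")
          (auto simp: mult_le_0_iff inner_commute)
    qed
    have "\<bar>(\<gamma> u - \<gamma> s0) \<bullet> n - (u - s0) * (T (\<gamma> s0) \<bullet> n)\<bar> \<le> B * \<bar>u - s0\<bar>\<^sup>2" using n by (intro chord_inner c(3) u(1)) simp
    then have 1: "(z - x) \<bullet> n \<le> B * h\<^sup>2" using cone by (simp add: u(3) c(4) h_def)
    have "norm (\<gamma> u - \<gamma> s0 - (u - s0) *\<^sub>R T (\<gamma> s0)) \<le> B * \<bar>u - s0\<bar>\<^sup>2" by (rule chord[OF c(3) u(1)])
    moreover have "norm ((u - s0) *\<^sub>R T (\<gamma> s0)) = \<bar>u - s0\<bar>" using unit[OF c(3)] by simp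
    moreover have "norm ((u - s0) *\<^sub>R T (\<gamma> s0)) - norm (\<gamma> u - \<gamma> s0) \<le> norm (\<gamma> u - \<gamma> s0 - (u - s0) *\<^sub>R T (\<gamma> s0))"
      using norm_triangle_ineq2[of "(u - s0) *\<^sub>R T (\<gamma> s0)" "\<gamma> u - \<gamma> s0"] by (simp add: norm_minus_commute)
    ultimately have "\<bar>u - s0\<bar> - B * \<bar>u - s0\<bar>\<^sup>2 \<le> norm (\<gamma> u - \<gamma> s0)" by linarith
    then have "\<bar>h\<bar> - B * h\<^sup>2 \<le> norm (z - x)" by (simp add: u(3) c(4) h_def)
    moreover have "B * h\<^sup>2 = (B * \<bar>h\<bar>) * \<bar>h\<bar>" by (simp add: power2_eq_square)
    moreover have "(B * \<bar>h\<bar>) * \<bar>h\<bar> \<le> (1 / 2) * \<bar>h\<bar>" using u(2) B_pos by (intro mult_right_mono) (auto simp: h_def field_simps)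
    ultimately have "\<bar>h\<bar> / 2 \<le> norm (z - x)" by linarith
    then have "(\<bar>h\<bar> / 2)\<^sup>2 \<le> (norm (z - x))\<^sup>2" by (intro power_mono) auto
    then have 2: "h\<^sup>2 / 4 \<le> (norm (z - x))\<^sup>2" by (simp add: power_divide)
    have "2 * s * ((z - x) \<bullet> n) \<le> 2 * s * (B * h\<^sup>2)" using 1 s by (intro mult_left_mono) auto
    also have "\<dots> = (s * B) * (2 * h\<^sup>2)" by (simp add: mult_ac)
    also have "\<dots> \<le> (1 / 8) * (2 * h\<^sup>2)" using s by (intro mult_right_mono) auto
    also have "\<dots> \<le> (norm (z - x))\<^sup>2" using 2 by simp
    finally have 3: "2 * s * ((z - x) \<bullet> n) \<le> (norm (z - x))\<^sup>2" .
    have "(dist (x + s *\<^sub>R n) z)\<^sup>2 = (norm (z - x))\<^sup>2 - 2 * s * ((z - x) \<bullet> n) + s\<^sup>2 * (n \<bullet> n)"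
      unfolding dist_norm power2_norm_eq_inner by (simp add: inner_diff inner_add algebra_simps inner_commute power2_eq_square)
    then have "s\<^sup>2 \<le> (dist (x + s *\<^sub>R n) z)\<^sup>2" using 3 n(1) by (simp add: dot_square_norm)
    then show ?thesis by (rule power2_le_imp_le) simp
  qed
  then show ?thesis using s(1) by blast
qed

text \<open>Continuation. The radii of open balls that touch L at x along n and miss L form a closed
  set containing all smaller radii. It is nontrivial by \<open>normal_nearest_small\<close>, and
  \<open>extend_normal\<close> forbids it to end before the reach.\<close>

lemma normal_nearest:
  assumes x: "x \<in> L" and n: "norm n = 1" "tangential L T x n = 0"
    and s: "0 \<le> s" "ereal s < reach L" and z: "z \<in> L"
  shows "s \<le> dist (x + s *\<^sub>R n) z"
proof (rule ccontr)
  assume neg: "\<not> s \<le> dist (x + s *\<^sub>R n) z"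
  define S where "S = {a. 0 \<le> a \<and> (\<forall>z\<in>L. a \<le> dist (x + a *\<^sub>R n) z)}"
  have down: "b \<in> S" if "a \<in> S" "0 \<le> b" "b \<le> a" for a b unfolding S_def
  proof (intro CollectI conjI ballI)
    fix z assume "z \<in> L"
    then have "a \<le> dist (x + a *\<^sub>R n) z" using that(1) by (auto simp: S_def)
    also have "\<dots> \<le> dist (x + a *\<^sub>R n) (x + b *\<^sub>R n) + dist (x + b *\<^sub>R n) z" by (rule dist_triangle)
    also have "dist (x + a *\<^sub>R n) (x + b *\<^sub>R n) = a - b" using n that by (simp add: dist_norm flip: scaleR_diff_left)
    finally show "b \<le> dist (x + b *\<^sub>R n) z" by simp
  qed (use that in auto)
  have bd: "a < s" if "a \<in> S" for a
  proof (rule ccontr)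
    assume "\<not> a < s"
    then have "s \<in> S" using down[OF that s(1)] by simp
    then show False using neg z by (auto simp: S_def)
  qed
  obtain a0 where a0: "0 < a0" "a0 \<in> S" using normal_nearest_small[OF x n] by (auto simp: S_def intro: less_imp_le)
  define m where "m = Sup S"
  have bdd: "bdd_above S" using bd by (auto simp: bdd_above_def intro: less_imp_le)
  have m: "a0 \<le> m" "m \<le> s" unfolding m_def using a0 bdd bd by (auto intro: cSup_upper cSup_least less_imp_le)
  have "closed S"
  proof -
    have "S = {0..} \<inter> (\<Inter>z\<in>L. {a. a \<le> dist (x + a *\<^sub>R n) z})" by (auto simp: S_def)
    moreover have "closed {a. a \<le> dist (x + a *\<^sub>R n) z}" for z by (intro closed_Collect_le continuous_intros)
    ultimately show ?thesis by auto
  qed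
  then have mS: "m \<in> S" unfolding m_def using a0 bdd by (intro closed_contains_Sup) auto
  have "ereal m < reach L" using m(2) s(2) by (meson ereal_less_eq(3) order.strict_trans1)
  then obtain \<delta> where \<delta>: "0 < \<delta>" "\<forall>z\<in>L. m + \<delta> \<le> dist (x + (m + \<delta>) *\<^sub>R n) z"
    using extend_normal[OF compact_L x n(1), of m] m a0 mS by (auto simp: S_def)
  then have "m + \<delta> \<in> S" using m a0 by (simp add: S_def)
  then have "m + \<delta> \<le> m" unfolding m_def using bdd by (intro cSup_upper)
  then show False using \<delta>(1) by simp
qed

text \<open>Federer's inequality. Let v = y - x, let w be v minus its projection to the tangent
  cone, and n the direction of w. For s < r the open ball of radius s touching L at x along n does
  not contain y; expanding |s n - v| >= s gives 2 s |w| <= |v|^2, and |w|^2 is |v|^2 minus the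
  square of the tangential part.\<close>

theorem reach_chord_bound:
  assumes x: "x \<in> L" and y: "y \<in> L" and r: "0 \<le> r" "ereal r \<le> reach L"
  shows "2 * r * sqrt ((norm (y - x))\<^sup>2 - (tangential L T x (y - x))\<^sup>2) \<le> (norm (y - x))\<^sup>2"
proof -
  define v where "v = y - x"
  let ?c = "tangential L T x v" and ?t = "T x"
  have t: "norm ?t = 1" "?t \<bullet> ?t = 1" using norm_T[OF x] by (simp_all add: dot_square_norm)
  \<comment> \<open>The coefficient of the projection to the tangent cone, which is a ray at an
    endpoint. It is always 0 or v \<bullet> T x, whence both identities that follow.\<close>
  define b where "b = (if x \<in> initial_points L T then max 0 (v \<bullet> ?t)
     else if x \<in> final_points L T then min 0 (v \<bullet> ?t) else v \<bullet> ?t)"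
  have c2: "?c\<^sup>2 = b * (v \<bullet> ?t)" and b2: "b * b = b * (v \<bullet> ?t)"
    by (auto simp: tangential_def b_def max_def min_def power2_eq_square)
  define w where "w = v - b *\<^sub>R ?t"
  have wv: "w \<bullet> v = (norm v)\<^sup>2 - ?c\<^sup>2" by (simp add: w_def inner_diff_left inner_diff_right power2_norm_eq_inner c2 inner_commute)
  have "w \<bullet> w = v \<bullet> v - 2 * (b * (v \<bullet> ?t)) + b * b * (?t \<bullet> ?t)" by (simp add: w_def inner_diff inner_commute algebra_simps)
  then have ww: "(norm w)\<^sup>2 = (norm v)\<^sup>2 - ?c\<^sup>2" unfolding power2_norm_eq_inner using t b2 c2 by simp
  have wt: "tangential L T x w = 0" using t by (auto simp: tangential_def w_def b_def inner_diff_left)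
  show ?thesis
  proof (cases "w = 0")
    case True
    then have "(norm v)\<^sup>2 - ?c\<^sup>2 = 0" using ww by simp
    then show ?thesis by (simp add: v_def[symmetric])
  next
    case False
    define n where "n = (1 / norm w) *\<^sub>R w"
    have n: "norm n = 1" "tangential L T x n = 0"
      using False wt tangential_scale[of "1 / norm w" L T x w] by (simp_all add: n_def)
    have sq: "sqrt ((norm v)\<^sup>2 - ?c\<^sup>2) = norm w" using ww by (metis norm_ge_zero real_sqrt_unique)
    have "w \<bullet> v = (norm w)\<^sup>2" using wv ww by simp
    then have nv: "n \<bullet> v = norm w" using False by (simp add: n_def power2_eq_square)
    have main: "2 * s * norm w \<le> (norm v)\<^sup>2" if s: "0 \<le> s" "s < r" for s
    proof -
      have "ereal s < reach L" using s r by (meson ereal_less(2) less_ereal.simps(1) order.strict_trans2)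
      then have "s \<le> dist (x + s *\<^sub>R n) y" by (intro normal_nearest x n s(1) y)
      then have "s\<^sup>2 \<le> (dist (x + s *\<^sub>R n) y)\<^sup>2" using s(1) by (intro power_mono)
      also have "dist (x + s *\<^sub>R n) y = norm (s *\<^sub>R n - v)" by (simp add: dist_norm v_def algebra_simps)
      also have "(norm (s *\<^sub>R n - v))\<^sup>2 = s\<^sup>2 * (norm n)\<^sup>2 - 2 * s * (n \<bullet> v) + (norm v)\<^sup>2"
        unfolding power2_norm_eq_inner by (simp add: inner_diff inner_commute power2_eq_square algebra_simps)
      finally show ?thesis using n nv by simp
    qed
    have "2 * r * norm w \<le> (norm v)\<^sup>2"
    proof (cases "r = 0")
      case False
      then have "0 < r" using r by simp
      show ?thesis
      proof (rule tendsto_upperbound[of "\<lambda>s. 2 * s * norm w" _ "at_left r"])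
        show "((\<lambda>s. 2 * s * norm w) \<longlongrightarrow> 2 * r * norm w) (at_left r)" by (intro tendsto_intros)
        have "\<forall>\<^sub>F s in at_left r. s \<in> {0<..<r}" using \<open>0 < r\<close> by (rule eventually_at_left_real)
        then show "\<forall>\<^sub>F s in at_left r. 2 * s * norm w \<le> (norm v)\<^sup>2" by eventually_elim (use main in auto)
      qed simp
    qed simp
    then show ?thesis using sq by (simp add: v_def[symmetric])
  qed
qed

lemma curvature_lipschitz:
  assumes curv: "\<And>x k. has_curvature L T x k \<Longrightarrow> norm k \<le> K" and K: "0 \<le> K"
    and C: "C \<in> components L" and p: "arclength_curve T C l J \<gamma>" and s: "s \<in> J" and u: "u \<in> J"
  shows "norm (T (\<gamma> s) - T (\<gamma> u)) \<le> K * \<bar>s - u\<bar>"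
proof -
  interpret arclength_curve T C l J \<gamma> by (rule p)
  have main: "norm (T (\<gamma> b) - T (\<gamma> a)) \<le> K * (b - a)" if ab: "a \<in> J" "b \<in> J" "a \<le> b" for a b
  proof (rule lipschitz_deriv_bound)
    have sub: "{a..b} \<subseteq> J" using segment_J[OF ab(1,2)] ab(3) by (simp add: closed_segment_eq_real_ivl)
    show "B-lipschitz_on {a..b} (\<lambda>s. T (\<gamma> s))" by (rule lipschitz_on_subset[OF B_lipschitz sub])
    fix x k assume x: "x \<in> {a<..<b}" "((\<lambda>s. T (\<gamma> s)) has_vector_derivative k) (at x)"
    then have "x \<in> J" using sub by auto
    then have "has_curvature L T (\<gamma> x) k" unfolding has_curvature_def
      by (intro bexI[OF _ C] exI[of _ l] exI[of _ J] exI[of _ \<gamma>] bexI[OF _ \<open>x \<in> J\<close>] conjI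
          param refl has_vector_derivative_at_within[OF x(2)])
    then show "norm k \<le> K" by (rule curv)
  qed (rule ab(3))
  show ?thesis using main[OF s u] main[OF u s] by (cases "s \<le> u") (auto simp: norm_minus_commute)
qed

text \<open>A local form of uniqueness of nearest points. A Lebesgue number for a cover by such sets
  bounds the distance of two nearest points from below.\<close>

definition separates :: "real \<Rightarrow> pt set \<Rightarrow> bool" where
  "separates d U \<longleftrightarrow> (\<forall>p q1 q2. q1 \<in> L \<inter> U \<longrightarrow> q2 \<in> L \<inter> U \<longrightarrow> dist p q1 = infdist p L \<longrightarrow>
    dist p q2 = infdist p L \<longrightarrow> infdist p L \<le> d \<longrightarrow> q1 = q2)"

text \<open>Let \<gamma> s1 and \<gamma> s2 with h = s2 - s1 > 0 both be nearest to p. Then (p -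
  \<gamma>) \<bullet> T is at most 0 at s1 and at least 0 at s2. But the curvature bound makes it
  drop by at least h - h^2 / r - d h / r, which is positive for h < r - d.\<close>

lemma double_nearest_separated:
  assumes curv: "\<And>x k. has_curvature L T x k \<Longrightarrow> norm k \<le> 1 / r" and r: "0 < r" and d: "d < r"
    and q: "q \<in> L"
  shows "\<exists>e>0. separates d (ball q e)"
proof -
  obtain C l J \<gamma> s0 where c: "C \<in> components L" "arclength_curve T C l J \<gamma>" "s0 \<in> J" "q = \<gamma> s0" using component_curve[OF q] .
  interpret arclength_curve T C l J \<gamma> by (rule c)
  have "0 < (r - d) / 2" using d by simp
  from local_chart[OF c(1,2,3) this]
  obtain e where e: "0 < e" "L \<inter> ball q e \<subseteq> \<gamma> ` (J \<inter> ball s0 ((r - d) / 2))" using c(4) by auto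
  have lip: "norm (T (\<gamma> a) - T (\<gamma> b)) \<le> 1 / r * \<bar>a - b\<bar>" if "a \<in> J" "b \<in> J" for a b
    using curvature_lipschitz[OF curv _ c(1,2) that] r by simp
  have False if s: "s1 \<in> J" "s2 \<in> J" "s1 < s2" "s2 - s1 < r - d"
    and n1: "dist p (\<gamma> s1) = infdist p L" and n2: "dist p (\<gamma> s2) = infdist p L" and ip: "infdist p L \<le> d" for p s1 s2
  proof -
    let ?h = "s2 - s1" and ?t1 = "T (\<gamma> s1)" and ?t2 = "T (\<gamma> s2)"
    have L: "\<gamma> s1 \<in> L" "\<gamma> s2 \<in> L" using C_eq in_components_subset[OF c(1)] s by auto
    have near: "dist p (\<gamma> s1) \<le> dist p z" "dist p (\<gamma> s2) \<le> dist p z" if "z \<in> L" for z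
      using infdist_le[OF that, of p] n1 n2 by auto
    have "(s2 - s1) * ((p - \<gamma> s1) \<bullet> ?t1) \<le> 0" using near by (intro first_order[OF L(1) _ c(1,2) s(1) refl s(2)])
    then have 1: "(p - \<gamma> s1) \<bullet> ?t1 \<le> 0" using s by (simp add: mult_le_0_iff)
    have "(s1 - s2) * ((p - \<gamma> s2) \<bullet> ?t2) \<le> 0" using near by (intro first_order[OF L(2) _ c(1,2) s(2) refl s(1)])
    then have 2: "0 \<le> (p - \<gamma> s2) \<bullet> ?t2" using s by (simp add: mult_le_0_iff)
    have "(p - \<gamma> s1) \<bullet> (?t2 - ?t1) \<le> norm (p - \<gamma> s1) * norm (?t2 - ?t1)" by (rule norm_cauchy_schwarz)
    also have "\<dots> \<le> d * (1 / r * \<bar>s2 - s1\<bar>)"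
      using n1 ip lip[OF s(2,1)] order_trans[OF infdist_nonneg ip] by (intro mult_mono) (auto simp: dist_norm)
    finally have 3: "(p - \<gamma> s1) \<bullet> (?t2 - ?t1) \<le> d * ?h / r" using s by simp
    have "norm (\<gamma> s2 - \<gamma> s1 - ?h *\<^sub>R ?t2) \<le> 1 / r * \<bar>?h\<bar>\<^sup>2"
    proof (rule chord_lipschitz[OF _ s(1,2)])
      show "(1 / r)-lipschitz_on {min s1 s2..max s1 s2} (\<lambda>s. T (\<gamma> s))"
      proof (rule lipschitz_onI)
        fix a b assume "a \<in> {min s1 s2..max s1 s2}" "b \<in> {min s1 s2..max s1 s2}"
        then have "a \<in> J" "b \<in> J" using ivl_J[OF s(1,2)] by blast+
        then show "dist (T (\<gamma> a)) (T (\<gamma> b)) \<le> 1 / r * dist a b" using lip by (simp add: dist_norm)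
      qed (use r in simp)
    qed auto
    then have "\<bar>(\<gamma> s2 - \<gamma> s1 - ?h *\<^sub>R ?t2) \<bullet> ?t2\<bar> \<le> ?h\<^sup>2 / r"
      using Cauchy_Schwarz_ineq2[of "\<gamma> s2 - \<gamma> s1 - ?h *\<^sub>R ?t2" ?t2] unit[OF s(2)] by simp
    then have 4: "?h - ?h\<^sup>2 / r \<le> (\<gamma> s2 - \<gamma> s1) \<bullet> ?t2" using unit[OF s(2)] by (simp add: inner_diff_left dot_square_norm)
    have "(p - \<gamma> s2) \<bullet> ?t2 - (p - \<gamma> s1) \<bullet> ?t1 = (p - \<gamma> s1) \<bullet> (?t2 - ?t1) - (\<gamma> s2 - \<gamma> s1) \<bullet> ?t2"
      by (simp add: inner_diff algebra_simps)
    then have "?h - ?h\<^sup>2 / r \<le> d * ?h / r" using 1 2 3 4 by linarith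
    then have "r * (?h - ?h\<^sup>2 / r) \<le> r * (d * ?h / r)" using r by (intro mult_left_mono) auto
    moreover have "r * (?h - ?h\<^sup>2 / r) = r * ?h - ?h\<^sup>2" using r by (simp add: right_diff_distrib)
    moreover have "r * (d * ?h / r) = d * ?h" using r by simp
    ultimately have "?h * r - ?h\<^sup>2 \<le> d * ?h" by (simp add: mult.commute)
    then have "?h * (r - ?h) \<le> ?h * d" by (simp add: power2_eq_square algebra_simps)
    then show False using s by simp
  qed
  note sep = this
  have "q1 = q2" if q12: "q1 \<in> L \<inter> ball q e" "q2 \<in> L \<inter> ball q e" and n: "dist p q1 = infdist p L"
    "dist p q2 = infdist p L" "infdist p L \<le> d" for p q1 q2
  proof -
    obtain s1 where s1: "s1 \<in> J" "\<bar>s1 - s0\<bar> < (r - d) / 2" "q1 = \<gamma> s1"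
      using q12(1) e(2) by (auto simp: dist_real_def abs_minus_commute)
    obtain s2 where s2: "s2 \<in> J" "\<bar>s2 - s0\<bar> < (r - d) / 2" "q2 = \<gamma> s2"
      using q12(2) e(2) by (auto simp: dist_real_def abs_minus_commute)
    have "\<bar>s2 - s1\<bar> < r - d" using abs_triangle_ineq4[of "s2 - s0" "s1 - s0"] s1(2) s2(2) by simp
    then have "s1 = s2" using sep[of s1 s2 p] sep[of s2 s1 p] s1 s2 n by (cases s1 s2 rule: linorder_cases) auto
    then show ?thesis using s1 s2 by simp
  qed
  then show ?thesis using e(1) unfolding separates_def by blast
qed

text \<open>Otherwise take a point p with two nearest points q1 and q2 at the least distance d < r.
  If q1 and q2 are opposite as seen from p, they form a critical pair of length 2 d, which is
  excluded. If not, the balls of radius d about q1 and q2 overlap near p. On the union of these two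
  pieces the nearest point is unique, hence continuous, so its values form a connected set. Yet they
  include q1 and q2 and lie in two disjoint open sets that separate q1 from the other points nearest
  to p.\<close>

theorem reach_ge:
  assumes ne: "L \<noteq> {}" and r: "0 < r"
    and curv: "\<And>x k. has_curvature L T x k \<Longrightarrow> norm k \<le> 1 / r"
    and crit: "\<And>x y. critical_pair L T x y \<Longrightarrow> 2 * r \<le> norm (x - y)"
  shows "ereal r \<le> reach L"
proof -
  have ex: "\<exists>q\<in>L. dist p q = infdist p L" for p using infdist_attains_inf[OF closed_L ne, of p] by metis
  have "unique_nearest L p0" if p0: "infdist p0 L < r" for p0
  proof (rule ccontr)
    assume "\<not> unique_nearest L p0"
    then obtain a b where ab: "a \<in> L" "b \<in> L" "a \<noteq> b" "dist p0 a = infdist p0 L" "dist p0 b = infdist p0 L"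
      using ex[of p0] unfolding unique_nearest_def by blast
    define d0 where "d0 = infdist p0 L"
    define \<G> where "\<G> = {ball q e | q e. separates d0 (ball q e)}"
    have "L \<subseteq> \<Union>\<G>"
    proof
      fix q assume q: "q \<in> L"
      have "\<exists>e>0. separates d0 (ball q e)" unfolding d0_def by (rule double_nearest_separated[OF _ r p0 q]) (rule curv)
      then obtain e where "0 < e" "separates d0 (ball q e)" by blast
      then have "ball q e \<in> \<G>" "q \<in> ball q e" by (auto simp: \<G>_def)
      then show "q \<in> \<Union>\<G>" by blast
    qed
    moreover have "\<And>G. G \<in> \<G> \<Longrightarrow> open G" by (auto simp: \<G>_def)
    ultimately obtain \<eta> where \<eta>: "0 < \<eta>" "\<And>x. x \<in> L \<Longrightarrow> \<exists>G\<in>\<G>. ball x \<eta> \<subseteq> G" using Heine_Borel_lemma[OF compact_L, of \<G>] by blast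
    \<comment> \<open>Pairs of nearest points cannot collapse in the limit; this makes
      \<open>S\<close> closed, so the least distance is attained.\<close>
    have sep: "\<eta> \<le> dist q1 q2" if "q1 \<in> L" "q2 \<in> L" "q1 \<noteq> q2" "dist p q1 = infdist p L" "dist p q2 = infdist p L"
      "infdist p L \<le> d0" for p q1 q2
    proof (rule ccontr)
      assume neg: "\<not> \<eta> \<le> dist q1 q2"
      obtain U where U: "ball q1 \<eta> \<subseteq> U" "separates d0 U" using \<eta>(2)[OF \<open>q1 \<in> L\<close>] unfolding \<G>_def by blast
      have "q1 \<in> U" "q2 \<in> U" using U(1) \<eta>(1) neg by (auto simp: subset_iff)
      then show False using U(2) that unfolding separates_def by blast
    qed
    define S where "S = {(p, q1, q2). q1 \<in> L \<and> q2 \<in> L \<and> \<eta> \<le> dist q1 q2 \<and>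
       dist p q1 = infdist p L \<and> dist p q2 = infdist p L \<and> infdist p L \<le> d0}"
    have "compact S"
    proof -
      have "S = ({p. infdist p L \<le> d0} \<times> L \<times> L) \<inter> {z. \<eta> \<le> dist (fst (snd z)) (snd (snd z))}
          \<inter> {z. dist (fst z) (fst (snd z)) = infdist (fst z) L} \<inter> {z. dist (fst z) (snd (snd z)) = infdist (fst z) L}"
        by (auto simp: S_def)
      moreover have "compact ({p. infdist p L \<le> d0} \<times> L \<times> L)"
      proof -
        have "0 < d0"
        proof (rule ccontr)
          assume "\<not> 0 < d0"
          then have "dist p0 a \<le> 0" "dist p0 b \<le> 0" using ab by (auto simp: d0_def)
          then show False using ab(3) by simp
        qed
        then show ?thesis by (intro compact_Times compact_infdist_le ne compact_L)
      qed
      moreover have "closed {z :: pt \<times> pt \<times> pt. \<eta> \<le> dist (fst (snd z)) (snd (snd z))}"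
        by (intro closed_Collect_le continuous_intros)
      moreover have "closed {z :: pt \<times> pt \<times> pt. dist (fst z) (fst (snd z)) = infdist (fst z) L}"
        by (intro closed_Collect_eq continuous_intros)
      moreover have "closed {z :: pt \<times> pt \<times> pt. dist (fst z) (snd (snd z)) = infdist (fst z) L}"
        by (intro closed_Collect_eq continuous_intros)
      ultimately show ?thesis by (simp add: compact_Int_closed)
    qed
    moreover have "(p0, a, b) \<in> S" using ab sep[OF ab] by (simp add: S_def d0_def)
    ultimately have "\<exists>z\<in>S. \<forall>w\<in>S. infdist (fst z) L \<le> infdist (fst w) L" by (intro continuous_attains_inf continuous_intros) auto
    then obtain z where z: "z \<in> S" "\<And>w. w \<in> S \<Longrightarrow> infdist (fst z) L \<le> infdist (fst w) L" by blast
    obtain p q1 q2 where zz: "z = (p, q1, q2)" by (cases z)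
    define d where "d = infdist p L"
    have q: "q1 \<in> L" "q2 \<in> L" "\<eta> \<le> dist q1 q2" "dist p q1 = d" "dist p q2 = d" and dd: "d \<le> d0"
      using z(1) by (auto simp: zz S_def d_def)
    have q12: "q1 \<noteq> q2" using q(3) \<eta>(1) by auto
    have d: "0 < d"
    proof (rule ccontr)
      assume "\<not> 0 < d"
      then have "dist p q1 \<le> 0" "dist p q2 \<le> 0" using q by auto
      then show False using q12 by simp
    qed
    have un: "unique_nearest L p'" if p': "infdist p' L < d" for p'
    proof (rule ccontr)
      assume "\<not> unique_nearest L p'"
      then obtain a b where ab: "a \<in> L" "b \<in> L" "a \<noteq> b" "dist p' a = infdist p' L" "dist p' b = infdist p' L"
        using ex[of p'] unfolding unique_nearest_def by blast
      then have "(p', a, b) \<in> S" using sep[OF ab] p' dd by (simp add: S_def)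
      then show False using z(2) p' by (fastforce simp: zz d_def)
    qed
    have near: "d \<le> dist p w" if "w \<in> L" for w using infdist_le[OF that, of p] by (simp add: d_def)
    have le2: "dist q1 q2 \<le> 2 * d" using dist_triangle[of q1 q2 p] q by (simp add: dist_commute)
    show False
    proof (cases "dist q1 q2 = 2 * d")
      case True
      \<comment> \<open>Equality in the triangle inequality: p is the midpoint, so the first-order
        conditions for q1 and q2 as nearest points of p are those of a critical pair.\<close>
      have mid: "p - q1 = q2 - p"
      proof -
        have "norm ((q2 - p) + (p - q1)) = norm (q2 - p) + norm (p - q1)"
          using True q by (simp add: dist_norm norm_minus_commute)
        then have "norm (q2 - p) *\<^sub>R (p - q1) = norm (p - q1) *\<^sub>R (q2 - p)" by (rule norm_triangle_eq[THEN iffD1])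
        then show ?thesis using q d by (simp add: dist_norm norm_minus_commute)
      qed
      have "tangential L T q1 (p - q1) = 0" by (rule nearest_tangential[OF q(1)]) (use near q in simp)
      moreover have "q2 - q1 = 2 *\<^sub>R (p - q1)" using mid by (simp add: scaleR_2 algebra_simps)
      ultimately have 1: "tangential L T q1 (q2 - q1) = 0" by (simp add: tangential_scale)
      have "tangential L T q2 (p - q2) = 0" by (rule nearest_tangential[OF q(2)]) (use near q in simp)
      moreover have "q1 - q2 = 2 *\<^sub>R (p - q2)" using mid by (simp add: scaleR_2 algebra_simps)
      ultimately have 2: "tangential L T q2 (q1 - q2) = 0" by (simp add: tangential_scale)
      have "2 * r \<le> norm (q1 - q2)" using 1 2 q q12 by (intro crit) (simp add: critical_iff)
      then show False using True dd p0 by (simp add: dist_norm d0_def)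
    next
      case False
      then have lt2: "dist q1 q2 < 2 * d" using le2 by simp
      \<comment> \<open>Points nearest to p have mutual distance at least \<eta>, so balls of radius
        \<eta> / 3 separate q1 from all others.\<close>
      define N where "N = {w \<in> L. dist p w = d}"
      define A where "A = ball q1 (\<eta> / 3)"
      define A' where "A' = (\<Union>w\<in>N - {q1}. ball w (\<eta> / 3))"
      have N: "q1 \<in> N" "q2 \<in> N" using q by (auto simp: N_def)
      have disj: "A \<inter> A' = {}"
      proof -
        have False if "v \<in> ball q1 (\<eta> / 3)" "w \<in> N" "w \<noteq> q1" "v \<in> ball w (\<eta> / 3)" for v w
        proof -
          have "w \<in> L" "dist p w = infdist p L" using \<open>w \<in> N\<close> by (simp_all add: N_def d_def)
          moreover have "dist p q1 = infdist p L" "infdist p L \<le> d0" using q(4) dd by (simp_all add: d_def)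
          ultimately have "\<eta> \<le> dist q1 w" using q(1) \<open>w \<noteq> q1\<close> by (intro sep[of q1 w p]) auto
          also have "\<dots> \<le> dist q1 v + dist w v" by (rule dist_triangle2)
          also have "\<dots> < \<eta>" using that \<eta>(1) by simp
          finally show False by simp
        qed
        then show ?thesis unfolding A_def A'_def by blast
      qed
      \<comment> \<open>Outside A and A' the link stays away from the sphere of radius d about p by
        a margin 2 \<epsilon>. Hence a point within \<epsilon> of p, and closer than d to L, has its
        nearest points in A or A'.\<close>
      have "\<exists>\<epsilon>>0. \<forall>w\<in>L - (A \<union> A'). d + 2 * \<epsilon> \<le> dist p w"
      proof (cases "L - (A \<union> A') = {}")
        case True
        show ?thesis by (rule exI[of _ 1]) (unfold True, simp)
      next
        case False
        have "compact (L - (A \<union> A'))" by (intro compact_diff compact_L) (auto simp: A_def A'_def)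
        then have "\<exists>w\<in>L - (A \<union> A'). \<forall>v\<in>L - (A \<union> A'). dist p w \<le> dist p v"
          using False by (intro continuous_attains_inf continuous_intros)
        then obtain w where w: "w \<in> L - (A \<union> A')" "\<And>v. v \<in> L - (A \<union> A') \<Longrightarrow> dist p w \<le> dist p v" by blast
        have "w \<notin> N"
        proof
          assume "w \<in> N"
          have "w \<in> A \<union> A'"
          proof (cases "w = q1")
            case True
            then show ?thesis using \<eta>(1) by (simp add: A_def)
          next
            case False
            then show ?thesis unfolding A'_def using \<eta>(1) \<open>w \<in> N\<close> by (intro UnI2 UN_I[of w]) auto
          qed
          then show False using w(1) by blast
        qed
        then have "d < dist p w" using near[of w] w(1) by (auto simp: N_def)
        moreover have "d + 2 * ((dist p w - d) / 2) = dist p w" by (simp add: field_simps)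
        ultimately show ?thesis using w(2) by (intro exI[of _ "(dist p w - d) / 2"]) (metis diff_gt_0_iff_gt half_gt_zero)
      qed
      then obtain \<epsilon> where \<epsilon>: "0 < \<epsilon>" "\<And>w. w \<in> L - (A \<union> A') \<Longrightarrow> d + 2 * \<epsilon> \<le> dist p w" by blast
      define X where "X = (ball q1 d \<inter> ball p \<epsilon>) \<union> (ball q2 d \<inter> ball p \<epsilon>)"
      have Xd: "infdist v L < d" if "v \<in> X" for v
        using that infdist_le[OF q(1), of v] infdist_le[OF q(2), of v] by (auto simp: X_def dist_commute)
      have move: "dist (p + t *\<^sub>R (w - p)) p < \<epsilon>" if "0 < t" "t * (norm (w - p) + 1) < \<epsilon>" for t w
      proof -
        have "dist (p + t *\<^sub>R (w - p)) p = t * norm (w - p)" using that(1) by (simp add: dist_norm)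
        then show ?thesis using that by (simp add: distrib_left)
      qed
      have small: "\<exists>t. 0 < t \<and> t < 1 \<and> t * (norm (w - p) + 1) < \<epsilon>" for w
      proof -
        define K where "K = norm (w - p) + 1"
        have K: "0 < K" by (simp add: K_def add_nonneg_pos)
        define t where "t = min (1/2) (\<epsilon> / (2 * K))"
        have t: "0 < t" "t < 1" "t \<le> \<epsilon> / (2 * K)" using K \<epsilon>(1) by (auto simp: t_def)
        have "t * K \<le> \<epsilon> / (2 * K) * K" using t K by (intro mult_right_mono) auto
        also have "\<dots> < \<epsilon>" using K \<epsilon>(1) by simp
        finally show ?thesis using t unfolding K_def by blast
      qed
      \<comment> \<open>The midpoint of q1 and q2 has distance less than d from both, as they are
        not opposite; a point slightly displaced from p towards it lies in both pieces.\<close>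
      have "ball q1 d \<inter> ball p \<epsilon> \<inter> (ball q2 d \<inter> ball p \<epsilon>) \<noteq> {}"
      proof -
        define m where "m = (1/2) *\<^sub>R (q1 + q2)"
        have m: "dist m q1 < d" "dist m q2 < d"
        proof -
          have "m - q1 = (1/2) *\<^sub>R (q2 - q1)" "m - q2 = (1/2) *\<^sub>R (q1 - q2)" by (simp_all add: m_def vec_eq_iff field_simps)
          then show "dist m q1 < d" "dist m q2 < d" using lt2 by (simp_all add: dist_norm norm_minus_commute)
        qed
        obtain t where t: "0 < t" "t < 1" "t * (norm (m - p) + 1) < \<epsilon>" using small by blast
        let ?v = "p + t *\<^sub>R (m - p)"
        have "dist ?v qq < d" if "dist m qq < d" "dist p qq = d" for qq
        proof -
          have "?v - qq = (1 - t) *\<^sub>R (p - qq) + t *\<^sub>R (m - qq)" by (simp add: algebra_simps)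
          then have "norm (?v - qq) \<le> (1 - t) * norm (p - qq) + t * norm (m - qq)"
            using t norm_triangle_ineq[of "(1 - t) *\<^sub>R (p - qq)" "t *\<^sub>R (m - qq)"] by simp
          also have "\<dots> < (1 - t) * d + t * d"
            using that t by (intro add_le_less_mono mult_strict_left_mono) (auto simp: dist_norm)
          also have "\<dots> = d" by (simp add: algebra_simps)
          finally show ?thesis by (simp add: dist_norm)
        qed
        then have "?v \<in> ball q1 d \<inter> ball p \<epsilon> \<inter> (ball q2 d \<inter> ball p \<epsilon>)"
          using m q(4,5) move[OF t(1,3)] by (simp add: dist_commute)
        then show ?thesis by blast
      qed
      moreover have "connected (ball c d \<inter> ball p \<epsilon>)" for c by (intro convex_connected convex_Int convex_ball)
      ultimately have "connected X" unfolding X_def by (intro connected_Un) auto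
      moreover have "continuous_on X (nearest L)" using Xd un by (intro continuous_nearest compact_L) blast
      ultimately have conn: "connected (nearest L ` X)" by (rule connected_continuous_image[rotated])
      have sub: "nearest L ` X \<subseteq> A \<union> A'"
      proof
        fix w assume "w \<in> nearest L ` X"
        then obtain v where v: "v \<in> X" "w = nearest L v" by blast
        have w: "w \<in> L" "dist v w = infdist v L" unfolding v(2) by (rule nearest(1,2)[OF un[OF Xd[OF v(1)]]])+
        have "dist p v < \<epsilon>" using v(1) by (auto simp: X_def)
        then have "dist p w < d + 2 * \<epsilon>" using dist_triangle[of p w v] w(2) Xd[OF v(1)] \<epsilon>(1) by linarith
        then have "\<not> d + 2 * \<epsilon> \<le> dist p w" by simp
        then show "w \<in> A \<union> A'" using \<epsilon>(2)[of w] w(1) by blast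
      qed
      \<comment> \<open>A point slightly displaced from p towards q1 has q1 as its nearest point,
        and likewise for q2.\<close>
      have hit: "c \<in> nearest L ` X" if c: "c = q1 \<or> c = q2" for c
      proof -
        have cL: "c \<in> L" "dist p c = d" using c q by auto
        obtain t where t: "0 < t" "t < 1" "t * (norm (c - p) + 1) < \<epsilon>" using small by blast
        let ?v = "p + t *\<^sub>R (c - p)"
        have "?v - c = (1 - t) *\<^sub>R (p - c)" by (simp add: algebra_simps)
        then have vc: "dist ?v c = (1 - t) * d" using t cL(2) by (simp add: dist_norm)
        have vp: "dist ?v p = t * d" using t cL(2) by (simp add: dist_norm norm_minus_commute)
        have "(1 - t) * d < 1 * d" using t d by (intro mult_strict_right_mono) auto
        then have vX: "?v \<in> X" using move[OF t(1,3)] vc c by (auto simp: X_def dist_commute)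
        have "infdist ?v L = dist ?v c"
        proof (rule infdist_eqI[OF cL(1)])
          fix w assume "w \<in> L"
          then have "d \<le> dist p w" by (rule near)
          also have "\<dots> \<le> dist ?v p + dist ?v w" by (metis dist_commute dist_triangle)
          finally show "dist ?v c \<le> dist ?v w" using vc vp by (simp add: algebra_simps)
        qed
        then have "c = nearest L ?v" using nearest(3)[OF un[OF Xd[OF vX]] cL(1)] by simp
        then show ?thesis using vX by blast
      qed
      have "q2 \<in> A'" unfolding A'_def using N q12 \<eta>(1) by (intro UN_I[of q2]) auto
      moreover have "q1 \<in> A" using \<eta>(1) by (simp add: A_def)
      moreover have "open A" "open A'" by (auto simp: A_def A'_def)
      ultimately show False using connectedD[OF conn, of A A'] sub hit disj by blast
    qed
  qed
  then have "ereal r \<in> {r. 0 \<le> r \<and> (\<forall>p. ereal (infdist p L) < r \<longrightarrow> (\<exists>!q. q \<in> L \<and> dist p q = infdist p L))}"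
    using r by (auto simp: unique_nearest_def)
  then show ?thesis unfolding reach_def by (rule Sup_upper)
qed

end

section \<open>Images under diffeomorphisms\<close>

lemma C2_has_derivative: "C2 f \<Longrightarrow> (f has_derivative D1 f x) (at x)"
proof -
  assume "C2 f"
  then have "f differentiable (at x)" by (simp add: C2_def differentiable_on_def)
  then show ?thesis by (simp add: frechet_derivative_works D1_def[abs_def])
qed

lemma C2_D1_has_derivative: "C2 f \<Longrightarrow> ((\<lambda>y. D1 f y v) has_derivative (\<lambda>u. D2 f x u v)) (at x)"
proof -
  assume "C2 f"
  then have "(\<lambda>y. D1 f y v) differentiable (at x)" by (simp add: C2_def differentiable_on_def)
  then show ?thesis by (simp add: frechet_derivative_works D2_def)
qed

lemma D1_eqI: "(f has_derivative f') (at x) \<Longrightarrow> D1 f x = f'"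
  using frechet_derivative_at[of f f' x] by (simp add: D1_def fun_eq_iff)

lemma D2_eqI: "((\<lambda>y. D1 f y v) has_derivative f') (at x) \<Longrightarrow> D2 f x u v = f' u"
  using frechet_derivative_at[of "\<lambda>y. D1 f y v" f' x] by (simp add: D2_def fun_eq_iff)

lemma C2_continuous: "C2 f \<Longrightarrow> continuous_on S f"
  using C2_def continuous_on_subset differentiable_imp_continuous_on by blast

lemma linear_D1: "C2 f \<Longrightarrow> linear (D1 f x)"
  by (rule has_derivative_linear[OF C2_has_derivative])

lemma linear_D2_left: "C2 f \<Longrightarrow> linear (\<lambda>u. D2 f x u v)"
  by (rule has_derivative_linear[OF C2_D1_has_derivative])

lemma vec_sum: "(v :: real^'n) = (\<Sum>i\<in>UNIV. v $ i *\<^sub>R axis i 1)"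
  using basis_expansion[of v] by (simp add: scalar_mult_eq_scaleR)

text \<open>\<open>C2\<close> speaks of one fixed direction at a time. Expansion in the standard
  basis is how first and second derivatives are handled when the direction moves with the
  point.\<close>

lemma linear_vec_sum:
  fixes F :: "real^'n \<Rightarrow> 'b::real_vector"
  assumes "linear F"
  shows "F v = (\<Sum>i\<in>UNIV. v $ i *\<^sub>R F (axis i 1))"
proof -
  have "F v = F (\<Sum>i\<in>UNIV. v $ i *\<^sub>R axis i 1)" by (simp add: vec_sum[symmetric])
  then show ?thesis using assms by (simp add: linear_sum linear_scale)
qed

lemma D1_sum: "C2 f \<Longrightarrow> D1 f x v = (\<Sum>i\<in>UNIV. v $ i *\<^sub>R D1 f x (axis i 1))"
  by (rule linear_vec_sum[OF linear_D1])

lemma D2_sum: "C2 f \<Longrightarrow> D2 f x u v = (\<Sum>i\<in>UNIV. v $ i *\<^sub>R D2 f x u (axis i 1))"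
proof (rule D2_eqI)
  assume f: "C2 f"
  have "((\<lambda>y. \<Sum>i\<in>UNIV. v $ i *\<^sub>R D1 f y (axis i 1)) has_derivative
      (\<lambda>u. \<Sum>i\<in>UNIV. v $ i *\<^sub>R D2 f x u (axis i 1))) (at x)"
    by (intro has_derivative_sum has_derivative_scaleR_right C2_D1_has_derivative f)
  then show "((\<lambda>y. D1 f y v) has_derivative (\<lambda>u. \<Sum>i\<in>UNIV. v $ i *\<^sub>R D2 f x u (axis i 1))) (at x)"
    by (simp add: D1_sum[OF f, symmetric])
qed

lemma linear_D2_right: "C2 f \<Longrightarrow> linear (D2 f x u)"
proof -
  assume f: "C2 f"
  have "linear (\<lambda>v. \<Sum>i\<in>UNIV. v $ i *\<^sub>R D2 f x u (axis i 1))"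
    by (rule linearI) (simp_all add: sum.distrib scaleR_add_left scaleR_sum_right)
  then show ?thesis using D2_sum[OF f, of x u, symmetric] by simp
qed

lemma D2_sum2: "C2 f \<Longrightarrow> D2 f x u v = (\<Sum>i\<in>UNIV. \<Sum>j\<in>UNIV. (v $ i * u $ j) *\<^sub>R D2 f x (axis j 1) (axis i 1))"
proof -
  assume f: "C2 f"
  have "D2 f x u v = (\<Sum>i\<in>UNIV. v $ i *\<^sub>R D2 f x u (axis i 1))" by (rule D2_sum[OF f])
  also have "\<dots> = (\<Sum>i\<in>UNIV. v $ i *\<^sub>R (\<Sum>j\<in>UNIV. u $ j *\<^sub>R D2 f x (axis j 1) (axis i 1)))"
    using linear_vec_sum[OF linear_D2_left[OF f], where v = u] by simp
  finally show ?thesis by (simp add: scaleR_sum_right)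
qed

lemma D1_has_derivative:
  assumes f: "C2 f" and g: "(g has_derivative g') (at x within S)" and h: "(h has_derivative h') (at x within S)"
  shows "((\<lambda>x. D1 f (g x) (h x)) has_derivative (\<lambda>d. D2 f (g x) (g' d) (h x) + D1 f (g x) (h' d))) (at x within S)"
proof -
  have g1: "((\<lambda>x. D1 f (g x) (axis i 1)) has_derivative (\<lambda>d. D2 f (g x) (g' d) (axis i 1))) (at x within S)" for i
    using has_derivative_compose[OF g C2_D1_has_derivative[OF f]] .
  have h1: "((\<lambda>x. h x $ i) has_derivative (\<lambda>d. h' d $ i)) (at x within S)" for i
    by (rule bounded_linear.has_derivative[OF bounded_linear_vec_nth h])
  have "((\<lambda>x. \<Sum>i\<in>UNIV. h x $ i *\<^sub>R D1 f (g x) (axis i 1)) has_derivative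
      (\<lambda>d. \<Sum>i\<in>UNIV. h x $ i *\<^sub>R D2 f (g x) (g' d) (axis i 1) + h' d $ i *\<^sub>R D1 f (g x) (axis i 1))) (at x within S)"
    by (intro has_derivative_sum has_derivative_scaleR h1 g1)
  then show ?thesis by (simp add: sum.distrib D1_sum[OF f, symmetric] D2_sum[OF f, symmetric])
qed

lemma D1_has_vector_derivative:
  assumes f: "C2 f" and g: "(g has_vector_derivative g') (at x within S)" and h: "(h has_vector_derivative h') (at x within S)"
  shows "((\<lambda>x. D1 f (g x) (h x)) has_vector_derivative D2 f (g x) g' (h x) + D1 f (g x) h') (at x within S)"
  using D1_has_derivative[OF f g[unfolded has_vector_derivative_def] h[unfolded has_vector_derivative_def]]
  by (simp add: has_vector_derivative_def linear_scale[OF linear_D1[OF f]] linear_scale[OF linear_D2_left[OF f]]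
      scaleR_add_right)

lemma continuous_on_D1:
  assumes f: "C2 f" and g: "continuous_on S g" and h: "continuous_on S h"
  shows "continuous_on S (\<lambda>c. D1 f (g c) (h c))"
proof -
  have "continuous_on UNIV (\<lambda>x. D1 f x v)" for v using f by (auto simp: C2_def intro: differentiable_imp_continuous_on)
  then have 1: "continuous_on S (\<lambda>c. D1 f (g c) v)" for v using continuous_on_compose2[OF _ g, of UNIV "\<lambda>x. D1 f x v"] by auto
  show ?thesis by (subst D1_sum[OF f]) (intro continuous_intros 1 h)
qed

lemma continuous_on_D2:
  assumes f: "C2 f" and g: "continuous_on S g" and h: "continuous_on S h" and k: "continuous_on S k"
  shows "continuous_on S (\<lambda>c. D2 f (g c) (h c) (k c))"
proof -
  have "continuous_on UNIV (\<lambda>x. D2 f x u v)" for u v using f by (simp add: C2_def)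
  then have 1: "continuous_on S (\<lambda>c. D2 f (g c) u v)" for u v
    using continuous_on_compose2[OF _ g, of UNIV "\<lambda>x. D2 f x u v"] by auto
  show ?thesis by (subst D2_sum2[OF f]) (intro continuous_intros 1 h k)
qed

lemma D1_bound:
  assumes f: "C2 f" and K: "compact K"
  shows "\<exists>M\<ge>0. \<forall>x\<in>K. \<forall>v. norm (D1 f x v) \<le> M * norm v"
proof -
  have "compact ((\<lambda>(x, v). D1 f x v) ` (K \<times> sphere 0 1))" unfolding case_prod_unfold
    by (intro compact_continuous_image continuous_on_D1 f continuous_intros compact_Times K compact_sphere)
  then obtain M where M': "\<forall>y\<in>(\<lambda>(x, v). D1 f x v) ` (K \<times> sphere 0 1). norm y \<le> M" using compact_imp_bounded bounded_iff by blast
  have M: "norm (D1 f x v) \<le> M" if "x \<in> K" "norm v = 1" for x v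
    using M'[rule_format, of "D1 f x v"] that by (simp add: image_iff) force
  have "norm (D1 f x v) \<le> \<bar>M\<bar> * norm v" if "x \<in> K" for x v
  proof (cases "v = 0")
    case True
    then show ?thesis using linear_0[OF linear_D1[OF f]] by simp
  next
    case False
    then have "norm (D1 f x ((1 / norm v) *\<^sub>R v)) \<le> M" using M[OF that, of "(1 / norm v) *\<^sub>R v"] by simp
    then have "norm (D1 f x v) \<le> M * norm v" using False by (simp add: linear_scale[OF linear_D1[OF f]] field_simps)
    also have "\<dots> \<le> \<bar>M\<bar> * norm v" by (intro mult_right_mono) auto
    finally show ?thesis .
  qed
  then show ?thesis by (intro exI[of _ "\<bar>M\<bar>"]) auto
qed

lemma D2_bound:
  assumes f: "C2 f" and K: "compact K"
  shows "\<exists>M\<ge>0. \<forall>x\<in>K. \<forall>u v. norm (D2 f x u v) \<le> M * norm u * norm v"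
proof -
  have "compact ((\<lambda>(x, u, v). D2 f x u v) ` (K \<times> sphere 0 1 \<times> sphere 0 1))" unfolding case_prod_unfold
    by (intro compact_continuous_image continuous_on_D2 f continuous_intros compact_Times K compact_sphere)
  then obtain M where M': "\<forall>y\<in>(\<lambda>(x, u, v). D2 f x u v) ` (K \<times> sphere 0 1 \<times> sphere 0 1). norm y \<le> M"
    using compact_imp_bounded bounded_iff by blast
  have M: "norm (D2 f x u v) \<le> M" if "x \<in> K" "norm u = 1" "norm v = 1" for x u v
    using M'[rule_format, of "D2 f x u v"] that by (simp add: image_iff) force
  have "norm (D2 f x u v) \<le> \<bar>M\<bar> * norm u * norm v" if "x \<in> K" for x u v
  proof (cases "u = 0 \<or> v = 0")
    case True
    then show ?thesis using linear_0[OF linear_D2_left[OF f]] linear_0[OF linear_D2_right[OF f]] by auto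
  next
    case False
    then have "norm (D2 f x ((1 / norm u) *\<^sub>R u) ((1 / norm v) *\<^sub>R v)) \<le> M"
      using M[OF that, of "(1 / norm u) *\<^sub>R u" "(1 / norm v) *\<^sub>R v"] by simp
    then have "norm (D2 f x u v) \<le> M * norm u * norm v"
      using False by (simp add: linear_scale[OF linear_D2_right[OF f]] linear_scale[OF linear_D2_left[OF f]] field_simps)
    also have "\<dots> \<le> \<bar>M\<bar> * norm u * norm v" by (intro mult_right_mono) auto
    finally show ?thesis .
  qed
  then show ?thesis by (intro exI[of _ "\<bar>M\<bar>"]) auto
qed

section \<open>Transport of arclength, tangents and curvatures by a diffeomorphism\<close>

locale C2_diffeomorphism =
  fixes f :: "pt \<Rightarrow> pt"
  assumes diffeo: "C2_diffeo f"
begin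

lemma f_C2: "C2 f" and inv_C2: "C2 (inv f)" and f_bij: "bij f"
  using diffeo by (auto simp: C2_diffeo_def)

lemma inv_f [simp]: "inv f (f x) = x" and f_inv [simp]: "f (inv f y) = y"
  using f_bij by (simp_all add: bij_def surj_f_inv_f)

lemma D1_inv: "D1 (inv f) (f x) (D1 f x v) = v"
proof -
  have "((\<lambda>y. inv f (f y)) has_derivative (\<lambda>v. D1 (inv f) (f x) (D1 f x v))) (at x)"
    by (rule has_derivative_compose[OF C2_has_derivative[OF f_C2] C2_has_derivative[OF inv_C2]])
  then have "((\<lambda>y. y) has_derivative (\<lambda>v. D1 (inv f) (f x) (D1 f x v))) (at x)" by simp
  then have "(\<lambda>v. D1 (inv f) (f x) (D1 f x v)) = (\<lambda>v. v)" by (rule has_derivative_unique[OF _ has_derivative_ident])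
  then show ?thesis by (rule fun_cong)
qed

lemma D1_nonzero: "v \<noteq> 0 \<Longrightarrow> D1 f x v \<noteq> 0"
  using D1_inv[of x v] linear_0[OF linear_D1[OF inv_C2]] by metis

lemma D2_inv: "D2 (inv f) (f x) (D1 f x u) (D1 f x v) + D1 (inv f) (f x) (D2 f x u v) = 0"
proof -
  have "((\<lambda>y. D1 (inv f) (f y) (D1 f y v)) has_derivative
     (\<lambda>u. D2 (inv f) (f x) (D1 f x u) (D1 f x v) + D1 (inv f) (f x) (D2 f x u v))) (at x)"
    by (rule D1_has_derivative[OF inv_C2 C2_has_derivative[OF f_C2] C2_D1_has_derivative[OF f_C2]])
  then have "((\<lambda>y. v) has_derivative
     (\<lambda>u. D2 (inv f) (f x) (D1 f x u) (D1 f x v) + D1 (inv f) (f x) (D2 f x u v))) (at x)" by (simp add: D1_inv)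
  then have "(\<lambda>u. D2 (inv f) (f x) (D1 f x u) (D1 f x v) + D1 (inv f) (f x) (D2 f x u v)) = (\<lambda>u. 0)"
    by (rule has_derivative_unique[OF _ has_derivative_const])
  then show ?thesis by (rule fun_cong)
qed

lemma inverse_diffeo: "C2_diffeo (inv f)"
  using diffeo by (simp add: C2_diffeo_def bij_imp_bij_inv inv_inv_eq)

end

text \<open>The curvature vector at \<open>f x\<close> of the image under \<open>f\<close> of a curve with tangent \<open>u\<close> and curvature \<open>k\<close> at \<open>x\<close>.\<close>

definition push_curvature :: "(pt \<Rightarrow> pt) \<Rightarrow> pt \<Rightarrow> pt \<Rightarrow> pt \<Rightarrow> pt" where
  "push_curvature f x u k = (let m = D1 f x u; w = D2 f x u u + D1 f x k in
     (1 / (norm m)\<^sup>2) *\<^sub>R (w - ((w \<bullet> m) / (norm m)\<^sup>2) *\<^sub>R m))"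

context C2_diffeomorphism
begin

text \<open>With m and w as in the proof, the transported curvature is the normal part of w / |m|^2.
  Under the inverse map the second derivatives cancel by \<open>D2_inv\<close>, and the multiple of
  m that had been removed returns as a multiple of u, which the second normal projection
  discards.\<close>

lemma push_curvature_inverse:
  assumes u: "norm u = 1" and k: "k \<bullet> u = 0"
  shows "push_curvature (inv f) (f x) (sgn (D1 f x u)) (push_curvature f x u k) = k"
proof -
  let ?g = "inv f"
  define m where "m = D1 f x u"
  define w where "w = D2 f x u u + D1 f x k"
  define a where "a = norm m"
  define c where "c = (w \<bullet> m) / a\<^sup>2"
  have "u \<noteq> 0" using u by auto
  then have a: "0 < a" using D1_nonzero[of u x] by (simp add: a_def m_def)
  note lin = linear_scale[OF linear_D1[OF inv_C2]] linear_scale[OF linear_D2_left[OF inv_C2]]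
     linear_scale[OF linear_D2_right[OF inv_C2]] linear_add[OF linear_D1[OF inv_C2]] linear_diff[OF linear_D1[OF inv_C2]]
  have s: "sgn m = (1 / a) *\<^sub>R m" by (simp add: sgn_div_norm a_def inverse_eq_divide)
  have k': "push_curvature f x u k = (1 / a\<^sup>2) *\<^sub>R (w - c *\<^sub>R m)" by (simp add: push_curvature_def Let_def m_def w_def a_def c_def)
  have m2: "D1 ?g (f x) (sgn m) = (1 / a) *\<^sub>R u" unfolding s lin by (simp add: m_def D1_inv)
  have "D2 ?g (f x) m m = - D1 ?g (f x) (D2 f x u u)" using D2_inv[of x u u] by (simp add: m_def eq_neg_iff_add_eq_0)
  then have w2: "D2 ?g (f x) (sgn m) (sgn m) + D1 ?g (f x) ((1 / a\<^sup>2) *\<^sub>R (w - c *\<^sub>R m)) = (1 / a\<^sup>2) *\<^sub>R (k - c *\<^sub>R u)"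
    by (simp add: s lin D1_inv w_def m_def[symmetric] D1_inv[of x u, folded m_def] power2_eq_square algebra_simps)
  have uu: "u \<bullet> u = 1" using u by (simp add: dot_square_norm)
  have n2: "(norm ((1 / a) *\<^sub>R u))\<^sup>2 = 1 / a\<^sup>2" using u a by (simp add: power_divide)
  have ip: "((1 / a\<^sup>2) *\<^sub>R (k - c *\<^sub>R u)) \<bullet> ((1 / a) *\<^sub>R u) = - c / (a\<^sup>2 * a)" using k uu by (simp add: inner_diff_left)
  have "push_curvature ?g (f x) (sgn m) ((1 / a\<^sup>2) *\<^sub>R (w - c *\<^sub>R m)) =
    a\<^sup>2 *\<^sub>R ((1 / a\<^sup>2) *\<^sub>R (k - c *\<^sub>R u) - (- c / a) *\<^sub>R ((1 / a) *\<^sub>R u))"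
    unfolding push_curvature_def Let_def m2 w2 n2 ip using a by (simp add: field_simps)
  also have "\<dots> = k" using a by (simp add: scaleR_diff_right power2_eq_square field_simps)
  finally show ?thesis unfolding k' m_def[symmetric] .
qed

end

lemma (in arclength_curve) at_J_nontrivial: "s \<in> J \<Longrightarrow> at s within J \<noteq> bot"
proof -
  assume s: "s \<in> J"
  have "connected J" using convex_J convex_connected by blast
  moreover have "J \<noteq> {s}" for s
    using J_cases l_pos by (metis UNIV_I atLeastAtMost_iff atLeastAtMost_singleton_iff less_irrefl singletonD zero_neq_one)
  ultimately have "s islimpt J" using s connected_imp_perfect by blast
  then show ?thesis by (simp add: trivial_limit_within)
qed

lemma curvature_orthogonal:
  assumes "has_curvature L T x k"
  shows "k \<bullet> T x = 0"
proof -
  obtain C l J \<gamma> s where c: "arclength_param T C l J \<gamma>" "s \<in> J" "x = \<gamma> s"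
    "((\<lambda>s. T (\<gamma> s)) has_vector_derivative k) (at s within J)" using assms unfolding has_curvature_def by blast
  interpret arclength_curve T C l J \<gamma> by unfold_locales (rule c)
  have "((\<lambda>s. T (\<gamma> s) \<bullet> T (\<gamma> s)) has_vector_derivative T (\<gamma> s) \<bullet> k + k \<bullet> T (\<gamma> s)) (at s within J)"
    using bounded_bilinear.has_vector_derivative[OF bounded_bilinear_inner c(4) c(4)] .
  moreover have "((\<lambda>s. T (\<gamma> s) \<bullet> T (\<gamma> s)) has_vector_derivative 0) (at s within J)"
    by (rule has_vector_derivative_transform[OF c(2) _ has_vector_derivative_const[of 1]])
      (use unit in \<open>simp add: dot_square_norm\<close>)
  ultimately have "T (\<gamma> s) \<bullet> k + k \<bullet> T (\<gamma> s) = 0" by (rule vector_derivative_unique_within[OF at_J_nontrivial[OF c(2)]])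
  then show ?thesis by (simp add: c(3) inner_commute)
qed

lemma curvature_unit: "has_curvature L T x k \<Longrightarrow> norm (T x) = 1"
  unfolding has_curvature_def arclength_param_def by blast

lemma curvature_in: "has_curvature L T x k \<Longrightarrow> x \<in> L"
  unfolding has_curvature_def arclength_param_def using in_components_subset by blast

lemma sgn_lipschitz:
  fixes a b :: "'a::real_normed_vector"
  assumes m: "0 < m" "m \<le> norm a"
  shows "norm (sgn a - sgn b) \<le> 2 / m * norm (a - b)"
proof (cases "b = 0")
  case True
  have "norm (sgn a - sgn b) = 1" using True m by (auto simp: norm_sgn)
  also have "1 \<le> 2 / m * norm (a - b)" using True m by (simp add: field_simps)
  finally show ?thesis .
next
  case False
  have a: "a \<noteq> 0" using m by auto
  have "norm a *\<^sub>R (sgn a - sgn b) = (a - b) + (norm b - norm a) *\<^sub>R sgn b"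
    using a False by (simp add: sgn_div_norm algebra_simps)
  then have "norm a * norm (sgn a - sgn b) = norm ((a - b) + (norm b - norm a) *\<^sub>R sgn b)" by (metis abs_norm_cancel norm_scaleR)
  also have "\<dots> \<le> norm (a - b) + norm ((norm b - norm a) *\<^sub>R sgn b)" by (rule norm_triangle_ineq)
  also have "\<dots> \<le> norm (a - b) + norm (a - b)" using False norm_triangle_ineq3[of b a] by (simp add: norm_sgn norm_minus_commute)
  finally have "norm a * norm (sgn a - sgn b) \<le> 2 * norm (a - b)" by simp
  moreover have "m * norm (sgn a - sgn b) \<le> norm a * norm (sgn a - sgn b)" using m by (intro mult_right_mono) auto
  ultimately show ?thesis using m by (simp add: field_simps)
qed

lemma sgn_has_vector_derivative:
  fixes m :: "real \<Rightarrow> 'a::real_inner"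
  assumes m: "(m has_vector_derivative w) (at s within S)" and n: "m s \<noteq> 0"
  shows "((\<lambda>s. sgn (m s)) has_vector_derivative
     (1 / norm (m s)) *\<^sub>R (w - ((w \<bullet> m s) / (norm (m s))\<^sup>2) *\<^sub>R m s)) (at s within S)"
proof -
  let ?n = "norm (m s)"
  have "((\<lambda>s. norm (m s)) has_derivative (\<lambda>h. (h *\<^sub>R w) \<bullet> sgn (m s))) (at s within S)"
    using has_derivative_compose[OF m[unfolded has_vector_derivative_def] has_derivative_norm[OF n]] .
  then have "((\<lambda>s. inverse (norm (m s))) has_derivative (\<lambda>h. - (inverse ?n * ((h *\<^sub>R w) \<bullet> sgn (m s)) * inverse ?n))) (at s within S)"
    by (rule Deriv.has_derivative_inverse[rotated]) (use n in simp)
  from has_derivative_scaleR[OF this m[unfolded has_vector_derivative_def]]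
  have "((\<lambda>s. inverse (norm (m s)) *\<^sub>R m s) has_derivative
    (\<lambda>h. inverse ?n *\<^sub>R h *\<^sub>R w + - (inverse ?n * ((h *\<^sub>R w) \<bullet> sgn (m s)) * inverse ?n) *\<^sub>R m s)) (at s within S)" .
  moreover have "(\<lambda>h. inverse ?n *\<^sub>R h *\<^sub>R w + - (inverse ?n * ((h *\<^sub>R w) \<bullet> sgn (m s)) * inverse ?n) *\<^sub>R m s)
     = (\<lambda>h. h *\<^sub>R ((1 / ?n) *\<^sub>R (w - ((w \<bullet> m s) / ?n\<^sup>2) *\<^sub>R m s)))"
    using n by (simp add: fun_eq_iff sgn_div_norm scaleR_diff_right power2_eq_square field_simps)
  ultimately show ?thesis by (simp add: has_vector_derivative_def sgn_div_norm)
qed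

lemma real_antiderivative:
  fixes v :: "real \<Rightarrow> real"
  assumes "continuous_on UNIV v"
  obtains \<tau> where "\<tau> 0 = 0" "\<And>s. (\<tau> has_real_derivative v s) (at s)"
proof (rule that)
  let ?\<tau> = "\<lambda>s. LBINT y=0..ereal s. v y"
  show "(?\<tau> has_real_derivative v s) (at s)" for s
  proof -
    let ?a = "- \<bar>s\<bar> - 1" and ?b = "\<bar>s\<bar> + 1"
    have "((\<lambda>u. LBINT y=ereal 0..ereal u. v y) has_vector_derivative v s) (at s within {?a..?b})"
      by (rule interval_integral_FTC2) (auto intro: continuous_on_subset[OF assms])
    moreover have "at s within {?a..?b} = at s" by (rule at_within_interior) auto
    ultimately show ?thesis by (simp add: has_real_derivative_iff_has_vector_derivative zero_ereal_def)
  qed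
  show "?\<tau> 0 = 0" by (simp add: zero_ereal_def)
qed

text \<open>For the arclength of an image curve: v is its speed, \<tau> the new parameter, and
  \<theta> the inverse change of parameter.\<close>

lemma antiderivative_diffeo:
  fixes v :: "real \<Rightarrow> real"
  assumes v: "continuous_on UNIV v" and m: "0 < m" "\<And>s. m \<le> v s"
  obtains \<tau> \<theta> where "\<tau> 0 = 0" "\<And>s. (\<tau> has_real_derivative v s) (at s)" "\<And>s. \<theta> (\<tau> s) = s" "\<And>u. \<tau> (\<theta> u) = u"
    "strict_mono \<tau>" "\<And>u. (\<theta> has_real_derivative 1 / v (\<theta> u)) (at u)" "\<And>u u'. \<bar>\<theta> u - \<theta> u'\<bar> \<le> \<bar>u - u'\<bar> / m"
proof -
  obtain \<tau> where \<tau>0: "\<tau> 0 = 0" and der: "\<And>s. (\<tau> has_real_derivative v s) (at s)"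
    by (rule real_antiderivative[OF v]) (rule that; assumption)
  have grow: "m * (b - a) \<le> \<tau> b - \<tau> a" if "a \<le> b" for a b
  proof (cases "a = b")
    case False
    then have "a < b" using that by simp
    then obtain z where "\<tau> b - \<tau> a = (b - a) * v z" using MVT2[of a b \<tau> v] der by blast
    moreover have "(b - a) * m \<le> (b - a) * v z" using that m by (intro mult_left_mono) auto
    ultimately show ?thesis by (simp add: mult.commute)
  qed simp
  have mono: "strict_mono \<tau>"
  proof (rule strict_monoI)
    fix a b :: real assume "a < b"
    then have "0 < m * (b - a)" using m by simp
    then show "\<tau> a < \<tau> b" using grow[of a b] \<open>a < b\<close> by linarith
  qed
  have cont: "isCont \<tau> s" for s using der DERIV_isCont by blast
  have "surj \<tau>" unfolding surj_def
  proof
    fix u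
    let ?c = "\<bar>u\<bar> / m"
    have c: "0 \<le> ?c" "m * ?c = \<bar>u\<bar>" using m by auto
    have "\<bar>u\<bar> \<le> \<tau> ?c" using grow[of 0 ?c] c \<tau>0 by simp
    moreover have "\<tau> (- ?c) \<le> - \<bar>u\<bar>" using grow[of "- ?c" 0] c \<tau>0 by simp
    ultimately have "\<exists>s. - ?c \<le> s \<and> s \<le> ?c \<and> \<tau> s = u" using c(1) cont by (intro IVT) auto
    then show "\<exists>s. u = \<tau> s" by metis
  qed
  then have bij: "bij \<tau>" using strict_mono_imp_inj_on[OF mono] by (simp add: bij_def)
  define \<theta> where "\<theta> = inv \<tau>"
  have 1: "\<theta> (\<tau> s) = s" and 2: "\<tau> (\<theta> u) = u" for s u using bij by (simp_all add: \<theta>_def bij_def surj_f_inv_f)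
  have lip: "\<bar>\<theta> u - \<theta> u'\<bar> \<le> \<bar>u - u'\<bar> / m" for u u' using grow[of "\<theta> u" "\<theta> u'"] grow[of "\<theta> u'" "\<theta> u"] m(1) 2
    by (cases "\<theta> u \<le> \<theta> u'") (auto simp: field_simps)
  have ct: "isCont \<theta> u" for u
  proof -
    have "(1 / m)-lipschitz_on UNIV \<theta>" using lip m(1) by (intro lipschitz_onI) (auto simp: dist_real_def)
    then have "continuous_on UNIV \<theta>" by (rule lipschitz_on_continuous_on)
    then show ?thesis by (simp add: continuous_on_eq_continuous_at)
  qed
  have "(\<theta> has_real_derivative 1 / v (\<theta> u)) (at u)" for u
  proof -
    have "v (\<theta> u) \<noteq> 0" using m(1) m(2)[of "\<theta> u"] by auto
    then have "DERIV \<theta> u :> inverse (v (\<theta> u))"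
      using der 2 ct by (intro DERIV_inverse_function[where f = \<tau> and g = \<theta> and a = "u - 1" and b = "u + 1"]) auto
    then show ?thesis by (simp add: inverse_eq_divide)
  qed
  then show ?thesis using that[OF \<tau>0 der 1 2 mono _ lip] by blast
qed

context C2_diffeomorphism
begin

text \<open>Reparametrizes the image curve by arclength. The change of parameter \<tau> is part of
  the conclusion, because the matching of endpoints and of curvatures is read off from it.\<close>

lemma push_arclength_param:
  assumes p: "arclength_param T C l J \<gamma>"
  obtains l' J' \<gamma>' \<tau> where "arclength_param (push_tangent f T) (f ` C) l' J' \<gamma>'" "\<tau> ` J = J'"
    "\<And>s. s \<in> J \<Longrightarrow> \<gamma>' (\<tau> s) = f (\<gamma> s)" "J = {0..l} \<Longrightarrow> J' = {0..l'} \<and> \<tau> 0 = 0 \<and> \<tau> l = l'"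
    "J = UNIV \<Longrightarrow> J' = UNIV" "inj \<tau>"
    "\<And>s k. s \<in> J \<Longrightarrow> ((\<lambda>s. T (\<gamma> s)) has_vector_derivative k) (at s within J) \<Longrightarrow>
       ((\<lambda>u. push_tangent f T (\<gamma>' u)) has_vector_derivative push_curvature f (\<gamma> s) (T (\<gamma> s)) k) (at (\<tau> s) within J')"
proof -
  interpret c: arclength_curve T C l J \<gamma> by unfold_locales (rule p)
  define \<beta>' where "\<beta>' s = D1 f (\<gamma> s) (T (\<gamma> s))" for s
  have Tne: "T (\<gamma> s) \<noteq> 0" if "s \<in> J" for s using c.unit[OF that] by auto
  have \<beta>ne: "\<beta>' s \<noteq> 0" if "s \<in> J" for s unfolding \<beta>'_def by (rule D1_nonzero[OF Tne[OF that]])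
  have contT: "continuous_on J (\<lambda>s. T (\<gamma> s))" by (rule lipschitz_on_continuous_on[OF c.B_lipschitz])
  have cont\<beta>: "continuous_on J \<beta>'" unfolding \<beta>'_def by (intro continuous_on_D1 f_C2 c.continuous_\<gamma> contT)
  have tan: "push_tangent f T (f (\<gamma> s)) = sgn (\<beta>' s)" for s by (simp add: push_tangent_def \<beta>'_def)
  have compC: "compact C" by (rule c.compact_C)
  \<comment> \<open>Lower bound for the speed: applying the derivative of the inverse map to the
    velocity returns the unit tangent, so 1 <= M |\<beta>'|. The denominator M + 1 avoids division
    by 0.\<close>
  obtain m where m: "0 < m" "\<And>s. s \<in> J \<Longrightarrow> m \<le> norm (\<beta>' s)"
  proof -
    obtain M where M: "0 \<le> M" "\<And>x v. x \<in> f ` C \<Longrightarrow> norm (D1 (inv f) x v) \<le> M * norm v"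
      using D1_bound[OF inv_C2, of "f ` C"] compact_continuous_image[OF C2_continuous[OF f_C2] compC] by blast
    show ?thesis
    proof (rule that[of "1 / (M + 1)"])
      show "0 < 1 / (M + 1)" using M(1) by simp
      fix s assume s: "s \<in> J"
      have "\<gamma> s \<in> C" using c.C_eq s by blast
      then have "norm (D1 (inv f) (f (\<gamma> s)) (\<beta>' s)) \<le> M * norm (\<beta>' s)" using M(2) by blast
      then have "1 \<le> M * norm (\<beta>' s)" using c.unit[OF s] by (simp add: \<beta>'_def D1_inv)
      also have "\<dots> \<le> (M + 1) * norm (\<beta>' s)" by (intro mult_right_mono) auto
      finally show "1 / (M + 1) \<le> norm (\<beta>' s)" using M(1) by (simp add: field_simps)
    qed
  qed
  \<comment> \<open>Clamping the parameter of an arc extends its speed to the whole line, so that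
    one construction of \<tau> serves arcs and circles.\<close>
  define cl where "cl s = (if J = UNIV then s else max 0 (min l s))" for s
  have cl: "cl s \<in> J" "s \<in> J \<Longrightarrow> cl s = s" for s using c.J_cases c.l_pos unfolding cl_def by auto
  have contcl: "continuous_on UNIV cl" unfolding cl_def[abs_def] by (cases "J = UNIV") (auto intro!: continuous_intros)
  define v where "v s = norm (\<beta>' (cl s))" for s
  have vcont: "continuous_on UNIV v" unfolding v_def using cl(1)
    by (intro continuous_intros continuous_on_compose2[OF cont\<beta> contcl]) auto
  have vm: "m \<le> v s" for s using m(2) cl(1) by (simp add: v_def)
  obtain \<tau> \<theta> where \<tau>: "\<tau> 0 = 0" "\<And>s. (\<tau> has_real_derivative v s) (at s)" "\<And>s. \<theta> (\<tau> s) = s" "\<And>u. \<tau> (\<theta> u) = u"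
    "strict_mono \<tau>" "\<And>u. (\<theta> has_real_derivative 1 / v (\<theta> u)) (at u)" "\<And>u u'. \<bar>\<theta> u - \<theta> u'\<bar> \<le> \<bar>u - u'\<bar> / m"
    by (rule antiderivative_diffeo[OF vcont m(1) vm]) (rule that; assumption)
  define J' where "J' = \<tau> ` J"
  define l' where "l' = \<tau> l"
  define \<gamma>' where "\<gamma>' u = f (\<gamma> (\<theta> u))" for u
  have \<theta>J: "\<theta> ` J' = J" by (simp add: J'_def image_image \<tau>(3))
  have l': "0 < l'" using \<tau>(1) strict_monoD[OF \<tau>(5) c.l_pos] by (simp add: l'_def)
  have J'_arc: "J' = {0..l'}" if J: "J = {0..l}"
  proof (intro equalityI subsetI)
    fix u assume "u \<in> J'"
    then obtain x where x: "u = \<tau> x" "0 \<le> x" "x \<le> l" by (auto simp: J'_def J)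
    then have "\<tau> 0 \<le> \<tau> x" "\<tau> x \<le> \<tau> l" using strict_mono_less_eq[OF \<tau>(5)] by simp_all
    then show "u \<in> {0..l'}" by (simp add: x \<tau>(1) l'_def)
  next
    fix u assume u: "u \<in> {0..l'}"
    have "\<tau> 0 \<le> \<tau> (\<theta> u)" "\<tau> (\<theta> u) \<le> \<tau> l" using u by (simp_all add: \<tau>(1,4) l'_def)
    then have "\<theta> u \<in> J" using strict_mono_less_eq[OF \<tau>(5)] by (simp add: J)
    then show "u \<in> J'" unfolding J'_def using \<tau>(4) by (metis imageI)
  qed
  have J'_circle: "J' = UNIV" if "J = UNIV" using \<tau>(4) that by (metis J'_def surjI)
  have \<beta>: "((\<lambda>s. f (\<gamma> s)) has_vector_derivative \<beta>' s) (at s within J)" if "s \<in> J" for s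
    using has_derivative_compose[OF c.deriv[OF that, unfolded has_vector_derivative_def] C2_has_derivative[OF f_C2]]
    by (simp add: has_vector_derivative_def \<beta>'_def linear_scale[OF linear_D1[OF f_C2]])
  have chain: "((\<lambda>u. g (\<theta> u)) has_vector_derivative (1 / norm (\<beta>' (\<theta> u))) *\<^sub>R g') (at u within J')"
    if u: "u \<in> J'" and g: "(g has_vector_derivative g') (at (\<theta> u) within J)" for g :: "real \<Rightarrow> pt" and g' u
  proof -
    have "\<theta> u \<in> J" using u \<theta>J by blast
    then have "(\<theta> has_vector_derivative 1 / norm (\<beta>' (\<theta> u))) (at u within J')"
      using \<tau>(6)[of u] cl(2) by (simp add: v_def has_real_derivative_iff_has_vector_derivative has_vector_derivative_at_within)
    from vector_diff_chain_within[OF this] show ?thesis using g by (simp add: \<theta>J o_def)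
  qed
  have tan': "push_tangent f T (\<gamma>' u) = sgn (\<beta>' (\<theta> u))" for u by (simp add: \<gamma>'_def tan)
  have inj_f: "inj f" using f_bij by (rule bij_is_inj)
  have param': "arclength_param (push_tangent f T) (f ` C) l' J' \<gamma>'" unfolding arclength_param_def
  proof (intro conjI ballI)
    show "0 < l'" by (rule l')
    have "\<gamma>' ` J' = f ` \<gamma> ` \<theta> ` J'" by (simp add: \<gamma>'_def image_image)
    then show "f ` C = \<gamma>' ` J'" by (simp add: \<theta>J c.C_eq)
    show "J' = {0..l'} \<and> inj_on \<gamma>' {0..l'} \<or> J' = UNIV \<and> inj_on \<gamma>' {0..<l'} \<and> (\<forall>s. \<gamma>' (s + l') = \<gamma>' s)" using c.J_cases
    proof (elim disjE conjE)
      assume J: "J = {0..l}" and inj: "inj_on \<gamma> {0..l}"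
      have "inj_on \<gamma>' {0..l'}"
      proof (rule inj_onI)
        fix a b assume ab: "a \<in> {0..l'}" "b \<in> {0..l'}" "\<gamma>' a = \<gamma>' b"
        then have "\<theta> a \<in> J" "\<theta> b \<in> J" using \<theta>J J'_arc[OF J] by blast+
        moreover have "\<gamma> (\<theta> a) = \<gamma> (\<theta> b)" using ab(3) inj_f by (simp add: \<gamma>'_def inj_eq)
        ultimately have "\<theta> a = \<theta> b" using inj unfolding J inj_on_def by blast
        then have "\<tau> (\<theta> a) = \<tau> (\<theta> b)" by (rule arg_cong)
        then show "a = b" by (simp only: \<tau>(4))
      qed
      then show ?thesis using J'_arc[OF J] by blast
    next
      assume J: "J = UNIV" and inj: "inj_on \<gamma> {0..<l}" and per: "\<forall>s. \<gamma> (s + l) = \<gamma> s"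
      have cl_id: "cl s = s" for s by (rule cl(2)) (simp add: J)
      have Tper: "T (\<gamma> (s + l)) = T (\<gamma> s)" for s using per by simp
      have vper: "v (s + l) = v s" for s using per by (simp add: v_def cl_id \<beta>'_def)
      \<comment> \<open>The speed is l-periodic, so the increment of \<tau> over a period does not
        depend on s.\<close>
      have \<tau>per: "\<tau> (s + l) = \<tau> s + l'" for s
      proof -
        have d0: "((\<lambda>s. \<tau> (s + l) - \<tau> s) has_real_derivative 0) (at s)" for s
        proof -
          have "((\<lambda>s. \<tau> (s + l)) has_real_derivative v (s + l)) (at s)" using DERIV_shift[of \<tau> "v (s + l)" s l] \<tau>(2) by blast
          from DERIV_diff[OF this \<tau>(2)[of s]] show ?thesis by (simp add: vper)
        qed
        have "\<tau> (s + l) - \<tau> s = \<tau> (0 + l) - \<tau> 0" using DERIV_isconst_all[of "\<lambda>s. \<tau> (s + l) - \<tau> s" s 0] d0 by blast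
        then show ?thesis by (simp add: \<tau>(1) l'_def)
      qed
      have \<theta>per: "\<theta> (u + l') = \<theta> u + l" for u using \<tau>per[of "\<theta> u"] \<tau>(3)[of "\<theta> u + l"] \<tau>(4)[of u] by simp
      have "inj_on \<gamma>' {0..<l'}"
      proof (rule inj_onI)
        fix a b assume ab: "a \<in> {0..<l'}" "b \<in> {0..<l'}" "\<gamma>' a = \<gamma>' b"
        have "\<theta> a \<in> {0..<l}" if "a \<in> {0..<l'}" for a
        proof -
          have "\<tau> 0 \<le> \<tau> (\<theta> a)" "\<tau> (\<theta> a) < \<tau> l" using that by (simp_all add: \<tau>(1,4) l'_def)
          then show ?thesis unfolding strict_mono_less_eq[OF \<tau>(5)] strict_mono_less[OF \<tau>(5)] by simp
        qed
        then have "\<theta> a \<in> {0..<l}" "\<theta> b \<in> {0..<l}" using ab by blast+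
        moreover have "\<gamma> (\<theta> a) = \<gamma> (\<theta> b)" using ab(3) inj_f by (simp add: \<gamma>'_def inj_eq)
        ultimately have "\<theta> a = \<theta> b" using inj unfolding inj_on_def by blast
        then have "\<tau> (\<theta> a) = \<tau> (\<theta> b)" by (rule arg_cong)
        then show "a = b" by (simp only: \<tau>(4))
      qed
      moreover have "\<gamma>' (u + l') = \<gamma>' u" for u using per by (simp add: \<gamma>'_def \<theta>per)
      ultimately show ?thesis using J'_circle[OF J] by blast
    qed
    fix u assume u: "u \<in> J'"
    then have \<theta>u: "\<theta> u \<in> J" using \<theta>J by blast
    show "(\<gamma>' has_vector_derivative push_tangent f T (\<gamma>' u)) (at u within J')" using chain[OF u \<beta>[OF \<theta>u]]
      unfolding tan' unfolding \<gamma>'_def[abs_def] sgn_div_norm inverse_eq_divide .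
    show "norm (push_tangent f T (\<gamma>' u)) = 1" using \<beta>ne[OF \<theta>u] by (simp add: tan' norm_sgn)
  next
    obtain R where R: "C \<subseteq> cball 0 R"
    proof -
      obtain R where "\<forall>x\<in>C. norm x \<le> R" using compact_imp_bounded[OF compC] by (auto simp: bounded_iff)
      then show ?thesis by (intro that[of R]) auto
    qed
    obtain M1 where M1: "0 \<le> M1" "\<And>x w. x \<in> cball 0 R \<Longrightarrow> norm (D1 f x w) \<le> M1 * norm w"
      using D1_bound[OF f_C2 compact_cball[of 0 R]] by blast
    obtain M2 where M2: "0 \<le> M2" "\<And>x u w. x \<in> cball 0 R \<Longrightarrow> norm (D2 f x u w) \<le> M2 * norm u * norm w"
      using D2_bound[OF f_C2 compact_cball[of 0 R]] by blast
    have \<gamma>R: "\<gamma> s \<in> cball 0 R" if "s \<in> J" for s using c.C_eq R that by blast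
    \<comment> \<open>First the point moves with the direction fixed, which costs the second
      derivative; then the direction moves, which costs the Lipschitz constant of the
      tangent.\<close>
    have \<beta>lip: "norm (\<beta>' s - \<beta>' u) \<le> (M2 + M1 * c.B) * \<bar>s - u\<bar>" if su: "s \<in> J" "u \<in> J" for s u
    proof -
      have "norm (D1 f (\<gamma> s) (T (\<gamma> s)) - D1 f (\<gamma> u) (T (\<gamma> s))) \<le> M2 * norm (\<gamma> s - \<gamma> u)"
      proof (rule differentiable_bound[where S = "cball 0 R" and f' = "\<lambda>x h. D2 f x h (T (\<gamma> s))"])
        show "((\<lambda>x. D1 f x (T (\<gamma> s))) has_derivative (\<lambda>h. D2 f x h (T (\<gamma> s)))) (at x within cball 0 R)" for x
          by (rule has_derivative_at_withinI[OF C2_D1_has_derivative[OF f_C2]])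
        show "onorm (\<lambda>h. D2 f x h (T (\<gamma> s))) \<le> M2" if "x \<in> cball 0 R" for x
          using M2(2)[OF that, of _ "T (\<gamma> s)"] c.unit[OF su(1)] by (intro onorm_le) simp
      qed (use \<gamma>R su in auto)
      also have "\<dots> \<le> M2 * \<bar>s - u\<bar>" using c.speed[OF su(2,1)] M2(1) by (intro mult_left_mono)
      finally have 1: "norm (D1 f (\<gamma> s) (T (\<gamma> s)) - D1 f (\<gamma> u) (T (\<gamma> s))) \<le> M2 * \<bar>s - u\<bar>" .
      have "norm (D1 f (\<gamma> u) (T (\<gamma> s) - T (\<gamma> u))) \<le> M1 * norm (T (\<gamma> s) - T (\<gamma> u))" using M1(2)[OF \<gamma>R[OF su(2)]] .
      also have "\<dots> \<le> M1 * (c.B * \<bar>s - u\<bar>)" using c.T_lipschitz[OF su] M1(1) by (rule mult_left_mono)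
      finally have 2: "norm (D1 f (\<gamma> u) (T (\<gamma> s) - T (\<gamma> u))) \<le> M1 * c.B * \<bar>s - u\<bar>" by simp
      have "\<beta>' s - \<beta>' u = (D1 f (\<gamma> s) (T (\<gamma> s)) - D1 f (\<gamma> u) (T (\<gamma> s))) + D1 f (\<gamma> u) (T (\<gamma> s) - T (\<gamma> u))"
        by (simp add: \<beta>'_def linear_diff[OF linear_D1[OF f_C2]])
      then have "norm (\<beta>' s - \<beta>' u) \<le> norm (D1 f (\<gamma> s) (T (\<gamma> s)) - D1 f (\<gamma> u) (T (\<gamma> s)))
          + norm (D1 f (\<gamma> u) (T (\<gamma> s) - T (\<gamma> u)))" by (simp only: norm_triangle_ineq)
      then have "norm (\<beta>' s - \<beta>' u) \<le> M2 * \<bar>s - u\<bar> + M1 * c.B * \<bar>s - u\<bar>" using 1 2 by linarith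
      then show ?thesis by (simp add: distrib_right)
    qed
    let ?K = "2 / m * ((M2 + M1 * c.B) * (1 / m))"
    have K: "0 \<le> ?K" using m(1) M1(1) M2(1) c.B_pos by simp
    have "?K-lipschitz_on J' (\<lambda>u. push_tangent f T (\<gamma>' u))"
    proof (rule lipschitz_onI[OF _ K])
      fix a b assume "a \<in> J'" "b \<in> J'"
      then have ab: "\<theta> a \<in> J" "\<theta> b \<in> J" using \<theta>J by blast+
      have "norm (sgn (\<beta>' (\<theta> a)) - sgn (\<beta>' (\<theta> b))) \<le> 2 / m * norm (\<beta>' (\<theta> a) - \<beta>' (\<theta> b))"
        by (rule sgn_lipschitz[OF m(1) m(2)[OF ab(1)]])
      also have "\<dots> \<le> 2 / m * ((M2 + M1 * c.B) * \<bar>\<theta> a - \<theta> b\<bar>)" using m(1) by (intro mult_left_mono \<beta>lip ab) auto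
      also have "\<dots> \<le> 2 / m * ((M2 + M1 * c.B) * (\<bar>a - b\<bar> / m))"
        using m(1) M1(1) M2(1) c.B_pos by (intro mult_left_mono \<tau>(7)) auto
      also have "\<dots> = ?K * \<bar>a - b\<bar>" by (simp only: mult.assoc times_divide_eq_right times_divide_eq_left mult_1 mult_1_right)
      finally show "dist (push_tangent f T (\<gamma>' a)) (push_tangent f T (\<gamma>' b)) \<le> ?K * dist a b"
        unfolding tan' dist_norm real_norm_def .
    qed
    then show "\<exists>B. B-lipschitz_on J' (\<lambda>s. push_tangent f T (\<gamma>' s))" by blast
  qed
  show ?thesis
  proof (rule that[OF param', of \<tau>])
    show "\<tau> ` J = J'" by (simp add: J'_def)
    show "\<gamma>' (\<tau> s) = f (\<gamma> s)" if "s \<in> J" for s by (simp add: \<gamma>'_def \<tau>(3))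
    show "J' = {0..l'} \<and> \<tau> 0 = 0 \<and> \<tau> l = l'" if "J = {0..l}" using J'_arc[OF that] \<tau>(1) by (simp add: l'_def)
    show "J' = UNIV" if "J = UNIV" using J'_circle[OF that] .
    show "inj \<tau>" by (rule strict_mono_imp_inj_on[OF \<tau>(5)])
    fix s k assume s: "s \<in> J" and k: "((\<lambda>s. T (\<gamma> s)) has_vector_derivative k) (at s within J)"
    have "(\<beta>' has_vector_derivative D2 f (\<gamma> s) (T (\<gamma> s)) (T (\<gamma> s)) + D1 f (\<gamma> s) k) (at s within J)"
      unfolding \<beta>'_def[abs_def] by (rule D1_has_vector_derivative[OF f_C2 c.deriv[OF s] k])
    from sgn_has_vector_derivative[OF this \<beta>ne[OF s]]
    have "((\<lambda>s. sgn (\<beta>' s)) has_vector_derivative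
       (1 / norm (\<beta>' s)) *\<^sub>R (D2 f (\<gamma> s) (T (\<gamma> s)) (T (\<gamma> s)) + D1 f (\<gamma> s) k -
          (((D2 f (\<gamma> s) (T (\<gamma> s)) (T (\<gamma> s)) + D1 f (\<gamma> s) k) \<bullet> \<beta>' s) / (norm (\<beta>' s))\<^sup>2) *\<^sub>R \<beta>' s))
       (at (\<theta> (\<tau> s)) within J)" by (simp only: \<tau>(3))
    from chain[OF _ this] s
    show "((\<lambda>u. push_tangent f T (\<gamma>' u)) has_vector_derivative push_curvature f (\<gamma> s) (T (\<gamma> s)) k) (at (\<tau> s) within J')"
      by (simp add: tan' \<tau>(3) J'_def push_curvature_def Let_def \<beta>'_def power2_eq_square)
  qed
qed

lemma image_components:
  assumes C: "C \<in> components L"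
  shows "f ` C \<in> components (f ` L)"
proof -
  have cf: "continuous_on S f" and cg: "continuous_on S (inv f)" for S using C2_continuous f_C2 inv_C2 by blast+
  have C': "C \<noteq> {}" "C \<subseteq> L" "connected C" "\<And>d. d \<noteq> {} \<Longrightarrow> C \<subseteq> d \<Longrightarrow> d \<subseteq> L \<Longrightarrow> connected d \<Longrightarrow> d = C"
    using C unfolding in_components_maximal by blast+
  have "d = f ` C" if d: "d \<noteq> {}" "f ` C \<subseteq> d" "d \<subseteq> f ` L" "connected d" for d
  proof -
    have fi: "f ` inv f ` d = d" "inv f ` f ` S = S" for S by (simp_all add: image_image)
    have "connected (inv f ` d)" by (rule connected_continuous_image[OF cg d(4)])
    moreover have "C \<subseteq> inv f ` d" using image_mono[OF d(2), of "inv f"] by (simp add: fi)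
    moreover have "inv f ` d \<subseteq> L" using image_mono[OF d(3), of "inv f"] by (simp add: fi)
    ultimately have "inv f ` d = C" using C'(4)[of "inv f ` d"] d(1) by blast
    then show ?thesis using fi(1) by metis
  qed
  then show ?thesis unfolding in_components_maximal using C' connected_continuous_image[OF cf C'(3)] by blast
qed

end

lemma (in C2_diffeomorphism) components_image: "components (f ` L) = (`) f ` components L"
proof (intro equalityI subsetI)
  interpret g: C2_diffeomorphism "inv f" by unfold_locales (rule inverse_diffeo)
  fix D assume "D \<in> components (f ` L)"
  then have "inv f ` D \<in> components (inv f ` f ` L)" by (rule g.image_components)
  moreover have "inv f ` f ` L = L" "f ` inv f ` D = D" by (simp_all add: image_image)
  ultimately show "D \<in> (`) f ` components L" by (metis imageI)
qed (use image_components in blast)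

locale moved_link = link L T + C2_diffeomorphism f for L T f
begin

abbreviation "L' \<equiv> f ` L"
abbreviation "T' \<equiv> push_tangent f T"

lemma link': "C11_link L' T'"
  unfolding C11_link_def components_image
proof (intro conjI ballI)
  show "finite ((`) f ` components L)" using finite_components by simp
  fix D assume "D \<in> (`) f ` components L"
  then obtain C where C: "C \<in> components L" "D = f ` C" by blast
  then obtain l J \<gamma> where "arclength_param T C l J \<gamma>" using link unfolding C11_link_def by blast
  from push_arclength_param[OF this] show "\<exists>l J \<gamma>. arclength_param T' D l J \<gamma>" using C(2) by metis
qed

sublocale moved: link L' T' by unfold_locales (rule link')

lemma T'_f: "T' (f x) = sgn (D1 f x (T x))"
  by (simp add: push_tangent_def)

text \<open>The change of parameter is injective and carries 0 and l to 0 and l', so ends of arcs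
  correspond with their orientation.\<close>

lemma endpoints_f:
  assumes x: "x \<in> L"
  shows "f x \<in> initial_points L' T' \<longleftrightarrow> x \<in> initial_points L T"
    and "f x \<in> final_points L' T' \<longleftrightarrow> x \<in> final_points L T"
proof -
  obtain C l J \<gamma> s where c: "C \<in> components L" "arclength_curve T C l J \<gamma>" "s \<in> J" "x = \<gamma> s" using component_curve[OF x] .
  interpret c: arclength_curve T C l J \<gamma> by (rule c)
  obtain l' J' \<gamma>' \<tau> where p: "arclength_param T' (f ` C) l' J' \<gamma>'" "\<tau> ` J = J'"
    "\<And>s. s \<in> J \<Longrightarrow> \<gamma>' (\<tau> s) = f (\<gamma> s)" "J = {0..l} \<Longrightarrow> J' = {0..l'} \<and> \<tau> 0 = 0 \<and> \<tau> l = l'"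
    "J = UNIV \<Longrightarrow> J' = UNIV" "inj \<tau>" by (rule push_arclength_param[OF c.param]) (rule that; assumption)
  have D: "f ` C \<in> components L'" by (rule image_components[OF c(1)])
  have p': "arclength_curve T' (f ` C) l' J' \<gamma>'" by unfold_locales (rule p(1))
  have s': "\<tau> s \<in> J'" using p(2) c(3) by blast
  interpret d: arclength_curve T' "f ` C" l' J' \<gamma>' by (rule p')
  have inj: "\<tau> s = \<tau> u \<longleftrightarrow> s = u" for u using p(6) by (simp add: inj_eq)
  have "UNIV \<noteq> {0..l'}" using bounded_closed_interval[of 0 l'] not_bounded_UNIV[where 'a = real] by metis
  then have JJ: "J' = {0..l'} \<longleftrightarrow> J = {0..l}" using p(4,5) c.J_cases by metis
  show "f x \<in> initial_points L' T' \<longleftrightarrow> x \<in> initial_points L T"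
    using moved.initial_iff[OF D p' s'] initial_iff[OF c(1-3)] JJ inj[of 0] p(3)[OF c(3)] p(4) c.l_pos c(4) by auto
  show "f x \<in> final_points L' T' \<longleftrightarrow> x \<in> final_points L T"
    using moved.final_iff[OF D p' s'] final_iff[OF c(1-3)] JJ inj[of l] p(3)[OF c(3)] p(4) c.l_pos c(4) by auto
qed

end

section \<open>First-order expansions\<close>

text \<open>A right-sided first-order expansion in t, uniform over X. The bounds on F0 and G are
  part of it because products need them.\<close>

definition expansion :: "'c set \<Rightarrow> (real \<Rightarrow> 'c \<Rightarrow> 'a::real_normed_vector) \<Rightarrow> ('c \<Rightarrow> 'a) \<Rightarrow> ('c \<Rightarrow> 'a) \<Rightarrow> bool" where
  "expansion X F F0 G \<longleftrightarrow> bounded (F0 ` X) \<and> bounded (G ` X)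
     \<and> (\<forall>e>0. \<forall>\<^sub>F t in at_right 0. \<forall>c\<in>X. norm (F t c - F0 c - t *\<^sub>R G c) \<le> e * t)"

lemma eventually_at_right_0: "0 < d \<Longrightarrow> \<forall>\<^sub>F t in at_right (0::real). 0 < t \<and> t < d"
  using eventually_at_right_real[of 0 d] by (auto elim: eventually_mono)

lemma expansionD: "expansion X F F0 G \<Longrightarrow> 0 < e \<Longrightarrow> \<forall>\<^sub>F t in at_right 0. \<forall>c\<in>X. norm (F t c - F0 c - t *\<^sub>R G c) \<le> e * t"
  by (auto simp: expansion_def)

lemma expansion_bound:
  assumes "expansion X F F0 G"
  obtains B where "0 < B" "\<And>c. c \<in> X \<Longrightarrow> norm (F0 c) \<le> B" "\<And>c. c \<in> X \<Longrightarrow> norm (G c) \<le> B"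
proof -
  obtain B1 where B1: "0 < B1" "\<forall>y\<in>F0 ` X. norm y \<le> B1" using assms bounded_pos unfolding expansion_def by blast
  obtain B2 where B2: "0 < B2" "\<forall>y\<in>G ` X. norm y \<le> B2" using assms bounded_pos unfolding expansion_def by blast
  show ?thesis
  proof (rule that[of "max B1 B2"])
    show "0 < max B1 B2" using B1 by simp
    show "norm (F0 c) \<le> max B1 B2" "norm (G c) \<le> max B1 B2" if "c \<in> X" for c
      using B1(2) B2(2) that by (auto simp: le_max_iff_disj)
  qed
qed

lemma expansion_const: "bounded (F0 ` X) \<Longrightarrow> expansion X (\<lambda>t. F0) F0 (\<lambda>_. 0)"
  unfolding expansion_def
proof (intro conjI allI impI)
  fix e :: real assume e: "0 < e"
  show "\<forall>\<^sub>F t in at_right 0. \<forall>c\<in>X. norm (F0 c - F0 c - t *\<^sub>R 0) \<le> e * t"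
    using eventually_at_right_0[of 1] e by (auto elim!: eventually_mono)
qed (auto intro: bounded_subset[of "{0}"])

lemma expansion_time: "expansion X (\<lambda>t c. a + t *\<^sub>R b) (\<lambda>_. a) (\<lambda>_. b)"
  unfolding expansion_def
proof (intro conjI allI impI)
  fix e :: real assume e: "0 < e"
  show "\<forall>\<^sub>F t in at_right 0. \<forall>c\<in>X. norm (a + t *\<^sub>R b - a - t *\<^sub>R b) \<le> e * t"
    using eventually_at_right_0[of 1] e by (auto elim!: eventually_mono)
qed (auto intro: bounded_subset[of "{a}"] bounded_subset[of "{b}"])

lemma expansion_cong:
  assumes "expansion X F F0 G" "\<And>t c. c \<in> X \<Longrightarrow> F t c = F' t c" "\<And>c. c \<in> X \<Longrightarrow> F0 c = F0' c" "\<And>c. c \<in> X \<Longrightarrow> G c = G' c"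
  shows "expansion X F' F0' G'"
proof -
  have "F0' ` X = F0 ` X" "G' ` X = G ` X" using assms by force+
  moreover have "(\<forall>c\<in>X. norm (F' t c - F0' c - t *\<^sub>R G' c) \<le> b) \<longleftrightarrow> (\<forall>c\<in>X. norm (F t c - F0 c - t *\<^sub>R G c) \<le> b)" for t b
    using assms by simp
  ultimately show ?thesis using assms(1) unfolding expansion_def by simp
qed

lemma expansion_add:
  assumes F: "expansion X F F0 G" and H: "expansion X H H0 K"
  shows "expansion X (\<lambda>t c. F t c + H t c) (\<lambda>c. F0 c + H0 c) (\<lambda>c. G c + K c)"
  unfolding expansion_def
proof (intro conjI allI impI)
  show "bounded ((\<lambda>c. F0 c + H0 c) ` X)" "bounded ((\<lambda>c. G c + K c) ` X)"
    using F H by (auto simp: expansion_def intro: bounded_plus_comp)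
  fix e :: real assume e: "0 < e"
  have "0 < e / 2" using e by simp
  from expansionD[OF F this] expansionD[OF H this]
  show "\<forall>\<^sub>F t in at_right 0. \<forall>c\<in>X. norm (F t c + H t c - (F0 c + H0 c) - t *\<^sub>R (G c + K c)) \<le> e * t"
  proof eventually_elim
    case (elim t)
    show ?case
    proof
      fix c assume c: "c \<in> X"
      have "F t c + H t c - (F0 c + H0 c) - t *\<^sub>R (G c + K c)
         = (F t c - F0 c - t *\<^sub>R G c) + (H t c - H0 c - t *\<^sub>R K c)" by (simp add: algebra_simps)
      then have "norm (F t c + H t c - (F0 c + H0 c) - t *\<^sub>R (G c + K c))
         \<le> norm (F t c - F0 c - t *\<^sub>R G c) + norm (H t c - H0 c - t *\<^sub>R K c)" by (simp only: norm_triangle_ineq)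
      also have "\<dots> \<le> e / 2 * t + e / 2 * t" using elim c by (intro add_mono) auto
      finally show "norm (F t c + H t c - (F0 c + H0 c) - t *\<^sub>R (G c + K c)) \<le> e * t" by simp
    qed
  qed
qed

lemma expansion_linear:
  assumes F: "expansion X F F0 G" and h: "bounded_linear h"
  shows "expansion X (\<lambda>t c. h (F t c)) (\<lambda>c. h (F0 c)) (\<lambda>c. h (G c))"
  unfolding expansion_def
proof (intro conjI allI impI)
  have "bounded (F0 ` X)" "bounded (G ` X)" using F by (simp_all add: expansion_def)
  then show "bounded ((\<lambda>c. h (F0 c)) ` X)" "bounded ((\<lambda>c. h (G c)) ` X)"
    using bounded_linear_image[of "F0 ` X" h] bounded_linear_image[of "G ` X" h] h by (simp_all add: image_image)
  obtain B where B: "0 < B" "\<And>x. norm (h x) \<le> norm x * B" using bounded_linear.pos_bounded[OF h] by blast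
  fix e :: real assume e: "0 < e"
  have "0 < e / B" using e B by simp
  from expansionD[OF F this]
  show "\<forall>\<^sub>F t in at_right 0. \<forall>c\<in>X. norm (h (F t c) - h (F0 c) - t *\<^sub>R h (G c)) \<le> e * t"
  proof eventually_elim
    case (elim t)
    show ?case
    proof
      fix c assume c: "c \<in> X"
      have "h (F t c) - h (F0 c) - t *\<^sub>R h (G c) = h (F t c - F0 c - t *\<^sub>R G c)"
        using bounded_linear.linear[OF h] by (simp add: linear_diff linear_scale)
      then have "norm (h (F t c) - h (F0 c) - t *\<^sub>R h (G c)) \<le> norm (F t c - F0 c - t *\<^sub>R G c) * B" using B(2) by simp
      also have "\<dots> \<le> (e / B * t) * B" using elim c B(1) by (intro mult_right_mono) auto
      finally show "norm (h (F t c) - h (F0 c) - t *\<^sub>R h (G c)) \<le> e * t" using B(1) by simp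
    qed
  qed
qed

lemma expansion_prod:
  assumes p: "bounded_bilinear p" and F: "expansion X F F0 G" and H: "expansion X H H0 K"
  shows "expansion X (\<lambda>t c. p (F t c) (H t c)) (\<lambda>c. p (F0 c) (H0 c)) (\<lambda>c. p (G c) (H0 c) + p (F0 c) (K c))"
proof -
  interpret bounded_bilinear p by (rule p)
  obtain B where B: "0 < B" "\<And>a b. norm (p a b) \<le> norm a * norm b * B" using pos_bounded by blast
  obtain B1 where B1: "0 < B1" "\<And>c. c \<in> X \<Longrightarrow> norm (F0 c) \<le> B1" "\<And>c. c \<in> X \<Longrightarrow> norm (G c) \<le> B1"
    by (rule expansion_bound[OF F]) (rule that; assumption)
  obtain B2 where B2: "0 < B2" "\<And>c. c \<in> X \<Longrightarrow> norm (H0 c) \<le> B2" "\<And>c. c \<in> X \<Longrightarrow> norm (K c) \<le> B2"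
    by (rule expansion_bound[OF H]) (rule that; assumption)
  have bp: "norm (p a b) \<le> s * r * B" if "norm a \<le> s" "norm b \<le> r" for a b s r
  proof -
    have "norm a * norm b \<le> s * r" by (intro mult_mono) (use that norm_ge_zero[of a] norm_ge_zero[of b] in linarith)+
    then have "norm a * norm b * B \<le> s * r * B" using B(1) by (intro mult_right_mono) auto
    then show ?thesis using B(2)[of a b] by linarith
  qed
  show ?thesis unfolding expansion_def
  proof (intro conjI allI impI)
    show "bounded ((\<lambda>c. p (F0 c) (H0 c)) ` X)" by (rule boundedI[of _ "B1 * B2 * B"]) (auto intro!: bp B1 B2)
    have "norm (p (G c) (H0 c) + p (F0 c) (K c)) \<le> B1 * B2 * B + B1 * B2 * B" if "c \<in> X" for c
      using bp[OF B1(3)[OF that] B2(2)[OF that]] bp[OF B1(2)[OF that] B2(3)[OF that]] by (intro norm_triangle_le) linarith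
    then show "bounded ((\<lambda>c. p (G c) (H0 c) + p (F0 c) (K c)) ` X)" by (intro boundedI[of _ "B1 * B2 * B + B1 * B2 * B"]) auto
    fix e :: real assume e: "0 < e"
    \<comment> \<open>Collects the coefficients of the three error terms in \<open>eq\<close> below,
      each of which carries the factor d t.\<close>
    define S where "S = (B2 + 1) * B + B1 * B + B1 * B"
    have S: "0 < S" using B B1 B2 by (simp add: S_def add_pos_pos)
    define d where "d = min 1 (e / S)"
    have d: "0 < d" "d \<le> 1" "d * S \<le> e" using e S by (auto simp: d_def min_def field_simps)
    define t0 where "t0 = d / (B2 + 1)"
    have t0: "0 < t0" "t0 * (B2 + 1) = d" using d B2 by (simp_all add: t0_def)
    from expansionD[OF F d(1)] expansionD[OF H d(1)] eventually_at_right_0[OF t0(1)]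
    show "\<forall>\<^sub>F t in at_right 0. \<forall>c\<in>X. norm (p (F t c) (H t c) - p (F0 c) (H0 c) - t *\<^sub>R (p (G c) (H0 c) + p (F0 c) (K c))) \<le> e * t"
    proof eventually_elim
      case (elim t)
      show ?case
      proof
        fix c assume c: "c \<in> X"
        define r where "r = F t c - F0 c - t *\<^sub>R G c"
        define q where "q = H t c - H0 c - t *\<^sub>R K c"
        have r: "norm r \<le> d * t" and q: "norm q \<le> d * t" using elim c by (auto simp: r_def q_def)
        have t: "0 < t" "t * (B2 + 1) \<le> d" using elim mult_right_mono[of t t0 "B2 + 1"] t0 B2(1) by auto
        have tK: "norm (t *\<^sub>R K c) \<le> t * B2" using t B2(3)[OF c] by (simp add: mult_left_mono)
        have "d * t \<le> t" using d t by (simp add: mult_left_le_one_le)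
        have HH0: "norm (H t c - H0 c) \<le> d"
        proof -
          have "H t c - H0 c = q + t *\<^sub>R K c" by (simp add: q_def)
          then have "norm (H t c - H0 c) \<le> d * t + t * B2" using norm_triangle_le[of q "t *\<^sub>R K c"] q tK by simp
          also have "\<dots> \<le> t * (B2 + 1)" using \<open>d * t \<le> t\<close> by (simp add: algebra_simps)
          finally show ?thesis using t by linarith
        qed
        have HH: "norm (H t c) \<le> B2 + 1" using norm_triangle_sub[of "H t c" "H0 c"] HH0 B2(2)[OF c] d(2) by linarith
        have eq: "p (F t c) (H t c) - p (F0 c) (H0 c) - t *\<^sub>R (p (G c) (H0 c) + p (F0 c) (K c))
          = p r (H t c) + p (F0 c) q + p (t *\<^sub>R G c) (H t c - H0 c)"
          by (simp add: r_def q_def diff_left diff_right add_left add_right scaleR_left scaleR_right algebra_simps)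
        have tG: "norm (t *\<^sub>R G c) \<le> t * B1" using t B1(3)[OF c] by (simp add: mult_left_mono)
        have "norm (p r (H t c) + p (F0 c) q + p (t *\<^sub>R G c) (H t c - H0 c))
           \<le> (d * t) * (B2 + 1) * B + B1 * (d * t) * B + (t * B1) * d * B"
          by (intro norm_triangle_le add_mono bp r q HH HH0 tG B1(2) c order_trans[OF norm_triangle_ineq])
        also have "\<dots> = d * S * t" by (simp add: S_def algebra_simps)
        also have "\<dots> \<le> e * t" using d(3) t by (intro mult_right_mono) auto
        finally show "norm (p (F t c) (H t c) - p (F0 c) (H0 c) - t *\<^sub>R (p (G c) (H0 c) + p (F0 c) (K c))) \<le> e * t"
          unfolding eq .
      qed
    qed
  qed
qed

lemma expansion_sum:
  assumes "finite I" "\<And>i. i \<in> I \<Longrightarrow> expansion X (F i) (F0 i) (G i)"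
  shows "expansion X (\<lambda>t c. \<Sum>i\<in>I. F i t c) (\<lambda>c. \<Sum>i\<in>I. F0 i c) (\<lambda>c. \<Sum>i\<in>I. G i c)"
  using assms
proof (induction rule: finite_induct)
  case empty
  have "expansion X (\<lambda>t c. 0) (\<lambda>c. 0) (\<lambda>c. 0)" by (rule expansion_const) (rule bounded_subset[of "{0}"]; auto)
  then show ?case by simp
next
  case (insert i I)
  then show ?case using expansion_add[of X "F i" "F0 i" "G i"] by simp
qed

lemma expansion_compose:
  assumes "expansion Y F F0 G" "x ` X \<subseteq> Y"
  shows "expansion X (\<lambda>t c. F t (x c)) (\<lambda>c. F0 (x c)) (\<lambda>c. G (x c))"
  unfolding expansion_def
proof (intro conjI allI impI)
  show "bounded ((\<lambda>c. F0 (x c)) ` X)" "bounded ((\<lambda>c. G (x c)) ` X)"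
    using assms unfolding expansion_def by (auto intro: bounded_subset)
  fix e :: real assume "0 < e"
  from expansionD[OF assms(1) this]
  show "\<forall>\<^sub>F t in at_right 0. \<forall>c\<in>X. norm (F t (x c) - F0 (x c) - t *\<^sub>R G (x c)) \<le> e * t" by eventually_elim (use assms(2) in blast)
qed

text \<open>If positivity fails at times tending to 0, then at the offending points - B t^2 <= F0 <=
  t (o(1) - G). A limit z of these points satisfies F0 z = 0, and division by t gives G z <= 0,
  against \<open>lim\<close>. The slack B t^2 is of second order and disappears; almost critical
  pairs need it. \<open>P\<close> singles out the points where the lower bound is known, and
  \<open>lim\<close> may use that the sequence satisfies it.\<close>

lemma expansion_positive:
  fixes F :: "real \<Rightarrow> 'c::metric_space \<Rightarrow> real"
  assumes X: "compact X" and F: "expansion X F F0 G" and c0: "continuous_on X F0" and cG: "continuous_on X G"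
    and low: "\<forall>\<^sub>F t in at_right 0. \<forall>c\<in>X. P t c \<longrightarrow> - (B * t\<^sup>2) \<le> F0 c"
    and lim: "\<And>c t z. z \<in> X \<Longrightarrow> F0 z = 0 \<Longrightarrow> (\<And>n. c n \<in> X \<and> 0 < t n \<and> P (t n) (c n)) \<Longrightarrow> t \<longlonglongrightarrow> 0 \<Longrightarrow>
        c \<longlonglongrightarrow> z \<Longrightarrow> 0 < G z"
  shows "\<forall>\<^sub>F t in at_right 0. \<forall>c\<in>X. P t c \<longrightarrow> 0 < F t c"
proof (rule ccontr)
  assume "\<not> ?thesis"
  then have fr: "\<exists>\<^sub>F t in at_right 0. \<not> (\<forall>c\<in>X. P t c \<longrightarrow> 0 < F t c)" by (simp add: not_eventually)
  have "\<exists>t c. 0 < t \<and> t < 1 / Suc n \<and> c \<in> X \<and> P t c \<and> F t c \<le> 0 \<and> - (B * t\<^sup>2) \<le> F0 c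
      \<and> \<bar>F t c - F0 c - t * G c\<bar> \<le> 1 / Suc n * t" for n
  proof -
    have "\<forall>\<^sub>F t in at_right 0. (0 < t \<and> t < 1 / Suc n) \<and> (\<forall>c\<in>X. P t c \<longrightarrow> - (B * t\<^sup>2) \<le> F0 c)
       \<and> (\<forall>c\<in>X. norm (F t c - F0 c - t *\<^sub>R G c) \<le> 1 / Suc n * t)"
      by (intro eventually_conj eventually_at_right_0 low expansionD[OF F]) auto
    from frequently_eventually_frequently[OF fr this]
    have "\<exists>t. (\<not> (\<forall>c\<in>X. P t c \<longrightarrow> 0 < F t c)) \<and> (0 < t \<and> t < 1 / Suc n) \<and> (\<forall>c\<in>X. P t c \<longrightarrow> - (B * t\<^sup>2) \<le> F0 c)
       \<and> (\<forall>c\<in>X. norm (F t c - F0 c - t *\<^sub>R G c) \<le> 1 / Suc n * t)" by (rule frequently_ex)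
    then obtain t c where "0 < t" "t < 1 / Suc n" "c \<in> X" "P t c" "\<not> 0 < F t c" "- (B * t\<^sup>2) \<le> F0 c"
      "norm (F t c - F0 c - t *\<^sub>R G c) \<le> 1 / Suc n * t" by blast
    then show ?thesis by (intro exI[of _ t] exI[of _ c]) (simp add: not_less)
  qed
  then obtain t c where tc: "\<And>n. 0 < t n" "\<And>n. t n < 1 / Suc n" "\<And>n. c n \<in> X" "\<And>n. P (t n) (c n)" "\<And>n. F (t n) (c n) \<le> 0"
    "\<And>n. - (B * (t n)\<^sup>2) \<le> F0 (c n)" "\<And>n. \<bar>F (t n) (c n) - F0 (c n) - t n * G (c n)\<bar> \<le> 1 / Suc n * t n" by metis
  have t0: "t \<longlonglongrightarrow> 0" by (rule real_tendsto_sandwich[OF _ _ tendsto_const LIMSEQ_inverse_real_of_nat])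
      (use tc(1,2) in \<open>auto intro!: always_eventually less_imp_le simp: inverse_eq_divide\<close>)
  have "\<exists>z\<in>X. \<exists>r::nat \<Rightarrow> nat. strict_mono r \<and> (c \<circ> r) \<longlonglongrightarrow> z" using X[unfolded compact_def, rule_format, of c] tc(3) by blast
  then obtain z and r :: "nat \<Rightarrow> nat" where z: "z \<in> X" "strict_mono r" "(\<lambda>n. c (r n)) \<longlonglongrightarrow> z" by (auto simp: o_def)
  have tr: "(\<lambda>n. t (r n)) \<longlonglongrightarrow> 0" using LIMSEQ_subseq_LIMSEQ[OF t0 z(2)] by (simp add: o_def)
  have F0r: "(\<lambda>n. F0 (c (r n))) \<longlonglongrightarrow> F0 z" using continuous_on_tendsto_compose[OF c0 z(3) z(1)] tc(3) by simp
  have Gr: "(\<lambda>n. G (c (r n))) \<longlonglongrightarrow> G z" using continuous_on_tendsto_compose[OF cG z(3) z(1)] tc(3) by simp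
  have inv: "(\<lambda>n. 1 / real (Suc (r n))) \<longlonglongrightarrow> 0"
    using LIMSEQ_subseq_LIMSEQ[OF LIMSEQ_inverse_real_of_nat z(2)] by (simp add: o_def inverse_eq_divide)
  have up: "F0 (c n) \<le> t n * (1 / Suc n - G (c n))" for n using tc(5)[of n] tc(7)[of n] by (simp add: abs_le_iff algebra_simps)
  have "F0 z \<le> 0 * (0 - G z)" by (rule LIMSEQ_le[OF F0r tendsto_mult[OF tr tendsto_diff[OF inv Gr]]]) (use up in blast)
  moreover have "- (B * 0\<^sup>2) \<le> F0 z"
    by (rule LIMSEQ_le[OF tendsto_minus[OF tendsto_mult[OF tendsto_const tendsto_power[OF tr]]] F0r]) (use tc(6) in blast)
  ultimately have "F0 z = 0" by simp
  then have "0 < G z" using z tc tr by (intro lim[of z "\<lambda>n. c (r n)" "\<lambda>n. t (r n)"]) auto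
  moreover have "G (c n) \<le> 1 / Suc n + B * t n" for n
  proof -
    have "t n * (- (B * t n)) \<le> t n * (1 / Suc n - G (c n))"
      using up[of n] tc(6)[of n] by (simp add: power2_eq_square mult.left_commute)
    then have "- (B * t n) \<le> 1 / Suc n - G (c n)" using tc(1)[of n] by (simp only: mult_le_cancel_left_pos)
    then show ?thesis by linarith
  qed
  then have "G z \<le> 0 + B * 0" by (intro LIMSEQ_le[OF Gr tendsto_add[OF inv tendsto_mult[OF tendsto_const tr]]]) blast
  ultimately show False by simp
qed

section \<open>Time derivatives of a smooth family\<close>

lemma C1_in_time_expansion:
  assumes \<tau>: "0 < \<tau>" and f: "C1_in_time {-\<tau><..<\<tau>} f"
    and g: "\<And>x. ((\<lambda>t. f t x) has_vector_derivative g x) (at 0)"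
    and X: "compact X" and f0: "continuous_on X (f 0)"
  shows "expansion X f (f 0) g" and "continuous_on UNIV g"
proof -
  obtain f' where f': "\<And>t x. t \<in> {-\<tau><..<\<tau>} \<Longrightarrow> ((\<lambda>s. f s x) has_vector_derivative f' t x) (at t)"
    "continuous_on ({-\<tau><..<\<tau>} \<times> UNIV) (\<lambda>(t, x). f' t x)" using f unfolding C1_in_time_def by blast
  have "f' 0 x = g x" for x using vector_derivative_unique_at[OF f'(1)[of 0 x] g[of x]] \<tau> by simp
  then have gf: "g = f' 0" by auto
  have "continuous_on UNIV (\<lambda>x. (\<lambda>(t, x). f' t x) (0, x))"
    using \<tau> by (intro continuous_on_compose2[OF f'(2)] continuous_intros) auto
  then show cg: "continuous_on UNIV g" by (simp add: gf)
  show "expansion X f (f 0) g" unfolding expansion_def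
  proof (intro conjI allI impI)
    show "bounded (f 0 ` X)" using compact_continuous_image[OF f0 X] by (rule compact_imp_bounded)
    show "bounded (g ` X)" using compact_continuous_image[OF continuous_on_subset[OF cg] X] by (simp add: compact_imp_bounded)
    fix e :: real assume e: "0 < e"
    have "uniformly_continuous_on ({0..\<tau>/2} \<times> X) (\<lambda>(t, x). f' t x)"
    proof (rule compact_uniformly_continuous)
      show "continuous_on ({0..\<tau>/2} \<times> X) (\<lambda>(t, x). f' t x)" by (rule continuous_on_subset[OF f'(2)]) (use \<tau> in auto)
    qed (intro compact_Times X compact_Icc)
    then obtain d where d: "0 < d" "\<And>p q. p \<in> {0..\<tau>/2} \<times> X \<Longrightarrow> q \<in> {0..\<tau>/2} \<times> X \<Longrightarrow> dist q p < d \<Longrightarrow>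
       dist ((\<lambda>(t, x). f' t x) q) ((\<lambda>(t, x). f' t x) p) < e" using e unfolding uniformly_continuous_on_def by blast
    have "0 < min d (\<tau>/2)" using d \<tau> by simp
    from eventually_at_right_0[OF this]
    show "\<forall>\<^sub>F t in at_right 0. \<forall>c\<in>X. norm (f t c - f 0 c - t *\<^sub>R g c) \<le> e * t"
    proof eventually_elim
      case (elim t)
      show ?case
      proof
        fix c assume c: "c \<in> X"
        have "norm (f t c - f 0 c - (t - 0) *\<^sub>R f' 0 c) \<le> norm (t - 0) * e"
        proof (rule vector_differentiable_bound_linearization[where S = "{0..t}" and f' = "\<lambda>s. f' s c"])
          show "((\<lambda>s. f s c) has_vector_derivative f' s c) (at s within {0..t})" if "s \<in> {0..t}" for s
            using f'(1)[of s c] that elim by (auto intro: has_vector_derivative_at_within)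
          show "closed_segment 0 t \<subseteq> {0..t}" using elim by (simp add: closed_segment_eq_real_ivl)
          show "norm (f' s c - f' 0 c) \<le> e" if "s \<in> {0..t}" for s
            using d(2)[of "(0, c)" "(s, c)"] that elim c \<tau> by (simp add: dist_Pair_Pair dist_norm less_imp_le)
        qed (use elim in simp)
        then show "norm (f t c - f 0 c - t *\<^sub>R g c) \<le> e * t" using elim by (simp add: gf mult.commute)
      qed
    qed
  qed
qed

text \<open>Smoothness in time provides some time derivative G of the space derivative; this lemma
  identifies G with the space derivative of the velocity. The mean value inequality along x + s v,
  applied to the increment of f in time and divided by t, shows that G x is the directional
  derivative of g.\<close>

lemma derivative_interchange:
  fixes f :: "real \<Rightarrow> pt \<Rightarrow> pt"
  assumes \<tau>: "0 < \<tau>" and A: "\<And>t x. t \<in> {-\<tau><..<\<tau>} \<Longrightarrow> (f t has_derivative A t x) (at x)"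
    and C: "C1_in_time {-\<tau><..<\<tau>} (\<lambda>t x. A t x v)" and A0: "continuous_on UNIV (\<lambda>x. A 0 x v)"
    and g: "\<And>x. ((\<lambda>t. f t x) has_vector_derivative g x) (at 0)" and g': "(g has_derivative g') (at x)"
  shows "((\<lambda>t. A t x v) has_vector_derivative g' v) (at 0)"
proof -
  have "\<forall>x. \<exists>d. ((\<lambda>t. A t x v) has_vector_derivative d) (at 0)"
    using C \<tau> unfolding C1_in_time_def by (metis greaterThanLessThan_iff neg_less_0_iff_less)
  then obtain G where G: "\<And>x. ((\<lambda>t. A t x v) has_vector_derivative G x) (at 0)" by metis
  have ex: "expansion (cball x (norm v)) (\<lambda>t x. A t x v) (\<lambda>x. A 0 x v) G" and cG: "continuous_on UNIV G"
    using C1_in_time_expansion[OF \<tau> C G compact_cball continuous_on_subset[OF A0]] by auto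
  have dir: "((\<lambda>h. g (x + h *\<^sub>R v)) has_vector_derivative G x) (at 0)" unfolding has_vector_derivative_def has_derivative_at_alt
  proof (intro conjI allI impI bounded_linear_scaleR_left)
    fix e :: real assume e: "0 < e"
    then have e3: "0 < e / 2" by simp
    have "continuous (at x) G" using cG by (simp add: continuous_on_eq_continuous_at)
    then obtain \<delta> where \<delta>: "0 < \<delta>" "\<And>y. dist y x < \<delta> \<Longrightarrow> dist (G y) (G x) < e / 2"
      using e3 unfolding continuous_at_eps_delta by blast
    define d where "d = min 1 (\<delta> / (norm v + 1))"
    have nv: "0 < norm v + 1" by (simp add: add_nonneg_pos)
    have d: "0 < d" "d \<le> 1" "d * norm v < \<delta>"
    proof -
      show "0 < d" "d \<le> 1" using \<delta> nv by (auto simp: d_def)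
      have "d * norm v < d * (norm v + 1)" using \<open>0 < d\<close> by simp
      also have "\<dots> \<le> \<delta> / (norm v + 1) * (norm v + 1)" using nv by (intro mult_right_mono) (auto simp: d_def)
      finally show "d * norm v < \<delta>" using nv by simp
    qed
    have "norm (g (x + h *\<^sub>R v) - g x - h *\<^sub>R G x) \<le> e * \<bar>h\<bar>" if h: "\<bar>h\<bar> < d" for h
    proof -
      have seg: "x + s *\<^sub>R v \<in> cball x (norm v)" "dist (x + s *\<^sub>R v) x < \<delta>" if "\<bar>s\<bar> \<le> \<bar>h\<bar>" for s
      proof -
        have 1: "dist (x + s *\<^sub>R v) x = \<bar>s\<bar> * norm v" by (simp add: dist_norm)
        have 2: "\<bar>s\<bar> * norm v \<le> d * norm v" using that h by (intro mult_right_mono) auto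
        then show "dist (x + s *\<^sub>R v) x < \<delta>" using 1 d(3) by linarith
        have "d * norm v \<le> norm v" using d by (simp add: mult_left_le_one_le)
        then show "x + s *\<^sub>R v \<in> cball x (norm v)" using 1 2 by (simp add: dist_commute)
      qed
      have near: "\<exists>d>0. \<forall>t. 0 < t \<and> t < d \<longrightarrow> norm (f t y - f 0 y - t *\<^sub>R g y) \<le> e' * t" if "0 < e'" for e' y
      proof -
        obtain d where d: "0 < d"
            and dd: "\<And>t. norm (t - 0) < d \<Longrightarrow> norm (f t y - f 0 y - (t - 0) *\<^sub>R g y) \<le> e' * norm (t - 0)"
          using g[of y] \<open>0 < e'\<close> unfolding has_vector_derivative_def has_derivative_at_alt by blast
        have "norm (f t y - f 0 y - t *\<^sub>R g y) \<le> e' * t" if "0 < t" "t < d" for t using dd[of t] that by simp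
        then show ?thesis using d by blast
      qed
      have "norm (g (x + h *\<^sub>R v) - g x - h *\<^sub>R G x) \<le> e * \<bar>h\<bar> + e'" if e': "0 < e'" for e'
      proof -
        obtain d1 where d1: "0 < d1" "\<And>t. 0 < t \<Longrightarrow> t < d1 \<Longrightarrow>
            norm (f t (x + h *\<^sub>R v) - f 0 (x + h *\<^sub>R v) - t *\<^sub>R g (x + h *\<^sub>R v)) \<le> e' / 2 * t"
          using near[of "e' / 2" "x + h *\<^sub>R v"] e' by auto
        obtain d2 where d2: "0 < d2" "\<And>t. 0 < t \<Longrightarrow> t < d2 \<Longrightarrow> norm (f t x - f 0 x - t *\<^sub>R g x) \<le> e' / 2 * t"
          using near[of "e' / 2" x] e' by auto
        have "0 < min (min d1 d2) \<tau>" using d1(1) d2(1) \<tau> by simp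
        from eventually_conj[OF eventually_at_right_0[OF this] expansionD[OF ex e3]]
        have "\<exists>t. (0 < t \<and> t < min (min d1 d2) \<tau>) \<and>
            (\<forall>c\<in>cball x (norm v). norm (A t c v - A 0 c v - t *\<^sub>R G c) \<le> e / 2 * t)" by (rule eventually_happens'[rotated]) simp
        then obtain t where t: "0 < t" "t < d1" "t < d2" "t < \<tau>"
          "\<And>c. c \<in> cball x (norm v) \<Longrightarrow> norm (A t c v - A 0 c v - t *\<^sub>R G c) \<le> e / 2 * t" by auto
        \<comment> \<open>The increment over time t minus the expected s t G x. Its derivative in s
          is small compared with t, as A expands uniformly in time and G is continuous.\<close>
        define \<Psi> where "\<Psi> s = f t (x + s *\<^sub>R v) - f 0 (x + s *\<^sub>R v) - (s * t) *\<^sub>R G x" for s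
        have "norm (\<Psi> h - \<Psi> 0) \<le> (e * t) * norm (h - 0)"
        proof (rule differentiable_bound[where S = "{- \<bar>h\<bar>..\<bar>h\<bar>}"
              and f' = "\<lambda>s u. u *\<^sub>R (A t (x + s *\<^sub>R v) v - A 0 (x + s *\<^sub>R v) v - t *\<^sub>R G x)"])
          fix s assume s: "s \<in> {- \<bar>h\<bar>..\<bar>h\<bar>}"
          have l: "((\<lambda>s. x + s *\<^sub>R v) has_derivative (\<lambda>u. u *\<^sub>R v)) (at s within {- \<bar>h\<bar>..\<bar>h\<bar>})"
            by (auto intro!: derivative_eq_intros)
          have tI: "t \<in> {-\<tau><..<\<tau>}" "0 \<in> {-\<tau><..<\<tau>}" using t \<tau> by auto
          have "(\<Psi> has_derivative (\<lambda>u. A t (x + s *\<^sub>R v) (u *\<^sub>R v) - A 0 (x + s *\<^sub>R v) (u *\<^sub>R v) - (u * t) *\<^sub>R G x))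
             (at s within {- \<bar>h\<bar>..\<bar>h\<bar>})" unfolding \<Psi>_def[abs_def]
            by (intro has_derivative_diff has_derivative_compose[OF l A] tI)
              (auto intro!: derivative_eq_intros)
          moreover have "(\<lambda>u. A t (x + s *\<^sub>R v) (u *\<^sub>R v) - A 0 (x + s *\<^sub>R v) (u *\<^sub>R v) - (u * t) *\<^sub>R G x)
            = (\<lambda>u. u *\<^sub>R (A t (x + s *\<^sub>R v) v - A 0 (x + s *\<^sub>R v) v - t *\<^sub>R G x))"
            using has_derivative_linear[OF A[OF tI(1)]] has_derivative_linear[OF A[OF tI(2)]]
            by (simp add: linear_scale scaleR_diff_right)
          ultimately show "(\<Psi> has_derivative (\<lambda>u. u *\<^sub>R (A t (x + s *\<^sub>R v) v - A 0 (x + s *\<^sub>R v) v - t *\<^sub>R G x)))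
             (at s within {- \<bar>h\<bar>..\<bar>h\<bar>})" by simp
          have s': "\<bar>s\<bar> \<le> \<bar>h\<bar>" using s by auto
          have "norm (G (x + s *\<^sub>R v) - G x) \<le> e / 2" using \<delta>(2)[OF seg(2)[OF s']] by (simp add: dist_norm)
          then have "norm (t *\<^sub>R (G (x + s *\<^sub>R v) - G x)) \<le> e / 2 * t" using t(1) by (simp add: mult.commute mult_left_mono)
          moreover have "A t (x + s *\<^sub>R v) v - A 0 (x + s *\<^sub>R v) v - t *\<^sub>R G x
            = (A t (x + s *\<^sub>R v) v - A 0 (x + s *\<^sub>R v) v - t *\<^sub>R G (x + s *\<^sub>R v)) + t *\<^sub>R (G (x + s *\<^sub>R v) - G x)"
            by (simp add: algebra_simps)
          ultimately have "norm (A t (x + s *\<^sub>R v) v - A 0 (x + s *\<^sub>R v) v - t *\<^sub>R G x) \<le> e / 2 * t + e / 2 * t"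
            using t(5)[OF seg(1)[OF s']] by (simp only:) (intro order_trans[OF norm_triangle_ineq] add_mono)
          then have "norm (A t (x + s *\<^sub>R v) v - A 0 (x + s *\<^sub>R v) v - t *\<^sub>R G x) \<le> e * t" by simp
          then show "onorm (\<lambda>u. u *\<^sub>R (A t (x + s *\<^sub>R v) v - A 0 (x + s *\<^sub>R v) v - t *\<^sub>R G x)) \<le> e * t"
            by (intro onorm_le) (simp add: mult.commute mult_left_mono)
        qed auto
        then have 1: "norm (\<Psi> h - \<Psi> 0) \<le> e * t * \<bar>h\<bar>" by simp
        define r1 where "r1 = f t (x + h *\<^sub>R v) - f 0 (x + h *\<^sub>R v) - t *\<^sub>R g (x + h *\<^sub>R v)"
        define r2 where "r2 = f t x - f 0 x - t *\<^sub>R g x"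
        have "norm r1 \<le> e' / 2 * t" "norm r2 \<le> e' / 2 * t"
          using d1(2)[OF t(1,2)] d2(2)[OF t(1,3)] by (simp_all add: r1_def r2_def)
        moreover define D where "D = g (x + h *\<^sub>R v) - g x - h *\<^sub>R G x"
        moreover have "t *\<^sub>R D = (\<Psi> h - \<Psi> 0) - r1 + r2" by (simp add: D_def \<Psi>_def r1_def r2_def algebra_simps)
        then have "norm (t *\<^sub>R D) \<le> norm (\<Psi> h - \<Psi> 0) + norm r1 + norm r2"
          by (simp only:) (intro order_trans[OF norm_triangle_ineq] add_right_mono norm_triangle_ineq4)
        moreover have "norm (t *\<^sub>R D) = t * norm D" using t(1) by simp
        moreover have "t * (e * \<bar>h\<bar> + e') = e * t * \<bar>h\<bar> + e' / 2 * t + e' / 2 * t" by (simp add: algebra_simps)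
        ultimately have "t * norm D \<le> t * (e * \<bar>h\<bar> + e')" using 1 by linarith
        then show ?thesis using t(1) by (simp add: D_def)
      qed
      then show ?thesis by (rule field_le_epsilon)
    qed
    then show "\<exists>d>0. \<forall>y. norm (y - 0) < d \<longrightarrow> norm (g (x + y *\<^sub>R v) - g (x + 0 *\<^sub>R v) - (y - 0) *\<^sub>R G x) \<le> e * norm (y - 0)"
      using d(1) by auto
  qed
  have "((\<lambda>h. g (x + h *\<^sub>R v)) has_vector_derivative g' v) (at 0)"
  proof -
    have "((\<lambda>h. x + h *\<^sub>R v) has_derivative (\<lambda>h. h *\<^sub>R v)) (at 0)" by (auto intro!: derivative_eq_intros)
    from has_derivative_compose[OF this, of g g'] g'
    show ?thesis by (simp add: has_vector_derivative_def linear_scale[OF has_derivative_linear[OF g']])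
  qed
  then have "G x = g' v" using vector_derivative_unique_at[OF dir] by simp
  then show ?thesis using G[of x] by simp
qed

section \<open>Existence of variations\<close>

lemma C2I:
  assumes A: "\<And>x. (f has_derivative A x) (at x)"
    and H: "\<And>x v. ((\<lambda>y. A y v) has_derivative (\<lambda>u. H x u v)) (at x)"
    and c: "\<And>u v. continuous_on UNIV (\<lambda>x. H x u v)"
  shows "C2 f" and "D1 f = A" and "D2 f = H"
proof -
  show D1: "D1 f = A" using D1_eqI[OF A] by (simp add: fun_eq_iff)
  have "D2 f x u v = H x u v" for x u v by (rule D2_eqI) (simp only: D1 H)
  then show D2: "D2 f = H" by (simp add: fun_eq_iff)
  show "C2 f" unfolding C2_def differentiable_on_def D1 D2 using A H c by (auto simp: differentiable_def)
qed

text \<open>Where one factor vanishes, continuity of the other suffices for the product rule. This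
  yields the derivative of an inverse Jacobian that is so far only known to be continuous.\<close>

lemma has_derivative_vanishing_factor:
  fixes a :: "'a::real_normed_vector \<Rightarrow> real" and b :: "'a \<Rightarrow> 'b::real_normed_vector"
  assumes a: "(a has_derivative a') (at x)" "a x = 0" and b: "continuous (at x) b"
  shows "((\<lambda>y. a y *\<^sub>R b y) has_derivative (\<lambda>u. a' u *\<^sub>R b x)) (at x)"
proof -
  have lin: "bounded_linear a'" using a(1) by (rule has_derivative_bounded_linear)
  have "((\<lambda>y. a y *\<^sub>R (b y - b x)) has_derivative (\<lambda>u. 0)) (at x)" unfolding has_derivative_at_alt
  proof (intro conjI allI impI bounded_linear_zero)
    fix e :: real assume e: "0 < e"
    obtain K where K: "0 < K" "\<And>u. norm (a' u) \<le> norm u * K" using bounded_linear.pos_bounded[OF lin] by blast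
    obtain d1 where d1: "0 < d1" "\<And>y. norm (y - x) < d1 \<Longrightarrow> norm (a y - a x - a' (y - x)) \<le> 1 * norm (y - x)"
      using a(1) zero_less_one unfolding has_derivative_at_alt by blast
    have "0 < e / (K + 1)" using e K by simp
    then obtain d2 where d2: "0 < d2" "\<And>y. dist y x < d2 \<Longrightarrow> dist (b y) (b x) < e / (K + 1)"
      using b unfolding continuous_at_eps_delta by blast
    have "norm (a y *\<^sub>R (b y - b x) - a x *\<^sub>R (b x - b x) - 0) \<le> e * norm (y - x)"
      if y: "norm (y - x) < min d1 d2" for y
    proof -
      have "norm (a y) \<le> norm (a y - a x - a' (y - x)) + norm (a' (y - x))"
        using norm_triangle_ineq[of "a y - a x - a' (y - x)" "a' (y - x)"] a(2) by simp
      also have "\<dots> \<le> 1 * norm (y - x) + norm (y - x) * K" using d1(2)[of y] K(2)[of "y - x"] y by (intro add_mono) auto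
      finally have 1: "norm (a y) \<le> norm (y - x) * (K + 1)" by (simp add: algebra_simps)
      have "norm (b y - b x) \<le> e / (K + 1)" using d2(2)[of y] y by (simp add: dist_norm)
      then have "norm (a y) * norm (b y - b x) \<le> (norm (y - x) * (K + 1)) * (e / (K + 1))"
        using 1 K(1) by (intro mult_mono) auto
      also have "\<dots> = e * norm (y - x)" using K(1) by simp
      finally show ?thesis by simp
    qed
    then show "\<exists>d>0. \<forall>y. norm (y - x) < d \<longrightarrow>
        norm (a y *\<^sub>R (b y - b x) - a x *\<^sub>R (b x - b x) - 0) \<le> e * norm (y - x)"
      using d1(1) d2(1) by (intro exI[of _ "min d1 d2"]) auto
  qed
  moreover have "((\<lambda>y. a y *\<^sub>R b x) has_derivative (\<lambda>u. a' u *\<^sub>R b x)) (at x)" by (rule has_derivative_scaleR_left[OF a(1)])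
  ultimately have "((\<lambda>y. a y *\<^sub>R (b y - b x) + a y *\<^sub>R b x) has_derivative (\<lambda>u. 0 + a' u *\<^sub>R b x)) (at x)"
    by (rule has_derivative_add)
  then show ?thesis by (simp add: scaleR_diff_right)
qed

text \<open>The difference of f and the identity is a contraction, so f x = y has a solution by
  Banach's fixed point theorem, and the inverse is 2-Lipschitz. The derivative of the inverse is the
  inverse matrix, which is differentiated through the identity \<open>diff\<close>.\<close>

lemma C2_diffeo_near_id:
  assumes f: "C2 f" and near: "\<And>x v. norm (D1 f x v - v) \<le> norm v / 2"
  shows "C2_diffeo f"
proof -
  note lin = linear_D1[OF f]
  have dev: "norm ((f x - x) - (f y - y)) \<le> 1/2 * norm (x - y)" for x y
  proof (rule differentiable_bound[where S = UNIV and f' = "\<lambda>x v. D1 f x v - v"])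
    show "((\<lambda>x. f x - x) has_derivative (\<lambda>v. D1 f x v - v)) (at x within UNIV)" for x
      by (intro has_derivative_diff has_derivative_ident C2_has_derivative f)
    show "onorm (\<lambda>v. D1 f x v - v) \<le> 1/2" for x using near by (intro onorm_le) simp
  qed auto
  have lower: "norm (x - y) \<le> 2 * norm (f x - f y)" for x y
  proof -
    have "norm (x - y) \<le> norm (f x - f y) + norm ((f x - x) - (f y - y))"
      using norm_triangle_ineq4[of "f x - f y" "(f x - x) - (f y - y)"] by (simp add: algebra_simps)
    then show ?thesis using dev[of x y] by linarith
  qed
  have "inj f"
  proof (rule injI)
    fix x y assume "f x = f y"
    then show "x = y" using lower[of x y] by simp
  qed
  moreover have "surj f" unfolding surj_def
  proof
    fix y
    have "dist (y - (f a - a)) (y - (f b - b)) \<le> 1/2 * dist a b" for a b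
    proof -
      have "(y - (f a - a)) - (y - (f b - b)) = (f b - b) - (f a - a)" by simp
      then show ?thesis using dev[of b a] by (simp only: dist_norm norm_minus_commute[of a b])
    qed
    then have "\<exists>!x. y - (f x - x) = x" by (intro banach_fix_type[of "1/2"]) auto
    then obtain x where x: "y - (f x - x) = x" by blast
    have "y = (y - (f x - x)) + (f x - x)" by simp
    then have "y = f x" by (simp only: x) simp
    then show "\<exists>x. y = f x" ..
  qed
  ultimately have bij: "bij f" by (simp add: bij_def)
  define g where "g = inv f"
  have fg: "f (g y) = y" and gf: "g (f x) = x" for x y using bij by (simp_all add: g_def bij_def surj_f_inv_f)
  have g_lip: "norm (g x - g y) \<le> 2 * norm (x - y)" for x y using lower[of "g x" "g y"] by (simp add: fg)
  have g_cont: "continuous_on UNIV g"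
  proof -
    have "2-lipschitz_on UNIV g" using g_lip by (intro lipschitz_onI) (auto simp: dist_norm)
    then show ?thesis by (rule lipschitz_on_continuous_on)
  qed
  have Dlow: "norm v \<le> 2 * norm (D1 f x v)" for x v using near[of x v] norm_triangle_ineq4[of "D1 f x v" "D1 f x v - v"] by simp
  have "\<exists>B. linear B \<and> (\<forall>v. B (D1 f x v) = v) \<and> (\<forall>w. D1 f x (B w) = w)" for x
  proof -
    have "inj (D1 f x)" unfolding linear_injective_0[OF lin]
    proof (intro allI impI)
      fix v assume "D1 f x v = 0"
      then show "v = 0" using Dlow[of v x] by simp
    qed
    then show ?thesis using linear_injective_isomorphism[OF lin] by blast
  qed
  then obtain B where B: "\<And>x. linear (B x)" "\<And>x v. B x (D1 f x v) = v" "\<And>x w. D1 f x (B x w) = w" by metis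
  have Bn: "norm (B x w) \<le> 2 * norm w" for x w using Dlow[of "B x w" x] by (simp add: B(3))
  define A where "A y = B (g y)" for y
  have gD: "(g has_derivative A y) (at y)" for y
  proof (rule has_derivative_inverse_basic[of f "D1 f (g y)" g y "A y" UNIV])
    show "(f has_derivative D1 f (g y)) (at (g y))" by (rule C2_has_derivative[OF f])
    show "bounded_linear (A y)" using B(1) linear_conv_bounded_linear by (auto simp: A_def)
    show "A y \<circ> D1 f (g y) = id" by (simp add: A_def B(2) fun_eq_iff)
    show "continuous (at y) g" using g_cont by (simp add: continuous_on_eq_continuous_at)
  qed (auto simp: fg)
  define p where "p w y0 y = D1 f (g y) (A y0 w)" for w y0 y
  have pD: "(p w y0 has_derivative (\<lambda>u. D2 f (g y0) (A y0 u) (A y0 w))) (at y0)" for w y0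
  proof -
    have "((\<lambda>y. D1 f (g y) (A y0 w)) has_derivative
       (\<lambda>u. D2 f (g y0) (A y0 u) (A y0 w) + D1 f (g y0) 0)) (at y0)" by (rule D1_has_derivative[OF f gD has_derivative_const])
    then show ?thesis by (simp add: p_def[abs_def] linear_0[OF lin])
  qed
  have p0: "p w y0 y0 = w" for w y0 by (simp add: p_def A_def B(3))
  \<comment> \<open>The identity A - A0 = - A (D - D0) A0 for inverse matrices. Its middle factor is
    differentiable and vanishes at y0, while A is at this stage only a candidate for
    continuity.\<close>
  have diff: "A y w - A y0 w = - A y (p w y0 y - p w y0 y0)" for y y0 w
  proof -
    have "A y (p w y0 y) = A y0 w" by (simp add: p_def A_def B(2))
    then show ?thesis using linear_diff[OF B(1), of "g y"] by (simp add: A_def p0)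
  qed
  have A_cont: "continuous_on UNIV (\<lambda>y. A y w)" for w
    unfolding continuous_on_eq_continuous_at[OF open_UNIV] continuous_at_eps_delta
  proof (intro ballI allI impI)
    fix y0 and e :: real assume e: "0 < e"
    then have "0 < e / 2" by simp
    moreover have "continuous (at y0) (p w y0)" by (rule has_derivative_continuous[OF pD])
    ultimately obtain d where d: "0 < d" "\<And>y. dist y y0 < d \<Longrightarrow> dist (p w y0 y) (p w y0 y0) < e / 2"
      unfolding continuous_at_eps_delta by blast
    have "dist (A y w) (A y0 w) < e" if "dist y y0 < d" for y
      using d(2)[OF that] Bn[of "g y" "p w y0 y - p w y0 y0"] diff[of y w y0] by (simp add: dist_norm A_def)
    then show "\<exists>d>0. \<forall>x'. dist x' y0 < d \<longrightarrow> dist (A x' w) (A y0 w) < e" using d(1) by blast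
  qed
  have A_sum: "A y z = (\<Sum>i\<in>UNIV. z $ i *\<^sub>R A y (axis i 1))" for y z unfolding A_def by (rule linear_vec_sum[OF B(1)])
  define H where "H y u w = - A y (D2 f (g y) (A y u) (A y w))" for y u w
  have AD: "((\<lambda>y. A y w) has_derivative (\<lambda>u. H y0 u w)) (at y0)" for y0 w
  proof -
    have "((\<lambda>y. (p w y0 y - p w y0 y0) $ i *\<^sub>R A y (axis i 1)) has_derivative
       (\<lambda>u. (D2 f (g y0) (A y0 u) (A y0 w)) $ i *\<^sub>R A y0 (axis i 1))) (at y0)" for i
    proof (rule has_derivative_vanishing_factor)
      have "((\<lambda>y. p w y0 y - p w y0 y0) has_derivative (\<lambda>u. D2 f (g y0) (A y0 u) (A y0 w) - 0)) (at y0)"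
        by (intro has_derivative_diff pD has_derivative_const)
      from bounded_linear.has_derivative[OF bounded_linear_vec_nth this]
      show "((\<lambda>y. (p w y0 y - p w y0 y0) $ i) has_derivative (\<lambda>u. D2 f (g y0) (A y0 u) (A y0 w) $ i)) (at y0)" by simp
      show "continuous (at y0) (\<lambda>y. A y (axis i 1))" using A_cont by (simp add: continuous_on_eq_continuous_at)
    qed simp
    then have "((\<lambda>y. \<Sum>i\<in>UNIV. (p w y0 y - p w y0 y0) $ i *\<^sub>R A y (axis i 1)) has_derivative
       (\<lambda>u. \<Sum>i\<in>UNIV. (D2 f (g y0) (A y0 u) (A y0 w)) $ i *\<^sub>R A y0 (axis i 1))) (at y0)" by (intro has_derivative_sum)
    then have "((\<lambda>y. A y (p w y0 y - p w y0 y0)) has_derivative (\<lambda>u. A y0 (D2 f (g y0) (A y0 u) (A y0 w)))) (at y0)"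
      by (simp only: A_sum[symmetric])
    then have "((\<lambda>y. A y0 w - A y (p w y0 y - p w y0 y0)) has_derivative (\<lambda>u. 0 - A y0 (D2 f (g y0) (A y0 u) (A y0 w)))) (at y0)"
      by (intro has_derivative_diff has_derivative_const)
    moreover have "A y0 w - A y (p w y0 y - p w y0 y0) = A y w" for y using diff[of y w y0] by (simp add: algebra_simps)
    ultimately show ?thesis by (simp add: H_def)
  qed
  have "continuous_on UNIV (\<lambda>y. D2 f (g y) (A y u) (A y w))" for u w by (intro continuous_on_D2 f g_cont A_cont)
  then have "continuous_on UNIV (\<lambda>y. H y u w)" for u w unfolding H_def by (subst A_sum) (intro continuous_intros A_cont)
  then have "C2 g" using C2I(1)[OF gD AD] by blast
  then show ?thesis using bij f by (simp add: C2_diffeo_def g_def)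
qed

text \<open>The witness is an average over \<open>[s, s + 2]\<close> of a decreasing minorant of \<open>d\<close>.\<close>

lemma radial_minorant:
  fixes d :: "'a::euclidean_space \<Rightarrow> real"
  assumes d: "continuous_on UNIV d" "\<And>x. 0 < d x"
  obtains V V' V'' :: "real \<Rightarrow> real" where "\<And>s. (V has_real_derivative V' s) (at s)" "\<And>s. (V' has_real_derivative V'' s) (at s)"
    "continuous_on UNIV V''" "\<And>s. 0 < V s" "\<And>x. V (x \<bullet> x) \<le> d x" "\<And>x. \<bar>V' (x \<bullet> x)\<bar> \<le> d x"
proof -
  \<comment> \<open>The penalty makes \<epsilon> decreasing and 1-Lipschitz, and it vanishes at
    points with x \<bullet> x = s, so that \<epsilon> (x \<bullet> x) <= d x.\<close>
  define \<epsilon> where "\<epsilon> s = (INF x. d x + max 0 (x \<bullet> x - s))" for s :: real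
  have bdd: "bdd_below (range (\<lambda>x. d x + max 0 (x \<bullet> x - s)))" for s
    using d(2) by (intro bdd_belowI2[of _ 0]) (simp add: add_nonneg_nonneg less_imp_le)
  have le: "\<epsilon> s \<le> d x + max 0 (x \<bullet> x - s)" for s x unfolding \<epsilon>_def by (rule cINF_lower[OF bdd UNIV_I])
  have le_d: "\<epsilon> (x \<bullet> x) \<le> d x" for x using le[of "x \<bullet> x" x] by simp
  have pos: "0 < \<epsilon> s" for s
  proof -
    \<comment> \<open>Outside this ball the penalty is at least 1; inside it d has a positive
      minimum.\<close>
    have "compact (cball 0 (sqrt (\<bar>s\<bar> + 1)) :: 'a set)" "cball 0 (sqrt (\<bar>s\<bar> + 1)) \<noteq> ({} :: 'a set)" by auto
    then obtain z where z: "\<And>x. x \<in> cball 0 (sqrt (\<bar>s\<bar> + 1)) \<Longrightarrow> d z \<le> d x"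
      using continuous_attains_inf[of "cball 0 (sqrt (\<bar>s\<bar> + 1)) :: 'a set" d] continuous_on_subset[OF d(1)] by blast
    have "min (d z) 1 \<le> d x + max 0 (x \<bullet> x - s)" for x
    proof (cases "x \<in> cball 0 (sqrt (\<bar>s\<bar> + 1))")
      case True
      then show ?thesis using z[of x] by simp
    next
      case False
      then have "\<bar>s\<bar> + 1 < x \<bullet> x" by (simp add: norm_eq_sqrt_inner not_le)
      then have "1 \<le> max 0 (x \<bullet> x - s)" by linarith
      moreover have "min (d z) 1 \<le> 1" by simp
      ultimately show ?thesis using d(2)[of x] by linarith
    qed
    then have "min (d z) 1 \<le> \<epsilon> s" unfolding \<epsilon>_def by (intro cINF_greatest) auto
    then show ?thesis using d(2)[of z] by linarith
  qed
  have anti: "\<epsilon> b \<le> \<epsilon> a" and lip: "\<epsilon> a \<le> \<epsilon> b + (b - a)" if "a \<le> b" for a b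
  proof -
    show "\<epsilon> b \<le> \<epsilon> a" unfolding \<epsilon>_def[of a]
    proof (rule cINF_greatest)
      fix x show "\<epsilon> b \<le> d x + max 0 (x \<bullet> x - a)" using le[of b x] that by linarith
    qed simp
    have "\<epsilon> a - (b - a) \<le> \<epsilon> b" unfolding \<epsilon>_def[of b]
    proof (rule cINF_greatest)
      fix x show "\<epsilon> a - (b - a) \<le> d x + max 0 (x \<bullet> x - b)" using le[of a x] that by linarith
    qed simp
    then show "\<epsilon> a \<le> \<epsilon> b + (b - a)" by simp
  qed
  have cont: "continuous_on UNIV \<epsilon>"
  proof -
    have "1-lipschitz_on UNIV \<epsilon>"
    proof (rule lipschitz_onI)
      fix a b :: real
      show "dist (\<epsilon> a) (\<epsilon> b) \<le> 1 * dist a b"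
        using anti[of a b] anti[of b a] lip[of a b] lip[of b a] by (cases "a \<le> b") (auto simp: dist_real_def)
    qed simp
    then show ?thesis by (rule lipschitz_on_continuous_on)
  qed
  obtain E1 where E1: "\<And>s. (E1 has_real_derivative \<epsilon> s) (at s)" using real_antiderivative[OF cont] by blast
  have "continuous_on UNIV E1" using E1 by (meson DERIV_continuous_on has_field_derivative_at_within)
  then obtain E2 where E2: "\<And>s. (E2 has_real_derivative E1 s) (at s)" using real_antiderivative by blast
  have shift: "((\<lambda>s. F (s + c)) has_real_derivative F' (s + c)) (at s)"
    if "\<And>s. (F has_real_derivative F' s) (at s)" for F F' :: "real \<Rightarrow> real" and c s
    using that[of "s + c"] by (simp add: DERIV_shift)
  \<comment> \<open>P is the mean of \<epsilon> over [s, s + 1], and V below is the mean of P over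
    [s, s + 1]. Hence V and |V'| are bounded by \<epsilon>, and V'' is a combination of values of
    \<epsilon>.\<close>
  define P where "P s = E1 (s + 1) - E1 s" for s
  have P: "\<epsilon> (s + 1) \<le> P s" "P s \<le> \<epsilon> s" for s
  proof -
    obtain z where z: "s < z" "z < s + 1" "E1 (s + 1) - E1 s = (s + 1 - s) * \<epsilon> z" using MVT2[of s "s + 1" E1 \<epsilon>] E1 by auto
    then show "\<epsilon> (s + 1) \<le> P s" "P s \<le> \<epsilon> s" using anti[of s z] anti[of z "s + 1"] by (simp_all add: P_def)
  qed
  define Q where "Q s = E2 (s + 1) - E2 s" for s
  have Q: "(Q has_real_derivative P s) (at s)" for s unfolding Q_def[abs_def] P_def by (intro DERIV_diff shift E2)
  define V where "V s = Q (s + 1) - Q s" for s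
  show ?thesis
  proof (rule that[of V "\<lambda>s. P (s + 1) - P s" "\<lambda>s. (\<epsilon> (s + 1 + 1) - \<epsilon> (s + 1)) - (\<epsilon> (s + 1) - \<epsilon> s)"])
    show "(V has_real_derivative P (s + 1) - P s) (at s)" for s unfolding V_def[abs_def] by (intro DERIV_diff shift Q)
    have "(P has_real_derivative \<epsilon> (s + 1) - \<epsilon> s) (at s)" for s unfolding P_def[abs_def] by (intro DERIV_diff shift E1)
    then show "((\<lambda>s. P (s + 1) - P s) has_real_derivative (\<epsilon> (s + 1 + 1) - \<epsilon> (s + 1)) - (\<epsilon> (s + 1) - \<epsilon> s)) (at s)" for s
      by (intro DERIV_diff shift[where F = P and F' = "\<lambda>s. \<epsilon> (s + 1) - \<epsilon> s"])
    show "continuous_on UNIV (\<lambda>s. (\<epsilon> (s + 1 + 1) - \<epsilon> (s + 1)) - (\<epsilon> (s + 1) - \<epsilon> s))"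
      by (intro continuous_intros continuous_on_compose2[OF cont]) auto
    have V: "0 < V s \<and> V s \<le> \<epsilon> s" for s
    proof -
      obtain z where z: "s < z" "z < s + 1" "Q (s + 1) - Q s = (s + 1 - s) * P z" using MVT2[of s "s + 1" Q P] Q by auto
      then show ?thesis using P[of z] pos[of "z + 1"] anti[of s z] by (simp add: V_def)
    qed
    show "0 < V s" for s using V by blast
    show "V (x \<bullet> x) \<le> d x" for x using V[of "x \<bullet> x"] le_d[of x] by linarith
    show "\<bar>P (x \<bullet> x + 1) - P (x \<bullet> x)\<bar> \<le> d x" for x
      using P[of "x \<bullet> x"] P[of "x \<bullet> x + 1"] pos[of "x \<bullet> x + 1"] pos[of "x \<bullet> x + 1 + 1"] anti[of "x \<bullet> x" "x \<bullet> x + 1"] le_d[of x]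
      by linarith
  qed
qed

section \<open>A family of diffeomorphisms with given initial velocity\<close>

definition time_derivative :: "(real \<Rightarrow> pt \<Rightarrow> 'a::real_normed_vector) \<Rightarrow> (real \<Rightarrow> pt \<Rightarrow> 'a) \<Rightarrow> bool" where
  "time_derivative F F' \<longleftrightarrow> (\<forall>t x. ((\<lambda>s. F s x) has_vector_derivative F' t x) (at t)) \<and> continuous_on UNIV (\<lambda>p. F' (fst p) (snd p))"

definition time_smooth :: "(real \<Rightarrow> pt \<Rightarrow> 'a::real_normed_vector) \<Rightarrow> bool" where
  "time_smooth F \<longleftrightarrow> continuous_on UNIV (\<lambda>p. F (fst p) (snd p)) \<and> (\<exists>F'. time_derivative F F')"

lemma time_derivativeD:
  assumes "time_derivative F F'"
  shows "((\<lambda>s. F s x) has_vector_derivative F' t x) (at t)" "continuous_on UNIV (\<lambda>p. F' (fst p) (snd p))"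
  using assms by (auto simp: time_derivative_def)

lemma time_smoothE:
  assumes "time_smooth F"
  obtains F' where "continuous_on UNIV (\<lambda>p. F (fst p) (snd p))" "time_derivative F F'"
  using assms unfolding time_smooth_def by blast

lemma time_smooth_C1_in_time:
  assumes "time_smooth F"
  shows "C1_in_time I F"
proof -
  obtain F' where F0: "continuous_on UNIV (\<lambda>p. F (fst p) (snd p))" and F': "time_derivative F F'" by (rule time_smoothE[OF assms])
  note F = F0 time_derivativeD[OF F']
  show ?thesis unfolding C1_in_time_def case_prod_unfold
    by (intro exI[of _ F'] conjI ballI allI F(2) continuous_on_subset[OF F(3) subset_UNIV])
qed

lemma time_smooth_space:
  assumes "continuous_on UNIV e"
  shows "time_smooth (\<lambda>t. e)"
proof -
  have "continuous_on UNIV (\<lambda>p. e (snd p))"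
    by (rule continuous_on_compose2[OF assms]) (auto intro: continuous_on_snd continuous_on_id)
  then show ?thesis unfolding time_smooth_def time_derivative_def
    by (intro conjI exI[of _ "\<lambda>t x. 0"] allI has_vector_derivative_const continuous_on_const)
qed

lemma time_smooth_time: "time_smooth (\<lambda>t x. t)"
  unfolding time_smooth_def time_derivative_def
  by (intro conjI exI[of _ "\<lambda>t x. 1"] allI continuous_on_const continuous_on_fst continuous_on_id has_vector_derivative_id)

lemma time_smooth_add:
  assumes "time_smooth F" "time_smooth G"
  shows "time_smooth (\<lambda>t x. F t x + G t x)"
proof -
  obtain F' where F0: "continuous_on UNIV (\<lambda>p. F (fst p) (snd p))" and F': "time_derivative F F'" by (rule time_smoothE[OF assms(1)])
  note F = F0 time_derivativeD[OF F']
  obtain G' where G0: "continuous_on UNIV (\<lambda>p. G (fst p) (snd p))" and G': "time_derivative G G'" by (rule time_smoothE[OF assms(2)])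
  note G = G0 time_derivativeD[OF G']
  show ?thesis unfolding time_smooth_def time_derivative_def
    by (intro conjI exI[of _ "\<lambda>t x. F' t x + G' t x"] allI has_vector_derivative_add F G continuous_on_add)
qed

lemma time_smooth_scaleR:
  assumes "time_smooth F" "time_smooth G"
  shows "time_smooth (\<lambda>t x. F t x *\<^sub>R G t x)"
proof -
  obtain F' where F0: "continuous_on UNIV (\<lambda>p. F (fst p) (snd p))" and F': "time_derivative F F'" by (rule time_smoothE[OF assms(1)])
  note F = F0 time_derivativeD[OF F']
  obtain G' where G0: "continuous_on UNIV (\<lambda>p. G (fst p) (snd p))" and G': "time_derivative G G'" by (rule time_smoothE[OF assms(2)])
  note G = G0 time_derivativeD[OF G']
  have "((\<lambda>s. F s x *\<^sub>R G s x) has_vector_derivative F t x *\<^sub>R G' t x + F' t x *\<^sub>R G t x) (at t)" for t x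
    by (rule bounded_bilinear.has_vector_derivative[OF bounded_bilinear_scaleR F(2) G(2)])
  then show ?thesis unfolding time_smooth_def time_derivative_def
    by (intro conjI exI[of _ "\<lambda>t x. F t x *\<^sub>R G' t x + F' t x *\<^sub>R G t x"] allI F(1,3) G(1,3) continuous_intros)
qed

lemma time_smooth_mult:
  fixes F G :: "real \<Rightarrow> pt \<Rightarrow> real"
  shows "time_smooth F \<Longrightarrow> time_smooth G \<Longrightarrow> time_smooth (\<lambda>t x. F t x * G t x)"
  using time_smooth_scaleR[of F G] by simp

lemma time_smooth_inverse:
  fixes F :: "real \<Rightarrow> pt \<Rightarrow> real"
  assumes "time_smooth F" and nz: "\<And>t x. F t x \<noteq> 0"
  shows "time_smooth (\<lambda>t x. inverse (F t x))"
proof -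
  obtain F' where F0: "continuous_on UNIV (\<lambda>p. F (fst p) (snd p))" and F': "time_derivative F F'" by (rule time_smoothE[OF assms(1)])
  note F = F0 time_derivativeD[OF F']
  have "((\<lambda>s. inverse (F s x)) has_real_derivative - (inverse (F t x) * F' t x * inverse (F t x))) (at t)" for t x
    using DERIV_inverse'[OF F(2)[folded has_real_derivative_iff_has_vector_derivative] nz] .
  then show ?thesis unfolding time_smooth_def time_derivative_def has_real_derivative_iff_has_vector_derivative
    using nz by (intro conjI exI[of _ "\<lambda>t x. - (inverse (F t x) * F' t x * inverse (F t x))"] allI F(1,3) continuous_intros) auto
qed

text \<open>For a field of fast growth the flow may blow up at once, and x + t \<xi> x need not be
  injective for any t > 0. The factor g = t w^2 / (w^2 + t^2) has time derivative 1 at t = 0, while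
  |g| <= w / 2 and the derivative of g in w has modulus at most 1 for all t. A positive radial w
  that is small where \<xi> is large thus keeps the differential within 1 / 2 of the identity. As
  the displacement is a multiple of \<xi>, the zero field yields the constant family.\<close>

theorem diffeo_family_exists:
  assumes \<xi>: "C2 \<xi>"
  obtains \<phi> \<psi> where "diffeo_family \<phi> \<xi>" "\<And>t x. \<phi> t x = x + \<psi> t x *\<^sub>R \<xi> x"
proof -
  define M where "M x = (\<Sum>i\<in>UNIV. norm (D1 \<xi> x (axis i 1)))" for x
  \<comment> \<open>Chosen so that 2 d |x| |\<xi> x| + d M / 2 <= 1 / 4 in the final estimate; the
    summand 1 keeps the denominator positive.\<close>
  define d where "d x = 1 / (2 * (1 + 4 * (norm x * norm (\<xi> x)) + M x))" for x
  have M0: "0 \<le> M x" for x unfolding M_def by (intro sum_nonneg) auto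
  have M: "norm (D1 \<xi> x v) \<le> M x * norm v" for x v
  proof -
    have "norm (D1 \<xi> x v) \<le> (\<Sum>i\<in>UNIV. norm (v $ i *\<^sub>R D1 \<xi> x (axis i 1)))" by (subst D1_sum[OF \<xi>]) (rule norm_sum)
    also have "\<dots> \<le> (\<Sum>i\<in>UNIV. norm v * norm (D1 \<xi> x (axis i 1)))"
      by (intro sum_mono) (simp add: component_le_norm_cart mult_right_mono)
    finally show ?thesis by (simp add: M_def sum_distrib_left mult.commute)
  qed
  have \<xi>c: "continuous_on UNIV \<xi>" by (rule C2_continuous[OF \<xi>])
  have D1c: "continuous_on UNIV (\<lambda>x. D1 \<xi> x v)" for v by (intro continuous_on_D1 \<xi> continuous_intros)
  have D2c: "continuous_on UNIV (\<lambda>x. D2 \<xi> x u v)" for u v by (intro continuous_on_D2 \<xi> continuous_intros)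
  have den: "0 < 2 * (1 + 4 * (norm x * norm (\<xi> x)) + M x)" for x using M0[of x] by (simp add: add_pos_nonneg)
  have d0: "0 < d x" for x using den[of x] by (simp only: d_def zero_less_divide_1_iff)
  have "continuous_on UNIV M" unfolding M_def[abs_def] by (intro continuous_intros D1c)
  moreover have "2 * (1 + 4 * (norm x * norm (\<xi> x)) + M x) \<noteq> 0" for x using den[of x] by linarith
  ultimately have "continuous_on UNIV d" unfolding d_def[abs_def] by (intro continuous_intros \<xi>c ballI)
  then obtain V V' V'' :: "real \<Rightarrow> real" where V: "\<And>s. (V has_real_derivative V' s) (at s)" "\<And>s. (V' has_real_derivative V'' s) (at s)"
    "continuous_on UNIV V''" "\<And>s. 0 < V s" "\<And>x. V (x \<bullet> x) \<le> d x" "\<And>x. \<bar>V' (x \<bullet> x)\<bar> \<le> d x"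
    by (rule radial_minorant[OF _ d0]) (rule that; assumption)
  have Vc: "continuous_on UNIV V" "continuous_on UNIV V'"
    using V(1,2) by (meson DERIV_continuous_on has_field_derivative_at_within)+
  define w where "w x = V (x \<bullet> x)" for x :: pt
  define w1 where "w1 x v = 2 * V' (x \<bullet> x) * (x \<bullet> v)" for x v :: pt
  define w2 where "w2 x u v = 4 * V'' (x \<bullet> x) * (x \<bullet> u) * (x \<bullet> v) + 2 * V' (x \<bullet> x) * (u \<bullet> v)" for x u v :: pt
  have w0: "0 < w x" for x by (simp add: w_def V(4))
  have xx: "((\<lambda>x. x \<bullet> x) has_derivative (\<lambda>v. 2 * (x \<bullet> v))) (at x)" for x :: pt
    by (auto intro!: derivative_eq_intros simp: inner_commute)
  have wD: "(w has_derivative w1 x) (at x)" for x using has_derivative_compose[OF xx V(1)[unfolded has_field_derivative_def]]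
    by (simp add: w_def[abs_def] w1_def[abs_def] mult_ac)
  have w1D: "((\<lambda>x. w1 x v) has_derivative (\<lambda>u. w2 x u v)) (at x)" for x v
  proof -
    have 1: "((\<lambda>x. V' (x \<bullet> x)) has_derivative (\<lambda>u. V'' (x \<bullet> x) * (2 * (x \<bullet> u)))) (at x)"
      by (rule has_derivative_compose[OF xx V(2)[unfolded has_field_derivative_def]])
    have 2: "((\<lambda>x. x \<bullet> v) has_derivative (\<lambda>u. u \<bullet> v)) (at x)" by (auto intro!: derivative_eq_intros)
    have "((\<lambda>x. 2 * (V' (x \<bullet> x) * (x \<bullet> v))) has_derivative
       (\<lambda>u. 2 * (V' (x \<bullet> x) * (u \<bullet> v) + V'' (x \<bullet> x) * (2 * (x \<bullet> u)) * (x \<bullet> v)))) (at x)"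
      by (intro has_derivative_mult_right has_derivative_mult 1 2)
    then show ?thesis by (simp add: w1_def w2_def[abs_def] algebra_simps)
  qed
  have wc: "continuous_on UNIV w" and w1c: "continuous_on UNIV (\<lambda>x. w1 x v)" and w2c: "continuous_on UNIV (\<lambda>x. w2 x u v)" for u v
    unfolding w_def w1_def w2_def
    by (intro continuous_intros continuous_on_compose2[OF Vc(1)] continuous_on_compose2[OF Vc(2)] continuous_on_compose2[OF V(3)]; auto)+
  define r where "r t x = inverse ((w x)\<^sup>2 + t\<^sup>2)" for t x
  have rpos: "0 < (w x)\<^sup>2 + t\<^sup>2" for t x using w0[of x] by (simp add: add_pos_nonneg)
  \<comment> \<open>Here g1 and g2 are the first and second derivatives of g in the variable w; G
    and G2 are those in x, by the chain rule.\<close>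
  define g where "g t x = t * (w x)\<^sup>2 * r t x" for t x
  define g1 where "g1 t x = 2 * t^3 * w x * (r t x)\<^sup>2" for t x
  define g2 where "g2 t x = 2 * t^3 * (t\<^sup>2 - 3 * (w x)\<^sup>2) * (r t x)^3" for t x
  define G where "G t x v = g1 t x * w1 x v" for t x v
  define G2 where "G2 t x u v = g2 t x * w1 x u * w1 x v + g1 t x * w2 x u v" for t x u v
  have gw: "((\<lambda>z. t * z\<^sup>2 * inverse (z\<^sup>2 + t\<^sup>2)) has_real_derivative 2 * t^3 * z * (inverse (z\<^sup>2 + t\<^sup>2))\<^sup>2) (at z)"
    if "0 < z" for t z :: real
  proof -
    have nz: "z\<^sup>2 + t\<^sup>2 \<noteq> 0" using that by (simp add: add_pos_nonneg less_imp_neq[symmetric])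
    have "((\<lambda>z. t * z\<^sup>2 * inverse (z\<^sup>2 + t\<^sup>2)) has_real_derivative
      t * (2 * z) * inverse (z\<^sup>2 + t\<^sup>2) + (- (inverse (z\<^sup>2 + t\<^sup>2) * (2 * z) * inverse (z\<^sup>2 + t\<^sup>2))) * (t * z\<^sup>2)) (at z)"
      using nz by (auto intro!: derivative_eq_intros simp: power2_eq_square)
    moreover have "t * (2 * z) * inverse (z\<^sup>2 + t\<^sup>2) + (- (inverse (z\<^sup>2 + t\<^sup>2) * (2 * z) * inverse (z\<^sup>2 + t\<^sup>2))) * (t * z\<^sup>2)
      = 2 * t^3 * z * (inverse (z\<^sup>2 + t\<^sup>2))\<^sup>2"
      using nz by (simp add: divide_simps) (simp add: algebra_simps power2_eq_square power3_eq_cube)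
    ultimately show ?thesis by simp
  qed
  have g1w: "((\<lambda>z. 2 * t^3 * z * (inverse (z\<^sup>2 + t\<^sup>2))\<^sup>2) has_real_derivative
     2 * t^3 * (t\<^sup>2 - 3 * z\<^sup>2) * (inverse (z\<^sup>2 + t\<^sup>2))^3) (at z)" if "0 < z" for t z :: real
  proof -
    have nz: "z\<^sup>2 + t\<^sup>2 \<noteq> 0" using that by (simp add: add_pos_nonneg less_imp_neq[symmetric])
    have "((\<lambda>z. 2 * t^3 * z * (inverse (z\<^sup>2 + t\<^sup>2))\<^sup>2) has_real_derivative
      2 * t^3 * (inverse (z\<^sup>2 + t\<^sup>2))\<^sup>2
       + 2 * (inverse (z\<^sup>2 + t\<^sup>2) * (- (inverse (z\<^sup>2 + t\<^sup>2) * (2 * z) * inverse (z\<^sup>2 + t\<^sup>2)))) * (2 * t^3 * z)) (at z)"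
      using nz by (auto intro!: derivative_eq_intros simp: power2_eq_square)
    moreover have "2 * t^3 * (inverse (z\<^sup>2 + t\<^sup>2))\<^sup>2
       + 2 * (inverse (z\<^sup>2 + t\<^sup>2) * (- (inverse (z\<^sup>2 + t\<^sup>2) * (2 * z) * inverse (z\<^sup>2 + t\<^sup>2)))) * (2 * t^3 * z)
      = 2 * t^3 * (t\<^sup>2 - 3 * z\<^sup>2) * (inverse (z\<^sup>2 + t\<^sup>2))^3"
      using nz by (simp add: divide_simps) (simp add: algebra_simps power2_eq_square power3_eq_cube)
    ultimately show ?thesis by simp
  qed
  have gD: "(g t has_derivative G t x) (at x)" for t x
    using has_derivative_compose[OF wD gw[OF w0, unfolded has_field_derivative_def]]
    by (simp add: g_def[abs_def] G_def[abs_def] g1_def r_def)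
  have g1D: "(g1 t has_derivative (\<lambda>u. g2 t x * w1 x u)) (at x)" for t x
    using has_derivative_compose[OF wD g1w[OF w0, unfolded has_field_derivative_def]]
    by (simp add: g1_def[abs_def] g2_def r_def)
  have GD: "((\<lambda>x. G t x v) has_derivative (\<lambda>u. G2 t x u v)) (at x)" for t x v
    using has_derivative_mult[OF g1D w1D, of t v x] by (simp add: G_def[abs_def] G2_def[abs_def] mult_ac add.commute)
  define \<phi> where "\<phi> t x = x + g t x *\<^sub>R \<xi> x" for t x
  define A where "A t x v = v + (G t x v *\<^sub>R \<xi> x + g t x *\<^sub>R D1 \<xi> x v)" for t x v
  define H where "H t x u v = G2 t x u v *\<^sub>R \<xi> x + (G t x v *\<^sub>R D1 \<xi> x u + (G t x u *\<^sub>R D1 \<xi> x v + g t x *\<^sub>R D2 \<xi> x u v))" for t x u v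
  have \<phi>D: "(\<phi> t has_derivative A t x) (at x)" for t x
  proof -
    have "((\<lambda>x. x + g t x *\<^sub>R \<xi> x) has_derivative (\<lambda>v. v + (g t x *\<^sub>R D1 \<xi> x v + G t x v *\<^sub>R \<xi> x))) (at x)"
      by (intro has_derivative_add has_derivative_ident has_derivative_scaleR gD C2_has_derivative \<xi>)
    then show ?thesis by (simp add: \<phi>_def[abs_def] A_def[abs_def] add.commute)
  qed
  have AD: "((\<lambda>y. A t y v) has_derivative (\<lambda>u. H t x u v)) (at x)" for t x v
  proof -
    have "((\<lambda>x. v + (G t x v *\<^sub>R \<xi> x + g t x *\<^sub>R D1 \<xi> x v)) has_derivative
      (\<lambda>u. 0 + ((G t x v *\<^sub>R D1 \<xi> x u + G2 t x u v *\<^sub>R \<xi> x) + (g t x *\<^sub>R D2 \<xi> x u v + G t x u *\<^sub>R D1 \<xi> x v)))) (at x)"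
      by (intro has_derivative_add has_derivative_const has_derivative_scaleR GD gD C2_has_derivative C2_D1_has_derivative \<xi>)
    then show ?thesis by (simp add: A_def H_def[abs_def] algebra_simps)
  qed
  have r_smooth: "time_smooth r" unfolding r_def[abs_def] power2_eq_square using rpos
    by (intro time_smooth_inverse time_smooth_add time_smooth_mult time_smooth_time time_smooth_space wc)
      (metis less_irrefl power2_eq_square)
  have g_smooth: "time_smooth g" unfolding g_def[abs_def] power2_eq_square
    by (intro time_smooth_mult time_smooth_time time_smooth_space wc r_smooth)
  have g1_smooth: "time_smooth g1" unfolding g1_def[abs_def] power2_eq_square power3_eq_cube
    by (intro time_smooth_mult time_smooth_time time_smooth_space wc r_smooth continuous_intros)
  have g2_smooth: "time_smooth g2"
  proof -
    have "g2 = (\<lambda>t x. 2 * (t * t * t) * (t * t + (- 3) * (w x * w x)) * (r t x * r t x * r t x))"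
      by (simp add: g2_def fun_eq_iff power2_eq_square power3_eq_cube)
    then show ?thesis by (simp only:) (intro time_smooth_mult time_smooth_add time_smooth_time time_smooth_space[OF wc] r_smooth
          time_smooth_space[OF continuous_on_const])
  qed
  have G_smooth: "time_smooth (\<lambda>t x. G t x v)" and G2_smooth: "time_smooth (\<lambda>t x. G2 t x u v)" for u v unfolding G_def G2_def
    by (intro time_smooth_mult time_smooth_add g1_smooth g2_smooth time_smooth_space w1c w2c)+
  have \<phi>_smooth: "time_smooth \<phi>" unfolding \<phi>_def[abs_def]
    by (intro time_smooth_add time_smooth_scaleR g_smooth time_smooth_space \<xi>c continuous_intros)
  have A_smooth: "time_smooth (\<lambda>t x. A t x v)" for v unfolding A_def
    by (intro time_smooth_add time_smooth_scaleR g_smooth G_smooth time_smooth_space[OF \<xi>c] time_smooth_space[OF D1c]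
        time_smooth_space[OF continuous_on_const])
  have H_smooth: "time_smooth (\<lambda>t x. H t x u v)" for u v unfolding H_def
    by (intro time_smooth_add time_smooth_scaleR g_smooth G_smooth G2_smooth time_smooth_space[OF \<xi>c] time_smooth_space[OF D1c]
        time_smooth_space[OF D2c])
  have Hc: "continuous_on UNIV (\<lambda>x. H t x u v)" for t u v
  proof -
    have "continuous_on UNIV (\<lambda>p. H (fst p) (snd p) u v)" using H_smooth by (simp add: time_smooth_def)
    moreover have "continuous_on UNIV (\<lambda>x::pt. (t, x))" by (intro continuous_intros)
    ultimately show ?thesis using continuous_on_compose2[of UNIV "\<lambda>p. H (fst p) (snd p) u v" UNIV "\<lambda>x. (t, x)"] by simp
  qed
  note C = C2I[OF \<phi>D AD Hc]
  have diffeo: "C2_diffeo (\<phi> t)" for t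
  proof (rule C2_diffeo_near_id[OF C(1)])
    fix x v
    let ?w = "w x" and ?s = "(w x)\<^sup>2 + t\<^sup>2"
    have s: "0 < ?s" by (rule rpos)
    have tw: "2 * (\<bar>t\<bar> * ?w) \<le> ?s" using sum_squares_ge_zero[of "\<bar>t\<bar> - ?w" 0] by (simp add: power2_eq_square algebra_simps)
    have t2: "t\<^sup>2 \<le> ?s" by simp
    have "\<bar>g1 t x\<bar> = (2 * (\<bar>t\<bar> * ?w)) * t\<^sup>2 / (?s * ?s)"
      using w0[of x] s by (simp add: g1_def r_def abs_mult power2_eq_square power3_eq_cube divide_inverse)
    also have "\<dots> \<le> (?s * ?s) / (?s * ?s)" using tw t2 s by (intro divide_right_mono mult_mono) auto
    also have "\<dots> = 1" using s mult_pos_pos[OF s s] by (intro divide_self less_imp_neq[symmetric])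
    finally have g1: "\<bar>g1 t x\<bar> \<le> 1" .
    have "\<bar>g t x\<bar> = (\<bar>t\<bar> * ?w) * ?w / ?s" using w0[of x] s by (simp add: g_def r_def abs_mult power2_eq_square divide_inverse)
    also have "\<dots> \<le> (?s / 2) * ?w / ?s" using tw s w0[of x] by (intro divide_right_mono mult_right_mono) auto
    also have "\<dots> = ?w / 2" using s w0[of x] by (simp add: field_simps less_imp_neq[symmetric])
    finally have g: "\<bar>g t x\<bar> \<le> d x / 2" using V(5)[of x] by (simp add: w_def)
    have "\<bar>w1 x v\<bar> \<le> 2 * d x * (norm x * norm v)"
      unfolding w1_def abs_mult using V(6)[of x] Cauchy_Schwarz_ineq2[of x v] d0[of x] by (intro mult_mono) auto
    then have "\<bar>G t x v\<bar> \<le> 1 * (2 * d x * (norm x * norm v))" unfolding G_def abs_mult using g1 by (intro mult_mono) auto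
    then have "norm (G t x v *\<^sub>R \<xi> x) \<le> (2 * d x * (norm x * norm v)) * norm (\<xi> x)" by (simp add: mult_right_mono)
    moreover have "norm (g t x *\<^sub>R D1 \<xi> x v) \<le> d x / 2 * (M x * norm v)"
      unfolding norm_scaleR using g M[of x v] d0[of x] by (intro mult_mono) auto
    moreover have "D1 (\<phi> t) x v - v = G t x v *\<^sub>R \<xi> x + g t x *\<^sub>R D1 \<xi> x v" by (simp add: C(2) A_def)
    ultimately have "norm (D1 (\<phi> t) x v - v) \<le> (2 * d x * (norm x * norm v)) * norm (\<xi> x) + d x / 2 * (M x * norm v)"
      by (simp only:) (intro norm_triangle_le add_mono)
    also have "\<dots> = (d x * (2 * (1 + 4 * (norm x * norm (\<xi> x)) + M x)) - 2 * d x) * norm v / 4" by (simp add: algebra_simps)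
    also have "\<dots> \<le> 1 * norm v / 4" using den[of x] d0[of x] by (intro divide_right_mono mult_right_mono) (auto simp: d_def)
    also have "\<dots> \<le> norm v / 2" by simp
    finally show "norm (D1 (\<phi> t) x v - v) \<le> norm v / 2" .
  qed
  have "((\<lambda>t. \<phi> t x) has_vector_derivative \<xi> x) (at 0)" for x
  proof -
    have nz: "w x \<noteq> 0" using w0[of x] by simp
    have "((\<lambda>t. t * (w x)\<^sup>2 * inverse ((w x)\<^sup>2 + t\<^sup>2)) has_real_derivative 1) (at 0)"
      using nz by (auto intro!: derivative_eq_intros simp: power2_eq_square field_simps)
    then have "((\<lambda>t. g t x) has_real_derivative 1) (at 0)" by (simp add: g_def r_def)
    then have "((\<lambda>t. x + g t x *\<^sub>R \<xi> x) has_vector_derivative 0 + (g 0 x *\<^sub>R 0 + 1 *\<^sub>R \<xi> x)) (at 0)"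
      by (intro has_vector_derivative_add has_vector_derivative_const has_vector_derivative_scaleR)
    then show ?thesis by (simp add: \<phi>_def)
  qed
  moreover have "\<phi> 0 = id" by (simp add: \<phi>_def g_def fun_eq_iff)
  ultimately have "diffeo_family \<phi> \<xi>" unfolding diffeo_family_def C(2,3)
    by (intro conjI exI[of _ 1] allI ballI diffeo time_smooth_C1_in_time \<phi>_smooth A_smooth H_smooth zero_less_one)
  then show ?thesis using that[of \<phi> g] by (simp add: \<phi>_def)
qed

section \<open>Osculating circles and thickness\<close>

lemma arclength_param_cong:
  assumes "arclength_param T C l J \<gamma>" and eq: "\<And>x. x \<in> C \<Longrightarrow> T' x = T x"
  shows "arclength_param T' C l J \<gamma>"
proof -
  interpret arclength_curve T C l J \<gamma> by unfold_locales (rule assms(1))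
  have T': "T' (\<gamma> s) = T (\<gamma> s)" if "s \<in> J" for s using eq that by (simp add: C_eq)
  have "B-lipschitz_on J (\<lambda>s. T' (\<gamma> s))" using B_lipschitz by (simp add: lipschitz_on_def T')
  moreover have "\<forall>s\<in>J. (\<gamma> has_vector_derivative T' (\<gamma> s)) (at s within J)" using deriv by (simp add: T')
  moreover have "\<forall>s\<in>J. norm (T' (\<gamma> s)) = 1" using unit by (simp add: T')
  ultimately show ?thesis unfolding arclength_param_def by (intro conjI l_pos C_eq J_cases exI[of _ B])
qed

lemma has_curvatureE:
  assumes "has_curvature L T x k"
  obtains C l J \<gamma> s where "C \<in> components L" "s \<in> J" "arclength_param T C l J \<gamma>" "x = \<gamma> s"
    "((\<lambda>s. T (\<gamma> s)) has_vector_derivative k) (at s within J)"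
  using assms unfolding has_curvature_def by blast

lemma has_curvature_cong:
  assumes "has_curvature L T x k" and eq: "\<And>x. x \<in> L \<Longrightarrow> T' x = T x"
  shows "has_curvature L T' x k"
proof -
  obtain C l J \<gamma> s where c: "C \<in> components L" "s \<in> J" "arclength_param T C l J \<gamma>" "x = \<gamma> s"
    "((\<lambda>s. T (\<gamma> s)) has_vector_derivative k) (at s within J)" using assms(1) by (rule has_curvatureE)
  have CL: "C \<subseteq> L" using c(1) by (rule in_components_subset)
  have "C = \<gamma> ` J" using c(3) by (simp add: arclength_param_def)
  then have "T' (\<gamma> u) = T (\<gamma> u)" if "u \<in> J" for u using that CL eq by blast
  then have "((\<lambda>s. T' (\<gamma> s)) has_vector_derivative k) (at s within J)" by (rule has_vector_derivative_transform[OF c(2) _ c(5)])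
  moreover have "arclength_param T' C l J \<gamma>" by (rule arclength_param_cong[OF c(3)]) (use CL eq in blast)
  ultimately show ?thesis using c(1,2,4) unfolding has_curvature_def by blast
qed

lemma Thi_cong:
  assumes eq: "\<And>x. x \<in> L \<Longrightarrow> T' x = T x"
  shows "Thi \<sigma> L T' = Thi \<sigma> L T"
proof -
  have "has_curvature L T' x k \<longleftrightarrow> has_curvature L T x k" for x k
    using has_curvature_cong[of L T x k T'] has_curvature_cong[of L T' x k T] eq by auto
  then have "{(x, T' x, k) |x k. has_curvature L T' x k} = {(x, T x, k) |x k. has_curvature L T x k}"
    using eq curvature_in by auto
  then have "osc_closure L T' = osc_closure L T" by (simp only: osc_closure_def)
  then show ?thesis by (simp only: Thi_def osc_radius_def)
qed

section \<open>Osculating circles and thickness of an image link\<close>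

context moved_link
begin

lemma curvature_forward:
  assumes "has_curvature L T x k"
  shows "has_curvature L' T' (f x) (push_curvature f x (T x) k)"
proof -
  obtain C l J \<gamma> s where c: "C \<in> components L" "s \<in> J" "arclength_param T C l J \<gamma>" "x = \<gamma> s"
    "((\<lambda>s. T (\<gamma> s)) has_vector_derivative k) (at s within J)" using assms(1) by (rule has_curvatureE)
  obtain l' J' \<gamma>' \<tau> where p: "arclength_param T' (f ` C) l' J' \<gamma>'" "\<tau> ` J = J'"
    "\<And>s. s \<in> J \<Longrightarrow> \<gamma>' (\<tau> s) = f (\<gamma> s)"
    "\<And>s k. s \<in> J \<Longrightarrow> ((\<lambda>s. T (\<gamma> s)) has_vector_derivative k) (at s within J) \<Longrightarrow>
       ((\<lambda>u. T' (\<gamma>' u)) has_vector_derivative push_curvature f (\<gamma> s) (T (\<gamma> s)) k) (at (\<tau> s) within J')"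
    by (rule push_arclength_param[OF c(3)]) (rule that; assumption)
  have "f ` C \<in> components L'" using c(1) by (rule image_components)
  moreover have "\<tau> s \<in> J'" using p(2) c(2) by blast
  moreover have "f x = \<gamma>' (\<tau> s)" using p(3)[OF c(2)] c(4) by simp
  ultimately show ?thesis using p(1) p(4)[OF c(2,5)] c(4) unfolding has_curvature_def by blast
qed

lemma push_tangent_inverse: "x \<in> L \<Longrightarrow> push_tangent (inv f) T' x = T x"
proof -
  assume "x \<in> L"
  then have T: "norm (T x) = 1" by (rule norm_T)
  then have "D1 f x (T x) \<noteq> 0" by (intro D1_nonzero) auto
  then show ?thesis using D1_inv[of x "T x"] linear_D1[OF inv_C2, of "f x"] T
    by (simp add: push_tangent_def inv_inv_eq[OF f_bij] sgn_div_norm linear_scale)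
qed

text \<open>\<open>curvature_forward\<close> for the inverse map. Every curvature of the image
  arises by transport, as an estimate for all of them requires.\<close>

lemma curvature_backward:
  assumes "has_curvature L' T' y k'"
  obtains x k where "has_curvature L T x k" "y = f x" "k' = push_curvature f x (T x) k"
proof -
  interpret g: moved_link L' T' "inv f" by unfold_locales (rule inverse_diffeo)
  have fgL: "inv f ` f ` L = L" by (simp add: image_image)
  define x where "x = inv f y"
  define k where "k = push_curvature (inv f) y (T' y) k'"
  have yx: "y = f x" by (simp add: x_def)
  have xL: "x \<in> L" using curvature_in[OF assms] by (auto simp: x_def)
  have "has_curvature L (push_tangent (inv f) T') x k" using g.curvature_forward[OF assms] by (simp add: fgL x_def k_def)
  then have h: "has_curvature L T x k" by (rule has_curvature_cong) (simp add: push_tangent_inverse)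
  have "push_curvature (inv (inv f)) (inv f y) (sgn (D1 (inv f) y (T' y))) (push_curvature (inv f) y (T' y) k') = k'"
    by (rule g.push_curvature_inverse[OF curvature_unit[OF assms] curvature_orthogonal[OF assms]])
  moreover have "sgn (D1 (inv f) y (T' y)) = T x"
    using push_tangent_inverse[OF xL] by (simp add: push_tangent_def[of "inv f"] inv_inv_eq[OF f_bij] yx)
  ultimately have "k' = push_curvature f x (T x) k" by (simp add: inv_inv_eq[OF f_bij] x_def[symmetric] k_def)
  with h yx show ?thesis by (rule that)
qed

text \<open>Cleared of denominators, the squared curvature is polynomial in inner products of m and
  w, so the product rule for expansions applies. The right side is the Gram determinant of w and
  m.\<close>

lemma norm_push_curvature:
  fixes k :: pt
  assumes "D1 f x u \<noteq> 0"
  defines "m \<equiv> D1 f x u" and "w \<equiv> D2 f x u u + D1 f x k"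
  shows "(norm (push_curvature f x u k))\<^sup>2 * (m \<bullet> m)^3 = (w \<bullet> w) * (m \<bullet> m) - (w \<bullet> m)\<^sup>2"
proof -
  have nz: "m \<bullet> m \<noteq> 0" using assms(1) by (simp add: m_def)
  have "push_curvature f x u k = (1 / (m \<bullet> m)) *\<^sub>R (w - ((w \<bullet> m) / (m \<bullet> m)) *\<^sub>R m)"
    by (simp add: push_curvature_def Let_def m_def w_def power2_norm_eq_inner)
  moreover have "(w - ((w \<bullet> m) / (m \<bullet> m)) *\<^sub>R m) \<bullet> (w - ((w \<bullet> m) / (m \<bullet> m)) *\<^sub>R m) * (m \<bullet> m) = (w \<bullet> w) * (m \<bullet> m) - (w \<bullet> m)\<^sup>2"
    using nz by (simp add: inner_diff_left inner_diff_right inner_commute[of m w] field_simps power2_eq_square)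
  ultimately show ?thesis
    using nz by (simp only: power2_norm_eq_inner power3_eq_cube inner_scaleR_left inner_scaleR_right) (simp add: mult_ac)
qed

end

lemma closed_Circ: "closed Circ"
proof -
  have eq: "Circ = {c. norm (fst (snd c)) = 1} \<inter> {c. snd (snd c) \<bullet> fst (snd c) = 0}" by (auto simp: Circ_def)
  show ?thesis unfolding eq by (intro closed_Int closed_Collect_eq continuous_intros)
qed

text \<open>\<open>Circ\<close> is closed, so the closure relative to it is the plain
  closure.\<close>

lemma osc_closure_eq: "osc_closure L T = closure {(x, T x, k) |x k. has_curvature L T x k}"
proof -
  let ?A = "{(x, T x, k) |x k. has_curvature L T x k}"
  have A: "?A \<subseteq> Circ" using curvature_unit curvature_orthogonal by (fastforce simp: Circ_def)
  then have "closure ?A \<subseteq> Circ" using closed_Circ by (rule closure_minimal)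
  with A show ?thesis by (simp add: osc_closure_def closure_of_subtopology Int_absorb1 euclidean_closure_of)
qed

lemma osc_closure_curvature: "has_curvature L T x k \<Longrightarrow> (x, T x, k) \<in> osc_closure L T"
  unfolding osc_closure_eq by (rule subsetD[OF closure_subset]) blast

lemma osc_closure_bound:
  assumes "\<And>x k. has_curvature L T x k \<Longrightarrow> norm k \<le> b" and "(x, u, k) \<in> osc_closure L T"
  shows "norm k \<le> b"
proof -
  have "closed {c :: pt \<times> pt \<times> pt. norm (snd (snd c)) \<le> b}" by (intro closed_Collect_le continuous_intros)
  moreover have "{(x, T x, k) |x k. has_curvature L T x k} \<subseteq> {c. norm (snd (snd c)) \<le> b}" using assms(1) by auto
  ultimately have "osc_closure L T \<subseteq> {c. norm (snd (snd c)) \<le> b}" unfolding osc_closure_eq by (intro closure_minimal)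
  then show ?thesis using assms(2) by auto
qed

lemma rho_ge:
  assumes r: "0 < r" and curv: "\<And>x k. has_curvature L T x k \<Longrightarrow> norm k \<le> 1 / r"
  shows "ereal r \<le> (INF x\<in>L. osc_radius L T x)"
proof (rule INF_greatest)
  fix x
  show "ereal r \<le> osc_radius L T x" unfolding osc_radius_def
  proof (rule INF_greatest)
    fix c assume c: "c \<in> {c \<in> osc_closure L T. fst c = x}"
    obtain y u k where cy: "c = (y, u, k)" by (cases c)
    have "norm k \<le> 1 / r" by (rule osc_closure_bound[of L T _ y u]) (use c cy curv in auto)
    then show "ereal r \<le> radius c" using r by (auto simp: radius_def cy field_simps)
  qed
qed

lemma (in link) osc_closureD:
  assumes "(x, u, k) \<in> osc_closure L T"
  shows "x \<in> L" "u = T x" "norm u = 1" "k \<bullet> u = 0"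
proof -
  have "(x, u, k) \<in> Circ" using assms unfolding osc_closure_def using closure_of_subset_topspace[of "top_of_set Circ"] by auto
  then show "norm u = 1" "k \<bullet> u = 0" by (auto simp: Circ_def)
  obtain c where c: "\<And>n. c n \<in> {(x, T x, k) |x k. has_curvature L T x k}" "c \<longlonglongrightarrow> (x, u, k)"
    using assms unfolding osc_closure_eq closure_sequential by blast
  have cn: "fst (c n) \<in> L" "fst (snd (c n)) = T (fst (c n))" for n
  proof -
    obtain x k where "c n = (x, T x, k)" "has_curvature L T x k" using c(1)[of n] by blast
    then show "fst (c n) \<in> L" "fst (snd (c n)) = T (fst (c n))" using curvature_in by auto
  qed
  have 1: "(\<lambda>n. fst (c n)) \<longlonglongrightarrow> x" using tendsto_fst[OF c(2)] by simp
  then show x: "x \<in> L" by (rule closed_sequentially[OF closed_L, rotated]) (simp add: cn(1))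
  have "(\<lambda>n. T (fst (c n))) \<longlonglongrightarrow> T x" by (rule continuous_on_tendsto_compose[OF continuous_T 1 x]) (simp add: cn(1))
  moreover have "(\<lambda>n. T (fst (c n))) \<longlonglongrightarrow> u" using tendsto_fst[OF tendsto_snd[OF c(2)]] by (simp add: cn(2))
  ultimately show "u = T x" by (rule LIMSEQ_unique[symmetric])
qed

lemma (in link) rho_le:
  assumes c: "(x, u, k) \<in> osc_closure L T" and k: "k \<noteq> 0"
  shows "(INF x\<in>L. osc_radius L T x) \<le> ereal (1 / norm k)"
proof -
  have "(INF x\<in>L. osc_radius L T x) \<le> osc_radius L T x" by (rule INF_lower[OF osc_closureD(1)[OF c]])
  also have "\<dots> \<le> radius (x, u, k)" unfolding osc_radius_def by (rule INF_lower) (simp add: c)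
  finally show ?thesis using k by (simp add: radius_def)
qed

text \<open>Here \<sigma> >= 1/2 enters: the curvature bound 1 / (\<sigma> \<delta>) implies the
  bound 2 / \<delta>, under which \<open>reach_ge\<close> gives reach at least \<delta> / 2.\<close>

lemma (in link) Thi_ge:
  assumes ne: "L \<noteq> {}" and \<sigma>: "1/2 \<le> \<sigma>" and d: "0 < \<delta>"
    and curv: "\<And>x k. has_curvature L T x k \<Longrightarrow> norm k * (\<sigma> * \<delta>) \<le> 1"
    and crit: "\<And>x y. critical_pair L T x y \<Longrightarrow> \<delta> \<le> norm (x - y)"
  shows "ereal \<delta> \<le> Thi \<sigma> L T"
proof -
  have sd: "0 < \<sigma> * \<delta>" using \<sigma> d by simp
  have c: "norm k \<le> 1 / (\<sigma> * \<delta>)" if "has_curvature L T x k" for x k using curv[OF that] sd by (simp add: pos_le_divide_eq)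
  have "ereal (\<delta> / 2) \<le> reach L"
  proof (rule reach_ge[OF ne])
    fix x k assume "has_curvature L T x k"
    then have "norm k \<le> 1 / (\<sigma> * \<delta>)" by (rule c)
    also have "\<dots> \<le> 1 / (\<delta> / 2)" using \<sigma> d by (intro divide_left_mono) auto
    finally show "norm k \<le> 1 / (\<delta> / 2)" .
  qed (use d crit in auto)
  then have "ereal 2 * ereal (\<delta> / 2) \<le> ereal 2 * reach L" by (rule ereal_mult_left_mono) simp
  moreover have "ereal (1 / \<sigma>) * ereal (\<sigma> * \<delta>) \<le> ereal (1 / \<sigma>) * (INF x\<in>L. osc_radius L T x)"
    using \<sigma> by (intro ereal_mult_left_mono rho_ge sd c) auto
  ultimately show ?thesis using \<sigma> by (auto simp: Thi_def)
qed

lemma (in link) Thi_le_radius: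
  assumes c: "(x, u, k) \<in> osc_closure L T" and k: "k \<noteq> 0" and \<sigma>: "0 < \<sigma>"
  shows "Thi \<sigma> L T \<le> ereal (1 / (\<sigma> * norm k))"
proof -
  have "Thi \<sigma> L T \<le> ereal (1 / \<sigma>) * (INF x\<in>L. osc_radius L T x)" by (simp add: Thi_def)
  also have "\<dots> \<le> ereal (1 / \<sigma>) * ereal (1 / norm k)" using \<sigma> by (intro ereal_mult_left_mono rho_le[OF c k]) auto
  finally show ?thesis by simp
qed

lemma Thi_le_reach: "ereal \<delta> \<le> Thi \<sigma> L T \<Longrightarrow> ereal (\<delta> / 2) \<le> reach L"
  by (cases "reach L") (auto simp: Thi_def)

section \<open>Links of thickness one\<close>

locale unit_link = link +
  fixes \<sigma> :: real
  assumes \<sigma>: "1/2 \<le> \<sigma>" and Thi_1: "Thi \<sigma> L T = 1"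
begin

lemma \<sigma>_pos: "0 < \<sigma>"
  using \<sigma> by simp

lemma reach_half: "ereal (1/2) \<le> reach L"
  by (rule Thi_le_reach[of _ \<sigma> L T]) (simp add: Thi_1 one_ereal_def)

lemma L_nonempty: "L \<noteq> {}"
proof
  assume "L = {}"
  \<comment> \<open>\<open>infdist\<close> to the empty set is 0 and no nearest point exists, so
    only r = 0 remains in the supremum.\<close>
  then have "reach L = Sup {0}" unfolding reach_def by (intro arg_cong[where f = Sup]) (auto simp: infdist_def zero_ereal_def)
  then show False using reach_half by (simp add: zero_ereal_def)
qed

lemma osc_bound:
  assumes "(x, u, k) \<in> osc_closure L T"
  shows "norm k * \<sigma> \<le> 1"
proof (cases "k = 0")
  case False
  then show ?thesis using Thi_le_radius[OF assms False \<sigma>_pos] \<sigma>_pos by (simp add: Thi_1 one_ereal_def field_simps)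
qed simp

lemma compact_osc: "compact (osc_closure L T)"
proof -
  let ?A = "{(x, T x, k) |x k. has_curvature L T x k}"
  have "?A \<subseteq> L \<times> (cball 0 1 \<times> cball 0 (1 / \<sigma>))"
  proof
    fix c assume "c \<in> ?A"
    then obtain x k where c: "c = (x, T x, k)" "has_curvature L T x k" by blast
    then show "c \<in> L \<times> (cball 0 1 \<times> cball 0 (1 / \<sigma>))"
      using osc_bound[OF osc_closure_curvature[OF c(2)]] \<sigma>_pos curvature_in[OF c(2)] curvature_unit[OF c(2)]
      by (simp add: field_simps)
  qed
  then have "bounded ?A" by (rule bounded_subset[rotated]) (intro bounded_Times compact_imp_bounded compact_L bounded_cball)
  then show ?thesis unfolding osc_closure_eq by simp
qed

lemma kink_iff: "(x, u, k) \<in> Kink \<sigma> L T \<longleftrightarrow> (x, u, k) \<in> osc_closure L T \<and> norm k * \<sigma> = 1"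
  using \<sigma>_pos by (auto simp: Kink_def Thi_1 radius_def one_ereal_def field_simps)

lemma strut_iff: "(x, y) \<in> Strut \<sigma> L T \<longleftrightarrow> x \<in> L \<and> y \<in> L \<and> norm (y - x) = 1
    \<and> tangential L T x (y - x) = 0 \<and> tangential L T y (x - y) = 0"
  by (auto simp: Strut_def Thi_1 one_ereal_def critical_iff norm_minus_commute[of x y])

lemma strut_swap: "(x, y) \<in> Strut \<sigma> L T \<Longrightarrow> (y, x) \<in> Strut \<sigma> L T"
  by (auto simp: strut_iff norm_minus_commute)

lemma compact_kink: "compact (Kink \<sigma> L T)"
proof -
  have "Kink \<sigma> L T = osc_closure L T \<inter> {c. norm (snd (snd c)) * \<sigma> = 1}" by (auto simp: kink_iff)
  moreover have "closed {c :: pt \<times> pt \<times> pt. norm (snd (snd c)) * \<sigma> = 1}" by (intro closed_Collect_eq continuous_intros)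
  ultimately show ?thesis using compact_osc by (simp add: compact_Int_closed)
qed

end

text \<open>\<open>tangential\<close> changes its form at endpoints. This is harmless in a limit: a
  sequence converging to x eventually avoids all endpoints other than x, and at the remaining points
  \<open>tangential\<close> is the two-sided expression, which dominates the one-sided expression
  that may apply at x.\<close>

lemma (in link) tangential_limit:
  assumes x: "x \<in> L" and xn: "\<And>n. X n \<in> L" "X \<longlonglongrightarrow> x" and v: "V \<longlonglongrightarrow> v"
    and le: "\<And>n. tangential L T (X n) (V n) \<le> b n" and b: "b \<longlonglongrightarrow> 0"
  shows "tangential L T x v = 0"
proof -
  define h where "h s = (if x \<in> initial_points L T then max 0 s else if x \<in> final_points L T then max 0 (- s) else \<bar>s\<bar>)" for s :: real
  have hc: "continuous_on UNIV h"
    by (cases "x \<in> initial_points L T"; cases "x \<in> final_points L T") (simp_all add: h_def[abs_def], (intro continuous_intros)+)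
  have "finite (boundary L T - {x})" using finite_boundary by simp
  then have "open (- (boundary L T - {x}))" by (intro open_Compl finite_imp_closed)
  then have ev: "\<forall>\<^sub>F n in sequentially. X n \<in> - (boundary L T - {x})" by (rule topological_tendstoD[OF xn(2)]) simp
  have "\<forall>\<^sub>F n in sequentially. h (V n \<bullet> T (X n)) \<le> b n" using ev
  proof eventually_elim
    case (elim n)
    then have "h (V n \<bullet> T (X n)) \<le> tangential L T (X n) (V n)"
      by (cases "X n = x") (auto simp: h_def tangential_def boundary_def)
    then show ?case using le[of n] by linarith
  qed
  moreover have "(\<lambda>n. h (V n \<bullet> T (X n))) \<longlonglongrightarrow> h (v \<bullet> T x)"
  proof -
    have "(\<lambda>n. T (X n)) \<longlonglongrightarrow> T x" by (rule continuous_on_tendsto_compose[OF continuous_T xn(2) x]) (simp add: xn(1))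
    then have "(\<lambda>n. V n \<bullet> T (X n)) \<longlonglongrightarrow> v \<bullet> T x" by (intro tendsto_inner v)
    then show ?thesis by (rule continuous_on_tendsto_compose[OF hc]) auto
  qed
  ultimately have "h (v \<bullet> T x) \<le> 0" using b by (intro tendsto_le[OF sequentially_bot b])
  moreover have "h (v \<bullet> T x) = tangential L T x v" by (simp add: h_def tangential_def)
  ultimately show ?thesis using tangential_nonneg[of L T x v] by linarith
qed

lemma (in unit_link) compact_strut: "compact (Strut \<sigma> L T)"
proof -
  have "closed (Strut \<sigma> L T)" unfolding closed_sequential_limits
  proof (intro allI impI, elim conjE)
    fix c z assume c: "\<forall>n. c n \<in> Strut \<sigma> L T" and cz: "c \<longlonglongrightarrow> z"
    obtain x y where z: "z = (x, y)" by (cases z)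
    have X: "(\<lambda>n. fst (c n)) \<longlonglongrightarrow> x" and Y: "(\<lambda>n. snd (c n)) \<longlonglongrightarrow> y" using tendsto_fst[OF cz] tendsto_snd[OF cz] by (simp_all add: z)
    have s: "fst (c n) \<in> L" "snd (c n) \<in> L" "norm (snd (c n) - fst (c n)) = 1"
      "tangential L T (fst (c n)) (snd (c n) - fst (c n)) = 0" "tangential L T (snd (c n)) (fst (c n) - snd (c n)) = 0" for n
      using c[rule_format, of n] strut_iff[of "fst (c n)" "snd (c n)"] by simp_all
    have x: "x \<in> L" and y: "y \<in> L"
      by (rule closed_sequentially[OF closed_L _ X], simp add: s(1)) (rule closed_sequentially[OF closed_L _ Y], simp add: s(2))
    have "(\<lambda>n. norm (snd (c n) - fst (c n))) \<longlonglongrightarrow> norm (y - x)" by (intro tendsto_intros X Y)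
    then have "norm (y - x) = 1" unfolding s(3) by (simp add: LIMSEQ_const_iff)
    moreover have "tangential L T x (y - x) = 0"
      by (rule tangential_limit[OF x s(1) X tendsto_diff[OF Y X], of "\<lambda>n. 0"]) (simp_all add: s(4))
    moreover have "tangential L T y (x - y) = 0"
      by (rule tangential_limit[OF y s(2) Y tendsto_diff[OF X Y], of "\<lambda>n. 0"]) (simp_all add: s(5))
    ultimately show "z \<in> Strut \<sigma> L T" using x y by (simp add: z strut_iff)
  qed
  moreover have "Strut \<sigma> L T \<subseteq> L \<times> L" by (auto simp: strut_iff)
  ultimately show ?thesis
    using compact_Int_closed[OF compact_Times[OF compact_L compact_L], of "Strut \<sigma> L T"] by (simp only: Int_absorb1)
qed

section \<open>The variation of thickness\<close>

lemma expansion_cong_eventually: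
  assumes F: "expansion X F F0 G" and eq: "\<forall>\<^sub>F t in at_right 0. \<forall>c\<in>X. F t c = F' t c"
  shows "expansion X F' F0 G"
proof -
  have "\<forall>\<^sub>F t in at_right 0. \<forall>c\<in>X. norm (F' t c - F0 c - t *\<^sub>R G c) \<le> e * t" if "0 < e" for e
    using expansionD[OF F that] eq by eventually_elim simp
  then show ?thesis using F by (simp add: expansion_def)
qed

lemma D1_id: "D1 id x v = v"
proof -
  have "D1 id x = (\<lambda>v. v)" unfolding id_def by (rule D1_eqI) (rule has_derivative_ident)
  then show ?thesis by simp
qed

lemma D2_id: "D2 id x u v = 0"
  using D2_eqI[of id v "\<lambda>_. 0" x u] by (simp add: D1_id)

locale variation = unit_link L T \<sigma> for L T \<sigma> +
  fixes \<phi> :: "real \<Rightarrow> pt \<Rightarrow> pt" and \<xi> :: "pt \<Rightarrow> pt"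
  assumes \<xi>_C2: "C2 \<xi>" and family: "diffeo_family \<phi> \<xi>"
begin

abbreviation L\<^sub>t where "L\<^sub>t t \<equiv> \<phi> t ` L"
abbreviation T\<^sub>t where "T\<^sub>t t \<equiv> push_tangent (\<phi> t) T"

definition smooth_until :: "real \<Rightarrow> bool" where
  "smooth_until \<tau> \<longleftrightarrow> \<tau> > 0 \<and> (\<forall>t\<in>{-\<tau><..<\<tau>}. C2_diffeo (\<phi> t)) \<and> C1_in_time {-\<tau><..<\<tau>} \<phi>
        \<and> (\<forall>v. C1_in_time {-\<tau><..<\<tau>} (\<lambda>t x. D1 (\<phi> t) x v))
        \<and> (\<forall>u v. C1_in_time {-\<tau><..<\<tau>} (\<lambda>t x. D2 (\<phi> t) x u v))"

definition \<tau> :: real where "\<tau> = (SOME \<tau>. smooth_until \<tau>)"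

lemma \<tau>_pos: "0 < \<tau>" and diffeo_t: "t \<in> {-\<tau><..<\<tau>} \<Longrightarrow> C2_diffeo (\<phi> t)" and flow_time: "C1_in_time {-\<tau><..<\<tau>} \<phi>"
  and D1_time: "C1_in_time {-\<tau><..<\<tau>} (\<lambda>t x. D1 (\<phi> t) x v)"
  and D2_time: "C1_in_time {-\<tau><..<\<tau>} (\<lambda>t x. D2 (\<phi> t) x u v)"
proof -
  have "\<exists>\<tau>. smooth_until \<tau>" using family unfolding diffeo_family_def smooth_until_def by blast
  then have "smooth_until \<tau>" unfolding \<tau>_def by (rule someI_ex)
  then show "0 < \<tau>" "t \<in> {-\<tau><..<\<tau>} \<Longrightarrow> C2_diffeo (\<phi> t)" "C1_in_time {-\<tau><..<\<tau>} \<phi>"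
    "C1_in_time {-\<tau><..<\<tau>} (\<lambda>t x. D1 (\<phi> t) x v)" "C1_in_time {-\<tau><..<\<tau>} (\<lambda>t x. D2 (\<phi> t) x u v)"
    unfolding smooth_until_def by blast+
qed

lemma \<phi>_0: "\<phi> 0 = id" and velocity: "((\<lambda>t. \<phi> t x) has_vector_derivative \<xi> x) (at 0)"
  using family by (simp_all add: diffeo_family_def)

lemma C2_t: "t \<in> {-\<tau><..<\<tau>} \<Longrightarrow> C2 (\<phi> t)"
  using diffeo_t by (simp add: C2_diffeo_def)

lemma small: "\<forall>\<^sub>F t in at_right 0. 0 < t \<and> t < \<tau>"
  by (rule eventually_at_right_0[OF \<tau>_pos])

lemma moved_t: "0 < t \<Longrightarrow> t < \<tau> \<Longrightarrow> moved_link L T (\<phi> t)"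
  by (intro moved_link.intro link_axioms C2_diffeomorphism.intro diffeo_t) simp

lemma D1_velocity: "((\<lambda>t. D1 (\<phi> t) x v) has_vector_derivative D1 \<xi> x v) (at 0)"
proof (rule derivative_interchange[OF \<tau>_pos _ D1_time _ velocity C2_has_derivative[OF \<xi>_C2]])
  show "(\<phi> t has_derivative D1 (\<phi> t) x) (at x)" if "t \<in> {-\<tau><..<\<tau>}" for t x by (rule C2_has_derivative[OF C2_t[OF that]])
  show "continuous_on UNIV (\<lambda>x. D1 (\<phi> 0) x v)" by (simp add: \<phi>_0 D1_id)
qed

lemma D2_velocity: "((\<lambda>t. D2 (\<phi> t) x u v) has_vector_derivative D2 \<xi> x u v) (at 0)"
proof (rule derivative_interchange[OF \<tau>_pos _ D2_time _ D1_velocity C2_D1_has_derivative[OF \<xi>_C2]])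
  show "((\<lambda>y. D1 (\<phi> t) y v) has_derivative (\<lambda>u. D2 (\<phi> t) x u v)) (at x)" if "t \<in> {-\<tau><..<\<tau>}" for t x
    by (rule C2_D1_has_derivative[OF C2_t[OF that]])
  show "continuous_on UNIV (\<lambda>x. D2 (\<phi> 0) x u v)" by (simp add: \<phi>_0 D2_id)
qed

lemma expansion_flow: "compact X \<Longrightarrow> expansion X \<phi> (\<lambda>x. x) \<xi>"
  using C1_in_time_expansion(1)[OF \<tau>_pos flow_time velocity, of X] by (simp add: \<phi>_0 id_def)

lemma expansion_D1: "compact X \<Longrightarrow> expansion X (\<lambda>t x. D1 (\<phi> t) x v) (\<lambda>x. v) (\<lambda>x. D1 \<xi> x v)"
  using C1_in_time_expansion(1)[OF \<tau>_pos D1_time D1_velocity, of X] by (simp add: \<phi>_0 D1_id)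

lemma expansion_D2: "compact X \<Longrightarrow> expansion X (\<lambda>t x. D2 (\<phi> t) x u v) (\<lambda>x. 0) (\<lambda>x. D2 \<xi> x u v)"
  using C1_in_time_expansion(1)[OF \<tau>_pos D2_time D2_velocity, of X] by (simp add: \<phi>_0 D2_id)

text \<open>Basis expansion reduces a moving direction to fixed ones, for which smoothness in time
  is given.\<close>

lemma expansion_D1_arg:
  assumes a: "bounded (a ` X)" and b: "b ` X \<subseteq> L"
  shows "expansion X (\<lambda>t c. D1 (\<phi> t) (b c) (a c)) a (\<lambda>c. D1 \<xi> (b c) (a c))"
proof -
  have "expansion X (\<lambda>t c. \<Sum>i\<in>UNIV. a c $ i *\<^sub>R D1 (\<phi> t) (b c) (axis i 1)) (\<lambda>c. \<Sum>i\<in>UNIV. a c $ i *\<^sub>R axis i 1)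
     (\<lambda>c. \<Sum>i\<in>UNIV. 0 *\<^sub>R axis i 1 + a c $ i *\<^sub>R D1 \<xi> (b c) (axis i 1))"
  proof (intro expansion_sum finite expansion_prod[OF bounded_bilinear_scaleR])
    fix i :: 3
    have "bounded ((\<lambda>v. v $ i) ` a ` X)" by (rule bounded_linear_image[OF a bounded_linear_vec_nth])
    then show "expansion X (\<lambda>t c. a c $ i) (\<lambda>c. a c $ i) (\<lambda>c. 0)" by (intro expansion_const) (simp add: image_image)
    show "expansion X (\<lambda>t c. D1 (\<phi> t) (b c) (axis i 1)) (\<lambda>c. axis i 1) (\<lambda>c. D1 \<xi> (b c) (axis i 1))"
      by (rule expansion_compose[OF expansion_D1[OF compact_L] b])
  qed
  then have "expansion X (\<lambda>t c. \<Sum>i\<in>UNIV. a c $ i *\<^sub>R D1 (\<phi> t) (b c) (axis i 1)) a (\<lambda>c. D1 \<xi> (b c) (a c))"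
    by (rule expansion_cong) (simp_all add: vec_sum[symmetric] D1_sum[OF \<xi>_C2, symmetric])
  then show ?thesis
  proof (rule expansion_cong_eventually)
    show "\<forall>\<^sub>F t in at_right 0. \<forall>c\<in>X. (\<Sum>i\<in>UNIV. a c $ i *\<^sub>R D1 (\<phi> t) (b c) (axis i 1)) = D1 (\<phi> t) (b c) (a c)"
      using small by eventually_elim (simp add: D1_sum[OF C2_t, symmetric])
  qed
qed

lemma expansion_D2_arg:
  assumes a: "bounded (a ` X)" and b: "b ` X \<subseteq> L"
  shows "expansion X (\<lambda>t c. D2 (\<phi> t) (b c) (a c) (a c)) (\<lambda>c. 0) (\<lambda>c. D2 \<xi> (b c) (a c) (a c))"
proof -
  have c: "expansion X (\<lambda>t c. a c $ i) (\<lambda>c. a c $ i) (\<lambda>c. 0)" for i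
  proof -
    have "bounded ((\<lambda>v. v $ i) ` a ` X)" by (rule bounded_linear_image[OF a bounded_linear_vec_nth])
    then show ?thesis by (intro expansion_const) (simp add: image_image)
  qed
  have "expansion X (\<lambda>t c. \<Sum>i\<in>UNIV. \<Sum>j\<in>UNIV. (a c $ i * a c $ j) *\<^sub>R D2 (\<phi> t) (b c) (axis j 1) (axis i 1))
     (\<lambda>c. \<Sum>i\<in>UNIV. \<Sum>j\<in>UNIV. (a c $ i * a c $ j) *\<^sub>R 0)
     (\<lambda>c. \<Sum>i\<in>UNIV. \<Sum>j\<in>UNIV. (0 * a c $ j + a c $ i * 0) *\<^sub>R 0 + (a c $ i * a c $ j) *\<^sub>R D2 \<xi> (b c) (axis j 1) (axis i 1))"
    by (intro expansion_sum finite expansion_prod[OF bounded_bilinear_scaleR] expansion_prod[OF bounded_bilinear_mult] c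
        expansion_compose[OF expansion_D2[OF compact_L] b])
  then have "expansion X (\<lambda>t c. \<Sum>i\<in>UNIV. \<Sum>j\<in>UNIV. (a c $ i * a c $ j) *\<^sub>R D2 (\<phi> t) (b c) (axis j 1) (axis i 1)) (\<lambda>c. 0)
      (\<lambda>c. D2 \<xi> (b c) (a c) (a c))" by (rule expansion_cong) (simp_all add: D2_sum2[OF \<xi>_C2, symmetric])
  then show ?thesis
  proof (rule expansion_cong_eventually)
    show "\<forall>\<^sub>F t in at_right 0. \<forall>c\<in>X. (\<Sum>i\<in>UNIV. \<Sum>j\<in>UNIV. (a c $ i * a c $ j) *\<^sub>R D2 (\<phi> t) (b c) (axis j 1) (axis i 1))
        = D2 (\<phi> t) (b c) (a c) (a c)" using small by eventually_elim (simp add: D2_sum2[OF C2_t, symmetric])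
  qed
qed

text \<open>An error of order t alone would say nothing about pairs that are close together; the
  mean value inequality supplies the factor |y - x|.\<close>

lemma flow_estimates:
  obtains C where "0 < C" "\<forall>\<^sub>F t in at_right 0. 0 < t \<and> t < \<tau>
      \<and> (\<forall>x\<in>L. \<forall>y\<in>L. norm (\<phi> t y - \<phi> t x - (y - x)) \<le> C * t * norm (y - x))
      \<and> (\<forall>x\<in>L. norm (T\<^sub>t t (\<phi> t x) - T x) \<le> C * t)"
proof -
  obtain R where R: "L \<subseteq> cball 0 R" using bounded_subset_ballD[OF compact_imp_bounded[OF compact_L], of 0] ball_subset_cball by blast
  have "\<exists>B>0. \<forall>\<^sub>F t in at_right 0. \<forall>x\<in>cball 0 R. norm (D1 (\<phi> t) x (axis i 1) - axis i 1) \<le> B * t" for i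
  proof -
    have ex: "expansion (cball 0 R) (\<lambda>t x. D1 (\<phi> t) x (axis i 1)) (\<lambda>x. axis i 1) (\<lambda>x. D1 \<xi> x (axis i 1))"
      by (rule expansion_D1) simp
    obtain B where B: "0 < B" "\<And>x. x \<in> cball 0 R \<Longrightarrow> norm (D1 \<xi> x (axis i 1)) \<le> B"
      by (rule expansion_bound[OF ex]) (rule that; assumption)
    have "\<forall>\<^sub>F t in at_right 0. \<forall>x\<in>cball 0 R. norm (D1 (\<phi> t) x (axis i 1) - axis i 1) \<le> (1 + B) * t"
      using expansionD[OF ex zero_less_one] small
    proof eventually_elim
      case (elim t)
      show ?case
      proof
        fix x :: pt assume x: "x \<in> cball 0 R"
        have "norm (D1 (\<phi> t) x (axis i 1) - axis i 1)
            \<le> norm (D1 (\<phi> t) x (axis i 1) - axis i 1 - t *\<^sub>R D1 \<xi> x (axis i 1)) + norm (t *\<^sub>R D1 \<xi> x (axis i 1))"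
          using norm_triangle_ineq[of "D1 (\<phi> t) x (axis i 1) - axis i 1 - t *\<^sub>R D1 \<xi> x (axis i 1)" "t *\<^sub>R D1 \<xi> x (axis i 1)"]
          by (simp only: diff_add_cancel)
        also have "\<dots> \<le> 1 * t + t * B" using elim x B(2)[OF x] by (intro add_mono) (auto intro: mult_left_mono)
        finally show "norm (D1 (\<phi> t) x (axis i 1) - axis i 1) \<le> (1 + B) * t" by (simp add: algebra_simps)
      qed
    qed
    then show ?thesis using B(1) by (intro exI[of _ "1 + B"]) auto
  qed
  then have "\<forall>i. \<exists>B>0. \<forall>\<^sub>F t in at_right 0. \<forall>x\<in>cball 0 R. norm (D1 (\<phi> t) x (axis i 1) - axis i 1) \<le> B * t" ..
  from choice[OF this] obtain B
    where B': "\<forall>i. 0 < B i \<and> (\<forall>\<^sub>F t in at_right 0. \<forall>x\<in>cball 0 R. norm (D1 (\<phi> t) x (axis i 1) - axis i 1) \<le> B i * t)" ..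
  note B = conjunct1[OF B'[rule_format]] conjunct2[OF B'[rule_format]]
  define C where "C = (\<Sum>i\<in>UNIV. B i)"
  have C: "0 < C" unfolding C_def by (rule sum_pos) (auto simp: B(1))
  have "\<forall>\<^sub>F t in at_right 0. \<forall>i\<in>UNIV. \<forall>x\<in>cball 0 R. norm (D1 (\<phi> t) x (axis i 1) - axis i 1) \<le> B i * t"
    by (rule eventually_ball_finite) (simp_all only: finite B(2) ball_UNIV, simp)
  then have "\<forall>\<^sub>F t in at_right 0. 0 < t \<and> t < \<tau>
      \<and> (\<forall>x\<in>L. \<forall>y\<in>L. norm (\<phi> t y - \<phi> t x - (y - x)) \<le> (2 * C) * t * norm (y - x))
      \<and> (\<forall>x\<in>L. norm (T\<^sub>t t (\<phi> t x) - T x) \<le> (2 * C) * t)" using small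
  proof eventually_elim
    case (elim t)
    then have t: "0 < t" "t < \<tau>" by auto
    interpret m: moved_link L T "\<phi> t" by (rule moved_t[OF t])
    have D: "norm (D1 (\<phi> t) x v - v) \<le> C * t * norm v" if x: "x \<in> cball 0 R" for x v
    proof -
      have "D1 (\<phi> t) x v - v = (\<Sum>i\<in>UNIV. v $ i *\<^sub>R (D1 (\<phi> t) x (axis i 1) - axis i 1))"
        unfolding scaleR_diff_right sum_subtractf D1_sum[OF m.f_C2, symmetric] vec_sum[symmetric] ..
      also have "norm \<dots> \<le> (\<Sum>i\<in>UNIV. norm v * (B i * t))"
        using elim(1) x by (intro sum_norm_le) (simp, intro mult_mono component_le_norm_cart, auto)
      also have "\<dots> = C * t * norm v" by (simp add: C_def sum_distrib_left sum_distrib_right mult_ac)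
      finally show ?thesis .
    qed
    have "norm (\<phi> t y - \<phi> t x - (y - x)) \<le> (2 * C) * t * norm (y - x)" if "x \<in> L" "y \<in> L" for x y
    proof -
      have "norm ((\<phi> t y - y) - (\<phi> t x - x)) \<le> (C * t) * norm (y - x)"
      proof (rule differentiable_bound[where S = "cball 0 R" and f' = "\<lambda>x v. D1 (\<phi> t) x v - v"])
        show "((\<lambda>x. \<phi> t x - x) has_derivative (\<lambda>v. D1 (\<phi> t) x v - v)) (at x within cball 0 R)" for x
          by (intro has_derivative_diff has_derivative_ident has_derivative_at_withinI[OF C2_has_derivative[OF m.f_C2]])
        show "onorm (\<lambda>v. D1 (\<phi> t) x v - v) \<le> C * t" if "x \<in> cball 0 R" for x using D[OF that] by (rule onorm_le)
        show "y \<in> cball 0 R" "x \<in> cball 0 R" using R \<open>x \<in> L\<close> \<open>y \<in> L\<close> by auto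
      qed auto
      moreover have "(\<phi> t y - y) - (\<phi> t x - x) = \<phi> t y - \<phi> t x - (y - x)" by simp
      moreover have "(C * t) * norm (y - x) \<le> (2 * C) * t * norm (y - x)" using C t by (intro mult_right_mono) auto
      ultimately show ?thesis by (simp only:)
    qed
    moreover have "norm (T\<^sub>t t (\<phi> t x) - T x) \<le> (2 * C) * t" if x: "x \<in> L" for x
    proof -
      have "norm (sgn (T x) - sgn (D1 (\<phi> t) x (T x))) \<le> 2 / 1 * norm (T x - D1 (\<phi> t) x (T x))"
        by (rule sgn_lipschitz) (simp_all add: norm_T[OF x])
      also have "\<dots> \<le> 2 * (C * t * norm (T x))" using D[of x "T x"] R x by (auto simp: norm_minus_commute)
      finally show ?thesis by (simp add: m.T'_f norm_T[OF x] sgn_div_norm norm_minus_commute)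
    qed
    ultimately show ?case using t by blast
  qed
  then show ?thesis using C that[of "2 * C"] by simp
qed

text \<open>A diffeomorphism preserves whether a point is initial, final or neither, and each of the
  three expressions in \<open>tangential\<close> is 1-Lipschitz in the product of chord and
  tangent.\<close>

lemma tangential_estimate:
  obtains C where "0 < C" "\<forall>\<^sub>F t in at_right 0. 0 < t \<and> t < \<tau> \<and>
      (\<forall>x\<in>L. \<forall>y\<in>L. \<bar>tangential (L\<^sub>t t) (T\<^sub>t t) (\<phi> t x) (\<phi> t y - \<phi> t x) - tangential L T x (y - x)\<bar>
        \<le> C * t * norm (y - x))"
proof -
  obtain C where C: "0 < C" "\<forall>\<^sub>F t in at_right 0. 0 < t \<and> t < \<tau>
      \<and> (\<forall>x\<in>L. \<forall>y\<in>L. norm (\<phi> t y - \<phi> t x - (y - x)) \<le> C * t * norm (y - x))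
      \<and> (\<forall>x\<in>L. norm (T\<^sub>t t (\<phi> t x) - T x) \<le> C * t)" by (rule flow_estimates) (rule that; assumption)
  have "\<forall>\<^sub>F t in at_right 0. 0 < t \<and> t < \<tau> \<and>
      (\<forall>x\<in>L. \<forall>y\<in>L. \<bar>tangential (L\<^sub>t t) (T\<^sub>t t) (\<phi> t x) (\<phi> t y - \<phi> t x) - tangential L T x (y - x)\<bar>
        \<le> (2 * C) * t * norm (y - x))" using C(2)
  proof eventually_elim
    case (elim t)
    then have t: "0 < t" "t < \<tau>" by auto
    interpret m: moved_link L T "\<phi> t" by (rule moved_t[OF t])
    have "\<bar>tangential (L\<^sub>t t) (T\<^sub>t t) (\<phi> t x) (\<phi> t y - \<phi> t x) - tangential L T x (y - x)\<bar>
        \<le> (2 * C) * t * norm (y - x)" if xy: "x \<in> L" "y \<in> L" for x y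
    proof -
      let ?v = "y - x" and ?w = "\<phi> t y - \<phi> t x" and ?T = "T\<^sub>t t (\<phi> t x)"
      have u: "norm ?T = 1" using m.moved.norm_T[of "\<phi> t x"] xy by simp
      have "?w \<bullet> ?T - ?v \<bullet> T x = (?w - ?v) \<bullet> ?T + ?v \<bullet> (?T - T x)" by (simp add: inner_diff_left inner_diff_right)
      also have "\<bar>\<dots>\<bar> \<le> norm (?w - ?v) * norm ?T + norm ?v * norm (?T - T x)"
        using Cauchy_Schwarz_ineq2[of "?w - ?v" ?T] Cauchy_Schwarz_ineq2[of ?v "?T - T x"] by linarith
      also have "\<dots> \<le> C * t * norm ?v + norm ?v * (C * t)" using elim xy by (intro add_mono mult_left_mono) (auto simp: u)
      finally have b: "\<bar>?w \<bullet> ?T - ?v \<bullet> T x\<bar> \<le> (2 * C) * t * norm ?v" by (simp add: algebra_simps)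
      have "\<bar>tangential (L\<^sub>t t) (T\<^sub>t t) (\<phi> t x) ?w - tangential L T x ?v\<bar> \<le> \<bar>?w \<bullet> ?T - ?v \<bullet> T x\<bar>"
        unfolding tangential_def m.endpoints_f[OF xy(1)] by (cases "x \<in> initial_points L T"; cases "x \<in> final_points L T") auto
      then show ?thesis using b by linarith
    qed
    then show ?case using t by blast
  qed
  then show ?thesis using C(1) that[of "2 * C"] by simp
qed

end

text \<open>The derivative of |x - y| for a chord of length 1, equivalently half the derivative of
  the squared length.\<close>

definition strut_variation :: "(pt \<Rightarrow> pt) \<Rightarrow> pt \<times> pt \<Rightarrow> real" where
  "strut_variation \<xi> p = (fst p - snd p) \<bullet> (\<xi> (fst p) - \<xi> (snd p))"

lemma continuous_strut_variation: "C2 \<xi> \<Longrightarrow> continuous_on S (strut_variation \<xi>)"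
  unfolding strut_variation_def[abs_def]
  by (intro continuous_intros continuous_on_compose2[OF C2_continuous[of \<xi> UNIV]]) auto

context unit_link
begin

definition kink_variation :: "(pt \<Rightarrow> pt) \<Rightarrow> pt \<times> pt \<times> pt \<Rightarrow> real" where
  "kink_variation \<xi> c = radius_variation \<xi> c / \<sigma>"

text \<open>At a kink 1 / |k| is \<sigma>; the formula becomes free of quotients, hence continuous
  in the circle.\<close>

lemma kink_variation_eq:
  assumes "c \<in> Kink \<sigma> L T"
  shows "kink_variation \<xi> c = 2 * (fst (snd c) \<bullet> D1 \<xi> (fst c) (fst (snd c)))
     - \<sigma>\<^sup>2 * (snd (snd c) \<bullet> (D2 \<xi> (fst c) (fst (snd c)) (fst (snd c)) + D1 \<xi> (fst c) (snd (snd c))))"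
proof -
  obtain x u k where c: "c = (x, u, k)" by (cases c)
  have "norm k * \<sigma> = 1" using assms by (simp add: c kink_iff)
  then have "1 / norm k = \<sigma>" by (metis mult_zero_left nonzero_divide_eq_eq zero_neq_one mult.commute)
  then have "radius_variation \<xi> c = 2 * \<sigma> * (u \<bullet> D1 \<xi> x u) - \<sigma>^3 * (k \<bullet> (D2 \<xi> x u u + D1 \<xi> x k))"
    unfolding radius_variation_def c prod.case Let_def by (simp only:)
  then show ?thesis using \<sigma>_pos by (simp add: kink_variation_def c diff_divide_distrib power3_eq_cube power2_eq_square)
qed

lemma continuous_kink_variation:
  assumes "C2 \<xi>"
  shows "continuous_on (Kink \<sigma> L T) (kink_variation \<xi>)"
proof -
  have "continuous_on (Kink \<sigma> L T) (\<lambda>c. 2 * (fst (snd c) \<bullet> D1 \<xi> (fst c) (fst (snd c)))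
     - \<sigma>\<^sup>2 * (snd (snd c) \<bullet> (D2 \<xi> (fst c) (fst (snd c)) (fst (snd c)) + D1 \<xi> (fst c) (snd (snd c)))))"
    by (intro continuous_intros continuous_on_D1 continuous_on_D2 assms)
  then show ?thesis by (rule continuous_on_eq) (simp add: kink_variation_eq)
qed

end

section \<open>One-sided bounds for the thickness of the moved link\<close>

context variation
begin

text \<open>Up to the positive factor (m \<bullet> m)^3 this is 1 - (|k'| \<sigma> (1 + t \<mu>))^2
  for the transported curvature k'. Its sign thus compares the transported radius with \<sigma> (1 +
  t \<mu>), and as a polynomial it expands term by term.\<close>

definition kink_defect :: "real \<Rightarrow> real \<Rightarrow> pt \<times> pt \<times> pt \<Rightarrow> real" where
  "kink_defect \<mu> t c = (let m = D1 (\<phi> t) (fst c) (fst (snd c));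
      w = D2 (\<phi> t) (fst c) (fst (snd c)) (fst (snd c)) + D1 (\<phi> t) (fst c) (snd (snd c)) in
      (m \<bullet> m)^3 - (\<sigma> * (1 + t * \<mu>))\<^sup>2 * ((w \<bullet> w) * (m \<bullet> m) - (w \<bullet> m)\<^sup>2))"

text \<open>The derivative of \<open>kink_defect\<close> in t at t = 0, simplified by |u| = 1 and k
  \<bullet> u = 0.\<close>

definition kink_slope :: "real \<Rightarrow> pt \<times> pt \<times> pt \<Rightarrow> real" where
  "kink_slope \<mu> c = (let u = fst (snd c); k = snd (snd c); m = D1 \<xi> (fst c) u; w = D2 \<xi> (fst c) u u + D1 \<xi> (fst c) k in
      6 * (u \<bullet> m) - \<sigma>\<^sup>2 * (2 * \<mu> * (k \<bullet> k) + 2 * (k \<bullet> w) + 2 * (k \<bullet> k) * (u \<bullet> m)))"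

lemma expansion_kink_defect:
  "expansion (osc_closure L T) (kink_defect \<mu>) (\<lambda>c. 1 - \<sigma>\<^sup>2 * (snd (snd c) \<bullet> snd (snd c))) (kink_slope \<mu>)"
proof -
  let ?X = "osc_closure L T"
  note bm = bounded_bilinear_mult[where ?'a = real]
  let ?M = "\<lambda>t c. D1 (\<phi> t) (fst c) (fst (snd c))"
  let ?W = "\<lambda>t c. D2 (\<phi> t) (fst c) (fst (snd c)) (fst (snd c)) + D1 (\<phi> t) (fst c) (snd (snd c))"
  let ?m = "\<lambda>c. D1 \<xi> (fst c) (fst (snd c))"
  let ?w = "\<lambda>c. D2 \<xi> (fst c) (fst (snd c)) (fst (snd c)) + D1 \<xi> (fst c) (snd (snd c))"
  have bdd: "bounded ((\<lambda>c. fst (snd c)) ` ?X)" "bounded ((\<lambda>c. snd (snd c)) ` ?X)"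
    by (intro compact_imp_bounded compact_continuous_image compact_osc continuous_intros)+
  have fst: "fst ` ?X \<subseteq> L" using osc_closureD(1) by auto
  have u: "fst (snd c) \<bullet> fst (snd c) = 1" "snd (snd c) \<bullet> fst (snd c) = 0" "fst (snd c) \<bullet> snd (snd c) = 0" if "c \<in> ?X" for c
    using osc_closureD(3,4)[of "fst c" "fst (snd c)" "snd (snd c)"] that by (simp_all add: norm_eq_1 inner_commute)
  have M: "expansion ?X ?M (\<lambda>c. fst (snd c)) ?m" by (rule expansion_D1_arg[OF bdd(1) fst])
  have W: "expansion ?X ?W (\<lambda>c. 0 + snd (snd c)) ?w"
    by (rule expansion_add[OF expansion_D2_arg[OF bdd(1) fst] expansion_D1_arg[OF bdd(2) fst]])
  note a = expansion_prod[OF bounded_bilinear_inner M M]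
  note b = expansion_prod[OF bounded_bilinear_inner W W]
  note d = expansion_prod[OF bounded_bilinear_inner W M]
  note s = expansion_linear[OF expansion_time[of ?X 1 \<mu>] bounded_linear_mult_right[of \<sigma>]]
  note N = expansion_add[OF expansion_prod[OF bm b a] expansion_linear[OF expansion_prod[OF bm d d] bounded_linear_minus[OF bounded_linear_ident]]]
  note F = expansion_add[OF expansion_prod[OF bm expansion_prod[OF bm a a] a]
      expansion_linear[OF expansion_prod[OF bm expansion_prod[OF bm s s] N] bounded_linear_minus[OF bounded_linear_ident]]]
  show ?thesis
  proof (rule expansion_cong[OF F])
    fix c assume c: "c \<in> ?X"
    show "(?M t c \<bullet> ?M t c) * (?M t c \<bullet> ?M t c) * (?M t c \<bullet> ?M t c)
       + - (\<sigma> * (1 + t *\<^sub>R \<mu>) * (\<sigma> * (1 + t *\<^sub>R \<mu>)) * ((?W t c \<bullet> ?W t c) * (?M t c \<bullet> ?M t c)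
          + - ((?W t c \<bullet> ?M t c) * (?W t c \<bullet> ?M t c)))) = kink_defect \<mu> t c" for t
      by (simp add: kink_defect_def Let_def power3_eq_cube power2_eq_square)
  qed (simp_all add: u kink_slope_def Let_def power2_eq_square inner_commute algebra_simps)
qed

lemma kink_defect_push:
  assumes t: "0 < t" "t < \<tau>" and u: "u \<noteq> 0"
  shows "kink_defect \<mu> t (x, u, k) = (D1 (\<phi> t) x u \<bullet> D1 (\<phi> t) x u)^3
     * (1 - (norm (push_curvature (\<phi> t) x u k) * (\<sigma> * (1 + t * \<mu>)))\<^sup>2)"
    and "0 < (D1 (\<phi> t) x u \<bullet> D1 (\<phi> t) x u)^3"
proof -
  interpret m: moved_link L T "\<phi> t" by (rule moved_t[OF t])
  have nz: "D1 (\<phi> t) x u \<noteq> 0" by (rule m.D1_nonzero[OF u])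
  show "kink_defect \<mu> t (x, u, k) = (D1 (\<phi> t) x u \<bullet> D1 (\<phi> t) x u)^3
     * (1 - (norm (push_curvature (\<phi> t) x u k) * (\<sigma> * (1 + t * \<mu>)))\<^sup>2)"
    unfolding kink_defect_def Let_def fst_conv snd_conv m.norm_push_curvature[OF nz, of k, symmetric]
    by (simp add: power_mult_distrib right_diff_distrib mult_ac)
  show "0 < (D1 (\<phi> t) x u \<bullet> D1 (\<phi> t) x u)^3" using nz by simp
qed

lemma continuous_kink_slope: "continuous_on S (kink_slope \<mu>)"
  unfolding kink_slope_def[abs_def] Let_def
  by (intro continuous_intros continuous_on_D1 continuous_on_D2 \<xi>_C2)

lemma kink_slope_eq:
  assumes "c \<in> Kink \<sigma> L T"
  shows "kink_slope \<mu> c = 2 * (kink_variation \<xi> c - \<mu>)"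
proof -
  have "norm (snd (snd c)) * \<sigma> = 1" using assms kink_iff[of "fst c" "fst (snd c)" "snd (snd c)"] by simp
  then have "(norm (snd (snd c)) * \<sigma>)\<^sup>2 = 1" by simp
  then have "\<sigma>\<^sup>2 * (snd (snd c) \<bullet> snd (snd c)) = 1" by (simp add: power_mult_distrib power2_norm_eq_inner mult.commute)
  moreover have "\<sigma>\<^sup>2 * (2 * \<mu> * (snd (snd c) \<bullet> snd (snd c)) + b + 2 * (snd (snd c) \<bullet> snd (snd c)) * a)
      = 2 * \<mu> * (\<sigma>\<^sup>2 * (snd (snd c) \<bullet> snd (snd c))) + \<sigma>\<^sup>2 * b + 2 * a * (\<sigma>\<^sup>2 * (snd (snd c) \<bullet> snd (snd c)))" for a b
    by (simp add: algebra_simps)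
  ultimately have "\<sigma>\<^sup>2 * (2 * \<mu> * (snd (snd c) \<bullet> snd (snd c)) + b + 2 * (snd (snd c) \<bullet> snd (snd c)) * a) = 2 * \<mu> + \<sigma>\<^sup>2 * b + 2 * a" for a b
    by simp
  then show ?thesis by (simp add: kink_slope_def Let_def kink_variation_eq[OF assms])
qed

text \<open>On the compact closure of osculating circles the leading term 1 - \<sigma>^2 |k|^2 is
  nonnegative and vanishes only at kinks, where the slope is twice \<open>kink_variation\<close>
  minus 2 \<mu>, hence positive. So \<open>expansion_positive\<close> applies without slack.\<close>

lemma kinks_lower:
  assumes m: "\<And>c. c \<in> Kink \<sigma> L T \<Longrightarrow> m \<le> kink_variation \<xi> c" and \<mu>: "\<mu> < m"
  shows "\<forall>\<^sub>F t in at_right 0. \<forall>y k'. has_curvature (L\<^sub>t t) (T\<^sub>t t) y k' \<longrightarrow> norm k' * (\<sigma> * (1 + t * \<mu>)) \<le> 1"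
proof -
  have "\<forall>\<^sub>F t in at_right 0. \<forall>c\<in>osc_closure L T. True \<longrightarrow> 0 < kink_defect \<mu> t c"
  proof (rule expansion_positive[OF compact_osc expansion_kink_defect _ continuous_kink_slope, where B = 0])
    have nn: "0 \<le> 1 - \<sigma>\<^sup>2 * (snd (snd c) \<bullet> snd (snd c))" and kink: "1 - \<sigma>\<^sup>2 * (snd (snd c) \<bullet> snd (snd c)) = 0 \<Longrightarrow> c \<in> Kink \<sigma> L T"
      if c: "c \<in> osc_closure L T" for c
    proof -
      have eq: "\<sigma>\<^sup>2 * (snd (snd c) \<bullet> snd (snd c)) = (norm (snd (snd c)) * \<sigma>)\<^sup>2"
        by (simp add: power_mult_distrib power2_norm_eq_inner)
      have "norm (snd (snd c)) * \<sigma> \<le> 1" by (rule osc_bound[of "fst c" "fst (snd c)"]) (simp add: c)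
      then show "0 \<le> 1 - \<sigma>\<^sup>2 * (snd (snd c) \<bullet> snd (snd c))" using \<sigma>_pos by (simp only: eq) (simp add: power_le_one)
      assume "1 - \<sigma>\<^sup>2 * (snd (snd c) \<bullet> snd (snd c)) = 0"
      then have "(norm (snd (snd c)) * \<sigma>)\<^sup>2 = 1\<^sup>2" by (simp only: eq) simp
      then have "norm (snd (snd c)) * \<sigma> = 1" by (rule power2_eq_imp_eq) (use \<sigma>_pos in simp_all)
      then show "c \<in> Kink \<sigma> L T" using c kink_iff[of "fst c" "fst (snd c)" "snd (snd c)"] by simp
    qed
    show "continuous_on (osc_closure L T) (\<lambda>c. 1 - \<sigma>\<^sup>2 * (snd (snd c) \<bullet> snd (snd c)))" by (intro continuous_intros)
    show "\<forall>\<^sub>F t in at_right 0. \<forall>c\<in>osc_closure L T. True \<longrightarrow> - (0 * t\<^sup>2) \<le> 1 - \<sigma>\<^sup>2 * (snd (snd c) \<bullet> snd (snd c))" using nn by simp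
    fix z assume "z \<in> osc_closure L T" "1 - \<sigma>\<^sup>2 * (snd (snd z) \<bullet> snd (snd z)) = 0"
    then have "z \<in> Kink \<sigma> L T" by (rule kink)
    then show "0 < kink_slope \<mu> z" using m[of z] \<mu> by (simp add: kink_slope_eq)
  qed
  then show ?thesis using small
  proof eventually_elim
    case (elim t)
    then have t: "0 < t" "t < \<tau>" by auto
    interpret m: moved_link L T "\<phi> t" by (rule moved_t[OF t])
    show ?case
    proof (intro allI impI)
      fix y k' assume "has_curvature (L\<^sub>t t) (T\<^sub>t t) y k'"
      then obtain x k where k: "has_curvature L T x k" "y = \<phi> t x" "k' = push_curvature (\<phi> t) x (T x) k"
        by (rule m.curvature_backward)
      have T: "T x \<noteq> 0" using curvature_unit[OF k(1)] by auto
      have "0 < kink_defect \<mu> t (x, T x, k)" using elim osc_closure_curvature[OF k(1)] by blast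
      then have "(norm k' * (\<sigma> * (1 + t * \<mu>)))\<^sup>2 < 1"
        using zero_less_mult_pos[OF _ kink_defect_push(2)[OF t T]] by (simp only: kink_defect_push(1)[OF t T] k(3)) force
      then have "\<bar>norm k' * (\<sigma> * (1 + t * \<mu>))\<bar> < 1" by (simp only: abs_square_less_1)
      then show "norm k' * (\<sigma> * (1 + t * \<mu>)) \<le> 1" by linarith
    qed
  qed
qed

lemma expansion_chord:
  "expansion (L \<times> L) (\<lambda>t c. (\<phi> t (snd c) - \<phi> t (fst c)) \<bullet> (\<phi> t (snd c) - \<phi> t (fst c))) (\<lambda>c. (snd c - fst c) \<bullet> (snd c - fst c))
     (\<lambda>c. 2 * strut_variation \<xi> c)"
proof -
  have V: "expansion (L \<times> L) (\<lambda>t c. \<phi> t (snd c) + - \<phi> t (fst c)) (\<lambda>c. snd c + - fst c) (\<lambda>c. \<xi> (snd c) + - \<xi> (fst c))"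
    by (intro expansion_add expansion_linear[OF _ bounded_linear_minus[OF bounded_linear_ident]]
        expansion_compose[OF expansion_flow[OF compact_L]]) auto
  show ?thesis by (rule expansion_cong[OF expansion_prod[OF bounded_bilinear_inner V V]])
      (simp_all add: strut_variation_def inner_commute algebra_simps)
qed

text \<open>Applies \<open>expansion_positive\<close> to |y - x|^2 - (1 + t \<mu>)^2 on all pairs.
  At a pair that is critical at time t the leading term may be negative, but by at most C^2 t^2: its
  tangential part at time 0 is at most C t |y - x|, and the link has reach at least 1/2. Limits of
  such pairs with vanishing leading term are struts by \<open>tangential_limit\<close>.\<close>

lemma struts_lower:
  assumes m: "\<And>c. c \<in> Strut \<sigma> L T \<Longrightarrow> m \<le> strut_variation \<xi> c" and \<mu>: "\<mu> < m"
  shows "\<forall>\<^sub>F t in at_right 0. \<forall>x y. critical_pair (L\<^sub>t t) (T\<^sub>t t) x y \<longrightarrow> 1 + t * \<mu> \<le> norm (x - y)"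
proof -
  obtain C where C: "0 < C" "\<forall>\<^sub>F t in at_right 0. 0 < t \<and> t < \<tau> \<and>
      (\<forall>x\<in>L. \<forall>y\<in>L. \<bar>tangential (L\<^sub>t t) (T\<^sub>t t) (\<phi> t x) (\<phi> t y - \<phi> t x) - tangential L T x (y - x)\<bar>
        \<le> C * t * norm (y - x))" by (rule tangential_estimate) (rule that; assumption)
  define P where "P t c \<longleftrightarrow> t < \<tau> \<and> critical_pair (L\<^sub>t t) (T\<^sub>t t) (\<phi> t (fst c)) (\<phi> t (snd c))
     \<and> tangential L T (fst c) (snd c - fst c) \<le> C * t * norm (snd c - fst c)
     \<and> tangential L T (snd c) (fst c - snd c) \<le> C * t * norm (fst c - snd c)" for t c
  have P: "\<forall>\<^sub>F t in at_right 0. \<forall>c\<in>L \<times> L. critical_pair (L\<^sub>t t) (T\<^sub>t t) (\<phi> t (fst c)) (\<phi> t (snd c)) \<longrightarrow> P t c" using C(2)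
  proof eventually_elim
    case (elim t)
    then have t: "0 < t" "t < \<tau>" by auto
    interpret m: moved_link L T "\<phi> t" by (rule moved_t[OF t])
    show ?case
    proof (intro ballI impI)
      fix c assume c: "c \<in> L \<times> L" and cp: "critical_pair (L\<^sub>t t) (T\<^sub>t t) (\<phi> t (fst c)) (\<phi> t (snd c))"
      have z: "tangential (L\<^sub>t t) (T\<^sub>t t) (\<phi> t (fst c)) (\<phi> t (snd c) - \<phi> t (fst c)) = 0"
        "tangential (L\<^sub>t t) (T\<^sub>t t) (\<phi> t (snd c)) (\<phi> t (fst c) - \<phi> t (snd c)) = 0" using cp m.moved.critical_iff by auto
      have xy: "fst c \<in> L" "snd c \<in> L" using c by auto
      have "\<bar>0 - tangential L T (fst c) (snd c - fst c)\<bar> \<le> C * t * norm (snd c - fst c)"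
        "\<bar>0 - tangential L T (snd c) (fst c - snd c)\<bar> \<le> C * t * norm (fst c - snd c)" using elim xy z by metis+
      then show "P t c" unfolding P_def using t cp by (intro conjI) linarith+
    qed
  qed
  have F: "expansion (L \<times> L) (\<lambda>t c. (\<phi> t (snd c) - \<phi> t (fst c)) \<bullet> (\<phi> t (snd c) - \<phi> t (fst c)) + - ((1 + t *\<^sub>R \<mu>) * (1 + t *\<^sub>R \<mu>)))
     (\<lambda>c. (snd c - fst c) \<bullet> (snd c - fst c) + - (1 * 1)) (\<lambda>c. 2 * strut_variation \<xi> c + - (\<mu> * 1 + 1 * \<mu>))"
    by (intro expansion_add expansion_chord expansion_linear[OF _ bounded_linear_minus[OF bounded_linear_ident]]
        expansion_prod[OF bounded_bilinear_mult] expansion_time)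
  have "\<forall>\<^sub>F t in at_right 0. \<forall>c\<in>L \<times> L. P t c \<longrightarrow>
      0 < (\<phi> t (snd c) - \<phi> t (fst c)) \<bullet> (\<phi> t (snd c) - \<phi> t (fst c)) + - ((1 + t *\<^sub>R \<mu>) * (1 + t *\<^sub>R \<mu>))"
  proof (rule expansion_positive[OF compact_Times[OF compact_L compact_L] F, where B = "C\<^sup>2"])
    show "continuous_on (L \<times> L) (\<lambda>c. (snd c - fst c) \<bullet> (snd c - fst c) + - (1 * 1))" by (intro continuous_intros)
    show "continuous_on (L \<times> L) (\<lambda>c. 2 * strut_variation \<xi> c + - (\<mu> * 1 + 1 * \<mu>))"
      by (intro continuous_intros continuous_strut_variation \<xi>_C2)
    show "\<forall>\<^sub>F t in at_right 0. \<forall>c\<in>L \<times> L. P t c \<longrightarrow> - (C\<^sup>2 * t\<^sup>2) \<le> (snd c - fst c) \<bullet> (snd c - fst c) + - (1 * 1)" using small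
    proof eventually_elim
      case (elim t)
      then have t: "0 < t" "t < \<tau>" by auto
      interpret m: moved_link L T "\<phi> t" by (rule moved_t[OF t])
      show ?case
      proof (intro ballI impI)
        fix c assume c: "c \<in> L \<times> L" and p: "P t c"
        let ?n = "norm (snd c - fst c)" and ?\<theta> = "tangential L T (fst c) (snd c - fst c)"
        \<comment> \<open>Critical pairs are off the diagonal, so the chord bound may be divided by
          the squared length.\<close>
        have "\<phi> t (fst c) \<noteq> \<phi> t (snd c)" using p m.moved.critical_iff by (auto simp: P_def)
        then have n: "0 < ?n" by auto
        have "2 * (1/2) * sqrt (?n\<^sup>2 - ?\<theta>\<^sup>2) \<le> ?n\<^sup>2" using c reach_half by (intro reach_chord_bound) auto
        then have "sqrt (?n\<^sup>2 - ?\<theta>\<^sup>2) \<le> ?n\<^sup>2" by simp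
        then have "?n\<^sup>2 - ?\<theta>\<^sup>2 \<le> (?n\<^sup>2)\<^sup>2" by (rule sqrt_le_D)
        moreover have "?\<theta>\<^sup>2 \<le> (C * t * ?n)\<^sup>2" using p tangential_nonneg by (intro power_mono) (auto simp: P_def)
        ultimately have "?n\<^sup>2 * (1 - C\<^sup>2 * t\<^sup>2) \<le> ?n\<^sup>2 * ?n\<^sup>2" by (simp add: power_mult_distrib power2_eq_square algebra_simps)
        then have "1 - C\<^sup>2 * t\<^sup>2 \<le> ?n\<^sup>2" using n by (simp only: mult_le_cancel_left_pos zero_less_power)
        then show "- (C\<^sup>2 * t\<^sup>2) \<le> (snd c - fst c) \<bullet> (snd c - fst c) + - (1 * 1)" by (simp add: power2_norm_eq_inner)
      qed
    qed
    fix c s z assume z: "z \<in> L \<times> L" "(snd z - fst z) \<bullet> (snd z - fst z) + - (1 * 1) = 0"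
      and cs: "\<And>n. c n \<in> L \<times> L \<and> 0 < s n \<and> P (s n) (c n)" and s: "s \<longlonglongrightarrow> 0" and cz: "c \<longlonglongrightarrow> z"
    have X: "(\<lambda>n. fst (c n)) \<longlonglongrightarrow> fst z" and Y: "(\<lambda>n. snd (c n)) \<longlonglongrightarrow> snd z" using tendsto_fst[OF cz] tendsto_snd[OF cz] .
    have L: "fst (c n) \<in> L" "snd (c n) \<in> L" for n using cs[of n] by auto
    have b: "(\<lambda>n. C * s n * norm (snd (c n) - fst (c n))) \<longlonglongrightarrow> C * 0 * norm (snd z - fst z)"
      "(\<lambda>n. C * s n * norm (fst (c n) - snd (c n))) \<longlonglongrightarrow> C * 0 * norm (fst z - snd z)" by (intro tendsto_intros s X Y)+
    have "tangential L T (fst z) (snd z - fst z) = 0"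
      by (rule tangential_limit[OF _ L(1) X tendsto_diff[OF Y X], of "\<lambda>n. C * s n * norm (snd (c n) - fst (c n))"])
        (use z cs b(1) in \<open>auto simp: P_def\<close>)
    moreover have "tangential L T (snd z) (fst z - snd z) = 0"
      by (rule tangential_limit[OF _ L(2) Y tendsto_diff[OF X Y], of "\<lambda>n. C * s n * norm (fst (c n) - snd (c n))"])
        (use z cs b(2) in \<open>auto simp: P_def\<close>)
    moreover have "norm (snd z - fst z) = 1" using z(2) by (simp add: norm_eq_1)
    ultimately have "z \<in> Strut \<sigma> L T" using z(1) strut_iff[of "fst z" "snd z"] by auto
    then show "0 < 2 * strut_variation \<xi> z + - (\<mu> * 1 + 1 * \<mu>)" using m[of z] \<mu> by simp
  qed
  then show ?thesis using P small
  proof eventually_elim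
    case (elim t)
    then have t: "0 < t" "t < \<tau>" by auto
    interpret m: moved_link L T "\<phi> t" by (rule moved_t[OF t])
    show ?case
    proof (intro allI impI)
      fix x y assume xy: "critical_pair (L\<^sub>t t) (T\<^sub>t t) x y"
      then obtain a b where ab: "x = \<phi> t a" "a \<in> L" "y = \<phi> t b" "b \<in> L" unfolding critical_pair_def by blast
      have c: "(a, b) \<in> L \<times> L" using ab by simp
      have "P t (a, b)" using elim(2)[rule_format, OF c] xy by (simp add: ab)
      then have "0 < (y - x) \<bullet> (y - x) + - ((1 + t *\<^sub>R \<mu>) * (1 + t *\<^sub>R \<mu>))" using elim(1)[rule_format, OF c] by (simp add: ab)
      then have "(1 + t * \<mu>)\<^sup>2 \<le> (norm (x - y))\<^sup>2"
        by (simp add: power2_norm_eq_inner[symmetric] norm_minus_commute power2_eq_square)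
      then show "1 + t * \<mu> \<le> norm (x - y)" by (rule power2_le_imp_le) simp
    qed
  qed
qed

lemma small_factor: "\<forall>\<^sub>F t in at_right (0::real). 0 < 1 + t * \<mu>"
proof -
  have "((\<lambda>t. 1 + t * \<mu>) \<longlongrightarrow> 1 + 0 * \<mu>) (at_right 0)" by (intro tendsto_intros)
  then show ?thesis by (intro order_tendstoD(1)) auto
qed

lemma Thi_lower:
  assumes "\<And>c. c \<in> Kink \<sigma> L T \<Longrightarrow> m \<le> kink_variation \<xi> c" "\<And>c. c \<in> Strut \<sigma> L T \<Longrightarrow> m \<le> strut_variation \<xi> c"
    and \<mu>: "\<mu> < m"
  shows "\<forall>\<^sub>F t in at_right 0. ereal (1 + t * \<mu>) \<le> Thi \<sigma> (L\<^sub>t t) (T\<^sub>t t)"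
proof -
  have "\<forall>\<^sub>F t in at_right 0. \<forall>y k'. has_curvature (L\<^sub>t t) (T\<^sub>t t) y k' \<longrightarrow> norm k' * (\<sigma> * (1 + t * \<mu>)) \<le> 1"
    by (rule kinks_lower[OF _ \<mu>]) (rule assms(1))
  moreover have "\<forall>\<^sub>F t in at_right 0. \<forall>x y. critical_pair (L\<^sub>t t) (T\<^sub>t t) x y \<longrightarrow> 1 + t * \<mu> \<le> norm (x - y)"
    by (rule struts_lower[OF _ \<mu>]) (rule assms(2))
  ultimately show ?thesis using small_factor[of \<mu>] small
  proof eventually_elim
  case (elim t)
  interpret m: moved_link L T "\<phi> t" by (rule moved_t) (use elim in auto)
  show ?case using L_nonempty elim(1,2,3) by (intro m.moved.Thi_ge \<sigma>) auto
  qed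
qed

lemma Thi_upper_kink:
  assumes c: "c \<in> Kink \<sigma> L T" and \<mu>: "kink_variation \<xi> c < \<mu>"
  shows "\<forall>\<^sub>F t in at_right 0. Thi \<sigma> (L\<^sub>t t) (T\<^sub>t t) \<le> ereal (1 + t * \<mu>)"
proof -
  obtain x u k where cx: "c = (x, u, k)" by (cases c)
  have osc: "(x, u, k) \<in> osc_closure L T" and k: "norm k * \<sigma> = 1" using c by (simp_all add: cx kink_iff)
  note x = osc_closureD[OF osc]
  have "expansion {c} (\<lambda>t c. - kink_defect \<mu> t c) (\<lambda>c. - (1 - \<sigma>\<^sup>2 * (snd (snd c) \<bullet> snd (snd c)))) (\<lambda>c. - kink_slope \<mu> c)"
    by (rule expansion_compose[OF expansion_linear[OF expansion_kink_defect bounded_linear_minus[OF bounded_linear_ident]], of "\<lambda>c. c"])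
      (simp add: cx osc)
  then have "\<forall>\<^sub>F t in at_right 0. \<forall>c\<in>{c}. True \<longrightarrow> 0 < - kink_defect \<mu> t c"
  proof (rule expansion_positive[where B = 0, rotated])
    have "\<sigma>\<^sup>2 * (k \<bullet> k) = (norm k * \<sigma>)\<^sup>2" by (simp add: power_mult_distrib power2_norm_eq_inner)
    then show "\<forall>\<^sub>F t in at_right 0. \<forall>c\<in>{c}. True \<longrightarrow> - (0 * t\<^sup>2) \<le> - (1 - \<sigma>\<^sup>2 * (snd (snd c) \<bullet> snd (snd c)))" by (simp add: cx k)
    show "0 < - kink_slope \<mu> z" if "z \<in> {c}" for z using that \<mu> c by (simp add: kink_slope_eq)
  qed (auto intro: continuous_on_sing)
  then show ?thesis using small_factor[of \<mu>] small
  proof eventually_elim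
    case (elim t)
    then have t: "0 < t" "t < \<tau>" by auto
    interpret m: moved_link L T "\<phi> t" by (rule moved_t[OF t])
    have \<delta>: "0 < 1 + t * \<mu>" using elim by blast
    let ?k = "push_curvature (\<phi> t) x u k"
    have u: "u \<noteq> 0" using x(3) by auto
    have "kink_defect \<mu> t (x, u, k) < 0" using elim(1) by (simp add: cx)
    then have "1 < (norm ?k * (\<sigma> * (1 + t * \<mu>)))\<^sup>2" using kink_defect_push(2)[OF t u, of x]
        mult_nonneg_nonneg[of "(D1 (\<phi> t) x u \<bullet> D1 (\<phi> t) x u)^3" "1 - (norm ?k * (\<sigma> * (1 + t * \<mu>)))\<^sup>2"]
      by (simp only: kink_defect_push(1)[OF t u]) linarith
    then have "1\<^sup>2 < (norm ?k * (\<sigma> * (1 + t * \<mu>)))\<^sup>2" by simp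
    then have k1: "1 < norm ?k * (\<sigma> * (1 + t * \<mu>))" by (rule power2_less_imp_less) (use \<sigma>_pos \<delta> in simp)
    then have k0: "?k \<noteq> 0" by auto
    \<comment> \<open>A kink may be only a limit of osculating circles. Transport is continuous on
      their closure, so it carries the kink into the closure for the moved link.\<close>
    define h where "h c = (\<phi> t (fst c), sgn (D1 (\<phi> t) (fst c) (fst (snd c))), push_curvature (\<phi> t) (fst c) (fst (snd c)) (snd (snd c)))" for c
    have hc: "continuous_on (osc_closure L T) h"
    proof -
      have nz: "D1 (\<phi> t) (fst c) (fst (snd c)) \<noteq> 0" if "c \<in> osc_closure L T" for c
        using osc_closureD(3)[of "fst c" "fst (snd c)" "snd (snd c)"] that by (intro m.D1_nonzero) auto
      then show ?thesis unfolding h_def push_curvature_def Let_def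
        by (intro continuous_intros continuous_on_D1 continuous_on_D2 m.f_C2 continuous_on_compose2[OF C2_continuous[OF m.f_C2, of UNIV]]) auto
    qed
    have "h ` osc_closure L T \<subseteq> osc_closure (L\<^sub>t t) (T\<^sub>t t)" unfolding osc_closure_eq[of L T]
    proof (rule image_closure_subset)
      show "continuous_on (closure {(x, T x, k) |x k. has_curvature L T x k}) h" using hc by (simp only: osc_closure_eq)
      show "closed (osc_closure (L\<^sub>t t) (T\<^sub>t t))" by (simp add: osc_closure_eq)
      show "h ` {(x, T x, k) |x k. has_curvature L T x k} \<subseteq> osc_closure (L\<^sub>t t) (T\<^sub>t t)"
        using osc_closure_curvature[OF m.curvature_forward] by (auto simp: h_def m.T'_f)
    qed
    then have "h (x, u, k) \<in> osc_closure (L\<^sub>t t) (T\<^sub>t t)" using osc by blast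
    then have "Thi \<sigma> (L\<^sub>t t) (T\<^sub>t t) \<le> ereal (1 / (\<sigma> * norm ?k))" using m.moved.Thi_le_radius[OF _ k0 \<sigma>_pos] by (simp add: h_def)
    also have "\<dots> \<le> ereal (1 + t * \<mu>)" using k1 \<sigma>_pos k0 by (simp add: pos_divide_le_eq mult_ac)
    finally show ?case .
  qed
qed

text \<open>At time t the tangential part of the moved strut at its first endpoint is at most C t.
  If the thickness exceeded 1 + t \<mu>, \<open>reach_chord_bound\<close> would make the quantity F
  nonpositive; but F has leading term 0 and slope twice \<mu> minus \<open>strut_variation\<close>,
  hence positive.\<close>

lemma Thi_upper_strut:
  assumes c: "c \<in> Strut \<sigma> L T" and \<mu>: "strut_variation \<xi> c < \<mu>"
  shows "\<forall>\<^sub>F t in at_right 0. Thi \<sigma> (L\<^sub>t t) (T\<^sub>t t) \<le> ereal (1 + t * \<mu>)"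
proof -
  obtain x y where cx: "c = (x, y)" by (cases c)
  have xy: "x \<in> L" "y \<in> L" "norm (y - x) = 1" "tangential L T x (y - x) = 0" using c by (simp_all add: cx strut_iff)
  obtain C where C: "0 < C" "\<forall>\<^sub>F t in at_right 0. 0 < t \<and> t < \<tau> \<and>
      (\<forall>x\<in>L. \<forall>y\<in>L. \<bar>tangential (L\<^sub>t t) (T\<^sub>t t) (\<phi> t x) (\<phi> t y - \<phi> t x) - tangential L T x (y - x)\<bar>
        \<le> C * t * norm (y - x))" by (rule tangential_estimate) (rule that; assumption)
  note bm = expansion_prod[OF bounded_bilinear_mult[where ?'a = real]]
  note q = expansion_compose[OF expansion_chord, of "\<lambda>c. c" "{c}"]
  define F where "F t c = (let q = (\<phi> t (snd c) - \<phi> t (fst c)) \<bullet> (\<phi> t (snd c) - \<phi> t (fst c)) in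
      (1 + t * \<mu>)\<^sup>2 * (q - (C * t)\<^sup>2) - q\<^sup>2)" for t c
  have "expansion {c} F (\<lambda>c. 0) (\<lambda>c. 2 * (\<mu> - strut_variation \<xi> c))"
  proof (rule expansion_cong[OF expansion_add[OF bm[OF bm[OF expansion_time[of _ 1 \<mu>] expansion_time[of _ 1 \<mu>]] expansion_add[OF q
         expansion_linear[OF bm[OF expansion_time[of _ 0 C] expansion_time[of _ 0 C]] bounded_linear_minus[OF bounded_linear_ident]]]]
         expansion_linear[OF bm[OF q q] bounded_linear_minus[OF bounded_linear_ident]]]])
    have "(y - x) \<bullet> (y - x) = 1" using xy(3) by (simp add: norm_eq_1)
    then show "1 * 1 * ((snd d - fst d) \<bullet> (snd d - fst d) + - (0 * 0)) + - ((snd d - fst d) \<bullet> (snd d - fst d) * ((snd d - fst d) \<bullet> (snd d - fst d))) = 0"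
      if "d \<in> {c}" for d using that by (simp add: cx)
  qed (use xy(1-3) cx in \<open>auto simp: F_def Let_def power2_eq_square norm_eq_1 algebra_simps\<close>)
  then have "\<forall>\<^sub>F t in at_right 0. \<forall>c\<in>{c}. True \<longrightarrow> 0 < F t c" by (rule expansion_positive[where B = 0, rotated]) (use \<mu> in auto)
  then show ?thesis using C(2) small_factor[of \<mu>]
  proof eventually_elim
    case (elim t)
    then have t: "0 < t" "t < \<tau>" by auto
    interpret m: moved_link L T "\<phi> t" by (rule moved_t[OF t])
    have \<delta>: "0 < 1 + t * \<mu>" using elim by blast
    show ?case
    proof (rule ccontr)
      assume "\<not> Thi \<sigma> (L\<^sub>t t) (T\<^sub>t t) \<le> ereal (1 + t * \<mu>)"
      then have "ereal (1 + t * \<mu>) \<le> Thi \<sigma> (L\<^sub>t t) (T\<^sub>t t)" by simp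
      then have r: "ereal ((1 + t * \<mu>) / 2) \<le> reach (L\<^sub>t t)" by (rule Thi_le_reach)
      let ?v = "\<phi> t y - \<phi> t x"
      let ?\<theta> = "tangential (L\<^sub>t t) (T\<^sub>t t) (\<phi> t x) ?v"
      have "2 * ((1 + t * \<mu>) / 2) * sqrt ((norm ?v)\<^sup>2 - ?\<theta>\<^sup>2) \<le> (norm ?v)\<^sup>2" using \<delta> xy r by (intro m.moved.reach_chord_bound) auto
      then have s: "(1 + t * \<mu>) * sqrt (?v \<bullet> ?v - ?\<theta>\<^sup>2) \<le> ?v \<bullet> ?v"
        by (simp only: power2_norm_eq_inner times_divide_eq_right nonzero_mult_div_cancel_left zero_neq_numeral[symmetric] not_False_eq_True)
      have "\<bar>?\<theta> - tangential L T x (y - x)\<bar> \<le> C * t * norm (y - x)" using elim(2) xy by blast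
      then have "\<bar>?\<theta>\<bar> \<le> C * t" using xy(3,4) by simp
      then have \<theta>: "?\<theta>\<^sup>2 \<le> (C * t)\<^sup>2" by (rule abs_le_square_iff[THEN iffD1, OF order_trans[OF _ abs_ge_self]])
      have "(1 + t * \<mu>)\<^sup>2 * (?v \<bullet> ?v - ?\<theta>\<^sup>2) \<le> (?v \<bullet> ?v)\<^sup>2"
      proof (cases "0 \<le> ?v \<bullet> ?v - ?\<theta>\<^sup>2")
        case True
        have "((1 + t * \<mu>) * sqrt (?v \<bullet> ?v - ?\<theta>\<^sup>2))\<^sup>2 \<le> (?v \<bullet> ?v)\<^sup>2" using s \<delta> True by (intro power_mono) auto
        then show ?thesis using True by (simp add: power_mult_distrib)
      next
        case False
        then have "(1 + t * \<mu>)\<^sup>2 * (?v \<bullet> ?v - ?\<theta>\<^sup>2) \<le> 0" by (intro mult_nonneg_nonpos) auto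
        then show ?thesis using zero_le_power2[of "?v \<bullet> ?v"] by linarith
      qed
      moreover have "(1 + t * \<mu>)\<^sup>2 * (?v \<bullet> ?v - (C * t)\<^sup>2) \<le> (1 + t * \<mu>)\<^sup>2 * (?v \<bullet> ?v - ?\<theta>\<^sup>2)"
        using \<theta> by (intro mult_left_mono) auto
      moreover have "0 < F t (x, y)" using elim(1) by (simp add: cx)
      ultimately show False by (simp add: F_def Let_def)
    qed
  qed
qed

end

section \<open>Linearity\<close>

lemma C2_combination:
  assumes \<xi>: "C2 \<xi>" and \<eta>: "C2 \<eta>"
  shows "C2 (\<lambda>x. a *\<^sub>R \<xi> x + b *\<^sub>R \<eta> x)"
    and "D1 (\<lambda>x. a *\<^sub>R \<xi> x + b *\<^sub>R \<eta> x) = (\<lambda>x v. a *\<^sub>R D1 \<xi> x v + b *\<^sub>R D1 \<eta> x v)"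
    and "D2 (\<lambda>x. a *\<^sub>R \<xi> x + b *\<^sub>R \<eta> x) = (\<lambda>x u v. a *\<^sub>R D2 \<xi> x u v + b *\<^sub>R D2 \<eta> x u v)"
proof -
  have 1: "((\<lambda>x. a *\<^sub>R \<xi> x + b *\<^sub>R \<eta> x) has_derivative (\<lambda>v. a *\<^sub>R D1 \<xi> x v + b *\<^sub>R D1 \<eta> x v)) (at x)" for x
    by (intro has_derivative_add has_derivative_scaleR_right C2_has_derivative \<xi> \<eta>)
  have 2: "((\<lambda>y. a *\<^sub>R D1 \<xi> y v + b *\<^sub>R D1 \<eta> y v) has_derivative (\<lambda>u. a *\<^sub>R D2 \<xi> x u v + b *\<^sub>R D2 \<eta> x u v)) (at x)" for x v
    by (intro has_derivative_add has_derivative_scaleR_right C2_D1_has_derivative \<xi> \<eta>)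
  have 3: "continuous_on UNIV (\<lambda>x. a *\<^sub>R D2 \<xi> x u v + b *\<^sub>R D2 \<eta> x u v)" for u v by (intro continuous_intros continuous_on_D2 \<xi> \<eta>)
  show "C2 (\<lambda>x. a *\<^sub>R \<xi> x + b *\<^sub>R \<eta> x)"
    and "D1 (\<lambda>x. a *\<^sub>R \<xi> x + b *\<^sub>R \<eta> x) = (\<lambda>x v. a *\<^sub>R D1 \<xi> x v + b *\<^sub>R D1 \<eta> x v)"
    and "D2 (\<lambda>x. a *\<^sub>R \<xi> x + b *\<^sub>R \<eta> x) = (\<lambda>x u v. a *\<^sub>R D2 \<xi> x u v + b *\<^sub>R D2 \<eta> x u v)"
    by (rule C2I[OF 1 2 3])+
qed

lemma C2_zero: "C2 (\<lambda>_. 0)" and D1_zero: "D1 (\<lambda>_. 0) = (\<lambda>x v. 0)"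
proof -
  have 1: "((\<lambda>_. 0 :: pt) has_derivative (\<lambda>v. 0)) (at x)" for x :: pt by simp
  show "C2 (\<lambda>_. 0)" "D1 (\<lambda>_. 0) = (\<lambda>x v. 0)" by (rule C2I[of "\<lambda>_. 0" "\<lambda>x v. 0" "\<lambda>x u v. 0", OF 1 1 continuous_on_const])+
qed

lemma strut_variation_combination:
  "strut_variation (\<lambda>x. a *\<^sub>R \<xi> x + b *\<^sub>R \<eta> x) c = a * strut_variation \<xi> c + b * strut_variation \<eta> c"
  by (simp add: strut_variation_def inner_diff_left inner_diff_right inner_add_right algebra_simps)

lemma radius_variation_combination:
  assumes "C2 \<xi>" "C2 \<eta>"
  shows "radius_variation (\<lambda>x. a *\<^sub>R \<xi> x + b *\<^sub>R \<eta> x) c = a * radius_variation \<xi> c + b * radius_variation \<eta> c"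
  by (simp add: radius_variation_def Let_def C2_combination(2,3)[OF assms] split: prod.split)
    (simp add: inner_add_right algebra_simps add_divide_distrib)

lemma compatible_zero:
  assumes "endpoint_constraints L T H0 H1"
  shows "compatible L T H0 H1 (\<lambda>_. 0)"
  using assms by (auto simp: compatible_def endpoint_constraints_def C2_zero D1_zero subspace_0 image_iff)

lemma compatible_combination:
  assumes con: "endpoint_constraints L T H0 H1" and \<xi>: "compatible L T H0 H1 \<xi>" and \<eta>: "compatible L T H0 H1 \<eta>"
  shows "compatible L T H0 H1 (\<lambda>x. a *\<^sub>R \<xi> x + b *\<^sub>R \<eta> x)"
proof -
  have C: "C2 \<xi>" "C2 \<eta>" using \<xi> \<eta> by (simp_all add: compatible_def)
  have "a *\<^sub>R \<xi> p + b *\<^sub>R \<eta> p \<in> (\<lambda>q. q - p) ` H0 p \<and> a *\<^sub>R D1 \<xi> p (T p) + b *\<^sub>R D1 \<eta> p (T p) \<in> H1 p"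
    if p: "p \<in> boundary L T" for p
  proof -
    have s: "subspace ((\<lambda>q. q - p) ` H0 p)" "subspace (H1 p)"
      using con p by (auto simp: endpoint_constraints_def intro: affine_diffs_subspace_subtract)
    have "\<xi> p \<in> (\<lambda>q. q - p) ` H0 p" "\<eta> p \<in> (\<lambda>q. q - p) ` H0 p" "D1 \<xi> p (T p) \<in> H1 p" "D1 \<eta> p (T p) \<in> H1 p"
      using \<xi> \<eta> p by (simp_all add: compatible_def)
    then show ?thesis by (intro conjI subspace_add[OF s(1)] subspace_add[OF s(2)] subspace_scale[OF s(1)] subspace_scale[OF s(2)])
  qed
  then show ?thesis unfolding compatible_def C2_combination(2)[OF C] using C2_combination(1)[OF C] by blast
qed

lemma (in link) len_variation_combination:
  assumes \<xi>: "C2 \<xi>" and \<eta>: "C2 \<eta>"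
  shows "len_variation L T (\<lambda>x. a *\<^sub>R \<xi> x + b *\<^sub>R \<eta> x) = a * len_variation L T \<xi> + b * len_variation L T \<eta>"
proof -
  have "(case component_param T C of (l, \<gamma>) \<Rightarrow> integral {0..l} (\<lambda>s. D1 (\<lambda>x. a *\<^sub>R \<xi> x + b *\<^sub>R \<eta> x) (\<gamma> s) (T (\<gamma> s)) \<bullet> T (\<gamma> s)))
    = a * (case component_param T C of (l, \<gamma>) \<Rightarrow> integral {0..l} (\<lambda>s. D1 \<xi> (\<gamma> s) (T (\<gamma> s)) \<bullet> T (\<gamma> s)))
    + b * (case component_param T C of (l, \<gamma>) \<Rightarrow> integral {0..l} (\<lambda>s. D1 \<eta> (\<gamma> s) (T (\<gamma> s)) \<bullet> T (\<gamma> s)))"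
    if C: "C \<in> components L" for C
  proof -
    obtain l \<gamma> where p: "component_param T C = (l, \<gamma>)" by (cases "component_param T C")
    have "\<exists>p J. arclength_param T C (fst p) J (snd p)" using link C by (fastforce simp: C11_link_def)
    from someI_ex[OF this] obtain J where "arclength_param T C l J \<gamma>" unfolding component_param_def[symmetric] p by auto
    then interpret arclength_curve T C l J \<gamma> by unfold_locales
    have J: "{0..l} \<subseteq> J" using J_cases by auto
    have "continuous_on J (\<lambda>s. T (\<gamma> s))" by (rule lipschitz_on_continuous_on[OF B_lipschitz])
    then have c: "continuous_on {0..l} \<gamma>" "continuous_on {0..l} (\<lambda>s. T (\<gamma> s))"
      using continuous_\<gamma> J by (auto intro: continuous_on_subset)
    have i: "(\<lambda>s. D1 f (\<gamma> s) (T (\<gamma> s)) \<bullet> T (\<gamma> s)) integrable_on {0..l}" if "C2 f" for f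
      using that c by (intro integrable_continuous_interval continuous_on_inner continuous_on_D1)
    show ?thesis unfolding p prod.case C2_combination(2)[OF \<xi> \<eta>] inner_add_left inner_scaleR_left
      by (subst integral_add) (auto intro!: integrable_on_cmult_left[where 'b = real, simplified] i \<xi> \<eta>)
  qed
  then show ?thesis unfolding len_variation_def arclength_integral_def sum_distrib_left sum.distrib[symmetric]
    by (intro sum.cong refl)
qed

section \<open>The formula for the variation of thickness\<close>

context unit_link
begin

lemma variationI: "C2 \<xi> \<Longrightarrow> diffeo_family \<phi> \<xi> \<Longrightarrow> variation L T \<sigma> \<phi> \<xi>"
  by (intro variation.intro variation_axioms.intro unit_link_axioms)

lemma Thi_id: "Thi \<sigma> (id ` L) (push_tangent id T) = 1"
proof -
  have "push_tangent id T x = T x" if "x \<in> L" for x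
    using norm_T[OF that] by (simp add: push_tangent_def D1_id sgn_div_norm inv_id)
  then show ?thesis using Thi_1 Thi_cong[of L "push_tangent id T" T \<sigma>] by simp
qed

lemma strut_or_kink: "Strut \<sigma> L T \<noteq> {} \<or> Kink \<sigma> L T \<noteq> {}"
proof (rule ccontr)
  assume "\<not> ?thesis"
  then have e: "Strut \<sigma> L T = {}" "Kink \<sigma> L T = {}" by auto
  obtain \<phi> \<psi> where \<phi>: "diffeo_family \<phi> (\<lambda>_. 0)" "\<And>t x. \<phi> t x = x + \<psi> t x *\<^sub>R (0 :: pt)"
    by (rule diffeo_family_exists[OF C2_zero]) (rule that; assumption)
  interpret variation L T \<sigma> \<phi> "\<lambda>_. 0" by (rule variationI[OF C2_zero \<phi>(1)])
  \<comment> \<open>The displacement is a multiple of the zero field, so the thickness stays 1.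
    Without struts and kinks \<open>Thi_lower\<close> would hold with every \<mu>, here with
    1.\<close>
  have id: "\<phi> t = id" for t using \<phi>(2)[of t] by (simp add: fun_eq_iff)
  have "\<forall>\<^sub>F t in at_right 0. ereal (1 + t * 1) \<le> Thi \<sigma> (\<phi> t ` L) (push_tangent (\<phi> t) T)"
    by (rule Thi_lower[of 2]) (simp_all add: e)
  then have "\<forall>\<^sub>F t in at_right (0::real). False" using small
  proof eventually_elim
    case (elim t)
    then have "ereal (1 + t * 1) \<le> 1" unfolding id Thi_id by simp
    then show ?case using elim by (simp add: one_ereal_def)
  qed
  then show False by (simp add: trivial_limit_at_right_real)
qed

definition variations :: "(pt \<Rightarrow> pt) \<Rightarrow> real set" where
  "variations \<xi> = strut_variation \<xi> ` Strut \<sigma> L T \<union> kink_variation \<xi> ` Kink \<sigma> L T"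

lemma strut_in_variations: "c \<in> Strut \<sigma> L T \<Longrightarrow> strut_variation \<xi> c \<in> variations \<xi>"
  and kink_in_variations: "d \<in> Kink \<sigma> L T \<Longrightarrow> kink_variation \<xi> d \<in> variations \<xi>"
  unfolding variations_def by blast+

lemma variations_nonempty: "variations \<xi> \<noteq> {}"
  using strut_or_kink by (auto simp: variations_def)

lemma bdd_below_variations:
  assumes "C2 \<xi>"
  shows "bdd_below (variations \<xi>)"
  unfolding variations_def
  by (intro bounded_imp_bdd_below compact_imp_bounded compact_Un compact_continuous_image continuous_strut_variation
      continuous_kink_variation compact_strut compact_kink assms)

lemma Thi_right_derivative:
  assumes \<xi>: "C2 \<xi>" and \<phi>: "diffeo_family \<phi> \<xi>"
  shows "((\<lambda>t. real_of_ereal (Thi \<sigma> (\<phi> t ` L) (push_tangent (\<phi> t) T))) has_real_derivative Inf (variations \<xi>)) (at_right 0)"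
  unfolding has_field_derivative_iff
proof (rule tendstoI)
  interpret variation L T \<sigma> \<phi> \<xi> by (rule variationI[OF \<xi> \<phi>])
  let ?d = "Inf (variations \<xi>)"
  fix e :: real assume e: "0 < e"
  have inf: "?d \<le> v" if "v \<in> variations \<xi>" for v using that bdd_below_variations[OF \<xi>] by (rule cInf_lower)
  have low: "\<forall>\<^sub>F t in at_right 0. ereal (1 + t * (?d - e / 2)) \<le> Thi \<sigma> (L\<^sub>t t) (T\<^sub>t t)"
    by (rule Thi_lower[of ?d]) (use e in \<open>simp_all add: inf strut_in_variations kink_in_variations\<close>)
  obtain v where v: "v \<in> variations \<xi>" "v < ?d + e / 2" using cInf_lessD[OF variations_nonempty, of \<xi> "?d + e / 2"] e by auto
  then have up: "\<forall>\<^sub>F t in at_right 0. Thi \<sigma> (L\<^sub>t t) (T\<^sub>t t) \<le> ereal (1 + t * (?d + e / 2))"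
    unfolding variations_def using Thi_upper_strut Thi_upper_kink by blast
  show "\<forall>\<^sub>F t in at_right 0. dist ((real_of_ereal (Thi \<sigma> (L\<^sub>t t) (T\<^sub>t t)) - real_of_ereal (Thi \<sigma> (L\<^sub>t 0) (T\<^sub>t 0))) / (t - 0)) ?d < e"
    using low up small
  proof eventually_elim
    case (elim t)
    obtain r where r: "Thi \<sigma> (L\<^sub>t t) (T\<^sub>t t) = ereal r" using elim(1,2) by (cases "Thi \<sigma> (L\<^sub>t t) (T\<^sub>t t)") auto
    have t: "0 < t" using elim by simp
    have "1 + t * (?d - e / 2) \<le> r" "r \<le> 1 + t * (?d + e / 2)" using elim(1,2) by (simp_all add: r)
    then have "?d - e / 2 \<le> (r - 1) / t" "(r - 1) / t \<le> ?d + e / 2"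
      using t by (simp_all add: pos_le_divide_eq pos_divide_le_eq mult.commute)
    then have "\<bar>(r - 1) / t - ?d\<bar> < e" using e by linarith
    then show ?case by (simp add: r \<phi>_0 Thi_id[simplified] dist_real_def Thi_id)
  qed
qed

lemma Thi_variation_eq:
  assumes \<xi>: "C2 \<xi>"
  shows "Thi_variation \<sigma> L T \<xi> = Inf (variations \<xi>)"
  unfolding Thi_variation_def
proof (rule the_equality)
  show "\<forall>\<phi>. diffeo_family \<phi> \<xi> \<longrightarrow> ((\<lambda>t. real_of_ereal (Thi \<sigma> (\<phi> t ` L) (push_tangent (\<phi> t) T)))
     has_real_derivative Inf (variations \<xi>)) (at_right 0)" using Thi_right_derivative[OF \<xi>] by blast
  fix d assume d: "\<forall>\<phi>. diffeo_family \<phi> \<xi> \<longrightarrow> ((\<lambda>t. real_of_ereal (Thi \<sigma> (\<phi> t ` L) (push_tangent (\<phi> t) T)))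
     has_real_derivative d) (at_right 0)"
  \<comment> \<open>Without a family the condition would hold vacuously for every d; existence makes
    the described number unique.\<close>
  obtain \<phi> \<psi> where \<phi>: "diffeo_family \<phi> \<xi>" "\<And>t x. \<phi> t x = x + \<psi> t x *\<^sub>R \<xi> x"
    by (rule diffeo_family_exists[OF \<xi>]) (rule that; assumption)
  show "d = Inf (variations \<xi>)" using d[rule_format, OF \<phi>(1)] Thi_right_derivative[OF \<xi> \<phi>(1)]
    unfolding has_field_derivative_iff by (rule tendsto_unique[OF trivial_limit_at_right_real])
qed

lemma Thi_variation_le:
  assumes \<xi>: "C2 \<xi>"
  shows "c \<in> Strut \<sigma> L T \<Longrightarrow> Thi_variation \<sigma> L T \<xi> \<le> strut_variation \<xi> c"
    and "d \<in> Kink \<sigma> L T \<Longrightarrow> Thi_variation \<sigma> L T \<xi> \<le> kink_variation \<xi> d"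
  unfolding Thi_variation_eq[OF \<xi>]
  by (intro cInf_lower bdd_below_variations \<xi> strut_in_variations kink_in_variations; assumption)+

lemma Thi_variation_ge:
  assumes \<xi>: "C2 \<xi>" and "\<And>c. c \<in> Strut \<sigma> L T \<Longrightarrow> m \<le> strut_variation \<xi> c" "\<And>d. d \<in> Kink \<sigma> L T \<Longrightarrow> m \<le> kink_variation \<xi> d"
  shows "m \<le> Thi_variation \<sigma> L T \<xi>"
  unfolding Thi_variation_eq[OF \<xi>]
  by (rule cInf_greatest[OF variations_nonempty]) (use assms(2,3) in \<open>auto simp: variations_def\<close>)

end

section \<open>Balance\<close>

lemma floor_sum:
  fixes y :: real
  assumes "\<bar>y\<bar> \<le> B" "0 < n" "of_nat n * B \<le> of_int K"
  shows "(\<Sum>k\<in>{- K..K}. (of_int k / of_nat n) * (if \<lfloor>of_nat n * y\<rfloor> = k then 1 else 0)) = of_int \<lfloor>of_nat n * y\<rfloor> / of_nat n"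
proof -
  have "\<bar>of_nat n * y\<bar> \<le> of_nat n * B" using assms(1) by (simp add: abs_mult mult_left_mono)
  then have y: "\<bar>of_nat n * y\<bar> \<le> of_int K" using assms(3) by linarith
  then have "of_int (- K) \<le> of_nat n * y" "of_nat n * y \<le> of_int K" by simp_all
  then have "- K \<le> \<lfloor>of_nat n * y\<rfloor>" "\<lfloor>of_nat n * y\<rfloor> \<le> K" by (simp_all only: le_floor_iff, linarith)
  then show ?thesis by (simp add: sum.delta' if_distrib cong: if_cong)
qed

text \<open>\<open>vector_measure_integral\<close> admits every decomposition P - N of a signed
  measure. Each gives the same integral, that of the density h against \<mu> pushed forward by g:
  the discrepancy vanishes on simple functions and is bounded by the supremum norm, and \<lfloor>n
  f\<rfloor> / n approximates f uniformly.\<close>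

lemma integral_eq_of_indicators:
  fixes P N :: "'a measure" and \<mu> :: "'b measure" and g :: "'b \<Rightarrow> 'a" and f :: "'a \<Rightarrow> real"
  assumes P: "finite_measure P" and N: "finite_measure N" "sets N = sets P" and \<mu>: "finite_measure \<mu>"
    and g: "g \<in> measurable \<mu> P" and h: "h \<in> borel_measurable \<mu>" "\<And>p. p \<in> space \<mu> \<Longrightarrow> \<bar>h p\<bar> \<le> H"
    and eq: "\<And>A. A \<in> sets P \<Longrightarrow> measure P A - measure N A = (\<integral>p. indicator A (g p) * h p \<partial>\<mu>)"
    and f: "f \<in> borel_measurable P" "\<And>x. x \<in> space P \<Longrightarrow> \<bar>f x\<bar> \<le> B"
  shows "(\<integral>x. f x \<partial>P) - (\<integral>x. f x \<partial>N) = (\<integral>p. f (g p) * h p \<partial>\<mu>)"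
proof -
  interpret P: finite_measure P by (rule P)
  interpret N: finite_measure N by (rule N)
  interpret \<mu>: finite_measure \<mu> by (rule \<mu>)
  have spN: "space N = space P" by (rule sets_eq_imp_space_eq[OF N(2)])
  have gS: "g p \<in> space P" if "p \<in> space \<mu>" for p using measurable_space[OF g that] .
  have measN: "u \<in> borel_measurable N" if "u \<in> borel_measurable P" for u :: "'a \<Rightarrow> real"
    using that by (simp only: measurable_cong_sets[OF N(2) refl])
  define \<Lambda> where "\<Lambda> u = (\<integral>x. u x \<partial>P) - (\<integral>x. u x \<partial>N) - (\<integral>p. u (g p) * h p \<partial>\<mu>)" for u :: "'a \<Rightarrow> real"
  have int: "integrable P u" "integrable N u" "integrable \<mu> (\<lambda>p. u (g p) * h p)"
    if u: "u \<in> borel_measurable P" "\<And>x. x \<in> space P \<Longrightarrow> \<bar>u x\<bar> \<le> b" for u b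
  proof -
    show "integrable P u" using u by (intro P.integrable_const_bound[of _ b]) auto
    show "integrable N u" using u measN[OF u(1)] by (intro N.integrable_const_bound[of _ b]) (auto simp: spN)
    have "\<bar>u (g p) * h p\<bar> \<le> b * H" if "p \<in> space \<mu>" for p
      unfolding abs_mult using u(2)[OF gS[OF that]] h(2)[OF that] by (intro mult_mono) auto
    then show "integrable \<mu> (\<lambda>p. u (g p) * h p)"
      using measurable_compose[OF g u(1)] h(1) by (intro \<mu>.integrable_const_bound[of _ "b * H"]) auto
  qed
  have \<Lambda>_bound: "\<bar>\<Lambda> u\<bar> \<le> b * (measure P (space P) + measure N (space P) + measure \<mu> (space \<mu>) * \<bar>H\<bar>)"
    if u: "u \<in> borel_measurable P" "\<And>x. x \<in> space P \<Longrightarrow> \<bar>u x\<bar> \<le> b" and b: "0 \<le> b" for u b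
  proof -
    note i = int[OF u]
    have "norm (\<integral>x. u x \<partial>P) \<le> (\<integral>x. b \<partial>P)"
      using u by (intro order_trans[OF integral_norm_bound] Bochner_Integration.integral_mono integrable_norm i) auto
    moreover have "norm (\<integral>x. u x \<partial>N) \<le> (\<integral>x. b \<partial>N)"
      using u by (intro order_trans[OF integral_norm_bound] Bochner_Integration.integral_mono integrable_norm i) (auto simp: spN)
    moreover have "norm (\<integral>p. u (g p) * h p \<partial>\<mu>) \<le> (\<integral>p. b * \<bar>H\<bar> \<partial>\<mu>)"
    proof (intro order_trans[OF integral_norm_bound] Bochner_Integration.integral_mono integrable_norm i)
      fix p assume p: "p \<in> space \<mu>"
      show "norm (u (g p) * h p) \<le> b * \<bar>H\<bar>"
        unfolding real_norm_def abs_mult using u(2)[OF gS[OF p]] h(2)[OF p] b by (intro mult_mono) auto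
    qed auto
    ultimately show ?thesis by (simp add: \<Lambda>_def spN abs_le_iff algebra_simps)
  qed
  define F :: "nat \<Rightarrow> 'a \<Rightarrow> real" where "F n x = of_int \<lfloor>of_nat n * f x\<rfloor> / of_nat n" for n x
  have Fm: "F n \<in> borel_measurable P" for n unfolding F_def[abs_def] using f(1) by measurable
  have \<Lambda>F: "\<Lambda> (F n) = 0" if n: "0 < n" for n
  proof -
    obtain K :: int where K: "of_nat n * B \<le> of_int K" using ex_le_of_int by blast
    define A where "A k = {x \<in> space P. \<lfloor>of_nat n * f x\<rfloor> = k}" for k
    have A: "A k \<in> sets P" for k unfolding A_def using f(1) by measurable
    have F_sum: "F n x = (\<Sum>k\<in>{- K..K}. (of_int k / of_nat n) * indicator (A k) x)" if "x \<in> space P" for x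
      unfolding F_def floor_sum[OF f(2)[OF that] n K, symmetric] using that
      by (intro sum.cong refl) (simp add: A_def indicator_def)
    have ind: "(indicator (A k) :: 'a \<Rightarrow> real) \<in> borel_measurable P" "\<bar>indicator (A k) x :: real\<bar> \<le> 1" for k x
      using A by (auto simp: indicator_def)
    note i = int[OF ind]
    have 1: "(\<integral>x. F n x \<partial>P) = (\<Sum>k\<in>{- K..K}. (of_int k / of_nat n) * measure P (A k))"
    proof -
      have "(\<integral>x. F n x \<partial>P) = (\<integral>x. (\<Sum>k\<in>{- K..K}. (of_int k / of_nat n) * indicator (A k) x) \<partial>P)"
        by (intro Bochner_Integration.integral_cong refl F_sum)
      also have "\<dots> = (\<Sum>k\<in>{- K..K}. (of_int k / of_nat n) * (\<integral>x. indicator (A k) x \<partial>P))"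
        using i by (subst Bochner_Integration.integral_sum) auto
      finally show ?thesis using A by (simp add: sets.Int_space_eq2)
    qed
    have 2: "(\<integral>x. F n x \<partial>N) = (\<Sum>k\<in>{- K..K}. (of_int k / of_nat n) * measure N (A k))"
    proof -
      have "(\<integral>x. F n x \<partial>N) = (\<integral>x. (\<Sum>k\<in>{- K..K}. (of_int k / of_nat n) * indicator (A k) x) \<partial>N)"
        by (intro Bochner_Integration.integral_cong refl F_sum) (simp add: spN)
      also have "\<dots> = (\<Sum>k\<in>{- K..K}. (of_int k / of_nat n) * (\<integral>x. indicator (A k) x \<partial>N))"
        using i by (subst Bochner_Integration.integral_sum) auto
      finally show ?thesis using A by (simp add: sets.Int_space_eq2 N(2))
    qed
    have 3: "(\<integral>p. F n (g p) * h p \<partial>\<mu>) = (\<Sum>k\<in>{- K..K}. (of_int k / of_nat n) * (\<integral>p. indicator (A k) (g p) * h p \<partial>\<mu>))"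
    proof -
      have "(\<integral>p. F n (g p) * h p \<partial>\<mu>) = (\<integral>p. (\<Sum>k\<in>{- K..K}. (of_int k / of_nat n) * (indicator (A k) (g p) * h p)) \<partial>\<mu>)"
        by (intro Bochner_Integration.integral_cong refl) (simp add: F_sum gS sum_distrib_right mult.assoc)
      also have "\<dots> = (\<Sum>k\<in>{- K..K}. (of_int k / of_nat n) * (\<integral>p. indicator (A k) (g p) * h p \<partial>\<mu>))"
        using i by (subst Bochner_Integration.integral_sum) auto
      finally show ?thesis .
    qed
    show ?thesis unfolding \<Lambda>_def 1 2 3 eq[OF A, symmetric] by (simp add: right_diff_distrib sum_subtractf)
  qed
  define W where "W = measure P (space P) + measure N (space P) + measure \<mu> (space \<mu>) * \<bar>H\<bar>"
  have "\<bar>\<Lambda> f\<bar> \<le> W / of_nat n" if n: "0 < n" for n :: nat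
  proof -
    have d: "\<bar>f x - F n x\<bar> \<le> 1 / of_nat n" for x
    proof -
      have "f x - F n x = (of_nat n * f x - of_int \<lfloor>of_nat n * f x\<rfloor>) / of_nat n" using n by (simp add: F_def diff_divide_distrib)
      moreover have "\<bar>of_nat n * f x - of_int \<lfloor>of_nat n * f x\<rfloor>\<bar> \<le> 1" by linarith
      ultimately show ?thesis using n by (simp add: divide_right_mono)
    qed
    have Fb: "\<bar>F n x\<bar> \<le> B + 1 / of_nat n" if "x \<in> space P" for x using d[of x] f(2)[OF that] by linarith
    have "\<Lambda> (\<lambda>x. f x - F n x) = \<Lambda> f - \<Lambda> (F n)" using int[OF f] int[OF Fm[of n] Fb] by (simp add: \<Lambda>_def left_diff_distrib)
    then have "\<bar>\<Lambda> f\<bar> = \<bar>\<Lambda> (\<lambda>x. f x - F n x)\<bar>" by (simp add: \<Lambda>F[OF n])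
    also have "\<dots> \<le> (1 / of_nat n) * W" unfolding W_def using f(1) Fm[of n] d by (intro \<Lambda>_bound) auto
    finally show ?thesis by simp
  qed
  then have "\<forall>\<^sub>F n in sequentially. \<bar>\<Lambda> f\<bar> \<le> W / of_nat n" by (auto simp: eventually_sequentially intro!: exI[of _ 1])
  moreover have "(\<lambda>n. W / of_nat n) \<longlonglongrightarrow> 0" by (rule lim_const_over_n)
  ultimately have "\<bar>\<Lambda> f\<bar> \<le> 0" by (intro tendsto_lowerbound[of "\<lambda>n. W / of_nat n"]) auto
  then show ?thesis by (simp add: \<Lambda>_def)
qed

section \<open>Radon measures on compact sets and the strut force\<close>

lemma radon_measure_on_restrict:
  fixes M :: "'a::{second_countable_topology, complete_space} measure"
  assumes M: "finite_measure M" and sM: "sets M = sets borel" and K: "compact K"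
  shows "radon_measure_on K (restrict_space M K)"
proof -
  interpret finite_measure M by (rule M)
  have Ks: "K \<in> sets M" using K by (simp add: sM borel_compact)
  have e: "emeasure (restrict_space M K) A = emeasure M A" if "A \<subseteq> K" for A
    using Ks that by (intro emeasure_restrict_space) (simp_all add: sets.Int_space_eq2)
  have "emeasure (restrict_space M K) A = (SUP C\<in>{C. compact C \<and> C \<subseteq> A}. emeasure (restrict_space M K) C)"
    if A: "A \<in> sets (restrict_space M K)" for A
  proof -
    have AK: "A \<subseteq> K" and AM: "A \<in> sets M" using A Ks by (auto simp: sets_restrict_space_iff sets.Int_space_eq2)
    have "emeasure M A = (SUP C\<in>{C. C \<subseteq> A \<and> compact C}. emeasure M C)" using AM sM emeasure_finite by (intro inner_regular) auto
    also have "\<dots> = (SUP C\<in>{C. compact C \<and> C \<subseteq> A}. emeasure (restrict_space M K) C)" using AK by (intro SUP_cong) (auto simp: e)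
    finally show ?thesis by (simp only: e[OF AK])
  qed
  moreover have "emeasure (restrict_space M K) C < \<infinity>" if "C \<subseteq> K" for C by (simp add: e[OF that] less_top[symmetric])
  ultimately show ?thesis unfolding radon_measure_on_def using sets_restrict_space_cong[OF sM] by blast
qed

lemma radon_measure_on_compact:
  fixes \<mu> :: "'a::topological_space measure" and f :: "'a \<Rightarrow> real"
  assumes \<mu>: "radon_measure_on K \<mu>" and K: "compact K"
  shows "finite_measure \<mu>" "space \<mu> = K" "sets \<mu> = sets (restrict_space borel K)"
    and "continuous_on K f \<Longrightarrow> f \<in> borel_measurable \<mu>"
    and "continuous_on K f \<Longrightarrow> integrable \<mu> f"
proof -
  show s: "sets \<mu> = sets (restrict_space borel K)" using \<mu> by (simp add: radon_measure_on_def)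
  show sp: "space \<mu> = K" using sets_eq_imp_space_eq[OF s] by (simp add: space_restrict_space)
  show fin: "finite_measure \<mu>" using \<mu> K by (intro finite_measureI) (auto simp: sp radon_measure_on_def less_top)
  show meas: "f \<in> borel_measurable \<mu>" if "continuous_on K f"
    using borel_measurable_continuous_on_restrict[OF that] by (simp only: measurable_cong_sets[OF s refl])
  show "integrable \<mu> f" if c: "continuous_on K f"
  proof -
    interpret finite_measure \<mu> by (rule fin)
    obtain B where "\<And>x. x \<in> K \<Longrightarrow> \<bar>f x\<bar> \<le> B"
      using compact_imp_bounded[OF compact_continuous_image[OF c K]] by (auto simp: bounded_iff)
    then show ?thesis using meas[OF c] by (intro integrable_const_bound[of _ B]) (auto simp: sp)
  qed
qed

text \<open>The sum of M and its image under the swap, realized as a push-forward from the product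
  of M with a two-point space; product formulas then give its values and integrals.\<close>

lemma symmetric_measure:
  fixes M :: "('a::second_countable_topology \<times> 'a) measure"
  assumes M: "finite_measure M" and sM: "sets M = sets borel"
  obtains N where "finite_measure N" "sets N = sets borel"
    "\<And>A. A \<in> sets borel \<Longrightarrow> emeasure N A = emeasure M A + emeasure M (prod.swap -` A)"
    "\<And>(f :: 'a \<times> 'a \<Rightarrow> real) B. f \<in> borel_measurable borel \<Longrightarrow> \<forall>p. \<bar>f p\<bar> \<le> B \<Longrightarrow>
      (\<integral>p. f p \<partial>N) = (\<integral>p. f p \<partial>M) + (\<integral>p. f (prod.swap p) \<partial>M)"
proof -
  interpret M: finite_measure M by (rule M)
  interpret b: finite_measure "count_space (UNIV :: bool set)" by (intro finite_measure_count_space) simp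
  interpret pair_sigma_finite M "count_space (UNIV :: bool set)" by unfold_locales
  have spM: "space M = UNIV" using sets_eq_imp_space_eq[OF sM] by simp
  define R where "R = M \<Otimes>\<^sub>M count_space (UNIV :: bool set)"
  define s :: "('a \<times> 'a) \<times> bool \<Rightarrow> 'a \<times> 'a" where "s q = (if snd q then fst q else prod.swap (fst q))" for q
  have swap: "prod.swap \<in> borel \<rightarrow>\<^sub>M (borel :: ('a \<times> 'a) measure)"
    unfolding prod.swap_def by (intro borel_measurable_continuous_onI continuous_intros)
  have fst: "fst \<in> R \<rightarrow>\<^sub>M borel"
    using measurable_fst[of M "count_space (UNIV :: bool set)"] by (simp add: R_def measurable_cong_sets[OF refl sM])
  have s: "s \<in> R \<rightarrow>\<^sub>M borel" unfolding s_def[abs_def]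
  proof (rule measurable_If)
    show "(\<lambda>q. prod.swap (fst q)) \<in> R \<rightarrow>\<^sub>M borel" by (rule measurable_compose[OF fst swap])
    show "{x \<in> space R. snd x} \<in> sets R" unfolding R_def by measurable
  qed (rule fst)
  define N where "N = distr R borel s"
  have spR: "space R = UNIV" by (simp add: R_def space_pair_measure spM)
  have em: "emeasure N A = emeasure M A + emeasure M (prod.swap -` A)" if A: "A \<in> sets borel" for A
  proof -
    have "emeasure N A = emeasure R (s -` A)" unfolding N_def using emeasure_distr[OF s A] by (simp add: spR)
    also have "\<dots> = (\<integral>\<^sup>+ y. emeasure M ((\<lambda>x. (x, y)) -` (s -` A)) \<partial>count_space UNIV)"
    proof -
      have "s -` A \<in> sets R" using measurable_sets[OF s A] by (simp add: spR)
      then show ?thesis unfolding R_def by (rule emeasure_pair_measure_alt2)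
    qed
    also have "\<dots> = (\<Sum>y\<in>UNIV. emeasure M ((\<lambda>x. (x, y)) -` (s -` A)))" by (rule nn_integral_count_space_finite) simp
    also have "\<dots> = emeasure M A + emeasure M (prod.swap -` A)" by (simp add: UNIV_bool s_def vimage_def add.commute)
    finally show ?thesis .
  qed
  have fin: "finite_measure N"
    by (rule finite_measureI) (simp add: em N_def[symmetric] spM[symmetric], simp add: N_def em[unfolded N_def] M.emeasure_finite ennreal_add_eq_top)
  have int: "(\<integral>p. f p \<partial>N) = (\<integral>p. f p \<partial>M) + (\<integral>p. f (prod.swap p) \<partial>M)"
    if f: "f \<in> borel_measurable borel" "\<forall>p. \<bar>f p\<bar> \<le> B" for f :: "'a \<times> 'a \<Rightarrow> real" and B
  proof -
    have fM: "integrable M f" "integrable M (\<lambda>p. f (prod.swap p))" using f measurable_compose[OF swap f(1)]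
      by (auto intro!: M.integrable_const_bound[of _ B] simp: measurable_cong_sets[OF sM refl])
    interpret R: finite_measure R unfolding R_def by (rule finite_measure_pair_measure) unfold_locales
    have i: "integrable R (\<lambda>q. f (s q))"
      by (intro R.integrable_const_bound[of _ B] AE_I2 measurable_compose[OF s f(1)]) (simp add: f(2)[rule_format])
    have "(\<integral>p. f p \<partial>N) = (\<integral>q. f (s q) \<partial>R)" unfolding N_def by (rule integral_distr[OF s f(1)])
    also have "\<dots> = (\<integral>p. (\<integral>y. f (s (p, y)) \<partial>count_space UNIV) \<partial>M)"
      unfolding R_def by (rule integral_fst'[symmetric]) (use i in \<open>simp add: R_def\<close>)
    also have "\<dots> = (\<integral>p. f p + f (prod.swap p) \<partial>M)"
      by (simp add: lebesgue_integral_count_space_finite UNIV_bool s_def add.commute)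
    also have "\<dots> = (\<integral>p. f p \<partial>M) + (\<integral>p. f (prod.swap p) \<partial>M)" using fM by simp
    finally show ?thesis .
  qed
  show ?thesis by (rule that[OF fin _ em int]) (simp_all add: N_def)
qed

context unit_link
begin

context
  fixes \<mu> :: "(pt \<times> pt) measure"
  assumes strut: "strut_measure \<sigma> L T \<mu>"
begin

lemmas strut_radon = conjunct1[OF strut[unfolded strut_measure_def]]
lemmas strut_finite = radon_measure_on_compact(1)[OF strut_radon compact_strut]
lemmas strut_space = radon_measure_on_compact(2)[OF strut_radon compact_strut]
lemmas strut_measurable = radon_measure_on_compact(4)[OF strut_radon compact_strut]
lemmas strut_integrable = radon_measure_on_compact(5)[OF strut_radon compact_strut]

lemma strut_fst: "fst \<in> \<mu> \<rightarrow>\<^sub>M restrict_space borel L"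
proof -
  have "fst \<in> \<mu> \<rightarrow>\<^sub>M borel" by (subst measurable_cong_sets[OF radon_measure_on_compact(3)[OF strut_radon compact_strut] refl])
      (intro borel_measurable_continuous_on_restrict continuous_intros)
  moreover have "fst p \<in> L" if "p \<in> space \<mu>" for p using that strut_iff[of "fst p" "snd p"] by (simp add: strut_space)
  ultimately show ?thesis by (intro measurable_restrict_space2) auto
qed

lemma strut_coordinate_bound: "p \<in> space \<mu> \<Longrightarrow> \<bar>2 * (fst p - snd p) $ i\<bar> \<le> 2"
  using strut_iff[of "fst p" "snd p"] component_le_norm_cart[of "fst p - snd p" i]
  by (simp add: strut_space abs_mult norm_minus_commute)

lemma strut_coordinate_measurable: "(\<lambda>p. 2 * (fst p - snd p) $ i) \<in> borel_measurable \<mu>"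
  by (intro strut_measurable continuous_intros)

lemma strut_force_component:
  assumes A: "A \<in> sets (restrict_space borel L)"
  shows "strut_force \<mu> A $ i = (\<integral>p. indicator A (fst p) * (2 * (fst p - snd p) $ i) \<partial>\<mu>)"
proof -
  interpret finite_measure \<mu> by (rule strut_finite)
  have "integrable \<mu> (\<lambda>p. indicator A (fst p) *\<^sub>R (2 *\<^sub>R (fst p - snd p)))"
  proof (rule integrable_const_bound[of _ 2])
    show "(\<lambda>p. indicator A (fst p) *\<^sub>R (2 *\<^sub>R (fst p - snd p))) \<in> borel_measurable \<mu>"
    proof (rule borel_measurable_scaleR)
      show "(\<lambda>p. indicator A (fst p) :: real) \<in> borel_measurable \<mu>"
        by (rule measurable_compose[OF strut_fst borel_measurable_indicator[OF A]])
      show "(\<lambda>p. 2 *\<^sub>R (fst p - snd p)) \<in> borel_measurable \<mu>"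
        by (subst measurable_cong_sets[OF radon_measure_on_compact(3)[OF strut_radon compact_strut] refl])
          (intro borel_measurable_continuous_on_restrict continuous_intros)
    qed
    have "norm (fst p - snd p) = 1" if "p \<in> space \<mu>" for p
      using that strut_iff[of "fst p" "snd p"] by (simp add: strut_space norm_minus_commute)
    then show "AE p in \<mu>. norm (indicator A (fst p) *\<^sub>R (2 *\<^sub>R (fst p - snd p))) \<le> 2" by (intro AE_I2) (simp add: indicator_def)
  qed
  from integral_bounded_linear[OF bounded_linear_vec_nth this, of i]
  have "strut_force \<mu> A $ i = (\<integral>p. (indicator A (fst p) *\<^sub>R (2 *\<^sub>R (fst p - snd p))) $ i \<partial>\<mu>)"
    by (simp only: strut_force_def case_prod_unfold)
  then show ?thesis by (simp only: vector_scaleR_component real_scaleR_def)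
qed

text \<open>By the definition of the force the integral is that of 2 (x - y) \<bullet> \<xi> x.
  Averaging with the exchanged pair, under which \<mu> is invariant, gives (x - y) \<bullet> (\<xi>
  x - \<xi> y).\<close>

lemma strut_force_integral:
  assumes \<xi>: "C2 \<xi>"
  shows "vector_measure_integral L \<xi> (strut_force \<mu>) = (\<integral>p. strut_variation \<xi> p \<partial>\<mu>)"
proof -
  interpret finite_measure \<mu> by (rule strut_finite)
  let ?S = "restrict_space borel L"
  define h where "h i p = 2 * (fst p - snd p) $ i" for i :: 3 and p :: "pt \<times> pt"
  have h: "h i \<in> borel_measurable \<mu>" "\<And>p. p \<in> space \<mu> \<Longrightarrow> \<bar>h i p\<bar> \<le> 2" for i
    unfolding h_def[abs_def] using strut_coordinate_measurable strut_coordinate_bound by auto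
  have \<xi>c: "continuous_on S \<xi>" for S by (rule C2_continuous[OF \<xi>])
  have spS: "space ?S = L" by (simp add: space_restrict_space)
  let ?valid = "\<lambda>P N :: 3 \<Rightarrow> pt measure. \<forall>i. finite_measure (P i) \<and> sets (P i) = sets ?S
        \<and> finite_measure (N i) \<and> sets (N i) = sets ?S
        \<and> (\<forall>A\<in>sets ?S. strut_force \<mu> A $ i = measure (P i) A - measure (N i) A)"
  let ?val = "\<lambda>P N :: 3 \<Rightarrow> pt measure. \<Sum>i\<in>UNIV. (\<integral>x. \<xi> x $ i \<partial>P i) - (\<integral>x. \<xi> x $ i \<partial>N i)"
  let ?V = "\<Sum>i\<in>UNIV. \<integral>p. \<xi> (fst p) $ i * h i p \<partial>\<mu>"
  have val: "?val P N = ?V" if v: "?valid P N" for P N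
  proof (intro sum.cong refl)
    fix i :: 3
    have v: "finite_measure (P i)" "sets (P i) = sets ?S" "finite_measure (N i)" "sets (N i) = sets ?S"
      "\<And>A. A \<in> sets ?S \<Longrightarrow> strut_force \<mu> A $ i = measure (P i) A - measure (N i) A" using v by blast+
    have sp: "space (P i) = L" using sets_eq_imp_space_eq[OF v(2)] spS by simp
    obtain B where B: "\<And>x. x \<in> L \<Longrightarrow> \<bar>\<xi> x $ i\<bar> \<le> B"
    proof -
      have "compact ((\<lambda>x. \<xi> x $ i) ` L)" by (intro compact_continuous_image compact_L continuous_intros \<xi>c)
      then have "bounded ((\<lambda>x. \<xi> x $ i) ` L)" by (rule compact_imp_bounded)
      then obtain b where "\<forall>y\<in>(\<lambda>x. \<xi> x $ i) ` L. norm y \<le> b" unfolding bounded_iff ..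
      then show thesis by (intro that[of b]) auto
    qed
    show "(\<integral>x. \<xi> x $ i \<partial>P i) - (\<integral>x. \<xi> x $ i \<partial>N i) = (\<integral>p. \<xi> (fst p) $ i * h i p \<partial>\<mu>)"
    proof (rule integral_eq_of_indicators[OF v(1,3) _ strut_finite _ h(1) h(2)])
      show "sets (N i) = sets (P i)" by (simp add: v)
      show "fst \<in> \<mu> \<rightarrow>\<^sub>M P i" using strut_fst by (simp only: measurable_cong_sets[OF refl v(2)])
      show "measure (P i) A - measure (N i) A = (\<integral>p. indicator A (fst p) * h i p \<partial>\<mu>)" if "A \<in> sets (P i)" for A
        using v(5)[of A] that strut_force_component[of A i] by (simp add: v(2) h_def)
      show "(\<lambda>x. \<xi> x $ i) \<in> borel_measurable (P i)"
        by (subst measurable_cong_sets[OF v(2) refl]) (intro borel_measurable_continuous_on_restrict continuous_intros \<xi>c)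
      show "\<bar>\<xi> x $ i\<bar> \<le> B" if "x \<in> space (P i)" for x using that B by (simp add: sp)
    qed
  qed
  \<comment> \<open>Push-forwards of the positive part (s = 1) and the negative part (s = -1) of the
    density. They provide a decomposition, so the description in
    \<open>vector_measure_integral\<close> is not void.\<close>
  define D where "D i s = distr (density \<mu> (\<lambda>p. ennreal (max 0 (s * h i p)))) ?S fst" for i and s :: real
  have D: "finite_measure (D i s)" "sets (D i s) = sets ?S"
    "\<And>A. A \<in> sets ?S \<Longrightarrow> measure (D i s) A = (\<integral>p. indicator A (fst p) * max 0 (s * h i p) \<partial>\<mu>)" for i and s :: real
  proof -
    show sD: "sets (D i s) = sets ?S" by (simp add: D_def)
    have m: "(\<lambda>p. max 0 (s * h i p)) \<in> borel_measurable \<mu>" using h(1)[of i] by measurable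
    have b: "max 0 (s * h i p) \<le> \<bar>s\<bar> * 2" if "p \<in> space \<mu>" for p
    proof -
      have "\<bar>s * h i p\<bar> \<le> \<bar>s\<bar> * 2" unfolding abs_mult using h(2)[OF that, of i] by (intro mult_left_mono) auto
      then show ?thesis by simp
    qed
    have em: "emeasure (D i s) A = ennreal (\<integral>p. indicator A (fst p) * max 0 (s * h i p) \<partial>\<mu>)" if A: "A \<in> sets ?S" for A
    proof -
      have fm: "fst \<in> density \<mu> (\<lambda>p. ennreal (max 0 (s * h i p))) \<rightarrow>\<^sub>M ?S" using strut_fst by simp
      have iA: "(\<lambda>p. indicator A (fst p) :: real) \<in> borel_measurable \<mu>"
        by (rule measurable_compose[OF strut_fst borel_measurable_indicator[OF A]])
      have sA: "fst -` A \<inter> space \<mu> \<in> sets \<mu>" by (rule measurable_sets[OF strut_fst A])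
      have "emeasure (D i s) A = (\<integral>\<^sup>+ p. ennreal (max 0 (s * h i p)) * indicator (fst -` A \<inter> space \<mu>) p \<partial>\<mu>)"
        unfolding D_def using emeasure_distr[OF fm A] m sA by (simp add: emeasure_density)
      also have "\<dots> = (\<integral>\<^sup>+ p. ennreal (indicator A (fst p) * max 0 (s * h i p)) \<partial>\<mu>)"
        by (intro nn_integral_cong) (simp add: indicator_def)
      also have "\<dots> = ennreal (\<integral>p. indicator A (fst p) * max 0 (s * h i p) \<partial>\<mu>)"
      proof (rule nn_integral_eq_integral)
        show "integrable \<mu> (\<lambda>p. indicator A (fst p) * max 0 (s * h i p))"
          using iA m b by (intro integrable_const_bound[of _ "\<bar>s\<bar> * 2"] AE_I2 borel_measurable_times) (auto simp: indicator_def)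
      qed (simp add: indicator_def)
      finally show ?thesis .
    qed
    show "measure (D i s) A = (\<integral>p. indicator A (fst p) * max 0 (s * h i p) \<partial>\<mu>)" if "A \<in> sets ?S" for A
      unfolding measure_def em[OF that] by (rule enn2real_ennreal) (intro integral_nonneg_AE AE_I2, simp add: indicator_def)
    show "finite_measure (D i s)"
    proof (rule finite_measureI)
      have "space (D i s) \<in> sets ?S" using sets.top[of "D i s"] by (simp add: sD)
      then show "emeasure (D i s) (space (D i s)) \<noteq> \<infinity>" by (simp add: em)
    qed
  qed
  have valid: "?valid (\<lambda>i. D i 1) (\<lambda>i. D i (- 1))"
  proof (intro allI conjI D(1,2) ballI)
    fix i A assume A: "A \<in> sets ?S"
    have iA: "(\<lambda>p. indicator A (fst p) :: real) \<in> borel_measurable \<mu>"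
      by (rule measurable_compose[OF strut_fst borel_measurable_indicator[OF A]])
    have i: "integrable \<mu> (\<lambda>p. indicator A (fst p) * max 0 (s * h i p))" if "\<bar>s\<bar> = 1" for s :: real
    proof (rule integrable_const_bound[of _ 2])
      show "AE p in \<mu>. norm (indicator A (fst p) * max 0 (s * h i p)) \<le> 2"
      proof (rule AE_I2)
        fix p assume "p \<in> space \<mu>"
        then have "\<bar>s * h i p\<bar> \<le> 2" using h(2)[of p i] by (simp only: abs_mult that mult_1_left)
        then show "norm (indicator A (fst p) * max 0 (s * h i p)) \<le> 2" by (auto simp: indicator_def abs_le_iff)
      qed
      show "(\<lambda>p. indicator A (fst p) * max 0 (s * h i p)) \<in> borel_measurable \<mu>" using iA h(1)[of i] by measurable
    qed
    have "measure (D i 1) A - measure (D i (- 1)) A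
       = (\<integral>p. indicator A (fst p) * max 0 (1 * h i p) - indicator A (fst p) * max 0 (- 1 * h i p) \<partial>\<mu>)"
      unfolding D(3)[OF A] by (rule Bochner_Integration.integral_diff[symmetric]) (rule i, simp)+
    also have "\<dots> = (\<integral>p. indicator A (fst p) * h i p \<partial>\<mu>)"
      by (intro Bochner_Integration.integral_cong refl) (simp add: indicator_def max_def)
    finally show "strut_force \<mu> A $ i = measure (D i 1) A - measure (D i (- 1)) A"
      unfolding strut_force_component[OF A] h_def ..
  qed
  have "vector_measure_integral L \<xi> (strut_force \<mu>) = ?V" unfolding vector_measure_integral_def
  proof (rule the_equality)
    show "\<exists>P N. ?valid P N \<and> ?V = ?val P N"
      using valid val[OF valid] by (intro exI[of _ "\<lambda>i. D i 1"] exI[of _ "\<lambda>i. D i (- 1)"]) simp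
    show "I = ?V" if "\<exists>P N. ?valid P N \<and> I = ?val P N" for I using that val by blast
  qed
  also have "?V = (\<integral>p. 2 * ((fst p - snd p) \<bullet> \<xi> (fst p)) \<partial>\<mu>)"
  proof -
    have "?V = (\<integral>p. (\<Sum>i\<in>UNIV. \<xi> (fst p) $ i * h i p) \<partial>\<mu>)" unfolding h_def
      by (intro Bochner_Integration.integral_sum[symmetric] strut_integrable continuous_intros continuous_on_compose2[OF \<xi>c[of UNIV]]) auto
    also have "\<dots> = (\<integral>p. 2 * ((fst p - snd p) \<bullet> \<xi> (fst p)) \<partial>\<mu>)" by (simp add: h_def inner_vec_def sum_distrib_left algebra_simps)
    finally show ?thesis .
  qed
  also have "\<dots> = (\<integral>p. strut_variation \<xi> p \<partial>\<mu>)"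
  proof -
    define q where "q p = (fst p - snd p) \<bullet> \<xi> (fst p)" for p :: "pt \<times> pt"
    have qc: "continuous_on S q" "continuous_on S (\<lambda>p. q (prod.swap p))" for S
      unfolding q_def fst_swap snd_swap by (intro continuous_intros continuous_on_compose2[OF \<xi>c[of UNIV]]; auto)+
    have swap: "distr \<mu> \<mu> prod.swap = \<mu>" using strut by (simp add: strut_measure_def)
    have sm: "prod.swap \<in> \<mu> \<rightarrow>\<^sub>M \<mu>"
    proof -
      note s = radon_measure_on_compact(3)[OF strut_radon compact_strut]
      have "continuous_on (Strut \<sigma> L T) (prod.swap :: pt \<times> pt \<Rightarrow> _)" unfolding prod.swap_def by (intro continuous_intros)
      then have "prod.swap \<in> restrict_space borel (Strut \<sigma> L T) \<rightarrow>\<^sub>M (borel :: (pt \<times> pt) measure)" by (rule borel_measurable_continuous_on_restrict)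
      then have "prod.swap \<in> restrict_space borel (Strut \<sigma> L T) \<rightarrow>\<^sub>M restrict_space borel (Strut \<sigma> L T)"
        using strut_swap by (intro measurable_restrict_space2) (auto simp: space_restrict_space)
      then show ?thesis by (simp only: measurable_cong_sets[OF s s])
    qed
    have "(\<integral>p. q p \<partial>\<mu>) = (\<integral>p. q p \<partial>distr \<mu> \<mu> prod.swap)" by (simp only: swap)
    also have "\<dots> = (\<integral>p. q (prod.swap p) \<partial>\<mu>)" by (rule integral_distr[OF sm strut_measurable[OF qc(1)]])
    finally have "(\<integral>p. 2 * q p \<partial>\<mu>) = (\<integral>p. q p \<partial>\<mu>) + (\<integral>p. q (prod.swap p) \<partial>\<mu>)" by simp
    also have "\<dots> = (\<integral>p. q p + q (prod.swap p) \<partial>\<mu>)" by (intro Bochner_Integration.integral_add[symmetric] strut_integrable qc)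
    also have "\<dots> = (\<integral>p. strut_variation \<xi> p \<partial>\<mu>)"
      by (intro Bochner_Integration.integral_cong refl) (simp add: q_def strut_variation_def algebra_simps)
    finally show ?thesis by (simp only: q_def)
  qed
  finally show ?thesis .
qed

end

text \<open>If a field with length variation -1 changed all struts and kinks at rates above - 1 / (W
  + 1), integration against measures of total weight W would give -1 >= - W / (W + 1). The summand 1
  keeps this absurd, and the constant finite, also for W = 0.\<close>

theorem balanced_imp_strongly_critical:
  assumes "balanced \<sigma> L T H0 H1"
  shows "strongly_critical \<sigma> L T H0 H1"
proof -
  obtain \<mu> \<nu> where \<mu>: "strut_measure \<sigma> L T \<mu>" and \<nu>: "kink_measure \<sigma> L T \<nu>"
    and bal: "\<And>\<xi>. compatible L T H0 H1 \<xi> \<Longrightarrow> len_variation L T \<xi> =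
      vector_measure_integral L \<xi> (strut_force \<mu>) + (\<integral>c. radius_variation \<xi> c \<partial>\<nu>)" using assms unfolding balanced_def by blast
  note S = radon_measure_on_compact[OF \<mu>[unfolded strut_measure_def, THEN conjunct1] compact_strut]
  note K = radon_measure_on_compact[OF \<nu>[unfolded kink_measure_def] compact_kink]
  interpret S: finite_measure \<mu> by (rule S(1))
  interpret K: finite_measure \<nu> by (rule K(1))
  \<comment> \<open>Kinks carry the weight \<sigma>, since \<open>radius_variation\<close> is
    \<sigma> times \<open>kink_variation\<close>.\<close>
  define W where "W = measure \<mu> (space \<mu>) + \<sigma> * measure \<nu> (space \<nu>)"
  have W: "0 \<le> W" using \<sigma>_pos by (simp add: W_def)
  have "Thi_variation \<sigma> L T \<xi> \<le> - (1 / (W + 1))" if \<xi>: "compatible L T H0 H1 \<xi>" and len: "len_variation L T \<xi> = -1" for \<xi>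
  proof (rule ccontr)
    define e where "e = 1 / (W + 1)"
    assume "\<not> Thi_variation \<sigma> L T \<xi> \<le> - (1 / (W + 1))"
    then have m: "- e < Thi_variation \<sigma> L T \<xi>" by (simp add: e_def)
    have C: "C2 \<xi>" using \<xi> by (simp add: compatible_def)
    have rk: "radius_variation \<xi> c = \<sigma> * kink_variation \<xi> c" for c using \<sigma>_pos by (simp add: kink_variation_def)
    have "(\<integral>p. - e \<partial>\<mu>) \<le> (\<integral>p. strut_variation \<xi> p \<partial>\<mu>)" using Thi_variation_le(1)[OF C] m
      by (intro Bochner_Integration.integral_mono S(5) continuous_strut_variation C) (auto simp: S(2) intro: less_imp_le less_le_trans)
    moreover have "(\<integral>c. \<sigma> * - e \<partial>\<nu>) \<le> (\<integral>c. \<sigma> * kink_variation \<xi> c \<partial>\<nu>)"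
    proof (intro Bochner_Integration.integral_mono)
      show "integrable \<nu> (\<lambda>c. \<sigma> * kink_variation \<xi> c)" by (intro integrable_mult_right K(5) continuous_kink_variation C)
      fix c assume "c \<in> space \<nu>"
      then have "- e \<le> kink_variation \<xi> c" using Thi_variation_le(2)[OF C, of c] m by (simp add: K(2))
      then show "\<sigma> * - e \<le> \<sigma> * kink_variation \<xi> c" using \<sigma>_pos by (intro mult_left_mono) auto
    qed simp
    ultimately have "- (e * W) \<le> -1"
      using bal[OF \<xi>] unfolding len strut_force_integral[OF \<mu> C] rk by (simp add: W_def algebra_simps)
    then have "1 \<le> W / (W + 1)" by (simp add: e_def)
    then show False using W by (simp add: pos_le_divide_eq)
  qed
  then show ?thesis unfolding strongly_critical_def using W by (intro exI[of _ "1 / (W + 1)"]) auto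
qed

text \<open>Domination for \<open>compact_farkas\<close> comes from reversing the field. If the
  length variation of \<xi> is positive, dividing - \<xi> by it gives \<zeta> with length variation
  -1, whose thickness variation is at most - \<epsilon>. An upper bound for the variations of \<xi>
  is, after rescaling, a lower bound for the thickness variation of \<zeta>; the two together bound
  the length variation of \<xi>.\<close>

theorem strongly_critical_imp_balanced:
  assumes con: "endpoint_constraints L T H0 H1" and crit: "strongly_critical \<sigma> L T H0 H1"
  shows "balanced \<sigma> L T H0 H1"
proof -
  obtain \<epsilon> where \<epsilon>: "0 < \<epsilon>" "\<And>\<xi>. compatible L T H0 H1 \<xi> \<Longrightarrow> len_variation L T \<xi> = -1 \<Longrightarrow> Thi_variation \<sigma> L T \<xi> \<le> - \<epsilon>"
    using crit unfolding strongly_critical_def by blast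
  \<comment> \<open>The factor 2 on struts anticipates symmetrization: M will be replaced by the sum
    R of M and its swapped image, which doubles the integral of the symmetric function
    \<open>strut_variation\<close>.\<close>
  let ?G = "{\<xi>. compatible L T H0 H1 \<xi>}" and ?l = "len_variation L T" and ?a = "\<lambda>\<xi> c. 2 * strut_variation \<xi> c"
  have C2: "C2 \<xi>" if "\<xi> \<in> ?G" for \<xi> using that by (simp add: compatible_def)
  have rk: "radius_variation \<xi> = (\<lambda>c. \<sigma> * kink_variation \<xi> c)" for \<xi> using \<sigma>_pos by (simp add: kink_variation_def)
  have rc: "continuous_on (Kink \<sigma> L T) (radius_variation \<xi>)" if "\<xi> \<in> ?G" for \<xi>
    unfolding rk by (intro continuous_intros continuous_kink_variation C2 that)
  have "\<exists>M N. sets M = sets borel \<and> finite_measure M \<and> emeasure M (- Strut \<sigma> L T) = 0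
     \<and> sets N = sets borel \<and> finite_measure N \<and> emeasure N (- Kink \<sigma> L T) = 0
     \<and> (\<forall>\<xi>\<in>?G. ?l \<xi> = (\<integral>x. (if x \<in> Strut \<sigma> L T then ?a \<xi> x else 0) \<partial>M) + (\<integral>y. (if y \<in> Kink \<sigma> L T then radius_variation \<xi> y else 0) \<partial>N))"
  \<comment> \<open>The 2 in the constant arises because \<open>radius_variation\<close> <= m only
    gives \<open>kink_variation\<close> <= m / \<sigma> <= 2 m.\<close>
  proof (rule compact_farkas[OF compact_strut compact_kink, where C = "2 / \<epsilon>"])
    show "0 \<le> 2 / \<epsilon>" using \<epsilon>(1) by simp
    show "continuous_on (Strut \<sigma> L T) (?a \<xi>) \<and> continuous_on (Kink \<sigma> L T) (radius_variation \<xi>)" if "\<xi> \<in> ?G" for \<xi>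
      by (intro conjI rc that continuous_intros continuous_strut_variation C2)
    show "?G \<noteq> {}" using compatible_zero[OF con] by blast
    show "\<exists>\<zeta>\<in>?G. ?l \<zeta> = s * ?l \<xi> + t * ?l \<eta> \<and> (\<forall>x\<in>Strut \<sigma> L T. ?a \<zeta> x = s * ?a \<xi> x + t * ?a \<eta> x)
        \<and> (\<forall>y\<in>Kink \<sigma> L T. radius_variation \<zeta> y = s * radius_variation \<xi> y + t * radius_variation \<eta> y)"
      if "\<xi> \<in> ?G" "\<eta> \<in> ?G" for \<xi> \<eta> s t
    proof (rule bexI[of _ "\<lambda>x. s *\<^sub>R \<xi> x + t *\<^sub>R \<eta> x"], intro conjI ballI)
      show "(\<lambda>x. s *\<^sub>R \<xi> x + t *\<^sub>R \<eta> x) \<in> ?G" using compatible_combination[OF con] that by simp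
    qed (simp_all only: len_variation_combination[OF C2[OF \<open>\<xi> \<in> ?G\<close>] C2[OF \<open>\<eta> \<in> ?G\<close>]] strut_variation_combination
        radius_variation_combination[OF C2[OF \<open>\<xi> \<in> ?G\<close>] C2[OF \<open>\<eta> \<in> ?G\<close>]], simp add: algebra_simps)
    show "?l \<xi> \<le> 2 / \<epsilon> * m"
      if \<xi>: "\<xi> \<in> ?G" and m: "0 \<le> m" and a: "\<And>x. x \<in> Strut \<sigma> L T \<Longrightarrow> ?a \<xi> x \<le> m"
        and b: "\<And>y. y \<in> Kink \<sigma> L T \<Longrightarrow> radius_variation \<xi> y \<le> m" for \<xi> m
    proof (cases "0 < ?l \<xi>")
      case False
      then have "?l \<xi> \<le> 0" by simp
      also have "0 \<le> 2 / \<epsilon> * m" using m \<epsilon>(1) by simp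
      finally show ?thesis .
    next
      case True
      define r where "r = 1 / ?l \<xi>"
      have r: "0 < r" "r * ?l \<xi> = 1" using True by (simp_all add: r_def)
      define \<zeta> where "\<zeta> = (\<lambda>x. (- r) *\<^sub>R \<xi> x + 0 *\<^sub>R \<xi> x)"
      note C = C2[OF \<xi>]
      have \<zeta>: "compatible L T H0 H1 \<zeta>" unfolding \<zeta>_def using \<xi> by (intro compatible_combination[OF con]) auto
      then have \<zeta>C: "C2 \<zeta>" by (simp add: compatible_def)
      have "?l \<zeta> = -1" unfolding \<zeta>_def len_variation_combination[OF C C] using r(2) by simp
      with \<zeta> have up: "Thi_variation \<sigma> L T \<zeta> \<le> - \<epsilon>" by (rule \<epsilon>(2))
      have "- (r * (2 * m)) \<le> Thi_variation \<sigma> L T \<zeta>"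
      proof (rule Thi_variation_ge[OF \<zeta>C])
        fix c assume "c \<in> Strut \<sigma> L T"
        from a[OF this] have "strut_variation \<xi> c \<le> 2 * m" using m by linarith
        then have "r * strut_variation \<xi> c \<le> r * (2 * m)" using r(1) by (intro mult_left_mono) auto
        then show "- (r * (2 * m)) \<le> strut_variation \<zeta> c" unfolding \<zeta>_def strut_variation_combination by simp
      next
        fix d assume d: "d \<in> Kink \<sigma> L T"
        have "kink_variation \<xi> d \<le> m / \<sigma>" unfolding kink_variation_def using b[OF d] \<sigma>_pos by (intro divide_right_mono) auto
        also have "m / \<sigma> \<le> m / (1/2)" using m \<sigma> \<sigma>_pos by (intro divide_left_mono) auto
        finally have "r * kink_variation \<xi> d \<le> r * (2 * m)" using r(1) by (intro mult_left_mono) auto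
        then show "- (r * (2 * m)) \<le> kink_variation \<zeta> d"
          unfolding \<zeta>_def kink_variation_def radius_variation_combination[OF C C] by simp
      qed
      with up have "\<epsilon> \<le> r * (2 * m)" by linarith
      then have "\<epsilon> * ?l \<xi> \<le> r * (2 * m) * ?l \<xi>" using True by (intro mult_right_mono) auto
      also have "\<dots> = 2 * m" using r(2) by (simp add: mult_ac)
      finally show ?thesis using \<epsilon>(1) by (simp add: pos_le_divide_eq mult.commute)
    qed
  qed
  then obtain M N where M: "sets M = sets borel" "finite_measure M" "emeasure M (- Strut \<sigma> L T) = 0"
    and N: "sets N = sets borel" "finite_measure N" "emeasure N (- Kink \<sigma> L T) = 0"
    and len: "\<And>\<xi>. \<xi> \<in> ?G \<Longrightarrow> ?l \<xi> = (\<integral>x. (if x \<in> Strut \<sigma> L T then ?a \<xi> x else 0) \<partial>M)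
        + (\<integral>y. (if y \<in> Kink \<sigma> L T then radius_variation \<xi> y else 0) \<partial>N)" by blast
  have strut_borel: "Strut \<sigma> L T \<in> sets borel" and kink_borel: "Kink \<sigma> L T \<in> sets borel"
    using compact_strut compact_kink by (simp_all add: borel_compact)
  obtain R where R: "finite_measure R" "sets R = sets borel"
    "\<And>A. A \<in> sets borel \<Longrightarrow> emeasure R A = emeasure M A + emeasure M (prod.swap -` A)"
    "\<And>(f :: pt \<times> pt \<Rightarrow> real) B. f \<in> borel_measurable borel \<Longrightarrow> \<forall>p. \<bar>f p\<bar> \<le> B \<Longrightarrow>
      (\<integral>p. f p \<partial>R) = (\<integral>p. f p \<partial>M) + (\<integral>p. f (prod.swap p) \<partial>M)"
  proof (rule symmetric_measure[OF M(2,1)])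
    fix N :: "(pt \<times> pt) measure"
    assume N: "finite_measure N" "sets N = sets borel"
      "\<And>A. A \<in> sets borel \<Longrightarrow> emeasure N A = emeasure M A + emeasure M (prod.swap -` A)"
      "\<And>(f :: pt \<times> pt \<Rightarrow> real) B. f \<in> borel_measurable borel \<Longrightarrow> \<forall>p. \<bar>f p\<bar> \<le> B \<Longrightarrow>
        (\<integral>p. f p \<partial>N) = (\<integral>p. f p \<partial>M) + (\<integral>p. f (prod.swap p) \<partial>M)"
    show thesis by (rule that[OF N(1,2)]) (rule N(3), assumption, rule N(4), assumption+)
  qed
  define \<mu> where "\<mu> = restrict_space R (Strut \<sigma> L T)"
  define \<nu> where "\<nu> = restrict_space N (Kink \<sigma> L T)"
  have rad: "radon_measure_on (Strut \<sigma> L T) \<mu>" unfolding \<mu>_def by (rule radon_measure_on_restrict[OF R(1,2) compact_strut])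
  note S = radon_measure_on_compact[OF rad compact_strut]
  have "kink_measure \<sigma> L T \<nu>" unfolding kink_measure_def \<nu>_def by (rule radon_measure_on_restrict[OF N(2,1) compact_kink])
  have swap: "prod.swap \<in> borel \<rightarrow>\<^sub>M (borel :: (pt \<times> pt) measure)"
    unfolding prod.swap_def by (intro borel_measurable_continuous_onI continuous_intros)
  have swap_strut: "prod.swap p \<in> Strut \<sigma> L T \<longleftrightarrow> p \<in> Strut \<sigma> L T" for p
    using strut_swap[of "fst p" "snd p"] strut_swap[of "snd p" "fst p"] by (auto simp: prod.swap_def)
  have swap\<mu>: "prod.swap \<in> \<mu> \<rightarrow>\<^sub>M \<mu>" unfolding \<mu>_def using swap
    by (intro measurable_restrict_space3) (auto simp: swap_strut measurable_cong_sets[OF R(2) R(2)])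
  have "distr \<mu> \<mu> prod.swap = \<mu>"
  proof (rule measure_eqI)
    fix A assume "A \<in> sets (distr \<mu> \<mu> prod.swap)"
    then have A: "A \<in> sets \<mu>" by simp
    have sub: "A \<subseteq> Strut \<sigma> L T" using sets.sets_into_space[OF A] by (simp add: S(2))
    have Ab: "A \<in> sets borel" using A strut_borel by (auto simp: S(3) sets_restrict_space_iff)
    have e: "emeasure \<mu> B = emeasure R B" if "B \<subseteq> Strut \<sigma> L T" for B
      unfolding \<mu>_def using strut_borel that by (intro emeasure_restrict_space) (simp_all add: R(2) sets.Int_space_eq2)
    have sw: "prod.swap -` A \<inter> space \<mu> = prod.swap -` A" "prod.swap -` A \<subseteq> Strut \<sigma> L T"
      using sub swap_strut by (auto simp: S(2))
    have sAb: "prod.swap -` A \<in> sets borel" using measurable_sets[OF swap Ab] by simp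
    have "prod.swap -` prod.swap -` A = A" by auto
    then show "emeasure (distr \<mu> \<mu> prod.swap) A = emeasure \<mu> A"
      unfolding emeasure_distr[OF swap\<mu> A] sw(1) e[OF sw(2)] e[OF sub] R(3)[OF Ab] R(3)[OF sAb] by (simp add: add.commute)
  qed simp
  then have strut: "strut_measure \<sigma> L T \<mu>" using rad by (simp add: strut_measure_def)
  have "?l \<xi> = vector_measure_integral L \<xi> (strut_force \<mu>) + (\<integral>c. radius_variation \<xi> c \<partial>\<nu>)" if \<xi>: "\<xi> \<in> ?G" for \<xi>
  proof -
    define f where "f p = (if p \<in> Strut \<sigma> L T then strut_variation \<xi> p else 0)" for p
    have sc: "continuous_on S (strut_variation \<xi>)" for S by (rule continuous_strut_variation[OF C2[OF \<xi>]])
    have fm: "f \<in> borel_measurable borel"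
      unfolding f_def[abs_def] using strut_borel borel_measurable_continuous_onI[OF sc] by (intro measurable_If_set) auto
    obtain B where B: "\<And>p. p \<in> Strut \<sigma> L T \<Longrightarrow> \<bar>strut_variation \<xi> p\<bar> \<le> B"
      using compact_imp_bounded[OF compact_continuous_image[OF sc compact_strut]] by (auto simp: bounded_iff)
    have fB: "\<forall>p. \<bar>f p\<bar> \<le> \<bar>B\<bar>" using B by (fastforce simp: f_def)
    have fs: "f (prod.swap p) = f p" for p by (simp add: f_def swap_strut strut_variation_def inner_diff_left inner_diff_right)
    have "(\<integral>x. (if x \<in> Strut \<sigma> L T then ?a \<xi> x else 0) \<partial>M) = (\<integral>x. 2 * f x \<partial>M)"
      by (intro Bochner_Integration.integral_cong refl) (simp add: f_def)
    also have "\<dots> = (\<integral>x. f x \<partial>R)" unfolding R(4)[OF fm fB] fs by simp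
    also have "\<dots> = (\<integral>x. strut_variation \<xi> x \<partial>\<mu>)" unfolding \<mu>_def using strut_borel by (subst integral_restrict_space)
        (auto simp: R(2) sets.Int_space_eq2 f_def indicator_def intro!: Bochner_Integration.integral_cong)
    also have "\<dots> = vector_measure_integral L \<xi> (strut_force \<mu>)" by (rule strut_force_integral[OF strut C2[OF \<xi>], symmetric])
    finally have 1: "(\<integral>x. (if x \<in> Strut \<sigma> L T then ?a \<xi> x else 0) \<partial>M) = vector_measure_integral L \<xi> (strut_force \<mu>)" .
    have "(\<integral>y. (if y \<in> Kink \<sigma> L T then radius_variation \<xi> y else 0) \<partial>N) = (\<integral>c. radius_variation \<xi> c \<partial>\<nu>)"
      unfolding \<nu>_def using kink_borel by (subst integral_restrict_space)
        (auto simp: N(1) sets.Int_space_eq2 indicator_def intro!: Bochner_Integration.integral_cong)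
    then show ?thesis using len[OF \<xi>] 1 by simp
  qed
  then show ?thesis unfolding balanced_def using strut \<open>kink_measure \<sigma> L T \<nu>\<close> by blast
qed

end

theorem theorem3p17:
  fixes \<sigma> :: real and L :: "pt set" and T :: "pt \<Rightarrow> pt"
    and H0 H1 :: "pt \<Rightarrow> pt set"
  assumes "1 / 2 \<le> \<sigma>"
    and "C11_link L T"
    and "endpoint_constraints L T H0 H1"
    and "Thi \<sigma> L T = 1"
  shows "strongly_critical \<sigma> L T H0 H1 \<longleftrightarrow> balanced \<sigma> L T H0 H1"
proof -
  interpret unit_link L T \<sigma> using assms by (intro unit_link.intro link.intro unit_link_axioms.intro)
  show ?thesis using strongly_critical_imp_balanced[OF assms(3)] balanced_imp_strongly_critical by blast
qed

end
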